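(* Let $p,q\ge2$ be integers, let $\beta>\beta_c(p,q)$, and let $\hat\beta$ be the maximum pseudolikelihood estimate of $\beta$ based on a single sample $\bm X=(X_1,\dots,X_N)\sim\mathbb P_{\beta,0,N}$. Let $\bm m_1,\dots,\bm m_q$ be the global maximizers of $H_{\beta,0}$ on $\mathcal P_q$, and let $\Sigma_i$ ($1\le i\le q$) be the matrices defined in the context. Then, as $N\to\infty$, $$\sup_{x\in\mathbb R}\left|\mathbb P_{\beta,0,N}\left(\sqrt N(\hat\beta-\beta)\le x\right)-\frac1q\sum_{i=1}^q\mathbb P\left(\boldsymbol\rho_i^\top\Sigma_i^{1/2}\bm Z\le x\right)\right|=O\left(\frac{\log N}{\sqrt N}\right),$$ where $\bm Z$ is a $q$-dimensional standard normal vector, $$\boldsymbol\rho_i=-\frac{\nabla_{\bm x}S(\bm m_i,\beta)}{\frac{\partial}{\partial\beta}S(\bm m_i,\beta)},\qquad S(\bm x,\beta):=\sum_{r=1}^q x_r^p-\frac{\sum_{r=1}^q x_r^{p-1}\exp(\beta p x_r^{p-1})}{\sum_{r=1}^q\exp(\beta p x_r^{p-1})}.$$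
   Context: For integers $p,q\ge2$, $\beta>0$, $N\ge1$, with $[m]=\{1,\dots,m\}$, the $p$-tensor Curie–Weiss Potts model with $h=0$ is the probability measure on $[q]^N$ $$\mathbb P_{\beta,0,N}(\bm X)=\frac{1}{q^N Z_N(\beta,0)}\exp\Big(\beta N\sum_{r=1}^q \bar X_{\cdot r}^p\Big),\qquad \bm X=(X_1,\dots,X_N)\in[q]^N,$$ where $\bar X_{\cdot r}:=N^{-1}\sum_{i=1}^N \mathbb 1_{X_i=r}$ and $Z_N(\beta,0)$ is the normalizing constant. The magnetization vector is $\bar{\bm X}_N:=(\bar X_{\cdot1},\dots,\bar X_{\cdot q})^\top$. The maximum pseudolikelihood estimate is $\hat\beta:=\arg\max_{\beta\in\mathbb R}L(\beta|\bm X)$, where $L(\beta|\bm X):=\prod_{i=1}^N\mathbb P_{\beta,0,N}(X_i\mid(X_j)_{j\ne i})$ (the conditional probabilities being given by the same formula for all real $\beta$); on the event that there is no unique maximizer, $\hat\beta$ is defined arbitrarily. $\mathcal P_q$ is the set of $q$-dimensional probability vectors, and $H_{\beta,0}(\bm t)=\beta\sum_{r=1}^q t_r^p-\sum_{r=1}^q t_r\log t_r$ on $\mathcal P_q$ (with $0\log0=0$). $\beta_c=\beta_c(p,q)>0$ is the threshold, known to exist, such that for all $\beta>\beta_c$ the function $H_{\beta,0}$ has exactly $q$ global maximizers $\bm m_1,\dots,\bm m_q$, which are permutations of one another. Fix $\epsilon>0$ smaller than the distance between any two of these maximizers. $\Sigma_i$ is the covariance matrix of $\bm W_N^{(i)}:=\sqrt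 N(\bar{\bm X}_N-\bm m_i)$ under the conditional measure $\mathbb P_{\beta,0,N}(\,\cdot\mid\bar{\bm X}_N\in B(\bm m_i,\epsilon))$, where $B(\bm m_i,\epsilon)$ is the ball of radius $\epsilon$ about $\bm m_i$; it depends on $N$. $\Sigma_i^{1/2}$ is its symmetric positive semidefinite square root. $\nabla_{\bm x}S$ is the gradient in $\bm x\in\mathbb R^q$. *)

theory Defs
  imports "HOL-Probability.Probability" "HOL-Library.Landau_Symbols"
begin

text \<open>
  The set of colours \<open>[q]\<close> is a finite type \<open>'q\<close>, so \<open>q = CARD('q)\<close> and \<open>\<real>\<^sup>q\<close> is \<open>real^'q\<close>.
  A configuration in \<open>[q]\<^sup>N\<close> is an extensional function on the sites \<open>{1..N}\<close>.
\<close>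

definition configs :: "nat \<Rightarrow> (nat \<Rightarrow> 'q::finite) set" where
  "configs N = {1..N} \<rightarrow>\<^sub>E UNIV"

definition magnetization :: "nat \<Rightarrow> (nat \<Rightarrow> 'q::finite) \<Rightarrow> real^'q" where
  "magnetization N X = (\<chi> r. (1 / real N) * (\<Sum>i\<in>{1..N}. of_bool (X i = r)))"

definition boltzmann_weight :: "nat \<Rightarrow> real \<Rightarrow> nat \<Rightarrow> (nat \<Rightarrow> 'q::finite) \<Rightarrow> real" where
  "boltzmann_weight p \<beta> N X = exp (\<beta> * real N * (\<Sum>r\<in>UNIV. (magnetization N X $ r) ^ p))"

definition partition_fun :: "'q::finite itself \<Rightarrow> nat \<Rightarrow> real \<Rightarrow> nat \<Rightarrow> real" where
  "partition_fun _ p \<beta> N =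
     (1 / real CARD('q) ^ N) * (\<Sum>X\<in>(configs N :: (nat \<Rightarrow> 'q) set). boltzmann_weight p \<beta> N X)"

definition potts :: "nat \<Rightarrow> real \<Rightarrow> nat \<Rightarrow> (nat \<Rightarrow> 'q::finite) measure" where
  "potts p \<beta> N = point_measure (configs N)
     (\<lambda>X. ennreal (boltzmann_weight p \<beta> N X /
        (real CARD('q) ^ N * partition_fun TYPE('q) p \<beta> N)))"

definition pseudolikelihood :: "nat \<Rightarrow> nat \<Rightarrow> (nat \<Rightarrow> 'q::finite) \<Rightarrow> real \<Rightarrow> real" where
  "pseudolikelihood p N X \<beta> =
     (\<Prod>i\<in>{1..N}. \<P>(Y in potts p \<beta> N. Y i = X i \<bar> \<forall>j\<in>{1..N} - {i}. Y j = X j))"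

text \<open>
  Only the value at samples whose pseudolikelihood has a unique maximizer over \<open>\<real>\<close> is prescribed;
  elsewhere the estimate is arbitrary.
\<close>

definition is_mple :: "nat \<Rightarrow> nat \<Rightarrow> ((nat \<Rightarrow> 'q::finite) \<Rightarrow> real) \<Rightarrow> bool" where
  "is_mple p N est \<longleftrightarrow>
     (\<forall>X\<in>configs N. (\<exists>!b. is_arg_max (pseudolikelihood p N X) (\<lambda>_. True) b) \<longrightarrow>
        is_arg_max (pseudolikelihood p N X) (\<lambda>_. True) (est X))"

definition prob_simplex :: "(real^'q::finite) set" where
  "prob_simplex = {t. (\<forall>r. 0 \<le> t $ r) \<and> (\<Sum>r\<in>UNIV. t $ r) = 1}"

text \<open>The convention \<open>0 log 0 = 0\<close> is automatic, as \<open>0 * ln 0 = 0\<close>.\<close>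

definition H :: "nat \<Rightarrow> real \<Rightarrow> real^'q::finite \<Rightarrow> real" where
  "H p \<beta> t = \<beta> * (\<Sum>r\<in>UNIV. (t $ r) ^ p) - (\<Sum>r\<in>UNIV. t $ r * ln (t $ r))"

definition maximizers :: "nat \<Rightarrow> real \<Rightarrow> (real^'q::finite) set" where
  "maximizers p \<beta> = {t. is_arg_max (H p \<beta>) (\<lambda>s. s \<in> prob_simplex) t}"

text \<open>
  The threshold is the least \<open>b > 0\<close> beyond which there are always exactly \<open>q\<close> global maximizers,
  all permutations of one another. The defining set is upward closed in \<open>(0, \<infinity>)\<close>.
\<close>

definition beta_c :: "'q::finite itself \<Rightarrow> nat \<Rightarrow> real" where
  "beta_c _ p = Inf {b. b > 0 \<and> (\<forall>\<beta>>b.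
       card (maximizers p \<beta> :: (real^'q) set) = CARD('q) \<and>
       (\<forall>s\<in>(maximizers p \<beta> :: (real^'q) set). \<forall>t\<in>maximizers p \<beta>.
          \<exists>\<pi> :: 'q \<Rightarrow> 'q. bij \<pi> \<and> t = (\<chi> r. s $ \<pi> r)))}"

definition covariance_matrix :: "'a measure \<Rightarrow> ('a \<Rightarrow> real^'n::finite) \<Rightarrow> real^'n^'n" where
  "covariance_matrix M W = (\<chi> r s. LINT \<omega>|M.
     (W \<omega> $ r - (LINT \<omega>'|M. W \<omega>' $ r)) * (W \<omega> $ s - (LINT \<omega>'|M. W \<omega>' $ s)))"

text \<open>\<open>uniform_measure M A\<close> is the measure \<open>M\<close> conditioned on the event \<open>A\<close>.\<close>

definition cond_covariance ::
    "nat \<Rightarrow> real \<Rightarrow> real \<Rightarrow> nat \<Rightarrow> real^'q::finite \<Rightarrow> real^'q^'q" where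
  "cond_covariance p \<beta> \<epsilon> N m = covariance_matrix
     (uniform_measure (potts p \<beta> N) {X \<in> configs N. magnetization N X \<in> ball m \<epsilon>})
     (\<lambda>X. sqrt (real N) *\<^sub>R (magnetization N X - m))"

definition psd_sqrt :: "real^'n^'n \<Rightarrow> real^'n^'n::finite" where
  "psd_sqrt A = (THE B. transpose B = B \<and> (\<forall>x. 0 \<le> x \<bullet> (B *v x)) \<and> B ** B = A)"

definition std_normal_vector :: "(real^'n::finite) measure" where
  "std_normal_vector = density lborel (\<lambda>z. ennreal (\<Prod>r\<in>UNIV. std_normal_density (z $ r)))"

definition S :: "nat \<Rightarrow> real^'q::finite \<Rightarrow> real \<Rightarrow> real" where
  "S p x \<beta> = (\<Sum>r\<in>UNIV. (x $ r) ^ p) -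
     (\<Sum>r\<in>UNIV. (x $ r) ^ (p - 1) * exp (\<beta> * real p * (x $ r) ^ (p - 1))) /
     (\<Sum>r\<in>UNIV. exp (\<beta> * real p * (x $ r) ^ (p - 1)))"

definition gradient :: "('a::real_inner \<Rightarrow> real) \<Rightarrow> 'a \<Rightarrow> 'a" where
  "gradient f x = (THE D. GDERIV f x :> D)"

definition rho :: "nat \<Rightarrow> real \<Rightarrow> real^'q::finite \<Rightarrow> real^'q" where
  "rho p \<beta> m = - (gradient (\<lambda>x. S p x \<beta>) m /\<^sub>R deriv (S p m) \<beta>)"

end

theory Submission
  imports Defs
begin

text \<open>
  Exactly \<open>q\<close> global maximizers can only be the \<open>q\<close> vectors with one coordinate \<open>a\<close> and all others equal to some
  \<open>b < a\<close>: moving mass between two coordinates shows that an interior maximizer which is not uniform has this shape,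
  and the number of maximizers excludes the uniform vector. That vector would also maximize if the Hessian degenerated
  at a peak.

  Resampling single sites from their conditional laws gives an exchange identity for the Gibbs measure. Near a peak
  \<open>m\<close> with large coordinate \<open>c\<close> it is an approximate Stein identity for the \<open>c\<close>-th coordinate of the magnetization alone,
  which yields the conditional variance and a Berry--Esseen bound of order \<open>1 / sqrt N\<close>.

  The logarithmic derivative of the pseudolikelihood is \<open>N p S (magnetization) + O(1)\<close> and strictly decreasing, hence
  \<open>est - \<beta> = \<rho> \<bullet> (magnetization - m) + O(ln N / N)\<close> off an event of probability \<open>O(1 / N\<^sup>2)\<close>. On vectors with
  coordinate sum \<open>0\<close>, \<open>\<rho>\<close> acts as a positive multiple of the \<open>c\<close>-th coordinate, so the one-dimensional bound suffices.
  The peaks have equal weight by symmetry.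
\<close>

section \<open>The shape of the maximizers\<close>

text \<open>The linearised drift on the tangent space of the simplex mixes the coordinates. The
  peak, however, is fixed by all colour permutations that fix \<open>c\<close>, so the
  \<open>c\<close>-th coordinate decouples with its own rate \<open>lam\<close>. This avoids any
  matrix inversion or multivariate normal approximation. Stein's solution for an indicator has a
  corner at the threshold. Thresholds are therefore first taken on the lattice of values of the
  coordinate: a single update then never jumps over the corner, the errors of all \<open>N\<close>
  updates add up to \<open>O(1)\<close>, and the main term has size \<open>sqrt N\<close>. The
  logarithm comes from the scale \<open>ln N / N\<close> of the squared deviation, at which the
  large deviation bound beats the polynomial number of magnetizations. The quadratic remainder of
  the estimator has this size, and the factor \<open>sqrt N\<close> turns it into the stated rate.
  As the covariance matrices depend on \<open>N\<close>, their convergence is needed with a rate as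
  well. Configurations are counted by comparison with product measures, so that no asymptotics of
  multinomial coefficients enter.\<close>

lemma stays_below_if_decrease_persists:
  fixes f f' :: "real \<Rightarrow> real"
  assumes der: "\<And>x. x \<ge> 1 \<Longrightarrow> (f has_real_derivative f' x) (at x)"
    and pers: "\<And>x y. 1 \<le> x \<Longrightarrow> x < y \<Longrightarrow> f' x < 0 \<Longrightarrow> f' y < 0"
    and "f 1 \<ge> B" "1 \<le> x" "x < y" "f x < B"
  shows "f y < B"
proof -
  have "1 < x" using assms by (cases "x = 1") auto
  then obtain \<xi> where \<xi>: "1 < \<xi>" "\<xi> < x" "f x - f 1 = (x - 1) * f' \<xi>"
    using MVT2[of 1 x f f'] der by auto
  have "(x - 1) * f' \<xi> < 0" using \<xi>(3) assms by linarith
  hence neg: "f' \<xi> < 0" using \<open>1 < x\<close> by (simp add: mult_less_0_iff)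
  obtain \<eta> where \<eta>: "x < \<eta>" "\<eta> < y" "f y - f x = (y - x) * f' \<eta>"
    using MVT2[of x y f f'] der assms by auto
  have "f' \<eta> < 0" using pers[of \<xi> \<eta>] \<xi> \<eta> neg by linarith
  hence "(y - x) * f' \<eta> < 0" using assms by (simp add: mult_less_0_iff)
  thus ?thesis using \<eta> assms by linarith
qed

text \<open>
  With \<open>c = q - 1\<close> and \<open>k = p - 1\<close>, \<open>Qpoly\<close> at \<open>x = a / b\<close> has the sign of the derivative of
  \<open>c a\<^sup>k b + a b\<^sup>k\<close> along the segment from the uniform vector to the peaks.
\<close>

definition Qpoly :: "real \<Rightarrow> nat \<Rightarrow> real \<Rightarrow> real" where
  "Qpoly c k x = - c * x ^ k + c\<^sup>2 * real k * x ^ (k - 1) - real k * x + c"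

text \<open>A positive power of \<open>x\<close> times a decreasing affine factor stays negative
  once it is negative, and for \<open>k \<ge> 3\<close> the second derivative has this form.
  \<open>stays_below_if_decrease_persists\<close> passes the property on to the first derivative and
  then to \<open>Qpoly\<close>, because both are nonnegative at \<open>1\<close>. For
  \<open>k = 2\<close> one such passage is enough, and for \<open>k = 1\<close> the polynomial
  factors.\<close>

lemma Qpoly_negative_persistent:
  fixes c :: real
  assumes c: "c \<ge> 1" and k: "k \<ge> 1" and xy: "1 \<le> x" "x < y" and neg: "Qpoly c k x < 0"
  shows "Qpoly c k y < 0"
proof -
  have Q1: "Qpoly c k 1 \<ge> 0"
  proof -
    have "Qpoly c k 1 = real k * (c\<^sup>2 - 1)" by (simp add: Qpoly_def algebra_simps)
    thus ?thesis using c by simp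
  qed
  consider "k = 1" | "k = 2" | j where "k = j + 3"
    using k by (metis One_nat_def Suc_1 add.commute le_Suc_ex not_less_eq_eq numeral_3_eq_3 le_antisym not_less_eq_eq)
  thus ?thesis
  proof cases
    case 1
    have e: "Qpoly c k t = (c + 1) * (c - t)" for t
      using 1 by (simp add: Qpoly_def algebra_simps power2_eq_square)
    show ?thesis using neg xy c unfolding e by (simp add: mult_less_0_iff)
  next
    case 2
    have e: "Qpoly c k t = - c * t^2 + 2 * c\<^sup>2 * t - 2 * t + c" for t
      using 2 by (simp add: Qpoly_def)
    show ?thesis
    proof (rule stays_below_if_decrease_persists[where f = "Qpoly c k" and f' = "\<lambda>t. - 2 * c * t + 2 * c\<^sup>2 - 2"])
      show "(Qpoly c k has_real_derivative - 2 * c * x + 2 * c\<^sup>2 - 2) (at x)" for x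
        unfolding e[abs_def] by (auto intro!: derivative_eq_intros)
      show "- 2 * c * y + 2 * c\<^sup>2 - 2 < 0" if "x < y" "- 2 * c * x + 2 * c\<^sup>2 - 2 < 0" for x y
      proof -
        have "c * x \<le> c * y" using that c by simp
        thus ?thesis using that by linarith
      qed
    qed (use Q1 xy neg in auto)
  next
    case 3
    define r where "r = real j"
    have r: "r \<ge> 0" by (simp add: r_def)
    define Q1f where "Q1f t = - c * (r + 3) * t ^ (j + 2) + c\<^sup>2 * (r + 3) * (r + 2) * t ^ (j + 1) - (r + 3)" for t :: real
    define Q2f where "Q2f t = c * (r + 3) * (r + 2) * t ^ j * (c * (r + 1) - t)" for t :: real
    have e: "Qpoly c k t = - c * t^(j + 3) + c\<^sup>2 * (r + 3) * t ^ (j + 2) - (r + 3) * t + c" for t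
      using 3 by (simp add: Qpoly_def r_def numeral_3_eq_3 add.commute)
    have pw: "((\<lambda>t. t ^ (j + n + 1)) has_real_derivative (r + real n + 1) * t ^ (j + n)) (at t)" for n and t :: real
      using DERIV_pow[of "j + n + 1" t] by (simp add: r_def algebra_simps del: power_Suc)
    have pw3: "((\<lambda>t. t ^ (j + 3)) has_real_derivative (r + 3) * t ^ (j + 2)) (at t)"
      and pw2: "((\<lambda>t. t ^ (j + 2)) has_real_derivative (r + 2) * t ^ (j + 1)) (at t)"
      and pw1: "((\<lambda>t. t ^ (j + 1)) has_real_derivative (r + 1) * t ^ j) (at t)" for t :: real
      using pw[where n = 2 and t = t] pw[where n = 1 and t = t] pw[where n = 0 and t = t] by (simp_all add: numeral_3_eq_3 add_ac del: power_Suc)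
    have d1: "(Qpoly c k has_real_derivative Q1f t) (at t)" for t
    proof -
      have "((\<lambda>t. - c * t^(j + 3) + c\<^sup>2 * (r + 3) * t ^ (j + 2) - (r + 3) * t + c) has_real_derivative
          - c * ((r + 3) * t ^ (j + 2)) + c\<^sup>2 * (r + 3) * ((r + 2) * t ^ (j + 1)) - (r + 3) * 1 + 0) (at t)"
        by (intro DERIV_add DERIV_diff DERIV_cmult pw3 pw2 DERIV_ident DERIV_const)
      thus ?thesis unfolding e[abs_def] Q1f_def by (simp add: mult.assoc)
    qed
    have d2: "(Q1f has_real_derivative Q2f t) (at t)" for t
    proof -
      have "(Q1f has_real_derivative - c * (r + 3) * ((r + 2) * t ^ (j + 1)) + c\<^sup>2 * (r + 3) * (r + 2) * ((r + 1) * t ^ j) - 0) (at t)"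
        unfolding Q1f_def[abs_def]
        by (intro DERIV_add DERIV_diff DERIV_cmult pw2 pw1 DERIV_const)
      thus ?thesis unfolding Q2f_def by (simp add: algebra_simps power2_eq_square)
    qed
    have p2: "Q2f v < 0" if "1 \<le> u" "u < v" "Q2f u < 0" for u v
    proof -
      have pos: "c * (r + 3) * (r + 2) * t ^ j > 0" if "t \<ge> 1" for t
        using that c r by (simp add: add_nonneg_pos)
      have "\<not> 0 \<le> c * (r + 1) - u"
      proof
        assume "0 \<le> c * (r + 1) - u"
        hence "0 \<le> Q2f u" unfolding Q2f_def by (rule mult_nonneg_nonneg[OF less_imp_le[OF pos[OF that(1)]]])
        thus False using that by simp
      qed
      hence "c * (r + 1) - v < 0" using that by simp
      thus ?thesis unfolding Q2f_def using pos[of v] that by (intro mult_pos_neg) auto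
    qed
    have "Q1f 1 = (r + 3) * (c\<^sup>2 * (r + 2) - c - 1)" by (simp add: Q1f_def algebra_simps)
    moreover have "c\<^sup>2 * (r + 2) - c - 1 \<ge> 0"
    proof -
      have "c \<le> c\<^sup>2" using c by (simp add: power2_eq_square)
      moreover have "c\<^sup>2 * 2 \<le> c\<^sup>2 * (r + 2)" using r by (intro mult_left_mono) auto
      ultimately show ?thesis using c by linarith
    qed
    ultimately have q11: "Q1f 1 \<ge> 0" using r by simp
    have p1: "Q1f v < 0" if "1 \<le> u" "u < v" "Q1f u < 0" for u v
      by (rule stays_below_if_decrease_persists[where f = Q1f and f' = Q2f, OF d2 p2 q11 that])
    show ?thesis
      by (rule stays_below_if_decrease_persists[where f = "Qpoly c k" and f' = Q1f, OF d1 p1 Q1 xy neg])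
  qed
qed

definition entropy_term :: "nat \<Rightarrow> real \<Rightarrow> real \<Rightarrow> real" where
  "entropy_term p \<beta> t = \<beta> * t ^ p - t * ln t"

lemma H_eq_sum: "H p \<beta> t = (\<Sum>r\<in>UNIV. entropy_term p \<beta> (t $ r))"
  by (simp add: H_def entropy_term_def sum_subtractf sum_distrib_left)

lemma entropy_term_deriv:
  assumes "t > 0"
  shows "(entropy_term p \<beta> has_real_derivative \<beta> * real p * t ^ (p - 1) - ln t - 1) (at t)"
  unfolding entropy_term_def[abs_def] using assms
  by (auto intro!: derivative_eq_intros simp: algebra_simps)

text \<open>The derivative of \<open>entropy_term\<close> plus \<open>1\<close>. At an interior
  maximizer on the simplex it has the same value at all coordinates (the Lagrange
  condition).\<close>

definition crit_fun :: "nat \<Rightarrow> real \<Rightarrow> real \<Rightarrow> real" where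
  "crit_fun p \<beta> t = \<beta> * real p * t ^ (p - 1) - ln t"

lemma crit_fun_deriv:
  assumes "t > 0" "p \<ge> 2"
  shows "(crit_fun p \<beta> has_real_derivative (\<beta> * real p * (real p - 1) * t ^ (p - 1) - 1) / t) (at t)"
proof -
  have "t ^ (p - 1) = t ^ (p - 2) * t" using assms
    by (metis Suc_1 Suc_diff_le diff_Suc_Suc diff_diff_left plus_1_eq_Suc power_Suc2)
  moreover have "p - Suc (Suc 0) = p - 2" by simp
  ultimately show ?thesis
    unfolding crit_fun_def[abs_def] using assms
    by (auto intro!: derivative_eq_intros simp: field_simps of_nat_diff)
qed

text \<open>Rolle's theorem gives a zero of the derivative strictly between the points. The
  derivative has the sign of \<open>\<beta> p (p - 1) t^(p - 1) - 1\<close>; its zero forces a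
  positive coefficient, so this expression increases strictly, and \<open>x\<close> lies on the
  decreasing branch of \<open>crit_fun\<close>, \<open>y\<close> on the increasing one.\<close>

lemma crit_fun_eq_imp:
  assumes "0 < x" "x < y" "crit_fun p \<beta> x = crit_fun p \<beta> y" "p \<ge> 2"
  shows "\<beta> > 0" "\<beta> * real p * (real p - 1) * x ^ (p - 1) < 1" "\<beta> * real p * (real p - 1) * y ^ (p - 1) > 1"
proof -
  let ?c = "\<beta> * real p * (real p - 1)"
  have "\<exists>z>x. z < y \<and> crit_fun p \<beta> y - crit_fun p \<beta> x = (y - x) * ((?c * z ^ (p - 1) - 1) / z)"
    by (rule MVT2) (use assms crit_fun_deriv in auto)
  then obtain z where z: "x < z" "z < y" "(y - x) * ((?c * z ^ (p - 1) - 1) / z) = 0"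
    using assms by auto
  hence e: "?c * z ^ (p - 1) = 1" using assms by auto
  have "z ^ (p - 1) > 0" using z assms by auto
  hence c: "?c > 0" using e by (metis zero_less_mult_pos2 zero_less_one)
  thus "\<beta> > 0" using assms by (simp add: zero_less_mult_iff)
  have "x ^ (p - 1) < z ^ (p - 1)" "z ^ (p - 1) < y ^ (p - 1)"
    using assms z by (auto intro!: power_strict_mono)
  thus "?c * x ^ (p - 1) < 1" "?c * y ^ (p - 1) > 1"
    using c e by (metis mult_less_cancel_left_pos)+
qed

definition shift_mass :: "'q \<Rightarrow> 'q \<Rightarrow> real \<Rightarrow> real^'q \<Rightarrow> real^'q::finite" where
  "shift_mass r s d t = (\<chi> u. if u = s then t $ s + d else if u = r then t $ r - d else t $ u)"

lemma sum_split2: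
  fixes f :: "'q::finite \<Rightarrow> real"
  assumes "r \<noteq> s"
  shows "(\<Sum>u\<in>UNIV. f u) = f r + f s + (\<Sum>u\<in>UNIV - {r, s}. f u)"
  using assms by (subst sum.subset_diff[of "{r, s}"]) auto

lemma shift_mass_simplex:
  assumes "t \<in> prob_simplex" "r \<noteq> s" "- (t $ s) \<le> d" "d \<le> t $ r"
  shows "shift_mass r s d t \<in> prob_simplex"
proof -
  have "(\<Sum>u\<in>UNIV. shift_mass r s d t $ u) = (\<Sum>u\<in>UNIV. t $ u)"
    using assms by (simp add: sum_split2[OF assms(2)] shift_mass_def)
  thus ?thesis using assms by (auto simp: prob_simplex_def shift_mass_def)
qed

lemma H_shift_mass:
  assumes "r \<noteq> s"
  shows "H p \<beta> (shift_mass r s d t) = H p \<beta> t + entropy_term p \<beta> (t $ s + d) + entropy_term p \<beta> (t $ r - d)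
      - entropy_term p \<beta> (t $ s) - entropy_term p \<beta> (t $ r)"
  using assms by (simp add: H_eq_sum sum_split2[OF assms] shift_mass_def)

lemma maximizers_iff:
  fixes t :: "real^'q::finite"
  shows "t \<in> maximizers p \<beta> \<longleftrightarrow> t \<in> prob_simplex \<and> (\<forall>s\<in>(prob_simplex :: (real^'q) set). H p \<beta> s \<le> H p \<beta> t)"
  by (auto simp: maximizers_def is_arg_max_linorder)

lemma maximizer_exchange:
  assumes "t \<in> maximizers p \<beta>" "r \<noteq> s" "- (t $ s) \<le> d" "d \<le> t $ r"
  shows "entropy_term p \<beta> (t $ s + d) + entropy_term p \<beta> (t $ r - d)
      \<le> entropy_term p \<beta> (t $ s) + entropy_term p \<beta> (t $ r)"
  using assms shift_mass_simplex[of t r s d] H_shift_mass[of r s p \<beta> d t]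
  by (fastforce simp: maximizers_iff)

text \<open>The slope of \<open>- t ln t\<close> is infinite at \<open>0\<close>, so moving a little
  mass from a positive coordinate to an empty one would raise \<open>H\<close>.\<close>

lemma maximizer_pos:
  assumes t: "t \<in> maximizers p \<beta>" and p: "p \<ge> 2"
  shows "t $ s > 0"
proof (rule ccontr)
  assume "\<not> ?thesis"
  hence s0: "t $ s = 0" using t by (force simp: maximizers_iff prob_simplex_def intro: antisym)
  have "\<exists>r. t $ r > 0"
  proof (rule ccontr)
    assume "\<not> ?thesis"
    hence "(\<Sum>r\<in>UNIV. t $ r) \<le> 0" by (intro sum_nonpos) (auto simp: not_less)
    thus False using t by (simp add: maximizers_iff prob_simplex_def)
  qed
  then obtain r where r: "t $ r > 0" by auto
  hence rs: "r \<noteq> s" using s0 by auto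
  let ?e = "entropy_term p \<beta>"
  let ?D = "\<beta> * real p * (t $ r) ^ (p - 1) - ln (t $ r) - 1"
  have lim: "((\<lambda>d. (?e (t $ r - d) - ?e (t $ r)) / - d) \<longlongrightarrow> ?D) (at_right 0)"
  proof -
    have "((\<lambda>h. (?e (t $ r + h) - ?e (t $ r)) / h) \<longlongrightarrow> ?D) (at 0)"
      using entropy_term_deriv[OF r, of p \<beta>] by (simp add: DERIV_def)
    moreover have "filterlim (\<lambda>d::real. - d) (at 0) (at_right 0)"
    proof (rule filterlim_atI)
      have "((\<lambda>d::real. - d) \<longlongrightarrow> - 0) (at_right 0)" by (intro tendsto_intros)
      thus "((\<lambda>d::real. - d) \<longlongrightarrow> 0) (at_right 0)" by simp
      show "\<forall>\<^sub>F x::real in at_right 0. - x \<noteq> 0"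
        by (rule eventually_at_rightI[of 0 1]) auto
    qed
    ultimately show ?thesis
      using filterlim_compose[of "\<lambda>h. (?e (t $ r + h) - ?e (t $ r)) / h" _ "at 0" "\<lambda>d::real. - d"] by simp
  qed
  have "eventually (\<lambda>d. (?e (t $ r - d) - ?e (t $ r)) / - d < ?D + 1) (at_right 0)"
    using order_tendstoD(2)[OF lim, of "?D + 1"] by simp
  \<comment> \<open>The entropy gain \<open>- d ln d\<close> has to exceed both the loss, at most
    \<open>(?D + 1) * d\<close>, and the term \<open>\<bar>\<beta>\<bar> * d\<close>, since
    \<open>\<beta>\<close> may be negative here.\<close>
  moreover have "eventually (\<lambda>d::real. ln d < - (?D + 1 + \<bar>\<beta>\<bar>)) (at_right 0)"
    using ln_at_0 by (auto simp: filterlim_at_bot_dense)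
  moreover have "eventually (\<lambda>d. 0 < d \<and> d < min 1 (t $ r)) (at_right 0)"
    using r by (intro eventually_at_rightI[of 0 "min 1 (t $ r)"]) auto
  ultimately have "eventually (\<lambda>d. False) (at_right (0::real))"
  proof eventually_elim
    case (elim d)
    hence d: "0 < d" "d < 1" "d < t $ r" by auto
    have "?e d + ?e (t $ r - d) \<le> ?e (t $ r)"
    proof -
      have "p > 0" using p by simp
      thus ?thesis using maximizer_exchange[OF t rs, of d] d s0 by (simp add: entropy_term_def zero_power)
    qed
    moreover have "?e (t $ r) - ?e (t $ r - d) < (?D + 1) * d"
      using elim(1) d by (simp add: field_simps)
    moreover have "?e d > (?D + 1) * d"
    proof -
      have "- (\<bar>\<beta>\<bar> * d) \<le> \<beta> * d ^ p"
      proof -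
        have "d ^ p \<le> d ^ 1" using d p by (intro power_decreasing) auto
        hence "\<bar>\<beta>\<bar> * d ^ p \<le> \<bar>\<beta>\<bar> * d" by (intro mult_left_mono) auto
        moreover have "- (\<bar>\<beta>\<bar> * d ^ p) \<le> \<beta> * d ^ p"
          using d by (smt (verit, best) abs_minus_le_zero mult_minus_left mult_right_mono zero_le_power)
        ultimately show ?thesis by linarith
      qed
      moreover have "d * ln d < d * (- (?D + 1 + \<bar>\<beta>\<bar>))"
        using elim(2) d by (intro mult_strict_left_mono) auto
      ultimately show ?thesis by (simp add: entropy_term_def algebra_simps)
    qed
    ultimately show False by linarith
  qed
  thus False by simp
qed

lemma maximizer_critical:
  assumes t: "t \<in> maximizers p \<beta>" and p: "p \<ge> 2"
  shows "crit_fun p \<beta> (t $ r) = crit_fun p \<beta> (t $ s)"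
proof (cases "r = s")
  case False
  have pos: "t $ r > 0" "t $ s > 0" using maximizer_pos[OF t p] by auto
  let ?e = "entropy_term p \<beta>"
  let ?f = "\<lambda>d. ?e (t $ s + d) + ?e (t $ r - d)"
  have d: "(?f has_real_derivative (crit_fun p \<beta> (t $ s) - 1) * 1 + (crit_fun p \<beta> (t $ r) - 1) * (-1)) (at 0)"
    unfolding crit_fun_def
    by (intro DERIV_add DERIV_chain2[of ?e] derivative_eq_intros
        entropy_term_deriv[THEN DERIV_cong]) (use pos in auto)
  have "(crit_fun p \<beta> (t $ s) - 1) * 1 + (crit_fun p \<beta> (t $ r) - 1) * (-1) = 0"
  proof (rule DERIV_local_max[OF d])
    show "0 < min (t $ r) (t $ s)" using pos by simp
    show "\<forall>y. \<bar>0 - y\<bar> < min (t $ r) (t $ s) \<longrightarrow> ?f y \<le> ?f 0"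
      using maximizer_exchange[OF t False] by auto
  qed
  thus ?thesis by simp
qed simp

text \<open>Spreading two equal coordinates to \<open>y + h\<close> and \<open>y - h\<close> changes
  \<open>H\<close> by \<open>h\<close> times the difference of \<open>crit_fun\<close> at
  \<open>y + z\<close> and \<open>y - z\<close> for some \<open>z\<close> below \<open>h\<close>.
  This is a gain if \<open>crit_fun\<close> increases at \<open>y\<close>.\<close>

lemma maximizer_second_order:
  assumes t: "t \<in> maximizers p \<beta>" and p: "p \<ge> 2" and rs: "r \<noteq> s" and eq: "t $ r = t $ s"
  shows "\<beta> * real p * (real p - 1) * (t $ r) ^ (p - 1) \<le> 1"
proof (rule ccontr)
  assume neg: "\<not> ?thesis"
  define y where "y = t $ r"
  have y: "y > 0" using maximizer_pos[OF t p] by (simp add: y_def)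
  have "(\<beta> * real p * (real p - 1) * y ^ (p - 1) - 1) / y > 0" using neg y by (simp add: y_def)
  from DERIV_pos_inc_right[OF crit_fun_deriv[OF y p] this] DERIV_pos_inc_left[OF crit_fun_deriv[OF y p] this]
  obtain d1 d2 where d: "d1 > 0" "\<And>h. 0 < h \<Longrightarrow> h < d1 \<Longrightarrow> crit_fun p \<beta> y < crit_fun p \<beta> (y + h)"
     "d2 > 0" "\<And>h. 0 < h \<Longrightarrow> h < d2 \<Longrightarrow> crit_fun p \<beta> (y - h) < crit_fun p \<beta> y"
    by blast
  define h where "h = min (min d1 d2) y / 2"
  have h: "0 < h" "h < d1" "h < d2" "h < y" using d y by (auto simp: h_def min_def)
  let ?e = "entropy_term p \<beta>"
  let ?f = "\<lambda>d. ?e (y + d) + ?e (y - d)"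
  have der: "(?f has_real_derivative crit_fun p \<beta> (y + u) - crit_fun p \<beta> (y - u)) (at u)" if "0 \<le> u" "u \<le> h" for u
  proof -
    have "(?f has_real_derivative (crit_fun p \<beta> (y + u) - 1) * 1 + (crit_fun p \<beta> (y - u) - 1) * (-1)) (at u)"
      unfolding crit_fun_def
      by (intro DERIV_add DERIV_chain2[of ?e] derivative_eq_intros
        entropy_term_deriv[THEN DERIV_cong]) (use that h in auto)
    thus ?thesis by simp
  qed
  have "\<exists>z>0. z < h \<and> ?f h - ?f 0 = (h - 0) * (crit_fun p \<beta> (y + z) - crit_fun p \<beta> (y - z))"
    by (rule MVT2) (use h der in auto)
  then obtain z where z: "0 < z" "z < h" "?f h - ?f 0 = h * (crit_fun p \<beta> (y + z) - crit_fun p \<beta> (y - z))"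
    by auto
  have "crit_fun p \<beta> (y + z) > crit_fun p \<beta> (y - z)" using d(2)[of z] d(4)[of z] z h by linarith
  hence "?f h > ?f 0" using z h by (smt (verit) mult_pos_pos)
  moreover have "?f h \<le> ?f 0"
    using maximizer_exchange[OF t rs, of h] h eq by (simp add: y_def)
  ultimately show False by simp
qed

definition peak :: "real \<Rightarrow> real \<Rightarrow> 'q \<Rightarrow> real^'q::finite" where
  "peak a b c = (\<chi> r. if r = c then a else b)"

lemma peak_nth: "peak a b c $ r = (if r = c then a else b)"
  by (simp add: peak_def)

text \<open>Each of the two branches of \<open>crit_fun\<close> takes a value at most once, so the
  coordinates have at most two values. Two coordinates on the increasing branch would violate
  \<open>maximizer_second_order\<close>, hence the larger value occurs once.\<close>

lemma nonuniform_maximizer_peak: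
  assumes t: "t \<in> maximizers p \<beta>" and p: "p \<ge> 2" and nu: "t $ s < t $ r"
  shows "t = peak (t $ r) (t $ s) r"
proof -
  have eq: "crit_fun p \<beta> (t $ u) = crit_fun p \<beta> (t $ v)" for u v using maximizer_critical[OF t p] .
  have pos: "t $ u > 0" for u using maximizer_pos[OF t p] .
  note F = crit_fun_eq_imp[OF pos _ eq p]
  have "t $ u = t $ s" if "u \<noteq> r" for u
  proof -
    have "t $ u \<noteq> t $ r" using maximizer_second_order[OF t p that] F(3)[OF nu] by auto
    moreover have "\<not> t $ u > t $ r" using F(2)[of r u] F(3)[of s r] nu by auto
    ultimately have "t $ u < t $ r" by linarith
    moreover have "\<not> t $ u < t $ s" using F(3)[of u s] F(2)[of s r] nu by auto
    moreover have "\<not> t $ s < t $ u" using F(3)[of s u] F(2)[of u r] \<open>t $ u < t $ r\<close> by auto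
    ultimately show ?thesis by linarith
  qed
  thus ?thesis by (auto simp: vec_eq_iff peak_nth)
qed

lemma H_permute:
  fixes \<pi> :: "'q::finite \<Rightarrow> 'q"
  assumes "bij \<pi>"
  shows "H p \<beta> (\<chi> r. t $ \<pi> r) = H p \<beta> t"
  unfolding H_eq_sum using sum.reindex_bij_betw[OF assms, of "\<lambda>r. entropy_term p \<beta> (t $ r)"] by simp

lemma simplex_permute:
  fixes \<pi> :: "'q::finite \<Rightarrow> 'q"
  assumes "bij \<pi>" "t \<in> prob_simplex"
  shows "(\<chi> r. t $ \<pi> r) \<in> prob_simplex"
  using assms sum.reindex_bij_betw[OF assms(1), of "\<lambda>r. t $ r"] by (auto simp: prob_simplex_def)

lemma maximizers_permute:
  fixes \<pi> :: "'q::finite \<Rightarrow> 'q"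
  assumes "bij \<pi>" "t \<in> maximizers p \<beta>"
  shows "(\<chi> r. t $ \<pi> r) \<in> maximizers p \<beta>"
  using assms simplex_permute[OF assms(1)] by (auto simp: maximizers_iff H_permute)

text \<open>If all maximizers were uniform there would be at most one. A nonuniform one is a peak,
  its images under transpositions are \<open>q\<close> distinct maximizers, and the count leaves no
  room for others.\<close>

lemma maximizers_eq_peaks:
  assumes card: "card (maximizers p \<beta> :: (real^'q::finite) set) = CARD('q)" and q: "CARD('q) \<ge> 2" and p: "p \<ge> 2"
  obtains a b where "b < a" "maximizers p \<beta> = range (peak a b :: 'q \<Rightarrow> real^'q)"
proof -
  let ?M = "maximizers p \<beta> :: (real^'q) set"
  have "\<exists>t\<in>?M. \<exists>r s. t $ s < t $ r"
  proof (rule ccontr)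
    assume "\<not> ?thesis"
    hence eq: "t $ r = t $ s" if "t \<in> ?M" for t r s using that by (meson linorder_neqE_linordered_idom)
    have "t = (\<chi> r. 1 / CARD('q))" if "t \<in> ?M" for t
    proof -
      have "t $ r = 1 / CARD('q)" for r
      proof -
        have "(\<Sum>s\<in>UNIV. t $ s) = (\<Sum>s\<in>(UNIV::'q set). t $ r)" using eq[OF that] by (intro sum.cong) auto
        thus ?thesis using that by (simp add: maximizers_iff prob_simplex_def field_simps)
      qed
      thus ?thesis by (simp add: vec_eq_iff)
    qed
    hence "?M \<subseteq> {\<chi> r. 1 / CARD('q)}" by auto
    hence "card ?M \<le> 1" by (metis card.empty card_insert_le_m1 card_mono finite.emptyI finite.insertI diff_self_eq_0 less_one One_nat_def card_1_singleton_iff)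
    thus False using card q by simp
  qed
  then obtain t r s where t: "t \<in> ?M" "t $ s < t $ r" by auto
  define a b where "a = t $ r" and "b = t $ s"
  have ab: "b < a" using t by (simp add: a_def b_def)
  have tp: "t = peak a b r" unfolding a_def b_def by (rule nonuniform_maximizer_peak[OF t(1) p t(2)])
  have "peak a b c \<in> ?M" for c
  proof -
    have "bij (Fun.swap c r id)" by simp
    hence "(\<chi> u. t $ (Fun.swap c r id) u) \<in> ?M" by (rule maximizers_permute[OF _ t(1)])
    moreover have "(\<chi> u. t $ (Fun.swap c r id) u) = peak a b c"
      by (subst tp) (auto simp: vec_eq_iff peak_nth Fun.swap_def)
    ultimately show ?thesis by simp
  qed
  hence sub: "range (peak a b :: 'q \<Rightarrow> real^'q) \<subseteq> ?M" by auto
  have "inj (peak a b :: 'q \<Rightarrow> real^'q)"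
  proof (rule injI)
    fix x y :: 'q assume "peak a b x = peak a b y"
    hence "peak a b x $ x = peak a b y $ x" by simp
    thus "x = y" using ab by (auto simp: peak_nth split: if_splits)
  qed
  hence "card (range (peak a b :: 'q \<Rightarrow> real^'q)) = card ?M" by (simp add: card_image card)
  moreover have "finite ?M" using card q by (metis card.infinite not_numeral_le_zero)
  ultimately have "range (peak a b :: 'q \<Rightarrow> real^'q) = ?M" using sub by (simp add: card_subset_eq)
  thus ?thesis using that[OF ab] by simp
qed

lemma mult_neg_right_cancel: "0 < x \<Longrightarrow> x * y < 0 \<Longrightarrow> y < (0::real)"
  by (simp add: mult_less_0_iff)

text \<open>
  Along the segment from the uniform vector to the peak, the derivative of \<open>H\<close> is a positive multiple of a function
  \<open>D\<close> that vanishes at both ends, and \<open>D'\<close> has the sign of \<open>\<beta> p (p - 1) K - 1\<close>. If this is nonnegative at the peak,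
  then \<open>D \<le> 0\<close> on the whole segment and the uniform vector does at least as well as the peak.
\<close>

lemma peak_nondegenerate:
  fixes a b \<beta> :: real and p q :: nat
  defines "K \<equiv> \<lambda>a b. (real q - 1) * a ^ (p - 1) * b + a * b ^ (p - 1)"
  assumes p: "p \<ge> 2" and q: "q \<ge> 2" and ab: "0 < b" "b < a" and tot: "a + (real q - 1) * b = 1"
    and crit: "crit_fun p \<beta> a = crit_fun p \<beta> b"
    and better: "real q * entropy_term p \<beta> (1 / real q) < entropy_term p \<beta> a + (real q - 1) * entropy_term p \<beta> b"
  shows "\<beta> * real p * (real p - 1) * K a b < 1"
proof (rule ccontr)
  assume contra: "\<not> ?thesis"
  define c' where "c' = \<beta> * real p * (real p - 1)"
  define c where "c = real q - 1"
  define k where "k = p - 1"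
  have c: "c \<ge> 1" using q by (simp add: c_def)
  have k: "k \<ge> 1" using p by (simp add: k_def)
  have \<beta>: "\<beta> > 0" using crit_fun_eq_imp(1)[OF ab crit[symmetric] p] .
  have c': "c' > 0" using \<beta> p by (simp add: c'_def)
  have q0: "real q > 0" using q by simp
  have qc: "real q = c + 1" by (simp add: c_def)
  \<comment> \<open>The segment from the uniform vector (\<open>s = 0\<close>) to the peak
    (\<open>s = s1\<close>): \<open>A s\<close> is the distinguished coordinate and
    \<open>B s\<close> each of the others.\<close>
  define A where "A s = (1 + c * s) / real q" for s
  define B where "B s = (1 - s) / real q" for s
  define s1 where "s1 = 1 - real q * b"
  have tot': "a + c * b = 1" using tot by (simp add: c_def)
  have B1: "B s1 = b" using q0 by (simp add: B_def s1_def)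
  have A1: "A s1 = a"
  proof -
    have "1 + c * s1 = real q * (1 - c * b)" by (simp add: s1_def qc algebra_simps)
    also have "1 - c * b = a" using tot' by simp
    finally show ?thesis using q0 by (simp add: A_def)
  qed
  have "real q * b < 1"
  proof -
    have "real q * b = c * b + b" by (simp add: qc algebra_simps)
    thus ?thesis using tot' ab by simp
  qed
  hence s1: "0 < s1" "s1 < 1" using ab q0 by (auto simp: s1_def)
  have Apos: "A s > 0" if "s \<ge> 0" for s using that c q0 by (simp add: A_def add_pos_nonneg)
  have Bpos: "B s > 0" if "s < 1" for s using that q0 by (simp add: B_def)
  have AB1: "c * B s + A s = 1" for s
  proof -
    have "c * B s + A s = (c + 1) / real q"
      by (simp add: A_def B_def add_divide_distrib diff_divide_distrib algebra_simps)
    thus ?thesis using q0 by (simp add: qc)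
  qed
  have dA: "(A has_real_derivative c / real q) (at s)" for s
    unfolding A_def[abs_def] using q0 by (auto intro!: derivative_eq_intros)
  have dB: "(B has_real_derivative - 1 / real q) (at s)" for s
    unfolding B_def[abs_def] using q0 by (auto intro!: derivative_eq_intros)
  define D where "D s = crit_fun p \<beta> (A s) - crit_fun p \<beta> (B s)" for s
  define KK where "KK s = c * A s ^ k * B s + A s * B s ^ k" for s
  define F where "F s = entropy_term p \<beta> (A s) + c * entropy_term p \<beta> (B s)" for s
  have dF: "(F has_real_derivative (c / real q) * D s) (at s)" if "0 \<le> s" "s < 1" for s
  proof -
    have "(F has_real_derivative (crit_fun p \<beta> (A s) - 1) * (c / real q) + c * ((crit_fun p \<beta> (B s) - 1) * (- 1 / real q))) (at s)"
      unfolding F_def[abs_def] crit_fun_def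
      by (intro DERIV_add DERIV_cmult DERIV_chain2[of "entropy_term p \<beta>"] entropy_term_deriv dA dB Apos Bpos that)
    thus ?thesis by (simp add: D_def algebra_simps diff_divide_distrib)
  qed
  have dD: "(D has_real_derivative (c' * KK s - 1) / (real q * A s * B s)) (at s)" if "0 \<le> s" "s < 1" for s
  proof -
    have pos: "A s > 0" "B s > 0" using Apos Bpos that by auto
    have "(D has_real_derivative (c' * A s ^ k - 1) / A s * (c / real q) - (c' * B s ^ k - 1) / B s * (- 1 / real q)) (at s)"
      unfolding D_def[abs_def] c'_def k_def
      by (intro DERIV_diff DERIV_chain2[of "crit_fun p \<beta>"] crit_fun_deriv dA dB pos p)
    moreover have "(c' * A s ^ k - 1) / A s * (c / real q) - (c' * B s ^ k - 1) / B s * (- 1 / real q)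
        = (c' * KK s - (c * B s + A s)) / (real q * A s * B s)"
      using pos q0 by (simp add: KK_def field_simps)
    ultimately show ?thesis unfolding AB1 by simp
  qed
  have dK: "(KK has_real_derivative B s ^ k / real q * Qpoly c k (A s / B s)) (at s)" if "0 \<le> s" "s < 1" for s
  proof -
    have pos: "A s > 0" "B s > 0" using Apos Bpos that by auto
    obtain j where j: "k = Suc j" using k by (cases k) auto
    have "(KK has_real_derivative (c * (real k * A s ^ (k - 1) * (c / real q))) * B s + (c * A s ^ k) * (- 1 / real q)
        + ((c / real q) * B s ^ k + (real k * B s ^ (k - 1) * (- 1 / real q)) * A s)) (at s)"
      unfolding KK_def[abs_def]
      by (rule derivative_eq_intros dA dB refl | simp)+
    moreover have "(c * (real k * A s ^ (k - 1) * (c / real q))) * B s + (c * A s ^ k) * (- 1 / real q)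
        + ((c / real q) * B s ^ k + (real k * B s ^ (k - 1) * (- 1 / real q)) * A s)
        = B s ^ k / real q * Qpoly c k (A s / B s)"
      using pos q0 by (simp add: Qpoly_def j field_simps power2_eq_square)
    ultimately show ?thesis by simp
  qed
  have ratio: "A x / B x < A y / B y" if "0 \<le> x" "x < y" "y < 1" for x y
  proof (rule frac_less)
    show "A x < A y" using that c q0 by (simp add: A_def divide_strict_right_mono)
    show "B y \<le> B x" using that q0 by (simp add: B_def divide_right_mono)
  qed (use that Apos[of x] Bpos[of y] in auto)
  have ratio1: "A x / B x \<ge> 1" if "0 \<le> x" "x < 1" for x
    using that c q0 Bpos[of x] by (simp add: A_def B_def divide_right_mono field_simps)
  have D0: "D 0 = 0" by (simp add: D_def A_def B_def)
  have D1: "D s1 = 0" using crit by (simp add: D_def A1 B1)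
  have K1: "c' * KK s1 \<ge> 1" using contra by (simp add: KK_def A1 B1 K_def c'_def c_def k_def)
  \<comment> \<open>If \<open>D\<close> were positive inside, \<open>c' * KK\<close> would exceed
    \<open>1\<close> before \<open>s\<close>, lie below \<open>1\<close> after \<open>s\<close>, and
    be at least \<open>1\<close> again at \<open>s1\<close>. So \<open>KK\<close> would first fall
    and then rise. But its derivative has the sign of \<open>Qpoly\<close> at the increasing ratio
    \<open>A / B\<close>, and this sign cannot leave the negative range.\<close>
  have Dle: "D s \<le> 0" if s: "0 < s" "s < s1" for s
  proof (rule ccontr)
    assume "\<not> D s \<le> 0"
    hence Ds: "D s > 0" by simp
    obtain u1 where u1: "0 < u1" "u1 < s" "D s - D 0 = (s - 0) * ((c' * KK u1 - 1) / (real q * A u1 * B u1))"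
      using MVT2[of 0 s D "\<lambda>s. (c' * KK s - 1) / (real q * A s * B s)"] dD s s1 by force
    obtain u2 where u2: "s < u2" "u2 < s1" "D s1 - D s = (s1 - s) * ((c' * KK u2 - 1) / (real q * A u2 * B u2))"
      using MVT2[of s s1 D "\<lambda>s. (c' * KK s - 1) / (real q * A s * B s)"] dD s s1 by force
    have p1: "real q * A u1 * B u1 > 0" "real q * A u2 * B u2 > 0"
      using Apos Bpos q0 u1 u2 s s1 by auto
    have "0 < s * ((c' * KK u1 - 1) / (real q * A u1 * B u1))" using u1 D0 Ds by simp
    hence k1: "c' * KK u1 > 1" using p1 s by (simp add: zero_less_mult_iff zero_less_divide_iff)
    have "(s1 - s) * ((c' * KK u2 - 1) / (real q * A u2 * B u2)) < 0" using u2 D1 Ds by simp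
    hence "(c' * KK u2 - 1) / (real q * A u2 * B u2) < 0" by (rule mult_neg_right_cancel[rotated]) (use s in simp)
    hence k2: "c' * KK u2 < 1" using p1 by (simp add: divide_less_0_iff)
    have kk: "KK u2 < KK u1" "KK u2 < KK s1"
      using k1 k2 K1 c' mult_less_cancel_left_pos[OF c'] by (smt (verit))+
    have u12: "u1 < u2" using u1 u2 by simp
    obtain x where x: "u1 < x" "x < u2" "KK u2 - KK u1 = (u2 - u1) * (B x ^ k / real q * Qpoly c k (A x / B x))"
      using MVT2[OF u12, of KK "\<lambda>s. B s ^ k / real q * Qpoly c k (A s / B s)"] dK u1 u2 s s1 by force
    obtain y where y: "u2 < y" "y < s1" "KK s1 - KK u2 = (s1 - u2) * (B y ^ k / real q * Qpoly c k (A y / B y))"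
      using MVT2[of u2 s1 KK "\<lambda>s. B s ^ k / real q * Qpoly c k (A s / B s)"] dK u1 u2 s s1 by force
    have bp: "B x ^ k / real q > 0" "B y ^ k / real q > 0" using Bpos x y u2 s1 q0 by auto
    have "(u2 - u1) * (B x ^ k / real q * Qpoly c k (A x / B x)) < 0" using kk x by simp
    hence "B x ^ k / real q * Qpoly c k (A x / B x) < 0"
      by (rule mult_neg_right_cancel[rotated]) (use u12 in simp)
    hence nx: "Qpoly c k (A x / B x) < 0" by (rule mult_neg_right_cancel[OF bp(1)])
    have "Qpoly c k (A y / B y) < 0"
      by (rule Qpoly_negative_persistent[OF c k ratio1 ratio nx]) (use x y u1 u2 s s1 in auto)
    hence "(s1 - u2) * (B y ^ k / real q * Qpoly c k (A y / B y)) < 0"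
      using bp u2 by (intro mult_pos_neg) auto
    thus False using y kk by simp
  qed
  obtain z where z: "0 < z" "z < s1" "F s1 - F 0 = (s1 - 0) * ((c / real q) * D z)"
    using MVT2[of 0 s1 F "\<lambda>s. (c / real q) * D s"] dF s1 by force
  have "(c / real q) * D z \<le> 0" by (rule mult_nonneg_nonpos) (use Dle[OF z(1,2)] c q0 in auto)
  hence "F s1 \<le> F 0" using z s1 by (smt (verit) mult_nonneg_nonpos)
  moreover have "F s1 = entropy_term p \<beta> a + (real q - 1) * entropy_term p \<beta> b"
    by (simp add: F_def A1 B1 c_def)
  moreover have "F 0 = real q * entropy_term p \<beta> (1 / real q)"
    by (simp add: F_def A_def B_def qc algebra_simps)
  ultimately show False using better by simp
qed

lemma uniform_simplex: "(\<chi> r. 1 / real CARD('q)) \<in> (prob_simplex :: (real^'q::finite) set)"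
  by (simp add: prob_simplex_def)

lemma sum_peak:
  fixes c :: "'q::finite"
  shows "(\<Sum>r\<in>UNIV. (if r = c then x else y)) = x + (real CARD('q) - 1) * (y::real)"
proof -
  have "(\<Sum>r\<in>UNIV. (if r = c then x else y)) = x + (\<Sum>r\<in>UNIV - {c}. y)"
    by (subst sum.remove[of _ c]) (auto intro!: sum.cong)
  also have "(\<Sum>r\<in>UNIV - {c}. y) = (real CARD('q) - 1) * y"
    by (simp add: card_Diff_singleton of_nat_diff Suc_leI card_gt_0_iff)
  finally show ?thesis .
qed

lemma maximizers_peak_structure:
  assumes card: "card (maximizers p \<beta> :: (real^'q::finite) set) = CARD('q)" and q: "CARD('q) \<ge> 2" and p: "p \<ge> 2"
  obtains a b where "0 < b" "b < a" "maximizers p \<beta> = range (peak a b :: 'q \<Rightarrow> real^'q)"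
    "a + (real CARD('q) - 1) * b = 1" "crit_fun p \<beta> a = crit_fun p \<beta> b" "\<beta> > 0"
    "\<beta> * real p * (real p - 1) * b ^ (p - 1) < 1"
    "\<beta> * real p * (real p - 1) * ((real CARD('q) - 1) * a ^ (p - 1) * b + a * b ^ (p - 1)) < 1"
proof -
  obtain a b where ab: "b < a" and M: "maximizers p \<beta> = range (peak a b :: 'q \<Rightarrow> real^'q)"
    using maximizers_eq_peaks[OF card q p] by blast
  obtain c d :: 'q where cd: "d \<noteq> c" using q by (metis (full_types) card_2_iff' card_le_Suc0_iff_eq finite_class.finite_UNIV not_less_eq_eq numeral_2_eq_2 UNIV_I)
  let ?t = "peak a b c"
  have t: "?t \<in> maximizers p \<beta>" unfolding M by simp
  have b: "b > 0" using maximizer_pos[OF t p, of d] cd by (simp add: peak_nth)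
  have crit: "crit_fun p \<beta> a = crit_fun p \<beta> b"
    using maximizer_critical[OF t p, of c d] cd by (simp add: peak_nth)
  have tot: "a + (real CARD('q) - 1) * b = 1"
    using t sum_peak[of c a b] by (simp add: maximizers_iff prob_simplex_def peak_nth)
  have Ht: "H p \<beta> ?t = entropy_term p \<beta> a + (real CARD('q) - 1) * entropy_term p \<beta> b"
  proof -
    have "H p \<beta> ?t = (\<Sum>r\<in>UNIV. if r = c then entropy_term p \<beta> a else entropy_term p \<beta> b)"
      unfolding H_eq_sum by (intro sum.cong) (auto simp: peak_nth)
    thus ?thesis by (simp only: sum_peak)
  qed
  let ?u = "(\<chi> r. 1 / real CARD('q)) :: real^'q"
  \<comment> \<open>Every maximizer is a peak and has two different entries. This makes the
    comparison with the uniform vector strict, as \<open>peak_nondegenerate\<close>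
    requires.\<close>
  have "?u \<notin> maximizers p \<beta>"
  proof
    assume "?u \<in> maximizers p \<beta>"
    then obtain e where "?u = peak a b e" unfolding M by auto
    hence "?u $ e = a" by (simp add: peak_nth)
    moreover obtain e' where "e' \<noteq> e" using cd by metis
    hence "?u $ e' = b" using \<open>?u = peak a b e\<close> by (simp add: peak_nth)
    ultimately show False using ab by simp
  qed
  hence "H p \<beta> ?u < H p \<beta> ?t"
    using t uniform_simplex[where 'q = 'q] by (fastforce simp: maximizers_iff not_le)
  hence better: "real CARD('q) * entropy_term p \<beta> (1 / real CARD('q)) < entropy_term p \<beta> a + (real CARD('q) - 1) * entropy_term p \<beta> b"
    by (simp add: Ht) (simp add: H_eq_sum)
  note F = crit_fun_eq_imp[OF b ab crit[symmetric] p]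
  show ?thesis
    by (rule that[OF b ab M tot crit F(1,2) peak_nondegenerate[OF p q b ab tot crit better]])
qed

section \<open>Expansion at a maximizer\<close>

text \<open>Mere differentiability would give no rate. A remainder of second order does, and the
  notion is closed under the operations that build \<open>S\<close> and \<open>mean_field\<close>,
  without any second derivative.\<close>

definition quad_approx :: "('a::real_normed_vector \<Rightarrow> real) \<Rightarrow> 'a \<Rightarrow> ('a \<Rightarrow> real) \<Rightarrow> bool" where
  "quad_approx f x L \<longleftrightarrow> bounded_linear L \<and>
     (\<exists>C. \<forall>\<^sub>F y in nhds x. \<bar>f y - f x - L (y - x)\<bar> \<le> C * (norm (y - x))\<^sup>2)"

lemma eventually_nhds_norm_le:
  fixes x :: "'a::real_normed_vector"
  assumes "e > 0"
  shows "\<forall>\<^sub>F y in nhds x. norm (y - x) \<le> e"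
  using eventually_nhds_ball[OF assms, of x]
  by eventually_elim (simp add: dist_norm norm_minus_commute)

lemma quad_approxI:
  assumes "bounded_linear L" "\<forall>\<^sub>F y in nhds x. \<bar>f y - f x - L (y - x)\<bar> \<le> C * (norm (y - x))\<^sup>2"
  shows "quad_approx f x L"
  using assms by (auto simp: quad_approx_def)

lemma quad_approxE:
  assumes "quad_approx f x L"
  obtains C K where "bounded_linear L" "C \<ge> 0" "K \<ge> 0" "\<And>v. \<bar>L v\<bar> \<le> K * norm v"
    "\<forall>\<^sub>F y in nhds x. \<bar>f y - f x - L (y - x)\<bar> \<le> C * (norm (y - x))\<^sup>2"
proof -
  from assms obtain C where L: "bounded_linear L"
    and C: "\<forall>\<^sub>F y in nhds x. \<bar>f y - f x - L (y - x)\<bar> \<le> C * (norm (y - x))\<^sup>2"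
    by (auto simp: quad_approx_def)
  obtain K where K: "K \<ge> 0" "\<And>v. norm (L v) \<le> norm v * K"
    using bounded_linear.nonneg_bounded[OF L] by auto
  have "\<forall>\<^sub>F y in nhds x. \<bar>f y - f x - L (y - x)\<bar> \<le> max C 0 * (norm (y - x))\<^sup>2"
    using C
  proof eventually_elim
    case (elim y)
    have "C * (norm (y - x))\<^sup>2 \<le> max C 0 * (norm (y - x))\<^sup>2" by (intro mult_right_mono) auto
    thus ?case using elim by linarith
  qed
  thus ?thesis using that[OF L, of "max C 0" K] K by (auto simp: mult.commute)
qed

lemma quad_approx_cong:
  assumes "quad_approx f x L" "\<And>y. f y = g y" "\<And>v. L v = M v"
  shows "quad_approx g x M"
  using assms by (metis ext)

lemma quad_approx_const: "quad_approx (\<lambda>_. c) x (\<lambda>_. 0)"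
  by (rule quad_approxI[where C = 0]) auto

lemma quad_approx_linear: "bounded_linear f \<Longrightarrow> quad_approx f x f"
  by (rule quad_approxI[where C = 0]) (auto simp: bounded_linear.linear linear_diff)

lemma quad_approx_add:
  assumes "quad_approx f x L" "quad_approx g x M"
  shows "quad_approx (\<lambda>y. f y + g y) x (\<lambda>v. L v + M v)"
proof -
  from assms obtain C D where *: "bounded_linear L" "bounded_linear M"
      "\<forall>\<^sub>F y in nhds x. \<bar>f y - f x - L (y - x)\<bar> \<le> C * (norm (y - x))\<^sup>2"
      "\<forall>\<^sub>F y in nhds x. \<bar>g y - g x - M (y - x)\<bar> \<le> D * (norm (y - x))\<^sup>2"
    by (auto simp: quad_approx_def)
  show ?thesis
  proof (rule quad_approxI)
    show "\<forall>\<^sub>F y in nhds x. \<bar>f y + g y - (f x + g x) - (L (y - x) + M (y - x))\<bar> \<le> (C + D) * (norm (y - x))\<^sup>2"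
      using *(3,4) by eventually_elim (simp add: algebra_simps)
  qed (intro bounded_linear_add *)
qed

lemma quad_approx_cmult:
  assumes "quad_approx f x L"
  shows "quad_approx (\<lambda>y. c * f y) x (\<lambda>v. c * L v)"
proof -
  from assms obtain C where *: "bounded_linear L"
      "\<forall>\<^sub>F y in nhds x. \<bar>f y - f x - L (y - x)\<bar> \<le> C * (norm (y - x))\<^sup>2"
    by (auto simp: quad_approx_def)
  show ?thesis
  proof (rule quad_approxI)
    show "\<forall>\<^sub>F y in nhds x. \<bar>c * f y - c * f x - c * L (y - x)\<bar> \<le> (\<bar>c\<bar> * C) * (norm (y - x))\<^sup>2"
      using *(2)
    proof eventually_elim
      case (elim y)
      have "\<bar>c * f y - c * f x - c * L (y - x)\<bar> = \<bar>c\<bar> * \<bar>f y - f x - L (y - x)\<bar>"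
        by (simp add: abs_mult[symmetric] algebra_simps)
      also have "\<dots> \<le> \<bar>c\<bar> * (C * (norm (y - x))\<^sup>2)" using elim by (intro mult_left_mono) auto
      finally show ?case by simp
    qed
  qed (intro bounded_linear_mult_right[THEN bounded_linear_compose] *)
qed

lemma quad_approx_diff:
  assumes "quad_approx f x L" "quad_approx g x M"
  shows "quad_approx (\<lambda>y. f y - g y) x (\<lambda>v. L v - M v)"
  using quad_approx_add[OF assms(1) quad_approx_cmult[OF assms(2), of "-1"]] by simp

lemma quad_approx_sum:
  assumes "\<And>i. i \<in> I \<Longrightarrow> quad_approx (f i) x (L i)"
  shows "quad_approx (\<lambda>y. \<Sum>i\<in>I. f i y) x (\<lambda>v. \<Sum>i\<in>I. L i v)"
  using assms
  by (induction I rule: infinite_finite_induct) (auto intro: quad_approx_add quad_approx_const)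

lemma abs_triangle3: "\<bar>x + y + z\<bar> \<le> \<bar>x\<bar> + \<bar>y\<bar> + \<bar>z :: real\<bar>"
  by linarith

lemma quad_approx_mult:
  assumes "quad_approx f x L" "quad_approx g x M"
  shows "quad_approx (\<lambda>y. f y * g y) x (\<lambda>v. f x * M v + L v * g x)"
proof -
  obtain C K where 1: "bounded_linear L" "C \<ge> 0" "K \<ge> 0" "\<And>v. \<bar>L v\<bar> \<le> K * norm v"
    "\<forall>\<^sub>F y in nhds x. \<bar>f y - f x - L (y - x)\<bar> \<le> C * (norm (y - x))\<^sup>2"
    using quad_approxE[OF assms(1)] by blast
  obtain D J where 2: "bounded_linear M" "D \<ge> 0" "J \<ge> 0" "\<And>v. \<bar>M v\<bar> \<le> J * norm v"
    "\<forall>\<^sub>F y in nhds x. \<bar>g y - g x - M (y - x)\<bar> \<le> D * (norm (y - x))\<^sup>2"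
    using quad_approxE[OF assms(2)] by blast
  let ?E = "C * (\<bar>g x\<bar> + J + D) + (\<bar>f x\<bar> + K) * D + K * J"
  show ?thesis
  proof (rule quad_approxI)
    show "\<forall>\<^sub>F y in nhds x. \<bar>f y * g y - f x * g x - (f x * M (y - x) + L (y - x) * g x)\<bar> \<le> ?E * (norm (y - x))\<^sup>2"
      using 1(5) 2(5) eventually_nhds_norm_le[of 1 x, OF zero_less_one]
    proof eventually_elim
      case (elim y)
      define n where "n = norm (y - x)"
      have n: "0 \<le> n" "n \<le> 1" using elim by (auto simp: n_def)
      have n2: "n\<^sup>2 \<le> n" using n mult_left_le[of n n] by (simp add: power2_eq_square)
      hence n2': "n\<^sup>2 \<le> 1" using n by simp
      define l where "l = L (y - x)"
      define k where "k = M (y - x)"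
      define e where "e = f y - f x - l"
      define d where "d = g y - g x - k"
      have l: "\<bar>l\<bar> \<le> K * n" "\<bar>k\<bar> \<le> J * n" using 1(4) 2(4) by (auto simp: l_def k_def n_def)
      have ed: "\<bar>e\<bar> \<le> C * n\<^sup>2" "\<bar>d\<bar> \<le> D * n\<^sup>2" using elim by (auto simp: e_def d_def l_def k_def n_def)
      have "\<bar>g y\<bar> \<le> \<bar>g x\<bar> + \<bar>k\<bar> + \<bar>d\<bar>" by (simp add: d_def)
      also have "\<dots> \<le> \<bar>g x\<bar> + J + D"
      proof -
        have "J * n \<le> J" "D * n\<^sup>2 \<le> D" using 2 n n2' by (auto intro: mult_left_le)
        thus ?thesis using l ed by linarith
      qed
      finally have gy: "\<bar>g y\<bar> \<le> \<bar>g x\<bar> + J + D" .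
      have fl: "\<bar>f x + l\<bar> \<le> \<bar>f x\<bar> + K"
      proof -
        have "K * n \<le> K" using 1 n by (auto intro: mult_left_le)
        thus ?thesis using l by linarith
      qed
      \<comment> \<open>Every summand is quadratic in the distance: a remainder times a bounded
        factor, or the product of two linear terms.\<close>
      have "f y * g y - f x * g x - (f x * k + l * g x) = e * g y + (f x + l) * d + l * k"
        by (simp add: e_def d_def algebra_simps)
      hence "\<bar>f y * g y - f x * g x - (f x * k + l * g x)\<bar> \<le> \<bar>e * g y\<bar> + \<bar>(f x + l) * d\<bar> + \<bar>l * k\<bar>"
        by (simp only: abs_triangle3)
      also have "\<dots> \<le> (C * n\<^sup>2) * (\<bar>g x\<bar> + J + D) + (\<bar>f x\<bar> + K) * (D * n\<^sup>2) + (K * n) * (J * n)"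
      proof (intro add_mono)
        show "\<bar>e * g y\<bar> \<le> (C * n\<^sup>2) * (\<bar>g x\<bar> + J + D)"
          unfolding abs_mult by (rule mult_mono[OF ed(1) gy]) (use 1(2) in simp_all)
        show "\<bar>(f x + l) * d\<bar> \<le> (\<bar>f x\<bar> + K) * (D * n\<^sup>2)"
          unfolding abs_mult by (rule mult_mono[OF fl ed(2)]) (use 1(3) in simp_all)
        show "\<bar>l * k\<bar> \<le> (K * n) * (J * n)"
          unfolding abs_mult by (rule mult_mono[OF l]) (use 1(3) n in simp_all)
      qed
      also have "\<dots> = ?E * n\<^sup>2" by (simp add: algebra_simps power2_eq_square)
      finally show ?case by (simp add: l_def k_def n_def)
    qed
    show "bounded_linear (\<lambda>v. f x * M v + L v * g x)"
      by (intro bounded_linear_add bounded_linear_mult_right[THEN bounded_linear_compose]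
          bounded_linear_mult_left[THEN bounded_linear_compose] 1 2)
  qed
qed

lemma quad_approx_tendsto:
  assumes "quad_approx f x L"
  shows "filterlim f (nhds (f x)) (nhds x)"
proof -
  obtain C K where 1: "bounded_linear L" "C \<ge> 0" "K \<ge> 0" "\<And>v. \<bar>L v\<bar> \<le> K * norm v"
    "\<forall>\<^sub>F y in nhds x. \<bar>f y - f x - L (y - x)\<bar> \<le> C * (norm (y - x))\<^sup>2"
    using quad_approxE[OF assms] by blast
  have "((\<lambda>y. f y - f x) \<longlongrightarrow> 0) (nhds x)"
  proof (rule Lim_null_comparison)
    show "\<forall>\<^sub>F y in nhds x. norm (f y - f x) \<le> C * (norm (y - x))\<^sup>2 + K * norm (y - x)"
      using 1(5)
    proof eventually_elim
      case (elim y)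
      thus ?case using 1(4)[of "y - x"] by simp
    qed
    have "((\<lambda>y. C * (norm (y - x))\<^sup>2 + K * norm (y - x)) \<longlongrightarrow> C * (norm (x - x))\<^sup>2 + K * norm (x - x)) (nhds x)"
      by (intro tendsto_intros filterlim_ident)
    thus "((\<lambda>y. C * (norm (y - x))\<^sup>2 + K * norm (y - x)) \<longlongrightarrow> 0) (nhds x)" by simp
  qed
  thus ?thesis by (simp add: LIM_zero_iff)
qed

lemma quad_approx_compose:
  assumes "quad_approx f x L" and g: "quad_approx g (f x) (\<lambda>t. d * t)"
  shows "quad_approx (\<lambda>y. g (f y)) x (\<lambda>v. d * L v)"
proof -
  obtain C K where 1: "bounded_linear L" "C \<ge> 0" "K \<ge> 0" "\<And>v. \<bar>L v\<bar> \<le> K * norm v"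
    "\<forall>\<^sub>F y in nhds x. \<bar>f y - f x - L (y - x)\<bar> \<le> C * (norm (y - x))\<^sup>2"
    using quad_approxE[OF assms(1)] by blast
  obtain D J where 2: "bounded_linear (\<lambda>t. d * t)" "D \<ge> 0" "J \<ge> 0" "\<And>v. \<bar>d * v\<bar> \<le> J * norm v"
    "\<forall>\<^sub>F t in nhds (f x). \<bar>g t - g (f x) - d * (t - f x)\<bar> \<le> D * (norm (t - f x))\<^sup>2"
    by (rule quad_approxE[OF g]) (rule that)
  have 3: "\<forall>\<^sub>F y in nhds x. \<bar>g (f y) - g (f x) - d * (f y - f x)\<bar> \<le> D * (norm (f y - f x))\<^sup>2"
    using eventually_compose_filterlim[OF 2(5) quad_approx_tendsto[OF assms(1)]] .
  show ?thesis
  proof (rule quad_approxI)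
    show "\<forall>\<^sub>F y in nhds x. \<bar>g (f y) - g (f x) - d * L (y - x)\<bar> \<le> (D * (K + C)\<^sup>2 + \<bar>d\<bar> * C) * (norm (y - x))\<^sup>2"
      using 1(5) 3 eventually_nhds_norm_le[of 1 x, OF zero_less_one]
    proof eventually_elim
      case (elim y)
      define n where "n = norm (y - x)"
      have n: "0 \<le> n" "n \<le> 1" using elim by (auto simp: n_def)
      have n2: "n\<^sup>2 \<le> n" using n mult_left_le[of n n] by (simp add: power2_eq_square)
      define l where "l = L (y - x)"
      define e where "e = f y - f x - l"
      have e: "\<bar>e\<bar> \<le> C * n\<^sup>2" using elim by (simp add: e_def l_def n_def)
      have "\<bar>f y - f x\<bar> \<le> \<bar>l\<bar> + \<bar>e\<bar>" by (simp add: e_def)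
      also have "\<dots> \<le> K * n + C * n"
        using e 1(4)[of "y - x"] mult_left_mono[OF n2 1(2)] unfolding l_def n_def by linarith
      finally have "\<bar>f y - f x\<bar> \<le> (K + C) * n" by (simp add: algebra_simps)
      hence "\<bar>f y - f x\<bar>\<^sup>2 \<le> ((K + C) * n)\<^sup>2" by (intro power_mono) auto
      hence s: "(norm (f y - f x))\<^sup>2 \<le> (K + C)\<^sup>2 * n\<^sup>2" by (simp add: power_mult_distrib)
      have "g (f y) - g (f x) - d * l = (g (f y) - g (f x) - d * (f y - f x)) + d * e"
        by (simp add: e_def algebra_simps)
      hence "\<bar>g (f y) - g (f x) - d * l\<bar> \<le> \<bar>g (f y) - g (f x) - d * (f y - f x)\<bar> + \<bar>d * e\<bar>"
        by (simp only: abs_triangle_ineq)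
      also have "\<dots> \<le> D * ((K + C)\<^sup>2 * n\<^sup>2) + \<bar>d\<bar> * (C * n\<^sup>2)"
        unfolding abs_mult using elim(2) e mult_left_mono[OF s 2(2)] mult_left_mono[OF e abs_ge_zero[of d]] by linarith
      finally show ?case by (simp add: l_def n_def algebra_simps)
    qed
  qed (intro bounded_linear_mult_right[THEN bounded_linear_compose] 1)
qed

lemma quad_approx_power:
  assumes "quad_approx f x L"
  shows "quad_approx (\<lambda>y. f y ^ n) x (\<lambda>v. real n * f x ^ (n - 1) * L v)"
proof (induction n)
  case (Suc n)
  have step: "quad_approx (\<lambda>y. f y ^ n * f y) x (\<lambda>v. f x ^ n * L v + real n * f x ^ (n - 1) * L v * f x)"
    using quad_approx_mult[OF Suc assms] .
  have eq: "f x ^ n * L v + real n * f x ^ (n - 1) * L v * f x = real (Suc n) * f x ^ (Suc n - 1) * L v" for v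
    by (cases n) (auto simp: algebra_simps)
  show ?case
    using step unfolding eq power_Suc2 .
qed (simp add: quad_approx_const)

lemma exp_minus_linear_le:
  fixes u :: real
  assumes "\<bar>u\<bar> \<le> 1/2"
  shows "\<bar>exp u - 1 - u\<bar> \<le> u\<^sup>2"
proof (cases "u \<ge> 0")
  case True
  hence "exp u \<le> 1 + u + u\<^sup>2" using exp_bound[of u] assms by simp
  thus ?thesis using exp_ge_add_one_self[of u] zero_le_power2[of u] unfolding abs_le_iff by linarith
next
  case False
  define w where "w = - u"
  have w: "w > 0" using False by (simp add: w_def)
  \<comment> \<open>The product equals \<open>1 + w ^ 3\<close>.\<close>
  have "1 \<le> (1 + w) * (1 - w + w\<^sup>2)" using w by (simp add: algebra_simps power2_eq_square)
  also have "\<dots> \<le> exp w * (1 - w + w\<^sup>2)"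
    using exp_ge_add_one_self[of w] assms by (intro mult_right_mono) (auto simp: w_def)
  finally have "exp u \<le> 1 - w + w\<^sup>2" by (simp add: w_def exp_minus field_simps)
  thus ?thesis using exp_ge_add_one_self[of u] zero_le_power2[of u] unfolding abs_le_iff w_def power2_minus by linarith
qed

lemma quad_approx_exp_real: "quad_approx exp (t::real) (\<lambda>v. exp t * v)"
proof (rule quad_approxI)
  show "\<forall>\<^sub>F y in nhds t. \<bar>exp y - exp t - exp t * (y - t)\<bar> \<le> exp t * (norm (y - t))\<^sup>2"
    using eventually_nhds_norm_le[OF half_gt_zero[OF zero_less_one], of t]
  proof eventually_elim
    case (elim y)
    have "\<bar>exp (y - t) - 1 - (y - t)\<bar> \<le> (y - t)\<^sup>2"
      by (rule exp_minus_linear_le) (use elim in simp)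
    moreover have "exp y = exp t * exp (y - t)" by (simp add: exp_add[symmetric])
    hence "exp y - exp t - exp t * (y - t) = exp t * (exp (y - t) - 1 - (y - t))"
      by (simp add: right_diff_distrib)
    hence "\<bar>exp y - exp t - exp t * (y - t)\<bar> = exp t * \<bar>exp (y - t) - 1 - (y - t)\<bar>"
      by (simp only: abs_mult abs_exp_cancel)
    ultimately show ?case by simp
  qed
qed (rule bounded_linear_mult_right)

lemma quad_approx_exp:
  assumes "quad_approx f x L"
  shows "quad_approx (\<lambda>y. exp (f y)) x (\<lambda>v. exp (f x) * L v)"
  by (rule quad_approx_compose[OF assms quad_approx_exp_real])

lemma quad_approx_inverse_real:
  assumes "t > (0::real)"
  shows "quad_approx inverse t (\<lambda>v. - (1 / t\<^sup>2) * v)"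
proof (rule quad_approxI)
  show "\<forall>\<^sub>F y in nhds t. \<bar>inverse y - inverse t - - (1 / t\<^sup>2) * (y - t)\<bar> \<le> (2 / t ^ 3) * (norm (y - t))\<^sup>2"
    using eventually_nhds_norm_le[OF half_gt_zero[OF assms], of t]
  proof eventually_elim
    case (elim y)
    have y: "y \<ge> t / 2" using elim by (auto simp: abs_if split: if_splits)
    hence y0: "y > 0" using assms by simp
    have "inverse y - inverse t - - (1 / t\<^sup>2) * (y - t) = (y - t)\<^sup>2 / (t\<^sup>2 * y)"
      using y0 assms by (simp add: field_simps power2_eq_square)
    hence "\<bar>inverse y - inverse t - - (1 / t\<^sup>2) * (y - t)\<bar> = (y - t)\<^sup>2 / (t\<^sup>2 * y)"
      using y0 assms by simp
    also have "\<dots> \<le> (y - t)\<^sup>2 / (t\<^sup>2 * (t / 2))"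
      using y assms by (intro divide_left_mono mult_left_mono mult_pos_pos) auto
    also have "\<dots> = (2 / t ^ 3) * (norm (y - t))\<^sup>2" by (simp add: power2_eq_square power3_eq_cube)
    finally show ?case .
  qed
qed (rule bounded_linear_mult_right)

lemma quad_approx_inverse:
  assumes "quad_approx f x L" "f x > 0"
  shows "quad_approx (\<lambda>y. inverse (f y)) x (\<lambda>v. - (1 / (f x)\<^sup>2) * L v)"
  by (rule quad_approx_compose[OF assms(1) quad_approx_inverse_real[OF assms(2)]])

lemma quad_approx_has_derivative:
  assumes "quad_approx f x L"
  shows "(f has_derivative L) (at x)"
proof -
  obtain C K where 1: "bounded_linear L" "C \<ge> 0"
    "\<forall>\<^sub>F y in nhds x. \<bar>f y - f x - L (y - x)\<bar> \<le> C * (norm (y - x))\<^sup>2"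
    using quad_approxE[OF assms] by blast
  have "((\<lambda>y. norm (f y - f x - L (y - x)) / norm (y - x)) \<longlongrightarrow> 0) (at x)"
  proof (rule Lim_null_comparison)
    have "\<forall>\<^sub>F y in at x. \<bar>f y - f x - L (y - x)\<bar> \<le> C * (norm (y - x))\<^sup>2"
      using 1(3) by (auto simp: at_within_def eventually_inf_principal elim: eventually_mono)
    thus "\<forall>\<^sub>F y in at x. norm (norm (f y - f x - L (y - x)) / norm (y - x)) \<le> C * norm (y - x)"
    proof eventually_elim
      case (elim y)
      show ?case
        using elim by (cases "y = x") (auto simp: divide_le_eq power2_eq_square mult.assoc)
    qed
    have "((\<lambda>y. C * norm (y - x)) \<longlongrightarrow> C * norm (x - x)) (at x)"
      by (intro tendsto_intros)
    thus "((\<lambda>y. C * norm (y - x)) \<longlongrightarrow> 0) (at x)" by simp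
  qed
  thus ?thesis using 1(1) by (simp add: has_derivative_iff_norm)
qed

text \<open>Away from \<open>x\<close> the distance is at least the radius \<open>d\<close> of the
  good neighbourhood, so a constant bound \<open>?M\<close> on the remainder is also the quadratic
  bound with factor \<open>?M / d\<^sup>2\<close>. In \<open>drift_approx\<close> this makes the
  expansion valid on the whole simplex.\<close>

lemma quad_approx_global:
  assumes "quad_approx f x L" and B: "\<And>y. y \<in> A \<Longrightarrow> \<bar>f y\<bar> \<le> B" and R: "\<And>y. y \<in> A \<Longrightarrow> norm (y - x) \<le> R"
  obtains C where "C \<ge> 0" "\<And>y. y \<in> A \<Longrightarrow> \<bar>f y - f x - L (y - x)\<bar> \<le> C * (norm (y - x))\<^sup>2"
proof -
  obtain C K where 1: "bounded_linear L" "C \<ge> 0" "K \<ge> 0" "\<And>v. \<bar>L v\<bar> \<le> K * norm v"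
    "\<forall>\<^sub>F y in nhds x. \<bar>f y - f x - L (y - x)\<bar> \<le> C * (norm (y - x))\<^sup>2"
    using quad_approxE[OF assms(1)] by blast
  obtain d where d: "d > 0" "\<And>y. dist y x < d \<Longrightarrow> \<bar>f y - f x - L (y - x)\<bar> \<le> C * (norm (y - x))\<^sup>2"
    using 1(5) unfolding eventually_nhds_metric by auto
  let ?M = "\<bar>B\<bar> + \<bar>f x\<bar> + K * \<bar>R\<bar>"
  have M0: "?M \<ge> 0" using 1 by simp
  show ?thesis
  proof (rule that[of "C + ?M / d\<^sup>2"])
    show "C + ?M / d\<^sup>2 \<ge> 0" using 1 M0 by simp
    fix y assume y: "y \<in> A"
    show "\<bar>f y - f x - L (y - x)\<bar> \<le> (C + ?M / d\<^sup>2) * (norm (y - x))\<^sup>2"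
    proof (cases "dist y x < d")
      case True
      have "C * (norm (y - x))\<^sup>2 \<le> (C + ?M / d\<^sup>2) * (norm (y - x))\<^sup>2"
        using M0 by (intro mult_right_mono) auto
      thus ?thesis using d(2)[OF True] by linarith
    next
      case False
      have "\<bar>L (y - x)\<bar> \<le> K * \<bar>R\<bar>"
        using 1(3) 1(4)[of "y - x"] R[OF y] by (smt (verit) mult_left_mono)
      hence "\<bar>f y - f x - L (y - x)\<bar> \<le> ?M" using B[OF y] by linarith
      also have "?M \<le> ?M / d\<^sup>2 * (norm (y - x))\<^sup>2"
      proof -
        have "d\<^sup>2 \<le> (norm (y - x))\<^sup>2" using False d by (intro power_mono) (auto simp: dist_norm)
        hence "1 \<le> (norm (y - x))\<^sup>2 / d\<^sup>2" using d by simp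
        thus ?thesis using mult_left_mono[OF _ M0, of 1 "(norm (y - x))\<^sup>2 / d\<^sup>2"] by simp
      qed
      also have "\<dots> \<le> (C + ?M / d\<^sup>2) * (norm (y - x))\<^sup>2"
        using 1 by (intro mult_right_mono) auto
      finally show ?thesis .
    qed
  qed
qed

section \<open>Softmax weights and the mean-field map\<close>

definition softmax :: "('q \<Rightarrow> real) \<Rightarrow> 'q \<Rightarrow> real" where
  "softmax \<theta> r = exp (\<theta> r) / (\<Sum>s\<in>UNIV. exp (\<theta> s))"

lemma sum_exp_pos: "(\<Sum>s\<in>(UNIV::'q::finite set). exp (\<theta> s :: real)) > 0"
  by (intro sum_pos) auto

lemma softmax_pos: "softmax \<theta> (r::'q::finite) > 0"
  unfolding softmax_def using sum_exp_pos[of \<theta>] by simp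

lemma softmax_nonneg: "softmax \<theta> (r::'q::finite) \<ge> 0"
  using softmax_pos[of \<theta> r] by simp

lemma sum_softmax: "(\<Sum>r\<in>(UNIV::'q::finite set). softmax \<theta> r) = 1"
  unfolding softmax_def using sum_exp_pos[of \<theta>] by (simp add: sum_divide_distrib[symmetric])

lemma softmax_le_1: "softmax \<theta> (r::'q::finite) \<le> 1"
  using member_le_sum[of r UNIV "softmax \<theta>"] by (simp add: sum_softmax softmax_nonneg)

lemma softmax_shift: "softmax (\<lambda>s. \<theta> s + d) (r::'q::finite) = softmax \<theta> r"
  unfolding softmax_def by (simp add: exp_add sum_distrib_right[symmetric])

lemma softmax_upper:
  assumes "\<And>s. \<bar>\<theta> s - \<eta> s\<bar> \<le> d"
  shows "softmax \<theta> (r::'q::finite) \<le> exp (2 * d) * softmax \<eta> r"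
proof -
  have "(\<Sum>s\<in>UNIV. exp (\<eta> s)) \<le> (\<Sum>s\<in>UNIV. exp d * exp (\<theta> s))"
  proof (intro sum_mono)
    fix s show "exp (\<eta> s) \<le> exp d * exp (\<theta> s)"
      unfolding exp_add[symmetric] using assms[of s] by simp
  qed
  also have "\<dots> = exp d * (\<Sum>s\<in>UNIV. exp (\<theta> s))" by (simp add: sum_distrib_left)
  finally have 1: "(\<Sum>s\<in>UNIV. exp (\<eta> s)) \<le> exp d * (\<Sum>s\<in>UNIV. exp (\<theta> s))" .
  have 2: "exp (\<theta> r) \<le> exp d * exp (\<eta> r)"
    unfolding exp_add[symmetric] using assms[of r] by simp
  have "exp (\<theta> r) * (\<Sum>s\<in>UNIV. exp (\<eta> s)) \<le> (exp d * exp (\<eta> r)) * (exp d * (\<Sum>s\<in>UNIV. exp (\<theta> s)))"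
    using 1 2 by (intro mult_mono) (auto intro: sum_nonneg)
  moreover have "exp (2 * d) = exp d * exp d" by (simp add: exp_add[symmetric])
  ultimately show ?thesis unfolding softmax_def using sum_exp_pos[of \<theta>] sum_exp_pos[of \<eta>]
    by (simp add: field_simps)
qed

text \<open>Numerator and denominator each change by a factor of at most \<open>exp d\<close>, and
  \<open>exp (2 * d) - 1 \<le> 4 * d\<close> as long as \<open>2 * d \<le> 1\<close>. Beyond that
  the bound is trivial, since the weights lie between \<open>0\<close> and \<open>1\<close>.\<close>

lemma softmax_diff_le:
  assumes d: "\<And>s. \<bar>\<theta> s - \<eta> s\<bar> \<le> d"
  shows "\<bar>softmax \<theta> (r::'q::finite) - softmax \<eta> r\<bar> \<le> 4 * d"
proof -
  have d0: "d \<ge> 0" using d[of r] by linarith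
  show ?thesis
  proof (cases "2 * d \<le> 1")
    case True
    have "exp (2 * d) \<le> 1 + 2 * d + (2 * d)\<^sup>2" using True d0 by (intro exp_bound) auto
    also have "(2 * d)\<^sup>2 \<le> 2 * d" using True d0 mult_left_le[of "2 * d" "2 * d"] by (simp add: power2_eq_square)
    finally have e: "exp (2 * d) - 1 \<le> 4 * d" by simp
    have *: "softmax \<theta> r - softmax \<eta> r \<le> 4 * d" if "\<And>s. \<bar>\<theta> s - \<eta> s\<bar> \<le> d" for \<theta> \<eta> :: "'q \<Rightarrow> real"
    proof -
      have "softmax \<theta> r - softmax \<eta> r \<le> (exp (2 * d) - 1) * softmax \<eta> r"
        using softmax_upper[OF that, where r = r] by (simp add: algebra_simps)
      also have "\<dots> \<le> (exp (2 * d) - 1) * 1"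
        using d0 by (intro mult_left_mono softmax_le_1) auto
      finally show ?thesis using e by simp
    qed
    show ?thesis using *[OF d] *[of \<eta> \<theta>] d by (simp add: abs_le_iff abs_minus_commute)
  next
    case False
    thus ?thesis using softmax_le_1[of \<theta> r] softmax_le_1[of \<eta> r] softmax_nonneg[of \<theta> r] softmax_nonneg[of \<eta> r]
      by (simp add: abs_le_iff)
  qed
qed

text \<open>The limiting conditional law of one spin at magnetization \<open>x\<close>; the exact
  law at each site differs from it by \<open>O(1 / N)\<close>.\<close>

definition mean_field :: "nat \<Rightarrow> real \<Rightarrow> real^'q::finite \<Rightarrow> 'q \<Rightarrow> real" where
  "mean_field p b x = softmax (\<lambda>s. b * real p * (x $ s) ^ (p - 1))"

lemma S_eq_mean_field:
  "S p x b = (\<Sum>r\<in>UNIV. (x $ r) ^ p) - (\<Sum>r\<in>UNIV. (x $ r) ^ (p - 1) * mean_field p b x r)"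
  by (simp add: S_def mean_field_def softmax_def sum_divide_distrib)

lemma quad_approx_softmax:
  fixes \<theta> :: "'a::real_normed_vector \<Rightarrow> 'q::finite \<Rightarrow> real"
  assumes "\<And>s. quad_approx (\<lambda>y. \<theta> y s) x (L s)"
  shows "quad_approx (\<lambda>y. softmax (\<theta> y) r) x
     (\<lambda>v. softmax (\<theta> x) r * (L r v - (\<Sum>s\<in>UNIV. softmax (\<theta> x) s * L s v)))"
proof (rule quad_approx_cong)
  let ?Z = "\<Sum>s\<in>UNIV. exp (\<theta> x s)"
  show "quad_approx (\<lambda>y. exp (\<theta> y r) * inverse (\<Sum>s\<in>UNIV. exp (\<theta> y s))) x
    (\<lambda>v. exp (\<theta> x r) * (- (1 / ?Z\<^sup>2) * (\<Sum>s\<in>UNIV. exp (\<theta> x s) * L s v))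
       + exp (\<theta> x r) * L r v * inverse ?Z)"
    by (intro quad_approx_mult quad_approx_inverse quad_approx_sum quad_approx_exp assms sum_exp_pos)
  show "exp (\<theta> x r) * (- (1 / ?Z\<^sup>2) * (\<Sum>s\<in>UNIV. exp (\<theta> x s) * L s v)) + exp (\<theta> x r) * L r v * inverse ?Z
      = softmax (\<theta> x) r * (L r v - (\<Sum>s\<in>UNIV. softmax (\<theta> x) s * L s v))" for v
  proof -
    have "(\<Sum>s\<in>UNIV. softmax (\<theta> x) s * L s v) = (\<Sum>s\<in>UNIV. exp (\<theta> x s) * L s v) / ?Z"
      by (simp add: softmax_def sum_divide_distrib)
    thus ?thesis using sum_exp_pos[of "\<theta> x"]
      by (simp add: softmax_def field_simps power2_eq_square)
  qed
qed (simp add: softmax_def divide_inverse)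

lemma quad_approx_nth_fst: "quad_approx (\<lambda>z. fst z $ s) z0 (\<lambda>v :: (real^'q::finite) \<times> real. fst v $ s)"
  by (rule quad_approx_linear, rule bounded_linear_compose[OF bounded_linear_vec_nth bounded_linear_fst])

lemma quad_approx_snd: "quad_approx snd z0 (snd :: (real^'q::finite) \<times> real \<Rightarrow> real)"
  by (rule quad_approx_linear, rule bounded_linear_snd)

text \<open>The differential of \<open>b p x_s^(p - 1)\<close> at \<open>(x, b)\<close> in the
  direction \<open>v\<close>, a joint change of \<open>x\<close> and \<open>b\<close>.\<close>

definition field_diff :: "nat \<Rightarrow> real^'q::finite \<Rightarrow> real \<Rightarrow> 'q \<Rightarrow> (real^'q) \<times> real \<Rightarrow> real" where
  "field_diff p x b s v = real p * (b * real (p - 1) * (x $ s) ^ (p - 2) * fst v $ s + (x $ s) ^ (p - 1) * snd v)"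

lemma quad_approx_mean_field:
  fixes x :: "real^'q::finite"
  shows "quad_approx (\<lambda>z. mean_field p (snd z) (fst z) r) (x, b)
     (\<lambda>v. mean_field p b x r * (field_diff p x b r v - (\<Sum>s\<in>UNIV. mean_field p b x s * field_diff p x b s v)))"
proof -
  have *: "quad_approx (\<lambda>z :: (real^'q) \<times> real. snd z * real p * (fst z $ s) ^ (p - 1)) (x, b) (field_diff p x b s)" for s
  proof (rule quad_approx_cong)
    show "quad_approx (\<lambda>z :: (real^'q) \<times> real. real p * (snd z * (fst z $ s) ^ (p - 1))) (x, b)
      (\<lambda>v. real p * (snd (x, b) * (real (p - 1) * (fst (x, b) $ s) ^ (p - 1 - 1) * fst v $ s)
          + snd v * (fst (x, b) $ s) ^ (p - 1)))"
      by (intro quad_approx_cmult quad_approx_mult quad_approx_power quad_approx_nth_fst quad_approx_snd)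
  qed (auto simp: field_diff_def algebra_simps numeral_2_eq_2)
  show ?thesis
    unfolding mean_field_def using quad_approx_softmax[OF *, where r = r] by (simp add: mean_field_def)
qed

text \<open>At a fixed point the differential of the weight \<open>r\<close> is \<open>x_r\<close>
  times the centred field differential. In the product rule the terms with
  \<open>p x_r^(p - 1)\<close> and \<open>(p - 1) x_r^(p - 1)\<close> leave the coefficient
  \<open>1\<close>, and the rest is a covariance under the weights \<open>x\<close>.\<close>

lemma quad_approx_S:
  fixes x :: "real^'q::finite"
  assumes mf: "\<And>r. mean_field p b x r = x $ r" and p: "p \<ge> 2"
  shows "quad_approx (\<lambda>z. S p (fst z) (snd z)) (x, b)
     (\<lambda>v. (\<Sum>r\<in>UNIV. (x $ r) ^ (p - 1) * fst v $ r)
        - (\<Sum>r\<in>UNIV. x $ r * ((x $ r) ^ (p - 1) - (\<Sum>s\<in>UNIV. (x $ s) ^ p)) * field_diff p x b r v))"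
    (is "quad_approx _ _ ?L")
proof -
  let ?M = "\<lambda>r v. x $ r * (field_diff p x b r v - (\<Sum>s\<in>UNIV. x $ s * field_diff p x b s v))"
  have M: "quad_approx (\<lambda>z. mean_field p (snd z) (fst z) r) (x, b) (?M r)" for r
    using quad_approx_mean_field[of p r x b] unfolding mf .
  have "quad_approx (\<lambda>z. (\<Sum>r\<in>UNIV. (fst z $ r) ^ p) - (\<Sum>r\<in>UNIV. (fst z $ r) ^ (p - 1) * mean_field p (snd z) (fst z) r)) (x, b)
    (\<lambda>v. (\<Sum>r\<in>UNIV. real p * (fst (x, b) $ r) ^ (p - 1) * fst v $ r)
      - (\<Sum>r\<in>UNIV. (fst (x, b) $ r) ^ (p - 1) * ?M r v
          + (real (p - 1) * (fst (x, b) $ r) ^ (p - 1 - 1) * fst v $ r) * mean_field p (snd (x, b)) (fst (x, b)) r))"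
    by (intro quad_approx_diff quad_approx_sum quad_approx_mult quad_approx_power quad_approx_nth_fst M)
  thus ?thesis
  proof (rule quad_approx_cong)
    fix v :: "(real^'q) \<times> real"
    let ?D = "\<lambda>r. field_diff p x b r v"
    let ?E = "\<Sum>s\<in>UNIV. (x $ s) ^ p"
    let ?T = "\<Sum>s\<in>UNIV. x $ s * ?D s"
    have pw: "x $ r * (x $ r) ^ (p - 2) = (x $ r) ^ (p - 1)" "x $ r * (x $ r) ^ (p - 1) = (x $ r) ^ p" for r
    proof -
      obtain j where "p = 2 + j" using p le_iff_add by blast
      thus "x $ r * (x $ r) ^ (p - 2) = (x $ r) ^ (p - 1)" "x $ r * (x $ r) ^ (p - 1) = (x $ r) ^ p" by auto
    qed
    have "(\<Sum>r\<in>UNIV. real p * (x $ r) ^ (p - 1) * fst v $ r)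
      - (\<Sum>r\<in>UNIV. (x $ r) ^ (p - 1) * ?M r v + (real (p - 1) * (x $ r) ^ (p - 2) * fst v $ r) * x $ r)
      = (\<Sum>r\<in>UNIV. real p * (x $ r) ^ (p - 1) * fst v $ r - real (p - 1) * (x $ r) ^ (p - 1) * fst v $ r
           - (x $ r) ^ p * ?D r + (x $ r) ^ p * ?T)"
      unfolding sum_subtractf[symmetric]
    proof (intro sum.cong refl)
      fix r
      have "(real (p - 1) * (x $ r) ^ (p - 2) * fst v $ r) * x $ r = real (p - 1) * (x $ r * (x $ r) ^ (p - 2)) * fst v $ r"
        by (simp add: mult_ac)
      hence 1: "(real (p - 1) * (x $ r) ^ (p - 2) * fst v $ r) * x $ r = real (p - 1) * (x $ r) ^ (p - 1) * fst v $ r"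
        by (simp only: pw(1))
      have "(x $ r) ^ (p - 1) * ?M r v = (x $ r * (x $ r) ^ (p - 1)) * (?D r - ?T)"
        by (simp add: mult_ac)
      hence 2: "(x $ r) ^ (p - 1) * ?M r v = (x $ r) ^ p * (?D r - ?T)"
        by (simp only: pw(2))
      show "real p * (x $ r) ^ (p - 1) * fst v $ r - ((x $ r) ^ (p - 1) * ?M r v + (real (p - 1) * (x $ r) ^ (p - 2) * fst v $ r) * x $ r)
        = real p * (x $ r) ^ (p - 1) * fst v $ r - real (p - 1) * (x $ r) ^ (p - 1) * fst v $ r - (x $ r) ^ p * ?D r + (x $ r) ^ p * ?T"
        unfolding 1 2 by (simp add: algebra_simps)
    qed
    also have "\<dots> = (\<Sum>r\<in>UNIV. (x $ r) ^ (p - 1) * fst v $ r - (x $ r) ^ p * ?D r + (x $ r) ^ p * ?T)"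
      using p by (intro sum.cong) (auto simp: of_nat_diff algebra_simps)
    also have "\<dots> = (\<Sum>r\<in>UNIV. (x $ r) ^ (p - 1) * fst v $ r) - (\<Sum>r\<in>UNIV. (x $ r) ^ p * ?D r) + ?E * ?T"
      by (simp add: sum.distrib sum_subtractf sum_distrib_right)
    also have "(\<Sum>r\<in>UNIV. (x $ r) ^ p * ?D r) = (\<Sum>r\<in>UNIV. x $ r * ((x $ r) ^ (p - 1) - ?E) * ?D r) + ?E * ?T"
    proof -
      define E where "E = ?E"
      have "x $ r * ((x $ r) ^ (p - 1) - E) * ?D r = (x $ r) ^ p * ?D r - E * (x $ r * ?D r)" for r
        unfolding pw(2)[of r, symmetric] by (simp add: algebra_simps)
      thus ?thesis unfolding E_def[symmetric] by (simp add: sum_subtractf sum_distrib_left)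
    qed
    also have "(\<Sum>r\<in>UNIV. (x $ r) ^ (p - 1) * fst v $ r) - ((\<Sum>r\<in>UNIV. x $ r * ((x $ r) ^ (p - 1) - ?E) * ?D r) + ?E * ?T) + ?E * ?T = ?L v"
      by simp
    finally show "(\<Sum>r\<in>UNIV. real p * (fst (x, b) $ r) ^ (p - 1) * fst v $ r)
      - (\<Sum>r\<in>UNIV. (fst (x, b) $ r) ^ (p - 1) * ?M r v
          + (real (p - 1) * (fst (x, b) $ r) ^ (p - 1 - 1) * fst v $ r) * mean_field p (snd (x, b)) (fst (x, b)) r) = ?L v"
      by (simp add: mf numeral_2_eq_2)
  qed (simp add: S_eq_mean_field)
qed

text \<open>Otherwise the simplifier rewrites the exponent \<open>p - 1\<close> to \<open>p - Suc 0\<close>.\<close>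

declare One_nat_def [simp del]

section \<open>One nondegenerate peak: linearised drift and curvature\<close>

locale potts_peak =
  fixes p :: nat and \<beta> a b :: real and c :: "'q::finite"
  assumes p2: "p \<ge> 2" and q2: "CARD('q) \<ge> 2" and beta_pos: "\<beta> > 0"
    and b_pos: "0 < b" and b_less_a: "b < a"
    and total: "a + (real CARD('q) - 1) * b = 1"
    and crit: "crit_fun p \<beta> a = crit_fun p \<beta> b"
    and nondeg_b: "\<beta> * real p * (real p - 1) * b ^ (p - 1) < 1"
    and nondeg_K: "\<beta> * real p * (real p - 1) * ((real CARD('q) - 1) * a ^ (p - 1) * b + a * b ^ (p - 1)) < 1"
    and peak_max: "peak a b c \<in> maximizers p \<beta>"
begin

abbreviation m :: "real^'q" where "m \<equiv> peak a b c"

definition c' :: real where "c' = \<beta> * real p * (real p - 1)"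
definition K :: real where "K = (real CARD('q) - 1) * a ^ (p - 1) * b + a * b ^ (p - 1)"
text \<open>The rate at which resampling pulls the \<open>c\<close>-th coordinate back to
  \<open>a\<close>, see \<open>drift_peak\<close>. Its positivity is the inequality
  \<open>nondeg_K\<close>.\<close>

definition lam :: real where "lam = 1 - c' * K"

lemma lam_pos: "lam > 0" using nondeg_K by (simp add: lam_def c'_def K_def)

lemma a_pos: "a > 0" using b_pos b_less_a by simp

lemma one_minus_a: "1 - a = (real CARD('q) - 1) * b" using total by simp

lemma qm1_pos: "real CARD('q) - 1 > 0" using q2 by simp

lemma a_less_1: "a < 1"
  using one_minus_a mult_pos_pos[OF qm1_pos b_pos] by simp

lemma b_less_1: "b < 1" using a_less_1 b_less_a by simp

lemma m_pos: "m $ r > 0" using a_pos b_pos by (simp add: peak_nth)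

lemma sum_m: "(\<Sum>r\<in>UNIV. m $ r) = 1"
  using peak_max by (simp add: maximizers_iff prob_simplex_def)

lemma m_simplex: "m \<in> prob_simplex" using peak_max by (simp add: maximizers_iff)

lemma sum_peak_split:
  fixes f :: "'q \<Rightarrow> real"
  shows "(\<Sum>r\<in>UNIV. f r) = f c + (\<Sum>r\<in>UNIV - {c}. f r)"
  by (subst sum.remove[of _ c]) auto

lemma exp_field_m: "exp (\<beta> * real p * (m $ r) ^ (p - 1)) = m $ r * exp (crit_fun p \<beta> a)"
proof -
  have "crit_fun p \<beta> (m $ r) = crit_fun p \<beta> a" using crit by (simp add: peak_nth)
  hence "\<beta> * real p * (m $ r) ^ (p - 1) = crit_fun p \<beta> a + ln (m $ r)"
    by (simp add: crit_fun_def)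
  thus ?thesis using m_pos[of r] by (simp add: exp_add)
qed

text \<open>Exponentiating the critical equation gives \<open>m $ r\<close> times a factor that is
  the same for all \<open>r\<close>; normalising removes the factor.\<close>

lemma mean_field_m: "mean_field p \<beta> m r = m $ r"
proof -
  have "(\<Sum>s\<in>UNIV. m $ s * exp (crit_fun p \<beta> a)) = exp (crit_fun p \<beta> a)"
    by (simp add: sum_distrib_right[symmetric] sum_m)
  thus ?thesis by (simp add: mean_field_def softmax_def exp_field_m)
qed

text \<open>The differential at \<open>m\<close> of \<open>x $ r - mean_field p \<beta> x r\<close>
  as a function of \<open>x\<close>.\<close>

definition drift :: "'q \<Rightarrow> real^'q \<Rightarrow> real" where
  "drift r v = v $ r - m $ r * (c' * (m $ r) ^ (p - 2) * v $ r - (\<Sum>s\<in>UNIV. c' * (m $ s) ^ (p - 1) * v $ s))"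

lemma pow_pred: "x * x ^ (p - 2) = x ^ (p - 1)" "x * x ^ (p - 1) = x ^ p" for x :: real
proof -
  obtain j where "p = 2 + j" using p2 le_iff_add by blast
  thus "x * x ^ (p - 2) = x ^ (p - 1)" "x * x ^ (p - 1) = x ^ p" by auto
qed

lemma norm_simplex_diff_le:
  assumes "x \<in> prob_simplex" "y \<in> prob_simplex"
  shows "norm (x - y :: real^'q) \<le> 2"
proof -
  have "norm (x - y) \<le> (\<Sum>r\<in>UNIV. \<bar>(x - y) $ r\<bar>)" by (rule norm_le_l1_cart)
  also have "\<dots> \<le> (\<Sum>r\<in>UNIV. x $ r + y $ r)"
    using assms by (intro sum_mono) (auto simp: prob_simplex_def abs_le_iff add_increasing add_increasing2)
  also have "\<dots> = 2" using assms by (simp add: sum.distrib prob_simplex_def)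
  finally show ?thesis .
qed

lemma drift_approx:
  obtains C where "C \<ge> 0" "\<And>x r. x \<in> prob_simplex \<Longrightarrow>
    \<bar>(x $ r - mean_field p \<beta> x r) - drift r (x - m)\<bar> \<le> C * (norm (x - m))\<^sup>2"
proof -
  have "\<exists>C\<ge>0. \<forall>x\<in>prob_simplex. \<bar>(x $ r - mean_field p \<beta> x r) - drift r (x - m)\<bar> \<le> C * (norm (x - m))\<^sup>2" for r
  proof -
    let ?L = "\<lambda>v. mean_field p \<beta> m r * (field_diff p m \<beta> r v - (\<Sum>s\<in>UNIV. mean_field p \<beta> m s * field_diff p m \<beta> s v))"
    have f0: "field_diff p m \<beta> s (v, 0) = c' * (m $ s) ^ (p - 2) * v $ s" for s v
      using p2 by (simp add: field_diff_def c'_def of_nat_diff algebra_simps)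
    have L: "?L (v, 0) = v $ r - drift r v" for v
    proof -
      have "(\<Sum>s\<in>UNIV. m $ s * (c' * (m $ s) ^ (p - 2) * v $ s)) = (\<Sum>s\<in>UNIV. c' * (m $ s) ^ (p - 1) * v $ s)"
        by (intro sum.cong refl) (simp add: pow_pred(1)[symmetric])
      thus ?thesis unfolding f0 mean_field_m drift_def by simp
    qed
    \<comment> \<open>The joint expansion in \<open>x\<close> and \<open>b\<close> is restricted to
      the slice \<open>b = \<beta>\<close>.\<close>
    let ?A = "(\<lambda>x. (x, \<beta>)) ` (prob_simplex :: (real^'q) set)"
    have "\<exists>C\<ge>0. \<forall>y\<in>?A. \<bar>mean_field p (snd y) (fst y) r - mean_field p \<beta> m r - ?L (y - (m, \<beta>))\<bar> \<le> C * (norm (y - (m, \<beta>)))\<^sup>2"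
    proof (rule quad_approx_global[OF quad_approx_mean_field[of p r m \<beta>], of ?A 1 2])
      show "\<bar>mean_field p (snd y) (fst y) r\<bar> \<le> 1" for y
        by (simp add: mean_field_def abs_of_nonneg softmax_nonneg softmax_le_1)
      show "norm (y - (m, \<beta>)) \<le> 2" if "y \<in> ?A" for y
        using that norm_simplex_diff_le[OF _ m_simplex] by (auto simp: norm_Pair)
    next
      fix C assume "C \<ge> 0" "\<And>y. y \<in> ?A \<Longrightarrow> \<bar>mean_field p (snd y) (fst y) r - mean_field p (snd (m, \<beta>)) (fst (m, \<beta>)) r
          - mean_field p \<beta> m r * (field_diff p m \<beta> r (y - (m, \<beta>)) - (\<Sum>s\<in>UNIV. mean_field p \<beta> m s * field_diff p m \<beta> s (y - (m, \<beta>))))\<bar> \<le> C * (norm (y - (m, \<beta>)))\<^sup>2"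
      thus "\<exists>C\<ge>0. \<forall>y\<in>?A. \<bar>mean_field p (snd y) (fst y) r - mean_field p \<beta> m r - ?L (y - (m, \<beta>))\<bar> \<le> C * (norm (y - (m, \<beta>)))\<^sup>2"
        unfolding fst_conv snd_conv by (intro exI[of _ C] conjI ballI)
    qed
    then obtain C where C: "C \<ge> 0" "\<And>x. x \<in> prob_simplex \<Longrightarrow>
       \<bar>mean_field p \<beta> x r - mean_field p \<beta> m r - ?L ((x, \<beta>) - (m, \<beta>))\<bar> \<le> C * (norm ((x, \<beta>) - (m, \<beta>)))\<^sup>2"
      by auto
    have "\<bar>(x $ r - mean_field p \<beta> x r) - drift r (x - m)\<bar> \<le> C * (norm (x - m))\<^sup>2" if "x \<in> prob_simplex" for x
    proof -
      have "\<bar>mean_field p \<beta> x r - m $ r - ((x - m) $ r - drift r (x - m))\<bar> \<le> C * (norm (x - m))\<^sup>2"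
        using C(2)[OF that] unfolding diff_Pair diff_self L by (simp add: norm_Pair mean_field_m)
      thus ?thesis by (simp add: abs_le_iff)
    qed
    thus ?thesis using C(1) by blast
  qed
  then obtain C where C: "\<And>r. C r \<ge> 0" "\<And>r x. x \<in> prob_simplex \<Longrightarrow>
     \<bar>(x $ r - mean_field p \<beta> x r) - drift r (x - m)\<bar> \<le> C r * (norm (x - m))\<^sup>2" by metis
  show ?thesis
  proof (rule that[of "sum C UNIV"])
    show "sum C UNIV \<ge> 0" using C(1) by (simp add: sum_nonneg)
    fix x r assume x: "x \<in> (prob_simplex :: (real^'q) set)"
    have "C r * (norm (x - m))\<^sup>2 \<le> sum C UNIV * (norm (x - m))\<^sup>2"
      using C(1) by (intro mult_right_mono member_le_sum) auto
    thus "\<bar>(x $ r - mean_field p \<beta> x r) - drift r (x - m)\<bar> \<le> sum C UNIV * (norm (x - m))\<^sup>2"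
      using C(2)[OF x, of r] by linarith
  qed
qed

text \<open>At \<open>m\<close> all coordinates other than \<open>c\<close> agree, so they enter the
  rank-one part only through their sum, which is \<open>- v $ c\<close>. Hence this component
  decouples from the others.\<close>

lemma drift_peak:
  assumes "(\<Sum>r\<in>UNIV. v $ r) = 0"
  shows "drift c v = lam * v $ c"
proof -
  have "(\<Sum>s\<in>UNIV. c' * (m $ s) ^ (p - 1) * v $ s) = c' * a ^ (p - 1) * v $ c + c' * b ^ (p - 1) * (\<Sum>s\<in>UNIV - {c}. v $ s)"
    by (subst sum_peak_split) (auto simp: peak_nth sum_distrib_left intro!: sum.cong)
  also have "(\<Sum>s\<in>UNIV - {c}. v $ s) = - v $ c"
    using assms sum_peak_split[of "\<lambda>s. v $ s"] by simp
  finally have s: "(\<Sum>s\<in>UNIV. c' * (m $ s) ^ (p - 1) * v $ s) = c' * (a ^ (p - 1) - b ^ (p - 1)) * v $ c"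
    by (simp add: algebra_simps)
  have "a * a ^ (p - 2) = a ^ (p - 1)" by (rule pow_pred)
  hence "drift c v = v $ c - c' * (a ^ (p - 1) - a * (a ^ (p - 1) - b ^ (p - 1))) * v $ c"
    unfolding drift_def s by (simp add: peak_nth algebra_simps)
  also have "a ^ (p - 1) - a * (a ^ (p - 1) - b ^ (p - 1)) = (1 - a) * a ^ (p - 1) + a * b ^ (p - 1)"
    by (simp add: algebra_simps)
  also have "\<dots> = K" unfolding one_minus_a K_def by (simp add: algebra_simps)
  finally show ?thesis by (simp add: lam_def algebra_simps)
qed

text \<open>Minus the second derivative of \<open>\<beta> t\<^sup>p - t ln t\<close> at \<open>t = m $ r\<close>.\<close>

definition curv :: "'q \<Rightarrow> real" where
  "curv r = (1 - c' * (m $ r) ^ (p - 1)) / m $ r"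

text \<open>Only the curvature at \<open>c\<close> is negative, because \<open>a\<close> lies on the
  increasing branch of \<open>crit_fun\<close>. On vectors of sum zero, Cauchy-Schwarz bounds the
  squares of the other coordinates below by \<open>(v $ c)\<^sup>2 / Q\<close>, and
  \<open>A + B / Q\<close> equals \<open>lam / (a * b * Q)\<close>.\<close>

lemma curv_form_lower:
  obtains \<kappa> where "\<kappa> > 0" "\<And>v. (\<Sum>r\<in>UNIV. v $ r) = 0 \<Longrightarrow> \<kappa> * (norm v)\<^sup>2 \<le> (\<Sum>r\<in>UNIV. curv r * (v $ r)\<^sup>2)"
proof -
  define Q where "Q = real CARD('q) - 1"
  define A where "A = (1 - c' * a ^ (p - 1)) / a"
  define B where "B = (1 - c' * b ^ (p - 1)) / b"
  have Q: "Q > 0" using qm1_pos by (simp add: Q_def)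
  have B: "B > 0" using nondeg_b b_pos by (simp add: B_def c'_def)
  have AB: "A + B / Q > 0"
  proof -
    have t: "a + Q * b = 1" using total by (simp add: Q_def)
    have "A + B / Q = ((a + Q * b) - c' * K) / (a * b * Q)"
      using a_pos b_pos Q by (simp add: A_def B_def K_def Q_def[symmetric] field_simps)
    also have "\<dots> = lam / (a * b * Q)" unfolding t lam_def ..
    finally show ?thesis using lam_pos a_pos b_pos Q by simp
  qed
  \<comment> \<open>With this choice \<open>A - \<kappa> + (B - \<kappa>) / Q\<close>, the
    coefficient of \<open>(v $ c)\<^sup>2\<close> that remains after Cauchy-Schwarz, is
    nonnegative.\<close>
  define \<kappa> where "\<kappa> = min B ((A + B / Q) / (1 + 1 / Q))"
  have q1: "1 + 1 / Q > 0" using Q by (simp add: add_pos_pos)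
  have k: "\<kappa> > 0" "\<kappa> \<le> B" "\<kappa> * (1 + 1 / Q) \<le> A + B / Q"
  proof -
    show "\<kappa> > 0" using B AB q1 unfolding \<kappa>_def by (simp only: min_less_iff_conj divide_pos_pos simp_thms)
    show "\<kappa> \<le> B" by (simp add: \<kappa>_def)
    have "\<kappa> \<le> (A + B / Q) / (1 + 1 / Q)" unfolding \<kappa>_def by (rule min.cobounded2)
    thus "\<kappa> * (1 + 1 / Q) \<le> A + B / Q" by (simp only: pos_le_divide_eq[OF q1])
  qed
  show ?thesis
  proof (rule that[OF k(1)])
    fix v :: "real^'q" assume v: "(\<Sum>r\<in>UNIV. v $ r) = 0"
    define T where "T = (\<Sum>r\<in>UNIV - {c}. (v $ r)\<^sup>2)"
    have "(v $ c)\<^sup>2 = (\<Sum>r\<in>UNIV - {c}. v $ r)\<^sup>2"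
      using v sum_peak_split[of "\<lambda>r. v $ r"] by (simp add: power2_eq_square eq_neg_iff_add_eq_0)
         (metis add.commute add_eq_0_iff minus_mult_minus)
    also have "\<dots> \<le> T * (\<Sum>r\<in>UNIV - {c}. 1\<^sup>2)"
      unfolding T_def using Cauchy_Schwarz_ineq_sum[of "\<lambda>r. v $ r" "\<lambda>_. 1" "UNIV - {c}"] by simp
    also have "(\<Sum>r\<in>UNIV - {c}. 1\<^sup>2 :: real) = Q"
      using q2 by (simp add: Q_def card_Diff_singleton of_nat_diff Suc_leI card_gt_0_iff)
    finally have vT: "(v $ c)\<^sup>2 / Q \<le> T" using Q by (simp add: field_simps)
    have n: "(norm v)\<^sup>2 = (v $ c)\<^sup>2 + T"
      unfolding power2_norm_eq_inner inner_vec_def T_def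
      by (subst sum_peak_split) (simp add: power2_eq_square)
    have "(\<Sum>r\<in>UNIV. curv r * (v $ r)\<^sup>2) = A * (v $ c)\<^sup>2 + B * T"
      unfolding T_def sum_distrib_left
      by (subst sum_peak_split) (auto simp: curv_def peak_nth A_def B_def intro!: sum.cong)
    moreover have "(B - \<kappa>) * ((v $ c)\<^sup>2 / Q) \<le> (B - \<kappa>) * T" using vT k by (intro mult_left_mono) auto
    moreover have "\<kappa> * (1 + 1 / Q) * (v $ c)\<^sup>2 \<le> (A + B / Q) * (v $ c)\<^sup>2" using k by (intro mult_right_mono) auto
    moreover have "\<kappa> * (1 + 1 / Q) * (v $ c)\<^sup>2 = \<kappa> * (v $ c)\<^sup>2 + \<kappa> * ((v $ c)\<^sup>2 / Q)"
      "(A + B / Q) * (v $ c)\<^sup>2 = A * (v $ c)\<^sup>2 + B * ((v $ c)\<^sup>2 / Q)"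
      by (simp_all add: algebra_simps)
    moreover define w where "w = (v $ c)\<^sup>2 / Q"
    ultimately show "\<kappa> * (norm v)\<^sup>2 \<le> (\<Sum>r\<in>UNIV. curv r * (v $ r)\<^sup>2)"
      unfolding n w_def[symmetric] left_diff_distrib right_diff_distrib distrib_left by linarith
  qed
qed

text \<open>The rank-one part of \<open>drift\<close> contributes a multiple of the coordinate sum,
  which vanishes. The weights \<open>1 / m $ r\<close> thus turn the drift into the Hessian form of
  \<open>- H\<close>, whose coercivity is known; \<open>second_moment_bound\<close> rests on
  this.\<close>

lemma drift_curv:
  assumes "(\<Sum>r\<in>UNIV. v $ r) = 0"
  shows "(\<Sum>r\<in>UNIV. v $ r / m $ r * drift r v) = (\<Sum>r\<in>UNIV. curv r * (v $ r)\<^sup>2)"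
proof -
  define T where "T = (\<Sum>s\<in>UNIV. c' * (m $ s) ^ (p - 1) * v $ s)"
  have "v $ r / m $ r * drift r v = curv r * (v $ r)\<^sup>2 + T * v $ r" for r
    using m_pos[of r] unfolding drift_def T_def[symmetric] curv_def
    by (simp add: field_simps power2_eq_square pow_pred(1)[symmetric])
  thus ?thesis by (simp add: sum.distrib sum_distrib_left[symmetric] assms)
qed

end

text \<open>Differentiability of \<open>crit_fun\<close> at the single point \<open>t\<close> bounds
  the derivative of the remainder by \<open>e * \<bar>u\<bar>\<close>, and the mean value inequality
  integrates this bound.\<close>

lemma entropy_term_taylor:
  fixes \<beta> t e :: real
  assumes t: "t > 0" and p: "p \<ge> 2" and e: "e > 0"
  defines "\<eta> \<equiv> (\<beta> * real p * (real p - 1) * t ^ (p - 1) - 1) / t"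
  shows "\<exists>d>0. \<forall>u. \<bar>u\<bar> < d \<longrightarrow>
     \<bar>entropy_term p \<beta> (t + u) - entropy_term p \<beta> t - (crit_fun p \<beta> t - 1) * u - \<eta> / 2 * u\<^sup>2\<bar> \<le> e * u\<^sup>2"
proof -
  have "((\<lambda>u. (crit_fun p \<beta> (t + u) - crit_fun p \<beta> t) / u) \<longlongrightarrow> \<eta>) (at 0)"
    using crit_fun_deriv[OF t p, of \<beta>] by (simp add: DERIV_def \<eta>_def)
  hence "\<forall>\<^sub>F u in at 0. dist ((crit_fun p \<beta> (t + u) - crit_fun p \<beta> t) / u) \<eta> < e"
    using e by (auto simp: tendsto_iff)
  then obtain d0 where d0: "d0 > 0"
    "\<And>u. u \<noteq> 0 \<Longrightarrow> dist u 0 < d0 \<Longrightarrow> dist ((crit_fun p \<beta> (t + u) - crit_fun p \<beta> t) / u) \<eta> < e"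
    by (auto simp: eventually_at)
  have g: "\<bar>crit_fun p \<beta> (t + u) - crit_fun p \<beta> t - \<eta> * u\<bar> \<le> e * \<bar>u\<bar>" if "\<bar>u\<bar> < d0" for u
  proof (cases "u = 0")
    case False
    define X where "X = crit_fun p \<beta> (t + u) - crit_fun p \<beta> t"
    have "\<bar>X / u - \<eta>\<bar> * \<bar>u\<bar> \<le> e * \<bar>u\<bar>"
      using d0(2)[OF False] that by (intro mult_right_mono) (auto simp: dist_real_def X_def)
    moreover have "\<bar>X / u - \<eta>\<bar> * \<bar>u\<bar> = \<bar>X - \<eta> * u\<bar>"
      unfolding abs_mult[symmetric] left_diff_distrib using False by simp
    ultimately show ?thesis by (simp add: X_def)
  qed simp
  let ?\<phi> = "\<lambda>u. entropy_term p \<beta> (t + u) - entropy_term p \<beta> t - (crit_fun p \<beta> t - 1) * u - \<eta> / 2 * u\<^sup>2"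
  have "\<bar>?\<phi> u\<bar> \<le> e * u\<^sup>2" if u: "\<bar>u\<bar> < min d0 t" for u
  proof -
    have "norm (?\<phi> u - ?\<phi> 0) \<le> (e * \<bar>u\<bar>) * norm (u - 0)"
    proof (rule field_differentiable_bound[where S = "{-\<bar>u\<bar>..\<bar>u\<bar>}"])
      fix z assume z: "z \<in> {-\<bar>u\<bar>..\<bar>u\<bar>}"
      hence tz: "t + z > 0" using u by auto
      have "((\<lambda>u. entropy_term p \<beta> (t + u)) has_real_derivative (crit_fun p \<beta> (t + z) - 1) * 1) (at z)"
        unfolding crit_fun_def by (rule DERIV_chain2[of "entropy_term p \<beta>"], rule entropy_term_deriv[OF tz])
          (auto intro!: derivative_eq_intros)
      hence "(?\<phi> has_real_derivative crit_fun p \<beta> (t + z) - crit_fun p \<beta> t - \<eta> * z) (at z)"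
        by (auto intro!: derivative_eq_intros)
      thus "(?\<phi> has_field_derivative crit_fun p \<beta> (t + z) - crit_fun p \<beta> t - \<eta> * z) (at z within {-\<bar>u\<bar>..\<bar>u\<bar>})"
        by (rule has_field_derivative_at_within)
      have "\<bar>crit_fun p \<beta> (t + z) - crit_fun p \<beta> t - \<eta> * z\<bar> \<le> e * \<bar>z\<bar>" using g[of z] z u by auto
      also have "\<dots> \<le> e * \<bar>u\<bar>" using z e by (intro mult_left_mono) auto
      finally show "norm (crit_fun p \<beta> (t + z) - crit_fun p \<beta> t - \<eta> * z) \<le> e * \<bar>u\<bar>" by simp
    qed auto
    also have "\<dots> = e * u\<^sup>2" by (simp add: power2_eq_square abs_mult[symmetric])
    finally show ?thesis by simp
  qed
  thus ?thesis using d0(1) t by (intro exI[of _ "min d0 t"]) auto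
qed

text \<open>At the boundary point \<open>0\<close> continuity follows from
  \<open>- ln t \<le> 2 / sqrt t\<close>. With it \<open>H\<close> attains its extrema on closed
  subsets of the simplex.\<close>

lemma continuous_on_x_ln_x: "continuous_on {0..} (\<lambda>t::real. t * ln t)"
  unfolding continuous_on_def
proof
  fix x :: real assume "x \<in> {0..}"
  show "((\<lambda>t. t * ln t) \<longlongrightarrow> x * ln x) (at x within {0..})"
  proof (cases "x = 0")
    case False
    hence "((\<lambda>t. t * ln t) \<longlongrightarrow> x * ln x) (at x)" using \<open>x \<in> {0..}\<close> by (intro tendsto_intros) auto
    thus ?thesis by (rule tendsto_within_subset) simp
  next
    case True
    have "((\<lambda>t. t * ln t) \<longlongrightarrow> 0) (at (0::real) within {0..})"
    proof (rule Lim_null_comparison)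
      show "\<forall>\<^sub>F t in at (0::real) within {0..}. norm (t * ln t) \<le> 2 * sqrt t"
      proof (rule eventually_at[THEN iffD2], intro exI[of _ 1] conjI ballI impI)
        fix t :: real assume t: "t \<in> {0..}" "t \<noteq> 0 \<and> dist t 0 < 1"
        hence t01: "0 < t" "t < 1" by auto
        let ?s = "sqrt t"
        have s: "?s > 0" "?s * ?s = t" using t01 by auto
        have "ln t = 2 * ln ?s" using t01 by (simp add: ln_sqrt)
        moreover have "- ln ?s \<le> 1 / ?s"
        proof -
          have "ln (1 / ?s) \<le> 1 / ?s - 1" using s by (intro ln_le_minus_one) simp
          thus ?thesis using s by (simp add: ln_div)
        qed
        ultimately have "- ln t \<le> 2 / ?s" by simp
        hence "t * - ln t \<le> t * (2 / ?s)" using t01 by (intro mult_left_mono) auto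
        also have "t * (2 / ?s) = 2 * ?s" using s by (simp add: field_simps)
        finally have "t * - ln t \<le> 2 * ?s" .
        moreover have "t * ln t \<le> 0" using t01 by (intro mult_nonneg_nonpos) auto
        ultimately show "norm (t * ln t) \<le> 2 * ?s" by simp
      qed simp
      have "((\<lambda>t. 2 * sqrt t) \<longlongrightarrow> 2 * sqrt 0) (at (0::real) within {0..})" by (intro tendsto_intros)
      thus "((\<lambda>t. 2 * sqrt t) \<longlongrightarrow> 0) (at (0::real) within {0..})" by simp
    qed
    thus ?thesis using True by simp
  qed
qed

lemma continuous_on_H: "continuous_on (prob_simplex :: (real^'q::finite) set) (H p \<beta>)"
proof -
  have 1: "continuous_on prob_simplex (\<lambda>t :: real^'q. t $ r * ln (t $ r))" for r
    by (rule continuous_on_compose2[OF continuous_on_x_ln_x])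
       (auto intro!: continuous_intros simp: prob_simplex_def)
  have 2: "continuous_on prob_simplex (\<lambda>t :: real^'q. \<beta> * (\<Sum>r\<in>UNIV. (t $ r) ^ p))"
    by (intro continuous_intros)
  show ?thesis unfolding H_def[abs_def] by (intro continuous_on_diff continuous_on_sum 1 2)
qed

lemma compact_prob_simplex: "compact (prob_simplex :: (real^'q::finite) set)"
proof -
  have eq: "prob_simplex = {t :: real^'q. \<forall>r. 0 \<le> t $ r} \<inter> {t. (\<Sum>r\<in>UNIV. t $ r) = 1}"
    by (auto simp: prob_simplex_def)
  have "closed (prob_simplex :: (real^'q) set)"
    unfolding eq
    by (intro closed_Int closed_Collect_all closed_Collect_le closed_Collect_eq continuous_intros)
  moreover have "bounded (prob_simplex :: (real^'q) set)"
    unfolding bounded_iff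
  proof (intro exI ballI)
    fix x :: "real^'q" assume "x \<in> prob_simplex"
    thus "norm x \<le> 1" using norm_le_l1_cart[of x] by (simp add: prob_simplex_def)
  qed
  ultimately show ?thesis by (simp add: compact_eq_bounded_closed)
qed

context potts_peak
begin

lemma H_local_quadratic:
  obtains \<kappa> d where "\<kappa> > 0" "d > 0"
    "\<And>x. x \<in> prob_simplex \<Longrightarrow> norm (x - m) < d \<Longrightarrow> \<kappa> * (norm (x - m))\<^sup>2 \<le> H p \<beta> m - H p \<beta> x"
proof -
  obtain \<kappa> where k: "\<kappa> > 0" "\<And>v. (\<Sum>r\<in>UNIV. v $ r) = 0 \<Longrightarrow> \<kappa> * (norm v)\<^sup>2 \<le> (\<Sum>r\<in>UNIV. curv r * (v $ r)\<^sup>2)"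
    using curv_form_lower by blast
  have "\<exists>d>0. \<forall>u. \<bar>u\<bar> < d \<longrightarrow> \<bar>entropy_term p \<beta> (m $ r + u) - entropy_term p \<beta> (m $ r)
      - (crit_fun p \<beta> (m $ r) - 1) * u - (- curv r) / 2 * u\<^sup>2\<bar> \<le> \<kappa> / 4 * u\<^sup>2" for r
  proof -
    have "(\<beta> * real p * (real p - 1) * (m $ r) ^ (p - 1) - 1) / m $ r = - curv r"
      by (simp add: curv_def c'_def minus_divide_left)
    thus ?thesis using entropy_term_taylor[OF m_pos p2, of "\<kappa> / 4" \<beta> r] k by simp
  qed
  then obtain d where d: "\<And>r. d r > 0" "\<And>r u. \<bar>u\<bar> < d r \<Longrightarrow> \<bar>entropy_term p \<beta> (m $ r + u) - entropy_term p \<beta> (m $ r)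
      - (crit_fun p \<beta> (m $ r) - 1) * u - (- curv r) / 2 * u\<^sup>2\<bar> \<le> \<kappa> / 4 * u\<^sup>2"
    by metis
  show ?thesis
  proof (rule that[of "\<kappa> / 4" "Min (range d)"])
    show "\<kappa> / 4 > 0" using k by simp
    show "Min (range d) > 0" using d(1) by (subst Min_gr_iff) auto
    fix x assume x: "x \<in> (prob_simplex :: (real^'q) set)" and n: "norm (x - m) < Min (range d)"
    define v where "v = x - m"
    have v0: "(\<Sum>r\<in>UNIV. v $ r) = 0" using x sum_m by (simp add: v_def sum_subtractf prob_simplex_def)
    have "entropy_term p \<beta> (x $ r) - entropy_term p \<beta> (m $ r)
        \<le> (crit_fun p \<beta> a - 1) * v $ r - 1 / 2 * (curv r * (v $ r)\<^sup>2) + \<kappa> / 4 * (v $ r)\<^sup>2" for r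
    proof -
      have "\<bar>v $ r\<bar> \<le> norm v" by (rule component_le_norm_cart)
      also have "\<dots> < d r" using n by (simp add: v_def Min_gr_iff)
      finally have "\<bar>v $ r\<bar> < d r" .
      note d(2)[OF this]
      moreover have "crit_fun p \<beta> (m $ r) = crit_fun p \<beta> a" using crit by (simp add: peak_nth)
      moreover have "m $ r + v $ r = x $ r" by (simp add: v_def)
      ultimately show ?thesis by (simp only: abs_le_iff) linarith
    qed
    hence "H p \<beta> x - H p \<beta> m \<le> (\<Sum>r\<in>UNIV. (crit_fun p \<beta> a - 1) * v $ r - 1 / 2 * (curv r * (v $ r)\<^sup>2) + \<kappa> / 4 * (v $ r)\<^sup>2)"
      unfolding H_eq_sum sum_subtractf[symmetric] by (intro sum_mono)
    also have "\<dots> = - (\<Sum>r\<in>UNIV. curv r * (v $ r)\<^sup>2) / 2 + \<kappa> / 4 * (\<Sum>r\<in>UNIV. (v $ r)\<^sup>2)"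
      unfolding sum.distrib sum_subtractf sum_distrib_left[symmetric] v0 by simp
    also have "(\<Sum>r\<in>UNIV. (v $ r)\<^sup>2) = (norm v)\<^sup>2"
      unfolding power2_norm_eq_inner inner_vec_def by (simp add: power2_eq_square)
    also have "- (\<Sum>r\<in>UNIV. curv r * (v $ r)\<^sup>2) / 2 + \<kappa> / 4 * (norm v)\<^sup>2 \<le> - (\<kappa> / 4) * (norm v)\<^sup>2"
      using k(2)[OF v0] by (simp add: field_simps)
    finally show "\<kappa> / 4 * (norm (x - m))\<^sup>2 \<le> H p \<beta> m - H p \<beta> x" by (simp add: v_def)
  qed
qed

text \<open>Near \<open>m\<close> the local bound applies. On the compact remainder of
  \<open>T\<close> the gap is at least some \<open>e > 0\<close>, and since
  \<open>norm (x - m) \<le> 2\<close> on the simplex, \<open>e / 4\<close> is a quadratic constant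
  there.\<close>

lemma H_quadratic_on:
  assumes T: "compact T" "T \<subseteq> prob_simplex" and uniq: "\<And>x. x \<in> T \<Longrightarrow> x \<in> maximizers p \<beta> \<Longrightarrow> x = m"
  obtains \<kappa> where "\<kappa> > 0" "\<And>x. x \<in> T \<Longrightarrow> \<kappa> * (norm (x - m))\<^sup>2 \<le> H p \<beta> m - H p \<beta> x"
proof -
  obtain k0 d where k0: "k0 > 0" "d > 0"
    "\<And>x. x \<in> prob_simplex \<Longrightarrow> norm (x - m) < d \<Longrightarrow> k0 * (norm (x - m))\<^sup>2 \<le> H p \<beta> m - H p \<beta> x"
    using H_local_quadratic by blast
  let ?T = "T - ball m d"
  have cT: "compact ?T" using T by (intro compact_diff) auto
  obtain e where e: "e > 0" "\<And>x. x \<in> ?T \<Longrightarrow> e \<le> H p \<beta> m - H p \<beta> x"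
  proof (cases "?T = {}")
    case True
    show ?thesis by (rule that[of 1]) (use True in auto)
  next
    case False
    have "continuous_on ?T (\<lambda>x. H p \<beta> m - H p \<beta> x)"
      by (intro continuous_intros continuous_on_subset[OF continuous_on_H]) (use T in auto)
    from continuous_attains_inf[OF cT False this]
    obtain z where z: "z \<in> ?T" "\<And>x. x \<in> ?T \<Longrightarrow> H p \<beta> m - H p \<beta> z \<le> H p \<beta> m - H p \<beta> x" by auto
    have "z \<noteq> m" using z k0 by auto
    hence "z \<notin> maximizers p \<beta>" using uniq z by auto
    then obtain y where y: "y \<in> (prob_simplex :: (real^'q) set)" "H p \<beta> z < H p \<beta> y"
      using z T by (auto simp: maximizers_iff not_le)
    have "H p \<beta> y \<le> H p \<beta> m" using y peak_max by (simp add: maximizers_iff)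
    hence "H p \<beta> m - H p \<beta> z > 0" using y by simp
    thus ?thesis using that z by blast
  qed
  show ?thesis
  proof (rule that[of "min k0 (e / 4)"])
    show "min k0 (e / 4) > 0" using k0 e by simp
    fix x assume x: "x \<in> T"
    show "min k0 (e / 4) * (norm (x - m))\<^sup>2 \<le> H p \<beta> m - H p \<beta> x"
    proof (cases "norm (x - m) < d")
      case True
      have "min k0 (e / 4) * (norm (x - m))\<^sup>2 \<le> k0 * (norm (x - m))\<^sup>2" by (intro mult_right_mono) auto
      thus ?thesis using k0(3)[of x] True x T by auto
    next
      case False
      have "norm (x - m) \<le> 2" using norm_simplex_diff_le[OF _ m_simplex] x T by auto
      hence "(norm (x - m))\<^sup>2 \<le> 2\<^sup>2" by (intro power_mono) auto
      hence "(e / 4) * (norm (x - m))\<^sup>2 \<le> (e / 4) * 4" using e by (intro mult_left_mono) auto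
      moreover have "min k0 (e / 4) * (norm (x - m))\<^sup>2 \<le> (e / 4) * (norm (x - m))\<^sup>2" by (intro mult_right_mono) auto
      moreover have "e \<le> H p \<beta> m - H p \<beta> x" using e(2)[of x] False x by (auto simp: dist_norm norm_minus_commute)
      ultimately show ?thesis by linarith
    qed
  qed
qed

definition E :: real where "E = (\<Sum>s\<in>UNIV. (m $ s) ^ p)"
definition \<Delta> :: real where "\<Delta> = a ^ (p - 1) - b ^ (p - 1)"
definition gradS :: "real^'q" where "gradS = (\<chi> r. (m $ r) ^ (p - 1) * (1 - c' * ((m $ r) ^ (p - 1) - E)))"
text \<open>\<open>p\<close> times the variance of \<open>(m $ r) ^ (p - 1)\<close> under the
  weights \<open>m\<close>. It is minus the derivative of \<open>S\<close> in \<open>\<beta>\<close>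
  at the peak.\<close>

definition VS :: real where "VS = real p * (\<Sum>r\<in>UNIV. m $ r * ((m $ r) ^ (p - 1) - E)\<^sup>2)"
text \<open>The scalar with \<open>rho p \<beta> m \<bullet> v = gam * v $ c\<close> for every
  \<open>v\<close> of coordinate sum zero.\<close>

definition gam :: real where "gam = \<Delta> * lam / VS"

lemma Delta_pos: "\<Delta> > 0"
  unfolding \<Delta>_def using b_less_a b_pos p2 by (simp add: power_strict_mono)

lemma E_eq: "E = a * a ^ (p - 1) + (1 - a) * b ^ (p - 1)"
proof -
  have "E = (\<Sum>r\<in>UNIV. if r = c then a ^ p else b ^ p)" unfolding E_def by (intro sum.cong) (auto simp: peak_nth)
  also have "\<dots> = a ^ p + (real CARD('q) - 1) * b ^ p" by (rule sum_peak)
  also have "\<dots> = a ^ p + ((real CARD('q) - 1) * b) * b ^ (p - 1)" by (simp add: pow_pred(2)[symmetric])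
  finally show ?thesis by (simp add: one_minus_a pow_pred(2))
qed

lemma pow_minus_E: "a ^ (p - 1) - E = (1 - a) * \<Delta>" "b ^ (p - 1) - E = - a * \<Delta>"
  unfolding E_eq \<Delta>_def by (simp_all add: algebra_simps)

lemma VS_pos: "VS > 0"
proof -
  have "0 < m $ c * ((m $ c) ^ (p - 1) - E)\<^sup>2"
    using a_pos a_less_1 Delta_pos by (simp add: peak_nth pow_minus_E)
  also have "\<dots> \<le> (\<Sum>r\<in>UNIV. m $ r * ((m $ r) ^ (p - 1) - E)\<^sup>2)"
    using m_pos by (intro member_le_sum) (auto simp: less_imp_le)
  finally show ?thesis using p2 by (simp add: VS_def)
qed

lemma gam_pos: "gam > 0" using Delta_pos lam_pos VS_pos by (simp add: gam_def)

text \<open>\<open>gradS\<close> has one entry at \<open>c\<close> and another at all other colours,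
  so on vectors of sum zero only the difference of the two matters. The combination \<open>K\<close>
  known from the drift reappears in it, hence the factor \<open>lam\<close>.\<close>

lemma gradS_inner:
  assumes "(\<Sum>r\<in>UNIV. v $ r) = 0"
  shows "gradS \<bullet> v = \<Delta> * lam * v $ c"
proof -
  define gb where "gb = b ^ (p - 1) * (1 - c' * (b ^ (p - 1) - E))"
  define ga where "ga = a ^ (p - 1) * (1 - c' * (a ^ (p - 1) - E))"
  have "gradS \<bullet> v = ga * v $ c + gb * (\<Sum>r\<in>UNIV - {c}. v $ r)"
    unfolding inner_vec_def
    by (subst sum_peak_split) (auto simp: gradS_def peak_nth ga_def gb_def sum_distrib_left intro!: sum.cong)
  also have "(\<Sum>r\<in>UNIV - {c}. v $ r) = - v $ c"
    using assms sum_peak_split[of "\<lambda>s. v $ s"] by simp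
  finally have "gradS \<bullet> v = (ga - gb) * v $ c" by (simp add: algebra_simps)
  have 1: "ga - gb = \<Delta> - c' * \<Delta> * ((1 - a) * a ^ (p - 1) + a * b ^ (p - 1))"
    unfolding ga_def gb_def pow_minus_E by (simp add: algebra_simps \<Delta>_def)
  have 2: "(1 - a) * a ^ (p - 1) + a * b ^ (p - 1) = K"
    unfolding one_minus_a K_def by (simp add: algebra_simps)
  have "ga - gb = \<Delta> * lam" using 1 unfolding 2 lam_def by (simp add: algebra_simps)
  with \<open>gradS \<bullet> v = (ga - gb) * v $ c\<close> show ?thesis by simp
qed

lemma quad_approx_S_peak: "quad_approx (\<lambda>z. S p (fst z) (snd z)) (m, \<beta>) (\<lambda>v. gradS \<bullet> fst v - VS * snd v)"
proof (rule quad_approx_cong[OF quad_approx_S[OF mean_field_m p2]])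
  fix v :: "(real^'q) \<times> real"
  have "(\<Sum>r\<in>UNIV. m $ r * ((m $ r) ^ (p - 1) - E) * field_diff p m \<beta> r v)
      = (\<Sum>r\<in>UNIV. c' * ((m $ r) ^ (p - 1) - E) * (m $ r) ^ (p - 1) * fst v $ r)
      + snd v * real p * (\<Sum>r\<in>UNIV. m $ r * ((m $ r) ^ (p - 1) - E) * (m $ r) ^ (p - 1))"
  proof -
    have "m $ r * ((m $ r) ^ (p - 1) - E) * field_diff p m \<beta> r v
        = c' * ((m $ r) ^ (p - 1) - E) * (m $ r * (m $ r) ^ (p - 2)) * fst v $ r
        + snd v * real p * (m $ r * ((m $ r) ^ (p - 1) - E) * (m $ r) ^ (p - 1))" for r
      using p2 by (simp add: field_diff_def c'_def of_nat_diff algebra_simps)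
    thus ?thesis by (simp add: sum.distrib sum_distrib_left pow_pred(1))
  qed
  \<comment> \<open>The last factor may be centred, because the weighted mean of the other one
    vanishes: \<open>E\<close> is the mean of \<open>(m $ r) ^ (p - 1)\<close> under the weights
    \<open>m\<close>.\<close>
  also have "(\<Sum>r\<in>UNIV. m $ r * ((m $ r) ^ (p - 1) - E) * (m $ r) ^ (p - 1))
      = (\<Sum>r\<in>UNIV. m $ r * ((m $ r) ^ (p - 1) - E)\<^sup>2)"
  proof -
    have "(\<Sum>r\<in>UNIV. m $ r * ((m $ r) ^ (p - 1) - E) * (m $ r) ^ (p - 1)) - (\<Sum>r\<in>UNIV. m $ r * ((m $ r) ^ (p - 1) - E)\<^sup>2)
       = E * (\<Sum>r\<in>UNIV. m $ r * (m $ r) ^ (p - 1) - m $ r * E)"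
      unfolding sum_subtractf[symmetric] sum_distrib_left
      by (intro sum.cong refl) (simp add: power2_eq_square algebra_simps)
    also have "(\<Sum>r\<in>UNIV. m $ r * (m $ r) ^ (p - 1) - m $ r * E) = 0"
      by (simp add: sum_subtractf pow_pred(2) E_def[symmetric] sum_distrib_right[symmetric] sum_m)
    finally show ?thesis by simp
  qed
  finally have e: "(\<Sum>r\<in>UNIV. m $ r * ((m $ r) ^ (p - 1) - E) * field_diff p m \<beta> r v)
      = (\<Sum>r\<in>UNIV. c' * ((m $ r) ^ (p - 1) - E) * (m $ r) ^ (p - 1) * fst v $ r) + VS * snd v"
    by (simp add: VS_def mult_ac)
  have "gradS \<bullet> fst v = (\<Sum>r\<in>UNIV. (m $ r) ^ (p - 1) * fst v $ r) - (\<Sum>r\<in>UNIV. c' * ((m $ r) ^ (p - 1) - E) * (m $ r) ^ (p - 1) * fst v $ r)"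
    unfolding sum_subtractf[symmetric] inner_vec_def
    by (intro sum.cong refl) (simp add: gradS_def algebra_simps)
  thus "(\<Sum>r\<in>UNIV. (m $ r) ^ (p - 1) * fst v $ r)
        - (\<Sum>r\<in>UNIV. m $ r * ((m $ r) ^ (p - 1) - (\<Sum>s\<in>UNIV. (m $ s) ^ p)) * field_diff p m \<beta> r v)
      = gradS \<bullet> fst v - VS * snd v"
    using e unfolding E_def[symmetric] by simp
qed simp

lemma S_peak: "S p m \<beta> = 0"
  unfolding S_eq_mean_field mean_field_m by (simp add: mult.commute[of _ "m $ _"] pow_pred)

text \<open>Both partial derivatives are restrictions of the joint differential to slices. The one
  in \<open>\<beta>\<close> is \<open>- VS\<close>, which cancels the sign in
  \<open>rho\<close>.\<close>

lemma rho_eq: "rho p \<beta> m = gradS /\<^sub>R VS"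
proof -
  note D = quad_approx_has_derivative[OF quad_approx_S_peak]
  have "((\<lambda>x. S p (fst (x, \<beta>)) (snd (x, \<beta>))) has_derivative (\<lambda>v. gradS \<bullet> fst (v, 0::real) - VS * snd (v, 0::real))) (at m)"
    by (rule has_derivative_compose[where f = "\<lambda>x. (x, \<beta>)" and g = "\<lambda>z. S p (fst z) (snd z)"])
       (auto intro!: derivative_eq_intros D)
  hence g: "GDERIV (\<lambda>x. S p x \<beta>) m :> gradS" by (simp add: gderiv_def inner_commute)
  have "gradient (\<lambda>x. S p x \<beta>) m = gradS"
    unfolding gradient_def
  proof (rule the_equality)
    show "GDERIV (\<lambda>x. S p x \<beta>) m :> gradS" by (rule g)
    fix D assume "GDERIV (\<lambda>x. S p x \<beta>) m :> D"
    hence "(\<lambda>h. h \<bullet> D) = (\<lambda>h. h \<bullet> gradS)" using g unfolding gderiv_def by (rule has_derivative_unique)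
    thus "D = gradS" by (metis vector_eq_ldot)
  qed
  moreover have "((\<lambda>b. S p (fst (m, b)) (snd (m, b))) has_derivative (\<lambda>y. gradS \<bullet> fst (0::real^'q, y) - VS * snd (0::real^'q, y))) (at \<beta>)"
    by (rule has_derivative_compose[where f = "\<lambda>b. (m, b)" and g = "\<lambda>z. S p (fst z) (snd z)"])
       (auto intro!: derivative_eq_intros D)
  hence "(S p m has_derivative (\<lambda>y. - VS * y)) (at \<beta>)" by simp
  hence "(S p m has_real_derivative - VS) (at \<beta>)" unfolding has_field_derivative_def .
  hence "deriv (S p m) \<beta> = - VS" by (rule DERIV_imp_deriv)
  ultimately show ?thesis by (simp add: rho_def)
qed

lemma rho_inner:
  assumes "(\<Sum>r\<in>UNIV. v $ r) = 0"
  shows "rho p \<beta> m \<bullet> v = gam * v $ c"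
  by (simp add: rho_eq gradS_inner[OF assms] gam_def divide_inverse)

end

section \<open>The Gibbs measure\<close>

lemma finite_configs [simp]: "finite (configs N :: (nat \<Rightarrow> 'q::finite) set)"
  unfolding configs_def by (intro finite_PiE) auto

lemma configs_nonempty: "(configs N :: (nat \<Rightarrow> 'q::finite) set) \<noteq> {}"
  unfolding configs_def by (simp add: PiE_eq_empty_iff)

lemma configs_update: "X \<in> configs N \<Longrightarrow> i \<in> {1..N} \<Longrightarrow> X(i := s) \<in> configs N"
  unfolding configs_def by (auto simp: PiE_iff extensional_def)

lemma boltzmann_weight_pos: "boltzmann_weight p b N X > 0"
  by (simp add: boltzmann_weight_def)

definition gibbs_total :: "'q::finite itself \<Rightarrow> nat \<Rightarrow> real \<Rightarrow> nat \<Rightarrow> real" where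
  "gibbs_total _ p b N = (\<Sum>X\<in>(configs N :: (nat \<Rightarrow> 'q) set). boltzmann_weight p b N X)"

text \<open>The expectation under \<open>potts\<close> as a finite sum; the powers of
  \<open>q\<close> in \<open>potts\<close> and \<open>partition_fun\<close> cancel. Probabilities
  and integrals are translated into it, and all estimates are made for it.\<close>

definition gibbs_mean :: "nat \<Rightarrow> real \<Rightarrow> nat \<Rightarrow> ((nat \<Rightarrow> 'q::finite) \<Rightarrow> real) \<Rightarrow> real" where
  "gibbs_mean p b N f = (\<Sum>X\<in>configs N. boltzmann_weight p b N X * f X) / gibbs_total TYPE('q) p b N"

lemma gibbs_total_pos: "gibbs_total TYPE('q::finite) p b N > 0"
  unfolding gibbs_total_def
  by (intro sum_pos finite_configs configs_nonempty boltzmann_weight_pos)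

lemma gibbs_mean_add: "gibbs_mean p b N (\<lambda>X. f X + g X) = gibbs_mean p b N f + gibbs_mean p b N g"
  by (simp add: gibbs_mean_def distrib_left sum.distrib add_divide_distrib)

lemma gibbs_mean_diff: "gibbs_mean p b N (\<lambda>X. f X - g X) = gibbs_mean p b N f - gibbs_mean p b N g"
  by (simp add: gibbs_mean_def right_diff_distrib sum_subtractf diff_divide_distrib)

lemma gibbs_mean_cmult: "gibbs_mean p b N (\<lambda>X. k * f X) = k * gibbs_mean p b N f"
  by (simp add: gibbs_mean_def sum_distrib_left mult.left_commute)

lemma gibbs_mean_sum: "gibbs_mean p b N (\<lambda>X. \<Sum>i\<in>I. f i X) = (\<Sum>i\<in>I. gibbs_mean p b N (f i))"
proof -
  have "(\<Sum>X\<in>configs N. boltzmann_weight p b N X * (\<Sum>i\<in>I. f i X)) = (\<Sum>i\<in>I. \<Sum>X\<in>configs N. boltzmann_weight p b N X * f i X)"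
    by (subst sum.swap) (simp add: sum_distrib_left)
  thus ?thesis by (simp add: gibbs_mean_def sum_divide_distrib)
qed

lemma gibbs_mean_mono:
  fixes f g :: "(nat \<Rightarrow> 'q::finite) \<Rightarrow> real"
  assumes "\<And>X. X \<in> configs N \<Longrightarrow> f X \<le> g X"
  shows "gibbs_mean p b N f \<le> gibbs_mean p b N g"
  unfolding gibbs_mean_def
  using assms
  by (intro divide_right_mono sum_mono mult_left_mono)
     (auto simp: boltzmann_weight_pos gibbs_total_pos intro: less_imp_le)

lemma gibbs_mean_const: "gibbs_mean p b N (\<lambda>X :: nat \<Rightarrow> 'q::finite. k) = k"
proof -
  have "(\<Sum>X\<in>(configs N :: (nat \<Rightarrow> 'q) set). boltzmann_weight p b N X) = gibbs_total TYPE('q) p b N"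
    by (simp add: gibbs_total_def)
  thus ?thesis using gibbs_total_pos[where 'q = 'q, of p b N]
    by (simp add: gibbs_mean_def sum_distrib_right[symmetric])
qed

lemma gibbs_mean_cong:
  fixes f g :: "(nat \<Rightarrow> 'q::finite) \<Rightarrow> real"
  assumes "\<And>X. X \<in> configs N \<Longrightarrow> f X = g X"
  shows "gibbs_mean p b N f = gibbs_mean p b N g"
  unfolding gibbs_mean_def using assms by (auto intro!: sum.cong arg_cong2[where f = "(/)"])

lemma gibbs_mean_nonneg:
  fixes f :: "(nat \<Rightarrow> 'q::finite) \<Rightarrow> real"
  assumes "\<And>X. X \<in> configs N \<Longrightarrow> 0 \<le> f X"
  shows "0 \<le> gibbs_mean p b N f"
  using gibbs_mean_mono[of N "\<lambda>_. 0" f p b] assms by (simp add: gibbs_mean_const)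

lemma gibbs_mean_abs_le:
  fixes f g :: "(nat \<Rightarrow> 'q::finite) \<Rightarrow> real"
  assumes "\<And>X. X \<in> configs N \<Longrightarrow> \<bar>f X\<bar> \<le> g X"
  shows "\<bar>gibbs_mean p b N f\<bar> \<le> gibbs_mean p b N g"
proof -
  have "gibbs_mean p b N f \<le> gibbs_mean p b N g"
    by (rule gibbs_mean_mono) (use assms in \<open>simp add: abs_le_iff\<close>)
  moreover have "gibbs_mean p b N (\<lambda>X. (-1) * f X) \<le> gibbs_mean p b N g"
    by (rule gibbs_mean_mono) (use assms in \<open>simp add: abs_le_iff\<close>)
  ultimately show ?thesis by (simp only: gibbs_mean_cmult abs_le_iff) simp
qed

lemma potts_eq_point_measure:
  "(potts p b N :: (nat \<Rightarrow> 'q::finite) measure) =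
     point_measure (configs N) (\<lambda>X. ennreal (boltzmann_weight p b N X / gibbs_total TYPE('q) p b N))"
  unfolding potts_def partition_fun_def gibbs_total_def by simp

lemma space_potts: "space (potts p b N :: (nat \<Rightarrow> 'q::finite) measure) = configs N"
  by (simp add: potts_eq_point_measure space_point_measure)

lemma sets_potts: "sets (potts p b N :: (nat \<Rightarrow> 'q::finite) measure) = Pow (configs N)"
  by (simp add: potts_eq_point_measure sets_point_measure)

lemma emeasure_potts:
  assumes "A \<subseteq> (configs N :: (nat \<Rightarrow> 'q::finite) set)"
  shows "emeasure (potts p b N) A = ennreal (gibbs_mean p b N (indicator A))"
proof -
  have fA: "finite A" using assms finite_subset[OF _ finite_configs] by blast
  have "emeasure (potts p b N) A = (\<Sum>X\<in>A. ennreal (boltzmann_weight p b N X / gibbs_total TYPE('q) p b N))"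
    unfolding potts_eq_point_measure by (rule emeasure_point_measure_finite[OF finite_configs assms])
  also have "\<dots> = ennreal (\<Sum>X\<in>A. boltzmann_weight p b N X / gibbs_total TYPE('q) p b N)"
    by (intro sum_ennreal) (auto simp: boltzmann_weight_pos gibbs_total_pos intro!: divide_nonneg_nonneg less_imp_le)
  also have "(\<Sum>X\<in>A. boltzmann_weight p b N X / gibbs_total TYPE('q) p b N) = gibbs_mean p b N (indicator A)"
    unfolding gibbs_mean_def sum_divide_distrib[symmetric]
    using assms by (simp add: indicator_def if_distrib sum.If_cases Int_absorb1 cong: if_cong)
  finally show ?thesis .
qed

lemma measure_potts:
  assumes "A \<subseteq> (configs N :: (nat \<Rightarrow> 'q::finite) set)"
  shows "measure (potts p b N) A = gibbs_mean p b N (indicator A)"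
  unfolding measure_def emeasure_potts[OF assms]
  by (intro enn2real_ennreal gibbs_mean_nonneg) simp

lemma integral_potts:
  fixes f :: "(nat \<Rightarrow> 'q::finite) \<Rightarrow> real"
  shows "(LINT X|potts p b N. f X) = gibbs_mean p b N f"
  unfolding potts_eq_point_measure
  by (subst lebesgue_integral_point_measure_finite)
     (auto simp: gibbs_mean_def sum_divide_distrib boltzmann_weight_pos less_imp_le gibbs_total_pos)

definition site_count :: "nat \<Rightarrow> (nat \<Rightarrow> 'q::finite) \<Rightarrow> 'q \<Rightarrow> real" where
  "site_count N X r = (\<Sum>i\<in>{1..N}. of_bool (X i = r))"

lemma magnetization_nth: "magnetization N X $ r = site_count N X r / real N"
  by (simp add: magnetization_def site_count_def)

lemma sum_site_count:
  fixes g :: "'q::finite \<Rightarrow> real"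
  shows "(\<Sum>r\<in>UNIV. site_count N X r * g r) = (\<Sum>i\<in>{1..N}. g (X i))"
proof -
  have "(\<Sum>r\<in>UNIV. site_count N X r * g r) = (\<Sum>i\<in>{1..N}. \<Sum>r\<in>UNIV. of_bool (X i = r) * g r)"
    unfolding site_count_def sum_distrib_right by (rule sum.swap)
  also have "\<dots> = (\<Sum>i\<in>{1..N}. g (X i))"
    by (intro sum.cong refl) (simp add: of_bool_def if_distrib[where f = "\<lambda>z. z * _"] cong: if_cong)
  finally show ?thesis .
qed

lemma site_count_nonneg: "site_count N X r \<ge> 0"
  unfolding site_count_def by (intro sum_nonneg) simp

lemma site_count_le: "site_count N X r \<le> real N"
proof -
  have "site_count N X r \<le> (\<Sum>i\<in>{1..N}. 1)" unfolding site_count_def by (intro sum_mono) simp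
  thus ?thesis by simp
qed

lemma magnetization_simplex:
  assumes "N \<ge> 1"
  shows "magnetization N X \<in> prob_simplex"
proof -
  have "(\<Sum>r\<in>UNIV. magnetization N X $ r) = (\<Sum>r\<in>UNIV. site_count N X r * 1) / real N"
    by (simp add: magnetization_nth sum_divide_distrib)
  also have "\<dots> = 1" using assms by (subst sum_site_count) simp
  finally show ?thesis by (simp add: prob_simplex_def magnetization_nth site_count_nonneg)
qed

lemma magnetization_le_1: "N \<ge> 1 \<Longrightarrow> magnetization N X $ r \<le> 1"
  using site_count_le[of N X r] by (simp add: magnetization_nth divide_le_eq)

lemma magnetization_nonneg: "0 \<le> magnetization N X $ r"
  using site_count_nonneg[of N X r] by (simp add: magnetization_nth)

definition rest_count :: "nat \<Rightarrow> (nat \<Rightarrow> 'q::finite) \<Rightarrow> nat \<Rightarrow> 'q \<Rightarrow> nat" where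
  "rest_count N X i r = card {j \<in> {1..N} - {i}. X j = r}"

lemma rest_count_update [simp]: "rest_count N (X(i := s)) i r = rest_count N X i r"
  unfolding rest_count_def by (intro arg_cong[where f = card]) auto

lemma site_count_rest:
  assumes "i \<in> {1..N}"
  shows "site_count N X r = real (rest_count N X i r) + of_bool (X i = r)"
proof -
  have "site_count N X r = (\<Sum>j\<in>{1..N} - {i}. of_bool (X j = r)) + of_bool (X i = r)"
    unfolding site_count_def using assms by (subst sum.remove[of _ i]) auto
  also have "(\<Sum>j\<in>{1..N} - {i}. of_bool (X j = r)) = real (rest_count N X i r)"
  proof -
    have "({1..N} - {i}) \<inter> {j. X j = r} = {j \<in> {1..N} - {i}. X j = r}" by blast
    thus ?thesis unfolding rest_count_def by (subst sum_of_bool_eq) simp_all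
  qed
  finally show ?thesis .
qed

lemma rest_count_less:
  assumes "i \<in> {1..N}"
  shows "rest_count N X i r < N"
proof -
  have "rest_count N X i r \<le> card ({1..N} - {i})" unfolding rest_count_def by (intro card_mono) auto
  also have "\<dots> < N" using assms by (subst card_Diff_singleton) auto
  finally show ?thesis .
qed

lemma site_count_update:
  assumes "i \<in> {1..N}"
  shows "site_count N (X(i := s)) r = site_count N X r - of_bool (X i = r) + of_bool (s = r)"
  using site_count_rest[OF assms, of X r] site_count_rest[OF assms, of "X(i := s)" r] by simp

definition cond_weight :: "nat \<Rightarrow> real \<Rightarrow> nat \<Rightarrow> (nat \<Rightarrow> 'q::finite) \<Rightarrow> nat \<Rightarrow> 'q \<Rightarrow> real" where
  "cond_weight p b N X i s = boltzmann_weight p b N (X(i := s)) / (\<Sum>t\<in>UNIV. boltzmann_weight p b N (X(i := t)))"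

text \<open>The map that sends the pair of \<open>X\<close> and \<open>s\<close> to the pair of
  \<open>X(i := s)\<close> and \<open>X i\<close> is an involution, and it exchanges the old and the
  new configuration.\<close>

lemma configs_swap_sum:
  fixes G :: "(nat \<Rightarrow> 'q::finite) \<Rightarrow> (nat \<Rightarrow> 'q) \<Rightarrow> real"
  assumes i: "i \<in> {1..N}"
  shows "(\<Sum>X\<in>configs N. \<Sum>s\<in>UNIV. G X (X(i := s))) = (\<Sum>X\<in>configs N. \<Sum>s\<in>UNIV. G (X(i := s)) X)"
proof -
  define f where "f z = ((fst z)(i := snd z), fst z i)" for z :: "(nat \<Rightarrow> 'q) \<times> 'q"
  let ?C = "(configs N :: (nat \<Rightarrow> 'q) set) \<times> UNIV"
  have ff: "f (f z) = z" for z by (cases z) (simp add: f_def)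
  have fC: "f z \<in> ?C" if "z \<in> ?C" for z
    using that unfolding f_def by (intro SigmaI configs_update i UNIV_I) (rule mem_Times_iff[THEN iffD1, THEN conjunct1])
  have "(\<Sum>X\<in>configs N. \<Sum>s\<in>UNIV. G X (X(i := s))) = (\<Sum>(X, s)\<in>?C. G X (X(i := s)))"
    by (rule sum.cartesian_product)
  also have "\<dots> = (\<Sum>z\<in>?C. G (fst z) ((fst z)(i := snd z)))"
    by (intro sum.cong refl) (simp add: case_prod_beta)
  also have "\<dots> = (\<Sum>z\<in>?C. G ((fst z)(i := snd z)) (fst z))"
  proof (rule sum.reindex_bij_witness[of ?C f f ?C])
    fix z show "G ((fst (f z))(i := snd (f z))) (fst (f z)) = G (fst z) ((fst z)(i := snd z))"
      by (simp add: f_def)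
  qed (rule ff, erule fC, rule ff, erule fC)
  also have "\<dots> = (\<Sum>(X, s)\<in>?C. G (X(i := s)) X)"
    by (intro sum.cong refl) (simp add: case_prod_beta)
  also have "\<dots> = (\<Sum>X\<in>configs N. \<Sum>s\<in>UNIV. G (X(i := s)) X)"
    by (rule sum.cartesian_product[symmetric])
  finally show ?thesis .
qed

text \<open>Resampling one site from its conditional law leaves the Gibbs measure invariant.\<close>

lemma gibbs_mean_resample:
  fixes f :: "(nat \<Rightarrow> 'q::finite) \<Rightarrow> real"
  assumes i: "i \<in> {1..N}"
  shows "gibbs_mean p b N f = gibbs_mean p b N (\<lambda>X. \<Sum>s\<in>UNIV. cond_weight p b N X i s * f (X(i := s)))"
proof -
  let ?w = "boltzmann_weight p b N"
  let ?D = "\<lambda>X. \<Sum>t\<in>UNIV. ?w (X(i := t))"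
  have D: "?D X > 0" for X :: "nat \<Rightarrow> 'q" by (intro sum_pos boltzmann_weight_pos) auto
  have "(\<Sum>X\<in>configs N. ?w X * (\<Sum>s\<in>UNIV. cond_weight p b N X i s * f (X(i := s))))
      = (\<Sum>X\<in>configs N. \<Sum>s\<in>UNIV. ?w X * (?w (X(i := s)) / ?D (X(i := s)) * f (X(i := s))))"
    by (simp add: cond_weight_def sum_distrib_left)
  also have "\<dots> = (\<Sum>X\<in>configs N. \<Sum>s\<in>UNIV. ?w (X(i := s)) * (?w X / ?D X * f X))"
    by (rule configs_swap_sum[OF i, of "\<lambda>X Y. ?w X * (?w Y / ?D Y * f Y)"])
  also have "\<dots> = (\<Sum>X\<in>configs N. ?w X * f X)"
  proof (intro sum.cong refl)
    fix X
    have "(\<Sum>s\<in>UNIV. ?w (X(i := s)) * (?w X / ?D X * f X)) = ?D X * (?w X / ?D X * f X)"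
      by (rule sum_distrib_right[symmetric])
    also have "\<dots> = ?w X * f X" using D[of X] by (simp add: less_imp_neq[symmetric])
    finally show "(\<Sum>s\<in>UNIV. ?w (X(i := s)) * (?w X / ?D X * f X)) = ?w X * f X" .
  qed
  finally show ?thesis by (simp add: gibbs_mean_def)
qed

text \<open>Resampling applied to \<open>g\<close> times the indicator of \<open>X i = r\<close>
  keeps only the outcome \<open>r\<close>. Subtracting \<open>g\<close> times the conditional weight
  leaves a discrete derivative of \<open>g\<close>.\<close>

lemma gibbs_mean_site:
  fixes g :: "(nat \<Rightarrow> 'q::finite) \<Rightarrow> real"
  assumes i: "i \<in> {1..N}"
  shows "gibbs_mean p b N (\<lambda>X. g X * (of_bool (X i = r) - cond_weight p b N X i r))
       = gibbs_mean p b N (\<lambda>X. cond_weight p b N X i r * (g (X(i := r)) - g X))"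
proof -
  have "gibbs_mean p b N (\<lambda>X. g X * of_bool (X i = r))
      = gibbs_mean p b N (\<lambda>X. \<Sum>s\<in>UNIV. cond_weight p b N X i s * (g (X(i := s)) * of_bool (s = r)))"
    by (subst gibbs_mean_resample[OF i]) simp
  also have "\<dots> = gibbs_mean p b N (\<lambda>X. cond_weight p b N X i r * g (X(i := r)))"
    by (simp add: of_bool_def if_distrib cong: if_cong)
  finally show ?thesis
    by (simp add: right_diff_distrib gibbs_mean_diff mult.commute)
qed

lemma gibbs_mean_exchange:
  fixes g :: "(nat \<Rightarrow> 'q::finite) \<Rightarrow> real"
  shows "gibbs_mean p b N (\<lambda>X. g X * (site_count N X r - (\<Sum>i\<in>{1..N}. cond_weight p b N X i r)))
       = gibbs_mean p b N (\<lambda>X. \<Sum>i\<in>{1..N}. cond_weight p b N X i r * (g (X(i := r)) - g X))"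
proof -
  have "gibbs_mean p b N (\<lambda>X. g X * (site_count N X r - (\<Sum>i\<in>{1..N}. cond_weight p b N X i r)))
      = gibbs_mean p b N (\<lambda>X. \<Sum>i\<in>{1..N}. g X * (of_bool (X i = r) - cond_weight p b N X i r))"
    unfolding site_count_def sum_subtractf[symmetric] sum_distrib_left ..
  also have "\<dots> = (\<Sum>i\<in>{1..N}. gibbs_mean p b N (\<lambda>X. g X * (of_bool (X i = r) - cond_weight p b N X i r)))"
    by (rule gibbs_mean_sum)
  also have "\<dots> = (\<Sum>i\<in>{1..N}. gibbs_mean p b N (\<lambda>X. cond_weight p b N X i r * (g (X(i := r)) - g X)))"
    by (rule sum.cong[OF refl], rule gibbs_mean_site)
  also have "\<dots> = gibbs_mean p b N (\<lambda>X. \<Sum>i\<in>{1..N}. cond_weight p b N X i r * (g (X(i := r)) - g X))"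
    by (rule gibbs_mean_sum[symmetric])
  finally show ?thesis .
qed

text \<open>Scaled so that adding a site whose colour \<open>k\<close> other sites already have
  multiplies the Boltzmann weight by \<open>exp (b * increment p N k)\<close>, relative to leaving
  the site out.\<close>

definition increment :: "nat \<Rightarrow> nat \<Rightarrow> nat \<Rightarrow> real" where
  "increment p N k = real N * (((real k + 1) / real N) ^ p - (real k / real N) ^ p)"

lemma energy_update:
  assumes "i \<in> {1..N}"
  shows "(\<Sum>r\<in>UNIV. (magnetization N (X(i := s)) $ r) ^ p)
     = (\<Sum>r\<in>UNIV. (real (rest_count N X i r) / real N) ^ p) + increment p N (rest_count N X i s) / real N"
proof -
  have "(\<Sum>r\<in>UNIV. (magnetization N (X(i := s)) $ r) ^ p)
      = (\<Sum>r\<in>UNIV. (real (rest_count N X i r) / real N) ^ p +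
          (if r = s then increment p N (rest_count N X i s) / real N else 0))"
  proof (intro sum.cong refl)
    fix r
    have sc: "site_count N (X(i := s)) r = real (rest_count N X i r) + of_bool (s = r)"
      using site_count_rest[OF assms, of "X(i := s)" r] by simp
    show "(magnetization N (X(i := s)) $ r) ^ p = (real (rest_count N X i r) / real N) ^ p +
          (if r = s then increment p N (rest_count N X i s) / real N else 0)"
    proof (cases "r = s")
      case True
      have "increment p N k / real N = ((real k + 1) / real N) ^ p - (real k / real N) ^ p" for k
        using assms by (simp add: increment_def)
      thus ?thesis unfolding magnetization_nth sc using True by simp
    next
      case False
      thus ?thesis by (simp add: magnetization_nth sc)
    qed
  qed
  also have "\<dots> = (\<Sum>r\<in>UNIV. (real (rest_count N X i r) / real N) ^ p)
      + (\<Sum>r\<in>UNIV. if r = s then increment p N (rest_count N X i s) / real N else 0)"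
    by (rule sum.distrib)
  also have "(\<Sum>r\<in>UNIV. if r = s then increment p N (rest_count N X i s) / real N else 0)
      = increment p N (rest_count N X i s) / real N"
    by (subst sum.delta) auto
  finally show ?thesis .
qed

text \<open>The energy of the other sites does not depend on the new colour and cancels in the
  normalisation.\<close>

lemma cond_weight_softmax:
  assumes i: "i \<in> {1..N}"
  shows "cond_weight p b N X i s = softmax (\<lambda>t. b * increment p N (rest_count N X i t)) s"
proof -
  define d where "d = b * real N * (\<Sum>r\<in>UNIV. (real (rest_count N X i r) / real N) ^ p)"
  have w: "boltzmann_weight p b N (X(i := t)) = exp (b * increment p N (rest_count N X i t) + d)" for t
  proof -
    have *: "b * real N * (A + x / real N) = b * x + b * real N * A" for A x
      using i by (simp add: distrib_left)
    show ?thesis by (simp only: boltzmann_weight_def energy_update[OF i] d_def *)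
  qed
  have "cond_weight p b N X i s = softmax (\<lambda>t. b * increment p N (rest_count N X i t) + d) s"
    unfolding cond_weight_def softmax_def w ..
  thus ?thesis by (simp only: softmax_shift)
qed

lemma increment_approx:
  assumes k: "k < N" and x: "x = real k / real N \<or> x = (real k + 1) / real N"
  shows "\<bar>increment p N k - real p * x ^ (p - 1)\<bar> \<le> (real p)\<^sup>2 / real N"
proof (cases "p = 0")
  case False
  have N: "real N > 0" using k by simp
  have lt: "real k / real N < (real k + 1) / real N" using N by (simp add: divide_strict_right_mono)
  have "\<exists>z>real k / real N. z < (real k + 1) / real N \<and> ((real k + 1) / real N) ^ p - (real k / real N) ^ p
     = ((real k + 1) / real N - real k / real N) * (real p * z ^ (p - 1))"
    using DERIV_pow[of p] by (intro MVT2[OF lt]) (simp add: One_nat_def)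
  then obtain z where z: "z > real k / real N" "z < (real k + 1) / real N"
     "((real k + 1) / real N) ^ p - (real k / real N) ^ p = (1 / real N) * (real p * z ^ (p - 1))"
    by (auto simp: diff_divide_distrib[symmetric])
  have inc: "increment p N k = real p * z ^ (p - 1)" unfolding increment_def z(3) using N by simp
  have k1: "(real k + 1) / real N \<le> 1" using k N by (simp add: divide_le_eq_1)
  have k0: "0 \<le> real k / real N" by simp
  have w: "(real k + 1) / real N = real k / real N + 1 / real N" by (simp add: add_divide_distrib)
  have zx: "\<bar>z - x\<bar> \<le> 1 / real N" using z x w by auto
  have "norm (z ^ (p - 1) - x ^ (p - 1)) \<le> real (p - 1) * norm (z - x)"
  proof (rule norm_power_diff)
    show "norm z \<le> 1" using z(1,2) k0 k1 unfolding real_norm_def by linarith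
    show "norm x \<le> 1" using x k0 k1 lt unfolding real_norm_def by linarith
  qed
  also have "\<dots> \<le> real p * (1 / real N)"
    unfolding real_norm_def by (rule mult_mono[OF _ zx]) simp_all
  finally have "\<bar>z ^ (p - 1) - x ^ (p - 1)\<bar> \<le> real p * (1 / real N)" by simp
  hence "real p * \<bar>z ^ (p - 1) - x ^ (p - 1)\<bar> \<le> real p * (real p * (1 / real N))" by (intro mult_left_mono) auto
  thus ?thesis unfolding inc right_diff_distrib[symmetric] abs_mult power2_eq_square by simp
qed (simp add: increment_def)

lemma increment_magnetization:
  assumes i: "i \<in> {1..N}"
  shows "\<bar>increment p N (rest_count N X i s) - real p * (magnetization N X $ s) ^ (p - 1)\<bar> \<le> (real p)\<^sup>2 / real N"
proof (rule increment_approx[OF rest_count_less[OF i]])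
  show "magnetization N X $ s = real (rest_count N X i s) / real N \<or>
        magnetization N X $ s = (real (rest_count N X i s) + 1) / real N"
    unfolding magnetization_nth site_count_rest[OF i] by auto
qed

lemma cond_weight_approx:
  assumes i: "i \<in> {1..N}"
  shows "\<bar>cond_weight p b N X i s - mean_field p b (magnetization N X) s\<bar> \<le> 4 * (\<bar>b\<bar> * (real p)\<^sup>2 / real N)"
  unfolding cond_weight_softmax[OF i] mean_field_def
proof (rule softmax_diff_le)
  fix t
  have "\<bar>b * increment p N (rest_count N X i t) - b * real p * magnetization N X $ t ^ (p - 1)\<bar>
      = \<bar>b\<bar> * \<bar>increment p N (rest_count N X i t) - real p * (magnetization N X $ t) ^ (p - 1)\<bar>"
    unfolding abs_mult[symmetric] right_diff_distrib mult.assoc ..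
  also have "\<dots> \<le> \<bar>b\<bar> * ((real p)\<^sup>2 / real N)"
    by (intro mult_left_mono increment_magnetization[OF i]) auto
  finally show "\<bar>b * increment p N (rest_count N X i t) - b * real p * magnetization N X $ t ^ (p - 1)\<bar>
      \<le> \<bar>b\<bar> * (real p)\<^sup>2 / real N" by simp
qed

lemma cond_weight_nonneg: "i \<in> {1..N} \<Longrightarrow> 0 \<le> cond_weight p b N X i s"
  by (simp add: cond_weight_softmax softmax_nonneg)

lemma cond_weight_le_1: "i \<in> {1..N} \<Longrightarrow> cond_weight p b N X i s \<le> 1"
  by (simp add: cond_weight_softmax softmax_le_1)

lemma sum_prod_configs:
  fixes f :: "'q::finite \<Rightarrow> real"
  shows "(\<Sum>X\<in>configs N. \<Prod>i\<in>{1..N}. f (X i)) = (\<Sum>r\<in>UNIV. f r) ^ N"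
proof -
  have "(\<Prod>i\<in>{1..N}. \<Sum>r\<in>UNIV. f r) = (\<Sum>X\<in>configs N. \<Prod>i\<in>{1..N}. f (X i))"
    unfolding configs_def by (rule prod_sum_PiE) auto
  thus ?thesis by simp
qed

text \<open>Under the product measure with marginal \<open>y\<close> all configurations of
  magnetization \<open>y\<close> have the same probability, namely \<open>exp\<close> of
  \<open>- N\<close> times the entropy of \<open>y\<close>, and the total is at most
  \<open>1\<close>. This bounds their number without Stirling's formula.\<close>

lemma sum_weights_same_magnetization:
  fixes y :: "real^'q::finite"
  assumes N: "N \<ge> 1"
  shows "(\<Sum>X\<in>{X \<in> configs N. magnetization N X = y}. boltzmann_weight p b N X) \<le> exp (real N * H p b y)"
proof (cases "{X \<in> configs N. magnetization N X = y} = {}")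
  case False
  let ?C = "{X \<in> configs N. magnetization N X = y}"
  from False obtain X0 where X0: "X0 \<in> configs N" "magnetization N X0 = y" by blast
  have y: "y \<in> prob_simplex" using magnetization_simplex[OF N, of X0] X0 by simp
  have pr: "(\<Prod>i\<in>{1..N}. y $ X i) = exp (real N * (\<Sum>r\<in>UNIV. y $ r * ln (y $ r)))" if X: "X \<in> ?C" for X
  proof -
    \<comment> \<open>Entries of \<open>y\<close> may vanish, but not those of colours that occur in
      \<open>X\<close>, so the logarithms below are genuine.\<close>
    have pos: "y $ X i > 0" if i: "i \<in> {1..N}" for i
    proof -
      have "site_count N X (X i) \<ge> 1" using site_count_rest[OF i, of X "X i"] by simp
      hence "magnetization N X $ X i > 0" using N by (simp add: magnetization_nth)
      thus ?thesis using X by simp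
    qed
    have "(\<Prod>i\<in>{1..N}. y $ X i) = exp (\<Sum>i\<in>{1..N}. ln (y $ X i))"
      using pos by (simp add: exp_sum)
    also have "(\<Sum>i\<in>{1..N}. ln (y $ X i)) = (\<Sum>r\<in>UNIV. site_count N X r * ln (y $ r))"
      by (rule sum_site_count[symmetric])
    also have "\<dots> = real N * (\<Sum>r\<in>UNIV. y $ r * ln (y $ r))"
    proof -
      have "site_count N X r = real N * y $ r" for r
        using X N magnetization_nth[of N X r] by simp
      thus ?thesis by (simp add: sum_distrib_left mult.assoc)
    qed
    finally show ?thesis .
  qed
  have "real (card ?C) * exp (real N * (\<Sum>r\<in>UNIV. y $ r * ln (y $ r))) = (\<Sum>X\<in>?C. \<Prod>i\<in>{1..N}. y $ X i)"
    by (subst sum.cong[OF refl pr]) auto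
  also have "\<dots> \<le> (\<Sum>X\<in>configs N. \<Prod>i\<in>{1..N}. y $ X i)"
    using y by (intro sum_mono2 prod_nonneg) (auto simp: prob_simplex_def)
  also have "\<dots> = 1" using y by (simp add: sum_prod_configs[of "\<lambda>r. y $ r"] prob_simplex_def)
  finally have card: "real (card ?C) * exp (real N * (\<Sum>r\<in>UNIV. y $ r * ln (y $ r))) \<le> 1" .
  have "(\<Sum>X\<in>?C. boltzmann_weight p b N X) = real (card ?C) * exp (b * real N * (\<Sum>r\<in>UNIV. (y $ r) ^ p))"
    by (simp add: boltzmann_weight_def)
  also have "\<dots> = (real (card ?C) * exp (real N * (\<Sum>r\<in>UNIV. y $ r * ln (y $ r)))) * exp (real N * H p b y)"
    by (simp add: H_def algebra_simps exp_add[symmetric])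
  also have "\<dots> \<le> 1 * exp (real N * H p b y)" using card by (intro mult_right_mono) auto
  finally show ?thesis by simp
next
  case True
  show ?thesis unfolding True by simp
qed

lemma card_magnetizations: "card (magnetization N ` (configs N :: (nat \<Rightarrow> 'q::finite) set)) \<le> (N + 1) ^ CARD('q)"
proof -
  let ?F = "\<lambda>k :: 'q \<Rightarrow> nat. (\<chi> r. real (k r) / real N) :: real^'q"
  have "magnetization N ` configs N \<subseteq> ?F ` (UNIV \<rightarrow>\<^sub>E {0..N})"
  proof
    fix y assume "y \<in> magnetization N ` (configs N :: (nat \<Rightarrow> 'q) set)"
    then obtain X :: "nat \<Rightarrow> 'q" where X: "y = magnetization N X" by auto
    let ?k = "\<lambda>r. card ({1..N} \<inter> {i. X i = r})"
    have "site_count N X r = real (?k r)" for r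
      unfolding site_count_def by (subst sum_of_bool_eq) auto
    hence "y = ?F ?k" by (simp add: X vec_eq_iff magnetization_nth)
    moreover have "?k r \<le> N" for r using card_mono[of "{1..N}" "{1..N} \<inter> {i. X i = r}"] by simp
    ultimately show "y \<in> ?F ` (UNIV \<rightarrow>\<^sub>E {0..N})" by (intro image_eqI[of _ _ ?k]) auto
  qed
  hence "card (magnetization N ` (configs N :: (nat \<Rightarrow> 'q) set)) \<le> card (?F ` (UNIV \<rightarrow>\<^sub>E {0..N}))"
    by (intro card_mono finite_imageI finite_PiE) auto
  also have "\<dots> \<le> card ((UNIV :: 'q set) \<rightarrow>\<^sub>E {0..N})" by (intro card_image_le finite_PiE) auto
  also have "\<dots> = (N + 1) ^ CARD('q)" by (simp add: card_PiE Suc_eq_plus1)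
  finally show ?thesis .
qed

context potts_peak
begin

lemma power_tangent: "x ^ p \<ge> t ^ p + real p * t ^ (p - 1) * (x - t)" if "x \<ge> 0" "t > 0" for x t :: real
proof -
  have "1 + real p * (x / t - 1) \<le> (1 + (x / t - 1)) ^ p"
    using that by (intro Bernoulli_inequality) simp
  hence "t ^ p * (1 + real p * (x / t - 1)) \<le> t ^ p * (x / t) ^ p" using that by (intro mult_left_mono) auto
  also have "t ^ p * (x / t) ^ p = x ^ p" using that by (simp add: power_divide)
  finally have "t ^ p * (1 + real p * (x / t - 1)) \<le> x ^ p" .
  moreover have "t * T * (1 + real p * (x / t - 1)) = t * T + real p * T * (x - t)" for T
    using that by (simp add: field_simps)
  ultimately show ?thesis by (simp only: pow_pred(2)[of t, symmetric])
qed

text \<open>Solving the critical equation for \<open>ln (m $ r)\<close> turns the entropy into a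
  multiple of the power sum \<open>E\<close>. The product measure in \<open>gibbs_total_ge\<close>
  produces just this exponent.\<close>

lemma H_peak: "H p \<beta> m = crit_fun p \<beta> a - \<beta> * (real p - 1) * E"
proof -
  have "m $ r * ln (m $ r) = \<beta> * real p * (m $ r) ^ p - crit_fun p \<beta> a * m $ r" for r
  proof -
    have "crit_fun p \<beta> (m $ r) = crit_fun p \<beta> a" using crit by (simp add: peak_nth)
    hence ln: "ln (m $ r) = \<beta> * real p * (m $ r) ^ (p - 1) - crit_fun p \<beta> a" by (simp add: crit_fun_def)
    have "m $ r * ln (m $ r) = \<beta> * real p * (m $ r * (m $ r) ^ (p - 1)) - crit_fun p \<beta> a * m $ r"
      unfolding ln by (simp add: algebra_simps)
    thus ?thesis by (simp only: pow_pred(2))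
  qed
  hence "(\<Sum>r\<in>UNIV. m $ r * ln (m $ r)) = \<beta> * real p * E - crit_fun p \<beta> a"
    by (simp add: sum_subtractf sum_distrib_left[symmetric] sum_m E_def)
  thus ?thesis by (simp add: H_def E_def[symmetric] algebra_simps)
qed

text \<open>Replacing each \<open>x\<^sup>p\<close> by its tangent at \<open>m\<close> turns the partition function into a product.\<close>

lemma gibbs_total_ge: "N \<ge> 1 \<Longrightarrow> exp (real N * H p \<beta> m) \<le> gibbs_total TYPE('q) p \<beta> N"
proof -
  assume N: "N \<ge> 1"
  define k where "k = - (\<beta> * (real p - 1) * E * real N)"
  have "(\<Sum>X\<in>configs N. exp k * (\<Prod>i\<in>{1..N}. exp (\<beta> * real p * (m $ X i) ^ (p - 1)))) \<le> gibbs_total TYPE('q) p \<beta> N"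
    unfolding gibbs_total_def
  proof (intro sum_mono)
    fix X :: "nat \<Rightarrow> 'q"
    let ?x = "magnetization N X"
    have nx: "real N * ?x $ r = site_count N X r" for r using N by (simp add: magnetization_nth)
    have "(\<Sum>r\<in>UNIV. (m $ r) ^ p + real p * (m $ r) ^ (p - 1) * (?x $ r - m $ r)) \<le> (\<Sum>r\<in>UNIV. (?x $ r) ^ p)"
      by (intro sum_mono power_tangent magnetization_nonneg m_pos)
    also have "(\<Sum>r\<in>UNIV. (m $ r) ^ p + real p * (m $ r) ^ (p - 1) * (?x $ r - m $ r))
        = (\<Sum>r\<in>UNIV. real p * ((m $ r) ^ (p - 1) * ?x $ r) - (real p - 1) * (m $ r) ^ p)"
      by (intro sum.cong refl) (simp add: pow_pred(2)[symmetric] algebra_simps)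
    also have "\<dots> = real p * (\<Sum>r\<in>UNIV. (m $ r) ^ (p - 1) * ?x $ r) - (real p - 1) * E"
      by (simp add: sum_subtractf sum_distrib_left E_def)
    finally have "\<beta> * real N * (real p * (\<Sum>r\<in>UNIV. (m $ r) ^ (p - 1) * ?x $ r) - (real p - 1) * E)
        \<le> \<beta> * real N * (\<Sum>r\<in>UNIV. (?x $ r) ^ p)"
      using beta_pos by (intro mult_left_mono) auto
    moreover have "real N * (\<Sum>r\<in>UNIV. (m $ r) ^ (p - 1) * ?x $ r) = (\<Sum>i\<in>{1..N}. (m $ X i) ^ (p - 1))"
      unfolding sum_site_count[of N X "\<lambda>r. (m $ r) ^ (p - 1)", symmetric] nx[symmetric] sum_distrib_left
      by (intro sum.cong refl) (simp add: mult_ac)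
    hence "\<beta> * real N * (real p * (\<Sum>r\<in>UNIV. (m $ r) ^ (p - 1) * ?x $ r) - (real p - 1) * E)
        = k + (\<Sum>i\<in>{1..N}. \<beta> * real p * (m $ X i) ^ (p - 1))"
      by (simp add: k_def sum_distrib_left[symmetric] algebra_simps)
    ultimately have "exp (k + (\<Sum>i\<in>{1..N}. \<beta> * real p * (m $ X i) ^ (p - 1))) \<le> boltzmann_weight p \<beta> N X"
      by (simp add: boltzmann_weight_def)
    thus "exp k * (\<Prod>i\<in>{1..N}. exp (\<beta> * real p * (m $ X i) ^ (p - 1))) \<le> boltzmann_weight p \<beta> N X"
      by (simp add: exp_add exp_sum)
  qed
  also have "(\<Sum>X\<in>configs N. exp k * (\<Prod>i\<in>{1..N}. exp (\<beta> * real p * (m $ X i) ^ (p - 1))))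
      = exp k * (\<Sum>r\<in>UNIV. exp (\<beta> * real p * (m $ r) ^ (p - 1))) ^ N"
    by (simp add: sum_distrib_left[symmetric] sum_prod_configs[of "\<lambda>r. exp (\<beta> * real p * (m $ r) ^ (p - 1))"])
  \<comment> \<open>By the fixed point equation the one-site sum is exactly
    \<open>exp (crit_fun p \<beta> a)\<close>, so not even a polynomial factor is lost against
    \<open>exp (real N * H p \<beta> m)\<close>.\<close>
  also have "(\<Sum>r\<in>UNIV. exp (\<beta> * real p * (m $ r) ^ (p - 1))) = exp (crit_fun p \<beta> a)"
    by (simp add: exp_field_m sum_distrib_right[symmetric] sum_m)
  also have "exp k * exp (crit_fun p \<beta> a) ^ N = exp (real N * H p \<beta> m)"
    by (simp add: exp_of_nat_mult[symmetric] exp_add[symmetric] H_peak k_def algebra_simps)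
  finally show ?thesis .
qed

text \<open>A magnetization \<open>y\<close> carries weight at most \<open>exp (N H(y))\<close>,
  there are at most \<open>(N + 1)^q\<close> magnetizations, and the total weight is at least
  \<open>exp (N H(m))\<close>.\<close>

lemma gibbs_concentration:
  fixes B :: "(real^'q) set"
  assumes N: "N \<ge> 1" and B: "\<And>x. x \<in> B \<Longrightarrow> x \<in> prob_simplex \<Longrightarrow> e \<le> H p \<beta> m - H p \<beta> x"
  shows "gibbs_mean p \<beta> N (\<lambda>X. of_bool (magnetization N X \<in> B)) \<le> (real N + 1) ^ CARD('q) * exp (- real N * e)"
proof -
  let ?w = "boltzmann_weight p \<beta> N :: (nat \<Rightarrow> 'q) \<Rightarrow> real"
  let ?T = "magnetization N ` configs N :: (real^'q) set"
  have "(\<Sum>X\<in>configs N. ?w X * of_bool (magnetization N X \<in> B))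
      = (\<Sum>y\<in>?T. \<Sum>X\<in>{X \<in> configs N. magnetization N X = y}. ?w X * of_bool (magnetization N X \<in> B))"
    by (rule sum.group[symmetric]) auto
  also have "\<dots> \<le> (\<Sum>y\<in>?T. exp (real N * H p \<beta> m - real N * e))"
  proof (intro sum_mono)
    fix y assume "y \<in> ?T"
    hence y: "y \<in> prob_simplex" using magnetization_simplex[OF N] by auto
    show "(\<Sum>X\<in>{X \<in> configs N. magnetization N X = y}. ?w X * of_bool (magnetization N X \<in> B))
        \<le> exp (real N * H p \<beta> m - real N * e)"
    proof (cases "y \<in> B")
      case True
      hence "(\<Sum>X\<in>{X \<in> configs N. magnetization N X = y}. ?w X * of_bool (magnetization N X \<in> B)) \<le> exp (real N * H p \<beta> y)"
        using sum_weights_same_magnetization[OF N, where y = y and p = p and b = \<beta>] by simp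
      also have "\<dots> \<le> exp (real N * H p \<beta> m - real N * e)"
      proof -
        have "real N * (e + H p \<beta> y) \<le> real N * H p \<beta> m" using B[OF True y] by (intro mult_left_mono) auto
        thus ?thesis by (simp add: algebra_simps)
      qed
      finally show ?thesis .
    qed simp
  qed
  also have "\<dots> = real (card ?T) * exp (real N * H p \<beta> m - real N * e)" by simp
  also have "\<dots> \<le> (real N + 1) ^ CARD('q) * exp (real N * H p \<beta> m - real N * e)"
  proof (rule mult_right_mono)
    have "real (card ?T) \<le> real ((N + 1) ^ CARD('q))" using card_magnetizations[where 'q = 'q, of N] by (simp only: of_nat_le_iff)
    thus "real (card ?T) \<le> (real N + 1) ^ CARD('q)" by (simp add: add.commute)
  qed simp
  also have "\<dots> = (real N + 1) ^ CARD('q) * exp (- real N * e) * exp (real N * H p \<beta> m)"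
    by (simp add: exp_add[symmetric])
  also have "\<dots> \<le> (real N + 1) ^ CARD('q) * exp (- real N * e) * gibbs_total TYPE('q) p \<beta> N"
    using gibbs_total_ge[OF N] by (intro mult_left_mono) auto
  finally show ?thesis
    unfolding gibbs_mean_def using gibbs_total_pos[where 'q = 'q, of p \<beta> N] by (simp add: divide_le_eq)
qed

end

section \<open>Stein's equation for the normal distribution\<close>

abbreviation Phi :: "real \<Rightarrow> real" where "Phi \<equiv> cdf std_normal_distribution"
abbreviation phi :: "real \<Rightarrow> real" where "phi \<equiv> std_normal_density"

interpretation std_normal: real_distribution std_normal_distribution
  by (rule real_dist_normal_dist)

lemma phi_pos: "phi x > 0" by (simp add: std_normal_density_def)

lemma phi_le_1: "phi x \<le> 1"
proof -
  have "exp (- x\<^sup>2 / 2) \<le> 1" by simp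
  moreover have "1 \<le> sqrt (2 * pi)" using pi_gt3 by simp
  ultimately have "1 / sqrt (2 * pi) * exp (- x\<^sup>2 / 2) \<le> 1 * 1"
    by (intro mult_mono) auto
  thus ?thesis by (simp add: std_normal_density_def)
qed

lemma phi_minus: "phi (- x) = phi x" by (simp add: std_normal_density_def)

lemma phi_deriv: "(phi has_real_derivative - x * phi x) (at x)"
proof -
  have "((\<lambda>x. (1 / sqrt (2 * pi)) * exp (- x\<^sup>2 / 2)) has_real_derivative (1 / sqrt (2 * pi)) * (exp (- x\<^sup>2 / 2) * (- x))) (at x)"
    by (intro DERIV_cmult DERIV_chain2[OF DERIV_exp]) (auto intro!: derivative_eq_intros)
  thus ?thesis unfolding std_normal_density_def[abs_def] by (simp add: mult_ac)
qed

lemma abs_mult_phi_le_1: "\<bar>x\<bar> * phi x \<le> 1"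
proof -
  have "\<bar>x\<bar> \<le> 1 + x\<^sup>2 / 2"
    using zero_le_power2[of "\<bar>x\<bar> - 1"] by (simp add: power2_diff)
  also have "\<dots> \<le> exp (x\<^sup>2 / 2)" by (rule exp_ge_add_one_self)
  finally have "\<bar>x\<bar> * exp (- (x\<^sup>2 / 2)) \<le> exp (x\<^sup>2 / 2) * exp (- (x\<^sup>2 / 2))" by (intro mult_right_mono) auto
  hence 1: "\<bar>x\<bar> * exp (- x\<^sup>2 / 2) \<le> 1" by (simp add: exp_add[symmetric])
  have "1 \<le> sqrt (2 * pi)" using pi_gt3 by simp
  hence "1 / sqrt (2 * pi) * (\<bar>x\<bar> * exp (- x\<^sup>2 / 2)) \<le> 1 * 1" using 1 by (intro mult_mono) auto
  thus ?thesis by (simp add: std_normal_density_def)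
qed

lemma continuous_on_phi: "continuous_on A phi"
  by (intro continuous_at_imp_continuous_on ballI DERIV_isCont[OF phi_deriv])

lemma Phi_diff:
  assumes "x < y"
  shows "Phi y - Phi x = integral {x..y} phi"
proof -
  have "Phi y - Phi x = measure std_normal_distribution {x<..y}"
    by (rule std_normal.cdf_diff_eq[OF assms])
  also have "\<dots> = (LINT t|std_normal_distribution. indicator {x<..y} t)" by simp
  also have "\<dots> = (LINT t|lborel. phi t *\<^sub>R indicator {x<..y} t)"
    by (rule integral_density) (auto simp: phi_pos less_imp_le)
  also have "\<dots> = (LINT t:{x<..y}|lborel. phi t)"
    by (simp add: set_lebesgue_integral_def mult.commute)
  also have "\<dots> = integral {x<..y} phi"
  proof (rule set_borel_integral_eq_integral)
    show "set_integrable lborel {x<..y} phi"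
      unfolding set_integrable_def by (intro integrable_mult_indicator) auto
  qed
  also have "\<dots> = integral {x..y} phi"
  proof (rule integral_spike_set)
    show "negligible {t \<in> {x<..y} - {x..y}. phi t \<noteq> 0}" by (rule negligible_subset[of "{}"]) auto
    show "negligible {t \<in> {x..y} - {x<..y}. phi t \<noteq> 0}" by (rule negligible_subset[of "{x}"]) auto
  qed
  finally show ?thesis .
qed

lemma Phi_deriv: "(Phi has_real_derivative phi x) (at x)"
proof -
  have "((\<lambda>y. integral {x - 1..y} phi) has_real_derivative phi x) (at x within {x - 1..x + 1})"
    by (rule integral_has_real_derivative[OF continuous_on_phi]) auto
  hence "((\<lambda>y. Phi (x - 1) + integral {x - 1..y} phi) has_real_derivative phi x) (at x within {x - 1..x + 1})"
    by (auto intro!: derivative_eq_intros)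
  hence "((\<lambda>y. Phi (x - 1) + integral {x - 1..y} phi) has_real_derivative phi x) (at x)"
    by (subst (asm) at_within_interior) auto
  moreover have "\<forall>\<^sub>F y in nhds x. Phi (x - 1) + integral {x - 1..y} phi = Phi y"
  proof -
    have "\<forall>\<^sub>F y in nhds x. y > x - 1" by (rule eventually_gt_at_top[THEN filter_leD[rotated]] order_tendstoD(1)[OF filterlim_ident])+ simp
    thus ?thesis
    proof eventually_elim
      case (elim y)
      thus ?case using Phi_diff[of "x - 1" y] by simp
    qed
  qed
  ultimately show ?thesis by (rule DERIV_cong_ev[OF refl _ refl, THEN iffD1, rotated])
qed

lemma Phi_bounds: "0 \<le> Phi x" "Phi x \<le> 1"
  by (rule std_normal.cdf_nonneg, rule std_normal.cdf_bounded_prob)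

lemma Phi_mono: "x \<le> y \<Longrightarrow> Phi x \<le> Phi y"
  by (rule std_normal.cdf_nondecreasing)

text \<open>\<open>Phi y + Phi (- y)\<close> has derivative zero because \<open>phi\<close> is even,
  and its limit at infinity is \<open>1\<close>.\<close>

lemma Phi_minus: "Phi (- x) = 1 - Phi x"
proof -
  have d: "((\<lambda>y. Phi y + Phi (- y)) has_real_derivative 0) (at y)" for y
  proof -
    have "((\<lambda>y. Phi y + Phi (- y)) has_real_derivative phi y + phi (- y) * (- 1)) (at y)"
      by (intro DERIV_add Phi_deriv DERIV_chain2[of Phi "phi (- y)"] ) (auto intro!: derivative_eq_intros)
    thus ?thesis by (simp add: phi_minus)
  qed
  have c: "(\<lambda>y. Phi y + Phi (- y)) = (\<lambda>_. Phi x + Phi (- x))"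
  proof
    fix y show "Phi y + Phi (- y) = Phi x + Phi (- x)"
      using DERIV_isconst_all[of "\<lambda>y. Phi y + Phi (- y)" y x] d by simp
  qed
  have "((\<lambda>y. Phi y + Phi (- y)) \<longlongrightarrow> 1 + 0) at_top"
    by (intro tendsto_add std_normal.cdf_lim_at_top_prob
        filterlim_compose[OF std_normal.cdf_lim_at_bot filterlim_uminus_at_bot_at_top])
  hence "((\<lambda>y::real. Phi x + Phi (- x)) \<longlongrightarrow> 1) at_top" unfolding c by simp
  hence "Phi x + Phi (- x) = 1" by (simp add: tendsto_const_iff)
  thus ?thesis by simp
qed

text \<open>The right side minus the left has derivative \<open>- phi t / t\<^sup>2\<close> and
  tends to \<open>0\<close>; being decreasing, it cannot start at a negative value.\<close>

lemma normal_tail_le: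
  assumes "y > 0"
  shows "1 - Phi y \<le> phi y / y"
proof (rule ccontr)
  define \<psi> where "\<psi> t = phi t / t - (1 - Phi t)" for t
  assume "\<not> ?thesis"
  hence neg: "\<psi> y < 0" by (simp add: \<psi>_def)
  have d: "(\<psi> has_real_derivative - phi t / t\<^sup>2) (at t)" if "t > 0" for t
  proof -
    have "(\<psi> has_real_derivative ((- t * phi t) * t - phi t * 1) / (t * t) - (0 - phi t)) (at t)"
      unfolding \<psi>_def[abs_def]
      by (intro DERIV_diff DERIV_divide phi_deriv Phi_deriv DERIV_const DERIV_ident) (use that in auto)
    moreover have "((- t * phi t) * t - phi t * 1) / (t * t) - (0 - phi t) = - phi t / t\<^sup>2"
      using that by (simp add: field_simps power2_eq_square)
    ultimately show ?thesis by simp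
  qed
  have le: "\<psi> t \<le> \<psi> y" if "t \<ge> y" for t
  proof (rule DERIV_nonpos_imp_nonincreasing[OF that])
    fix u assume "y \<le> u" "u \<le> t"
    hence "u > 0" using assms by simp
    thus "\<exists>z. (\<psi> has_real_derivative z) (at u) \<and> z \<le> 0"
      using d[of u] phi_pos[of u] by (intro exI[of _ "- phi u / u\<^sup>2"]) (simp add: divide_le_0_iff less_imp_le)
  qed
  have l1: "((\<lambda>t. phi t / t) \<longlongrightarrow> 0) at_top"
  proof (rule Lim_null_comparison)
    show "\<forall>\<^sub>F t in at_top. norm (phi t / t) \<le> 1 / t"
      using eventually_gt_at_top[of 0]
    proof eventually_elim
      case (elim t)
      thus ?case using phi_le_1[of t] phi_pos[of t] by (simp add: divide_right_mono)
    qed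
    show "((\<lambda>t::real. 1 / t) \<longlongrightarrow> 0) at_top"
      using tendsto_inverse_0_at_top[OF filterlim_ident] by (simp add: inverse_eq_divide)
  qed
  have "(\<psi> \<longlongrightarrow> 0 - (1 - 1)) at_top"
    unfolding \<psi>_def[abs_def] by (intro tendsto_diff l1 tendsto_const std_normal.cdf_lim_at_top_prob)
  hence "(\<psi> \<longlongrightarrow> 0) at_top" by simp
  moreover have "\<forall>\<^sub>F t in at_top. \<psi> t \<le> \<psi> y"
    using eventually_ge_at_top[of y] by eventually_elim (rule le)
  ultimately have "0 \<le> \<psi> y" by (rule tendsto_upperbound) simp
  thus False using neg by simp
qed

lemma Phi_lipschitz: "\<bar>Phi x - Phi y\<bar> \<le> \<bar>x - y\<bar>"
proof -
  have "norm (Phi x - Phi y) \<le> 1 * norm (x - y)"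
    by (rule field_differentiable_bound[of UNIV Phi phi])
       (auto intro: Phi_deriv simp: phi_le_1 abs_of_pos phi_pos)
  thus ?thesis by simp
qed

text \<open>The derivative of \<open>Phi (x * u)\<close> in \<open>u\<close> is
  \<open>x * phi (x * u)\<close>. Because \<open>\<bar>x * u\<bar> * phi (x * u) \<le> 1\<close>, it
  is at most \<open>1 / u\<close> in absolute value whatever \<open>x\<close> is, which makes the
  bound uniform in \<open>x\<close>.\<close>

lemma Phi_scale:
  assumes "0 < s" "0 < t"
  shows "\<bar>Phi (x * s) - Phi (x * t)\<bar> \<le> \<bar>s - t\<bar> / min s t"
proof -
  have "norm (Phi (x * s) - Phi (x * t)) \<le> (1 / min s t) * norm (s - t)"
  proof (rule field_differentiable_bound[where S = "{min s t..max s t}" and f = "\<lambda>u. Phi (x * u)" and f' = "\<lambda>u. phi (x * u) * x"])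
    fix u assume u: "u \<in> {min s t..max s t}"
    hence u0: "u > 0" "u \<ge> min s t" using assms by auto
    show "((\<lambda>u. Phi (x * u)) has_field_derivative phi (x * u) * x) (at u within {min s t..max s t})"
      by (rule has_field_derivative_at_within, rule DERIV_chain2[OF Phi_deriv]) (auto intro!: derivative_eq_intros)
    have "\<bar>x * u\<bar> * phi (x * u) \<le> 1" by (rule abs_mult_phi_le_1)
    hence "(\<bar>x\<bar> * phi (x * u)) * u \<le> 1"
      using u0 unfolding abs_mult by (simp add: mult_ac)
    hence "\<bar>x\<bar> * phi (x * u) \<le> 1 / u" using u0 by (simp only: pos_le_divide_eq)
    hence "norm (phi (x * u) * x) \<le> 1 / u"
      unfolding real_norm_def abs_mult using phi_pos[of "x * u"] by (simp add: mult.commute)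
    also have "\<dots> \<le> 1 / min s t" using u0 assms by (intro divide_left_mono) auto
    finally show "norm (phi (x * u) * x) \<le> 1 / min s t" .
  qed auto
  thus ?thesis by simp
qed

text \<open>The reflection \<open>mills (- y)\<close> is the classical Mills ratio. The function
  solves \<open>f' = 1 + y f\<close>, so its multiples solve Stein's equation on a
  half-line.\<close>

definition mills :: "real \<Rightarrow> real" where "mills y = Phi y / phi y"

lemma mills_nonneg: "0 \<le> mills y"
  using phi_pos[of y] Phi_bounds[of y] by (simp add: mills_def)

lemma mills_deriv: "(mills has_real_derivative 1 + y * mills y) (at y)"
proof -
  have "(mills has_real_derivative (phi y * phi y - Phi y * (- y * phi y)) / (phi y * phi y)) (at y)"
    unfolding mills_def[abs_def]
    by (intro DERIV_divide Phi_deriv phi_deriv) (use phi_pos[of y] in auto)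
  moreover have "(phi y * phi y - Phi y * (- y * phi y)) / (phi y * phi y) = 1 + y * mills y"
    using phi_pos[of y] by (simp add: mills_def field_simps)
  ultimately show ?thesis by simp
qed

lemma mills_bounds:
  assumes "y \<le> 0"
  shows "mills y \<le> 1 + 1 / phi 1" "\<bar>y\<bar> * mills y \<le> 1"
proof -
  have *: "mills y \<le> 1 / \<bar>y\<bar>" if "y < 0" for y
  proof -
    have "Phi y \<le> phi y / \<bar>y\<bar>"
      using normal_tail_le[of "- y"] that by (simp add: Phi_minus phi_minus)
    thus ?thesis using phi_pos[of y] that by (simp add: mills_def field_simps)
  qed
  show "\<bar>y\<bar> * mills y \<le> 1"
    using *[of y] assms by (cases "y = 0") (simp_all add: field_simps)
  show "mills y \<le> 1 + 1 / phi 1"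
  proof (cases "y < -1")
    case True
    have "mills y \<le> 1 / \<bar>y\<bar>" using * True by simp
    also have "\<dots> \<le> 1 / 1" using True by (intro divide_left_mono) auto
    finally show ?thesis using phi_pos[of 1] by (simp add: add_increasing2)
  next
    case False
    have "y\<^sup>2 \<le> 1\<^sup>2" using False assms by (subst abs_le_square_iff[symmetric]) auto
    hence "phi 1 \<le> phi y" by (simp add: std_normal_density_def divide_right_mono)
    hence "mills y \<le> 1 / phi 1"
      unfolding mills_def using Phi_bounds[of y] phi_pos[of 1] by (intro frac_le) auto
    thus ?thesis by simp
  qed
qed

text \<open>The differential equation itself shows how fast the derivative
  \<open>t * g t + k\<close> varies: \<open>t * g t\<close> has derivative
  \<open>g t + t * g' t\<close>, where \<open>g\<close> is bounded by \<open>C\<close>,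
  \<open>g'\<close> by \<open>2\<close>, and \<open>\<bar>t\<bar>\<close> by
  \<open>\<bar>y\<bar> + h\<close>.\<close>

lemma stein_piece:
  fixes g :: "real \<Rightarrow> real"
  assumes h: "h \<ge> 0"
    and der: "\<And>t. y \<le> t \<Longrightarrow> t \<le> y + h \<Longrightarrow> (g has_real_derivative t * g t + k) (at t)"
    and B: "\<And>t. y \<le> t \<Longrightarrow> t \<le> y + h \<Longrightarrow> \<bar>g t\<bar> \<le> C"
    and D: "\<And>t. y \<le> t \<Longrightarrow> t \<le> y + h \<Longrightarrow> \<bar>t * g t + k\<bar> \<le> 2"
  shows "\<bar>g (y + h) - g y\<bar> \<le> 2 * h"
    and "\<bar>g (y + h) - g y - h * (y * g y + k)\<bar> \<le> h\<^sup>2 * (C + 2 * \<bar>y\<bar> + 2 * h)"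
proof -
  show "\<bar>g (y + h) - g y\<bar> \<le> 2 * h"
  proof -
    have "norm (g (y + h) - g y) \<le> 2 * norm ((y + h) - y)"
    proof (rule field_differentiable_bound[where S = "{y..y + h}" and f = g and f' = "\<lambda>t. t * g t + k"])
      fix t assume t: "t \<in> {y..y + h}"
      show "(g has_field_derivative t * g t + k) (at t within {y..y + h})"
        by (rule has_field_derivative_at_within[OF der]) (use t in auto)
      show "norm (t * g t + k) \<le> 2" using D[of t] t by simp
    qed (use h in auto)
    thus ?thesis using h by simp
  qed
  let ?M = "C + 2 * \<bar>y\<bar> + 2 * h"
  have w: "\<bar>t * g t - y * g y\<bar> \<le> ?M * h" if t: "y \<le> t" "t \<le> y + h" for t
  proof -
    have "norm (t * g t - y * g y) \<le> ?M * norm (t - y)"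
    proof (rule field_differentiable_bound[where S = "{y..y + h}" and f = "\<lambda>t. t * g t" and f' = "\<lambda>t. 1 * g t + (t * g t + k) * t"])
      fix u assume u: "u \<in> {y..y + h}"
      show "((\<lambda>t. t * g t) has_field_derivative 1 * g u + (u * g u + k) * u) (at u within {y..y + h})"
        by (rule has_field_derivative_at_within, rule DERIV_mult[OF DERIV_ident der]) (use u in auto)
      have "\<bar>(u * g u + k) * u\<bar> \<le> 2 * (\<bar>y\<bar> + h)"
        unfolding abs_mult by (rule mult_mono[OF D]) (use u in auto)
      moreover have "\<bar>g u\<bar> \<le> C" using B[of u] u by simp
      ultimately show "norm (1 * g u + (u * g u + k) * u) \<le> ?M"
        unfolding real_norm_def using abs_triangle_ineq[of "1 * g u" "(u * g u + k) * u"] by simp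
    qed (use t h in auto)
    also have "\<dots> \<le> ?M * h" using t h B[of y] by (intro mult_left_mono) auto
    finally show ?thesis by simp
  qed
  have "norm ((g (y + h) - (y * g y + k) * (y + h)) - (g y - (y * g y + k) * y)) \<le> (?M * h) * norm ((y + h) - y)"
  proof (rule field_differentiable_bound[where S = "{y..y + h}" and f = "\<lambda>t. g t - (y * g y + k) * t" and f' = "\<lambda>t. t * g t + k - (y * g y + k) * 1"])
    fix u assume u: "u \<in> {y..y + h}"
    show "((\<lambda>t. g t - (y * g y + k) * t) has_field_derivative u * g u + k - (y * g y + k) * 1) (at u within {y..y + h})"
      by (rule has_field_derivative_at_within, rule DERIV_diff[OF der DERIV_cmult[OF DERIV_ident]]) (use u in auto)
    show "norm (u * g u + k - (y * g y + k) * 1) \<le> ?M * h" using w[of u] u by simp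
  qed (use h in auto)
  moreover have "(g (y + h) - (y * g y + k) * (y + h)) - (g y - (y * g y + k) * y) = g (y + h) - g y - h * (y * g y + k)"
    by (simp add: algebra_simps)
  moreover have "(?M * h) * norm ((y + h) - y) = h\<^sup>2 * ?M"
    using h by (simp add: power2_eq_square mult_ac)
  ultimately show "\<bar>g (y + h) - g y - h * (y * g y + k)\<bar> \<le> h\<^sup>2 * ?M" by (simp only: real_norm_def)
qed

text \<open>The bounded solution of \<open>f' y = y * f y + of_bool (y \<le> z) - Phi z\<close> away
  from \<open>z\<close>. It is continuous, with a corner at \<open>z\<close>.\<close>

definition stein_sol :: "real \<Rightarrow> real \<Rightarrow> real" where
  "stein_sol z y = (if y \<le> z then (1 - Phi z) * mills y else Phi z * mills (- y))"

definition stein_C :: real where "stein_C = 1 + 1 / phi 1"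

lemma stein_C_ge_1: "stein_C \<ge> 1" using phi_pos[of 1] by (simp add: stein_C_def)

text \<open>For positive \<open>y\<close> the growth of \<open>mills\<close> is compensated by
  \<open>1 - Phi z \<le> 1 - Phi y\<close>. In all cases the product is at most
  \<open>mills (- \<bar>y\<bar>)\<close>, which \<open>mills_bounds\<close> controls.\<close>

lemma stein_left_bounds:
  assumes "y \<le> z"
  shows "\<bar>(1 - Phi z) * mills y\<bar> \<le> stein_C" "\<bar>y * ((1 - Phi z) * mills y)\<bar> \<le> 1"
proof -
  have nn: "0 \<le> (1 - Phi z) * mills y" using Phi_bounds mills_nonneg by simp
  have le: "(1 - Phi z) * mills y \<le> mills (- \<bar>y\<bar>)"
  proof (cases "y \<le> 0")
    case True
    have "(1 - Phi z) * mills y \<le> 1 * mills y" using Phi_bounds[of z] mills_nonneg by (intro mult_right_mono) auto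
    thus ?thesis using True by simp
  next
    case False
    have "(1 - Phi z) * mills y = ((1 - Phi z) * Phi y) / phi y" by (simp add: mills_def)
    also have "\<dots> \<le> ((1 - Phi y) * 1) / phi y"
      using Phi_bounds Phi_mono[OF assms] phi_pos[of y] by (intro divide_right_mono mult_mono) auto
    also have "\<dots> = mills (- y)" by (simp add: mills_def Phi_minus phi_minus)
    finally show ?thesis using False by simp
  qed
  show "\<bar>(1 - Phi z) * mills y\<bar> \<le> stein_C"
    using le nn mills_bounds(1)[of "- \<bar>y\<bar>"] by (simp add: stein_C_def)
  have "\<bar>y\<bar> * ((1 - Phi z) * mills y) \<le> \<bar>y\<bar> * mills (- \<bar>y\<bar>)" using le by (intro mult_left_mono) auto
  thus "\<bar>y * ((1 - Phi z) * mills y)\<bar> \<le> 1"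
    using nn mills_bounds(2)[of "- \<bar>y\<bar>"] by (simp only: abs_mult[of y] abs_of_nonneg[OF nn]) simp
qed

lemma stein_right_bounds:
  assumes "z \<le> y"
  shows "\<bar>Phi z * mills (- y)\<bar> \<le> stein_C" "\<bar>y * (Phi z * mills (- y))\<bar> \<le> 1"
  using stein_left_bounds[of "- y" "- z"] assms by (simp_all add: Phi_minus)

lemma stein_sol_bounds: "\<bar>stein_sol z y\<bar> \<le> stein_C" "\<bar>y * stein_sol z y\<bar> \<le> 1"
  using stein_left_bounds[of y z] stein_right_bounds[of z y] by (auto simp: stein_sol_def)

text \<open>The step stays on one side of the corner, so it involves a single smooth branch. A step
  that starts at \<open>z\<close> itself uses the right branch, which is why the indicator is the
  strict one.\<close>

lemma stein_sol_step:
  assumes h: "0 \<le> h" and yz: "y + h \<le> z \<or> z \<le> y" and h0: "y < z \<Longrightarrow> y + h \<le> z"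
  shows "\<bar>stein_sol z (y + h) - stein_sol z y\<bar> \<le> 2 * h"
    and "\<bar>stein_sol z (y + h) - stein_sol z y - h * (y * stein_sol z y + of_bool (y < z) - Phi z)\<bar>
        \<le> h\<^sup>2 * (stein_C + 2 * \<bar>y\<bar> + 2 * h)"
proof -
  note Pb = Phi_bounds[of z]
  have "\<bar>stein_sol z (y + h) - stein_sol z y\<bar> \<le> 2 * h \<and>
     \<bar>stein_sol z (y + h) - stein_sol z y - h * (y * stein_sol z y + of_bool (y < z) - Phi z)\<bar>
        \<le> h\<^sup>2 * (stein_C + 2 * \<bar>y\<bar> + 2 * h)"
  proof (cases "y < z")
    case True
    let ?g = "\<lambda>t. (1 - Phi z) * mills t"
    have der: "(?g has_real_derivative t * ?g t + (1 - Phi z)) (at t)" for t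
      using DERIV_cmult[OF mills_deriv[of t], of "1 - Phi z"] by (simp add: algebra_simps)
    have D: "\<bar>t * ?g t + (1 - Phi z)\<bar> \<le> 2" if "t \<le> z" for t
      using stein_left_bounds(2)[OF that] Pb by linarith
    have yh: "y + h \<le> z" using h0 True by simp
    have e: "stein_sol z y = ?g y" "stein_sol z (y + h) = ?g (y + h)" using yh h by (auto simp: stein_sol_def)
    have t: "t \<le> z" if "t \<le> y + h" for t using that yh by simp
    show ?thesis unfolding e
      using stein_piece[OF h der stein_left_bounds(1)[OF t] D[OF t]] True by (simp add: add_diff_eq)
  next
    case False
    let ?g = "\<lambda>t. Phi z * mills (- t)"
    have der: "(?g has_real_derivative t * ?g t + - Phi z) (at t)" for t
    proof -
      have "((\<lambda>t. mills (- t)) has_real_derivative (1 + (- t) * mills (- t)) * (- 1)) (at t)"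
        by (rule DERIV_chain2[OF mills_deriv]) (auto intro!: derivative_eq_intros)
      from DERIV_cmult[OF this, of "Phi z"] show ?thesis by (simp add: algebra_simps)
    qed
    have D: "\<bar>t * ?g t + - Phi z\<bar> \<le> 2" if "z \<le> t" for t
      using stein_right_bounds(2)[OF that] Pb by linarith
    \<comment> \<open>At \<open>z\<close> both branches have the value
      \<open>Phi z * (1 - Phi z) / phi z\<close>.\<close>
    have zg: "stein_sol z t = ?g t" if "z \<le> t" for t
    proof (cases "t = z")
      case True
      thus ?thesis by (simp add: stein_sol_def mills_def Phi_minus phi_minus)
    qed (use that in \<open>simp add: stein_sol_def\<close>)
    have e: "stein_sol z y = ?g y" "stein_sol z (y + h) = ?g (y + h)" using zg False h by auto
    have t: "z \<le> t" if "y \<le> t" for t using that False by simp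
    show ?thesis unfolding e
      using stein_piece[OF h der stein_right_bounds(1)[OF t] D[OF t]] False by simp
  qed
  thus "\<bar>stein_sol z (y + h) - stein_sol z y\<bar> \<le> 2 * h"
    and "\<bar>stein_sol z (y + h) - stein_sol z y - h * (y * stein_sol z y + of_bool (y < z) - Phi z)\<bar>
        \<le> h\<^sup>2 * (stein_C + 2 * \<bar>y\<bar> + 2 * h)" by auto
qed

section \<open>Fluctuations of the magnetization near a peak\<close>

text \<open>The inequality \<open>x \<le> exp x\<close> at \<open>x = N \<eta> / j\<close> is raised
  to the power \<open>j = q + 4\<close>; after the factor \<open>(N + 1)^q\<close> four powers of
  \<open>N\<close> remain.\<close>

lemma exp_decay_poly:
  fixes \<eta> :: real and q :: nat
  assumes "\<eta> > 0"
  obtains C where "C \<ge> 0" "\<And>N. N \<ge> 1 \<Longrightarrow> (real N + 1) ^ q * exp (- real N * \<eta>) \<le> C / real N ^ 4"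
proof -
  define j where "j = q + 4"
  have j: "real j > 0" by (simp add: j_def)
  define C where "C = 2 ^ q * (real j / \<eta>) ^ j"
  show ?thesis
  proof (rule that[of C])
    show "C \<ge> 0" using assms by (simp add: C_def)
    fix N :: nat assume N: "N \<ge> 1"
    have n: "real N \<ge> 1" using N by simp
    have "real N * \<eta> / real j \<le> exp (real N * \<eta> / real j)"
      using exp_ge_add_one_self[of "real N * \<eta> / real j"] by linarith
    hence "(real N * \<eta> / real j) ^ j \<le> exp (real N * \<eta> / real j) ^ j"
      using assms by (intro power_mono) auto
    also have "\<dots> = exp (real N * \<eta>)" using j by (simp add: exp_of_nat_mult[symmetric])
    finally have 1: "(real N * \<eta> / real j) ^ j \<le> exp (real N * \<eta>)" .
    have p: "(real N * \<eta> / real j) ^ j > 0" using n assms j by simp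
    have "exp (- real N * \<eta>) = inverse (exp (real N * \<eta>))" by (simp add: exp_minus)
    also have "\<dots> \<le> inverse ((real N * \<eta> / real j) ^ j)" using 1 p by (intro le_imp_inverse_le)
    also have "\<dots> = (real j / \<eta>) ^ j / real N ^ j"
      by (simp add: power_divide power_mult_distrib inverse_eq_divide)
    finally have 2: "exp (- real N * \<eta>) \<le> (real j / \<eta>) ^ j / real N ^ j" .
    have "(real N + 1) ^ q \<le> (2 * real N) ^ q" using n by (intro power_mono) auto
    hence "(real N + 1) ^ q * exp (- real N * \<eta>) \<le> (2 * real N) ^ q * ((real j / \<eta>) ^ j / real N ^ j)"
      using 2 by (intro mult_mono) auto
    also have "\<dots> = C / real N ^ 4"
      using n by (simp add: C_def j_def power_mult_distrib power_add)
    finally show "(real N + 1) ^ q * exp (- real N * \<eta>) \<le> C / real N ^ 4" .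
  qed
qed

lemma gibbs_mean_diff_le:
  fixes f g :: "(nat \<Rightarrow> 'q::finite) \<Rightarrow> real"
  assumes "\<And>X. X \<in> configs N \<Longrightarrow> \<bar>f X - g X\<bar> \<le> k X"
  shows "\<bar>gibbs_mean p b N f - gibbs_mean p b N g\<bar> \<le> gibbs_mean p b N k"
  unfolding gibbs_mean_diff[symmetric] by (rule gibbs_mean_abs_le[OF assms])

lemma magnetization_update_norm:
  assumes i: "i \<in> {1..N}"
  shows "norm (magnetization N (X(i := s)) - magnetization N X) \<le> 2 / real N"
proof -
  have "magnetization N (X(i := s)) - magnetization N X = (1 / real N) *\<^sub>R (axis s 1 - axis (X i) 1)"
    by (auto simp: vec_eq_iff magnetization_nth site_count_update[OF i] axis_def diff_divide_distrib[symmetric])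
  also have "norm \<dots> = (1 / real N) * norm (axis s 1 - axis (X i) 1 :: real^'a)" by simp
  also have "\<dots> \<le> (1 / real N) * 2"
  proof (rule mult_left_mono)
    have "norm (axis s 1 - axis (X i) 1 :: real^'a) \<le> norm (axis s 1 :: real^'a) + norm (axis (X i) 1 :: real^'a)"
      by (rule norm_triangle_ineq4)
    thus "norm (axis s 1 - axis (X i) 1 :: real^'a) \<le> 2" by simp
  qed simp
  finally show ?thesis by simp
qed

locale potts_ball = potts_peak p \<beta> a b c
  for p :: nat and \<beta> a b :: real and c :: "'q::finite" +
  fixes \<epsilon> :: real
  assumes eps_pos: "\<epsilon> > 0"
    and finite_maximizers: "finite (maximizers p \<beta> :: (real^'q) set)"
    and eps_less: "\<And>t. t \<in> maximizers p \<beta> \<Longrightarrow> t \<noteq> peak a b c \<Longrightarrow> \<epsilon> < dist (peak a b c) t"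
begin

abbreviation gm :: "nat \<Rightarrow> ((nat \<Rightarrow> 'q) \<Rightarrow> real) \<Rightarrow> real" where
  "gm N f \<equiv> gibbs_mean p \<beta> N f"

definition V :: "nat \<Rightarrow> (nat \<Rightarrow> 'q) \<Rightarrow> real^'q" where
  "V N X = magnetization N X - m"

definition chi :: "nat \<Rightarrow> (nat \<Rightarrow> 'q) \<Rightarrow> real" where
  "chi N X = of_bool (magnetization N X \<in> ball m \<epsilon>)"

lemma chi_01: "chi N X = 0 \<or> chi N X = 1" by (simp add: chi_def)
lemma chi_nonneg: "0 \<le> chi N X" by (simp add: chi_def)
lemma chi_le_1: "chi N X \<le> 1" by (simp add: chi_def)
lemma chi_eq: "chi N X = of_bool (norm (V N X) < \<epsilon>)"
  by (simp add: chi_def V_def dist_norm norm_minus_commute)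

lemma norm_V_le: "N \<ge> 1 \<Longrightarrow> norm (V N X) \<le> 2"
  unfolding V_def by (rule norm_simplex_diff_le[OF magnetization_simplex m_simplex])

lemma abs_V_nth_le: "\<bar>V N X $ r\<bar> \<le> norm (V N X)" by (rule component_le_norm_cart)

lemma sum_V: "N \<ge> 1 \<Longrightarrow> (\<Sum>r\<in>UNIV. V N X $ r) = 0"
  using magnetization_simplex[of N X] sum_m by (simp add: V_def sum_subtractf prob_simplex_def)

text \<open>The other maximizers are finitely many and lie strictly beyond
  \<open>\<epsilon>\<close>, so \<open>m\<close> is the only one in a slightly larger ball too. The
  margin \<open>\<delta>\<close> is needed because a single update may carry the magnetization
  across the boundary of the ball.\<close>

lemma H_quadratic_ball:
  obtains \<kappa> \<delta> where "\<kappa> > 0" "\<delta> > 0"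
    "\<And>x. x \<in> prob_simplex \<Longrightarrow> norm (x - m) \<le> \<epsilon> + \<delta> \<Longrightarrow> \<kappa> * (norm (x - m))\<^sup>2 \<le> H p \<beta> m - H p \<beta> x"
proof -
  let ?D = "dist m ` (maximizers p \<beta> - {m})"
  define \<delta> where "\<delta> = (Min (insert (\<epsilon> + 1) ?D) - \<epsilon>) / 2"
  have fin: "finite (insert (\<epsilon> + 1) ?D)" using finite_maximizers by simp
  have "Min (insert (\<epsilon> + 1) ?D) > \<epsilon>" using fin eps_less by (subst Min_gr_iff) auto
  hence d: "\<delta> > 0" "\<epsilon> + \<delta> < Min (insert (\<epsilon> + 1) ?D)" by (auto simp: \<delta>_def field_simps)
  let ?T = "prob_simplex \<inter> cball m (\<epsilon> + \<delta>)"
  have "compact ?T" by (intro compact_Int compact_prob_simplex compact_cball)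
  moreover have "x = m" if "x \<in> ?T" "x \<in> maximizers p \<beta>" for x
  proof (rule ccontr)
    assume "x \<noteq> m"
    hence "dist m x \<in> insert (\<epsilon> + 1) ?D" using that by auto
    hence "Min (insert (\<epsilon> + 1) ?D) \<le> dist m x" using fin by (rule Min_le[rotated])
    thus False using d that by auto
  qed
  ultimately obtain \<kappa> where k: "\<kappa> > 0" "\<And>x. x \<in> ?T \<Longrightarrow> \<kappa> * (norm (x - m))\<^sup>2 \<le> H p \<beta> m - H p \<beta> x"
    using H_quadratic_on[of ?T] by (metis inf_le1)
  show ?thesis by (rule that[OF k(1) d(1)]) (use k(2) in \<open>auto simp: dist_norm norm_minus_commute\<close>)
qed

lemma annulus_tail:
  assumes t: "t > 0"
  obtains \<delta> C where "\<delta> > 0" "C \<ge> 0"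
    "\<And>N. N \<ge> 1 \<Longrightarrow> gm N (\<lambda>X. of_bool (t \<le> norm (V N X) \<and> norm (V N X) \<le> \<epsilon> + \<delta>)) \<le> C / real N ^ 4"
proof -
  obtain \<kappa> \<delta> where k: "\<kappa> > 0" "\<delta> > 0"
    "\<And>x. x \<in> prob_simplex \<Longrightarrow> norm (x - m) \<le> \<epsilon> + \<delta> \<Longrightarrow> \<kappa> * (norm (x - m))\<^sup>2 \<le> H p \<beta> m - H p \<beta> x"
    using H_quadratic_ball by blast
  have "\<kappa> * t\<^sup>2 > 0" using k t by simp
  then obtain C where C: "C \<ge> 0" "\<And>N. N \<ge> 1 \<Longrightarrow> (real N + 1) ^ CARD('q) * exp (- real N * (\<kappa> * t\<^sup>2)) \<le> C / real N ^ 4"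
    using exp_decay_poly by blast
  let ?B = "{x. t \<le> norm (x - m) \<and> norm (x - m) \<le> \<epsilon> + \<delta>}"
  show ?thesis
  proof (rule that[OF k(2) C(1)])
    fix N :: nat assume N: "N \<ge> 1"
    have "gm N (\<lambda>X. of_bool (magnetization N X \<in> ?B)) \<le> (real N + 1) ^ CARD('q) * exp (- real N * (\<kappa> * t\<^sup>2))"
    proof (rule gibbs_concentration[OF N])
      fix x assume x: "x \<in> ?B" "x \<in> prob_simplex"
      have "t\<^sup>2 \<le> (norm (x - m))\<^sup>2" using x t by (intro power_mono) auto
      hence "\<kappa> * t\<^sup>2 \<le> \<kappa> * (norm (x - m))\<^sup>2" using k by (intro mult_left_mono) auto
      thus "\<kappa> * t\<^sup>2 \<le> H p \<beta> m - H p \<beta> x" using k(3)[of x] x by auto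
    qed
    thus "gm N (\<lambda>X. of_bool (t \<le> norm (V N X) \<and> norm (V N X) \<le> \<epsilon> + \<delta>)) \<le> C / real N ^ 4"
      using C(2)[OF N] by (simp add: V_def)
  qed
qed

lemma inner_tail:
  assumes t: "t > 0"
  obtains C where "C \<ge> 0" "\<And>N. N \<ge> 1 \<Longrightarrow> gm N (\<lambda>X. chi N X * of_bool (t \<le> norm (V N X))) \<le> C / real N ^ 4"
proof -
  obtain \<delta> C where d: "\<delta> > 0" "C \<ge> 0"
    "\<And>N. N \<ge> 1 \<Longrightarrow> gm N (\<lambda>X. of_bool (t \<le> norm (V N X) \<and> norm (V N X) \<le> \<epsilon> + \<delta>)) \<le> C / real N ^ 4"
    using annulus_tail[OF t] by blast
  show ?thesis
  proof (rule that[OF d(2)])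
    fix N :: nat assume N: "N \<ge> 1"
    have "gm N (\<lambda>X. chi N X * of_bool (t \<le> norm (V N X))) \<le> gm N (\<lambda>X. of_bool (t \<le> norm (V N X) \<and> norm (V N X) \<le> \<epsilon> + \<delta>))"
      by (rule gibbs_mean_mono) (use d(1) in \<open>auto simp: chi_eq\<close>)
    thus "gm N (\<lambda>X. chi N X * of_bool (t \<le> norm (V N X))) \<le> C / real N ^ 4" using d(3)[OF N] by linarith
  qed
qed

text \<open>\<open>K = (q + 2) / \<kappa>\<close> makes the exponential equal to
  \<open>1 / N^(q + 2)\<close>: \<open>q\<close> powers pay for the number of magnetizations and two
  are left.\<close>

lemma log_scale_tail:
  obtains K C where "K > 0" "C \<ge> 0"
    "\<And>N. N \<ge> 1 \<Longrightarrow> gm N (\<lambda>X. chi N X * of_bool (K * ln (real N) / real N \<le> (norm (V N X))\<^sup>2)) \<le> C / (real N)\<^sup>2"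
proof -
  obtain \<kappa> \<delta> where k: "\<kappa> > 0" "\<delta> > 0"
    "\<And>x. x \<in> prob_simplex \<Longrightarrow> norm (x - m) \<le> \<epsilon> + \<delta> \<Longrightarrow> \<kappa> * (norm (x - m))\<^sup>2 \<le> H p \<beta> m - H p \<beta> x"
    using H_quadratic_ball by blast
  define q where "q = CARD('q)"
  define K where "K = (real q + 2) / \<kappa>"
  have K: "K > 0" "\<kappa> * K = real (q + 2)" using k by (auto simp: K_def add_nonneg_pos)
  show ?thesis
  proof (rule that[of K "2 ^ q"])
    fix N :: nat assume N: "N \<ge> 1"
    have n: "real N \<ge> 1" using N by simp
    let ?e = "\<kappa> * (K * ln (real N) / real N)"
    let ?B = "{x. K * ln (real N) / real N \<le> (norm (x - m))\<^sup>2 \<and> norm (x - m) < \<epsilon>}"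
    have "gm N (\<lambda>X. of_bool (magnetization N X \<in> ?B)) \<le> (real N + 1) ^ q * exp (- real N * ?e)"
      unfolding q_def
    proof (rule gibbs_concentration[OF N])
      fix x assume x: "x \<in> ?B" "x \<in> prob_simplex"
      have "?e \<le> \<kappa> * (norm (x - m))\<^sup>2" using x k by (intro mult_left_mono) auto
      thus "?e \<le> H p \<beta> m - H p \<beta> x" using k(2) k(3)[of x] x by auto
    qed
    also have "exp (- real N * ?e) = 1 / real N ^ (q + 2)"
    proof -
      have "- real N * ?e = - ((\<kappa> * K) * ln (real N))" using n by simp
      also have "\<dots> = - (real (q + 2) * ln (real N))" by (simp only: K(2))
      also have "exp \<dots> = inverse (exp (ln (real N)) ^ (q + 2))"
        by (simp only: exp_minus exp_of_nat_mult)
      finally show ?thesis using n by (simp add: inverse_eq_divide)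
    qed
    also have "(real N + 1) ^ q * (1 / real N ^ (q + 2)) \<le> (2 * real N) ^ q * (1 / real N ^ (q + 2))"
      using n by (intro mult_right_mono power_mono) auto
    also have "\<dots> = 2 ^ q / (real N)\<^sup>2" using n by (simp add: power_mult_distrib power_add power2_eq_square)
    finally have "gm N (\<lambda>X. of_bool (magnetization N X \<in> ?B)) \<le> 2 ^ q / (real N)\<^sup>2" .
    moreover have "gm N (\<lambda>X. chi N X * of_bool (K * ln (real N) / real N \<le> (norm (V N X))\<^sup>2)) = gm N (\<lambda>X. of_bool (magnetization N X \<in> ?B))"
      by (rule gibbs_mean_cong) (auto simp: chi_eq V_def)
    ultimately show "gm N (\<lambda>X. chi N X * of_bool (K * ln (real N) / real N \<le> (norm (V N X))\<^sup>2)) \<le> 2 ^ q / (real N)\<^sup>2"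
      by simp
  qed (use K in auto)
qed

definition W :: "nat \<Rightarrow> (nat \<Rightarrow> 'q) \<Rightarrow> 'q \<Rightarrow> real" where
  "W N X r = (\<Sum>i\<in>{1..N}. cond_weight p \<beta> N X i r)"

text \<open>The exchange identity for a test function cut off at the boundary of the ball, where the measure is negligible.\<close>

lemma local_exchange:
  obtains C where "C \<ge> 0"
    "\<And>N g B r. N \<ge> 1 \<Longrightarrow> \<forall>X\<in>configs N. \<bar>g X\<bar> \<le> B \<Longrightarrow>
      \<bar>gm N (\<lambda>X. chi N X * (g X * (site_count N X r - W N X r)))
       - gm N (\<lambda>X. chi N X * (\<Sum>i\<in>{1..N}. cond_weight p \<beta> N X i r * (g (X(i := r)) - g X)))\<bar> \<le> C * B / real N ^ 3"
proof -
  obtain \<delta>0 C0 where d0: "\<delta>0 > 0" "C0 \<ge> 0"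
    "\<And>N. N \<ge> 1 \<Longrightarrow> gm N (\<lambda>X. of_bool (\<epsilon> / 2 \<le> norm (V N X) \<and> norm (V N X) \<le> \<epsilon> + \<delta>0)) \<le> C0 / real N ^ 4"
    using annulus_tail[of "\<epsilon> / 2"] eps_pos by auto
  define \<delta> where "\<delta> = min \<delta>0 (\<epsilon> / 2)"
  have \<delta>: "\<delta> > 0" using d0 eps_pos by (simp add: \<delta>_def)
  \<comment> \<open>\<open>C0\<close> serves when an update moves the magnetization by at most
    \<open>\<delta>\<close>. The other term makes the bound trivial for the finitely many
    \<open>N < 2 / \<delta>\<close>.\<close>
  define C where "C = C0 + (2 / \<delta>) ^ 4"
  show ?thesis
  proof (rule that[of C])
    show "C \<ge> 0" using d0 \<delta> by (simp add: C_def)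
    fix N :: nat and g :: "(nat \<Rightarrow> 'q) \<Rightarrow> real" and B :: real and r :: 'q
    assume N: "N \<ge> 1" and gB': "\<forall>X\<in>configs N. \<bar>g X\<bar> \<le> B"
    hence gB: "\<bar>g X\<bar> \<le> B" if "X \<in> configs N" for X using that by blast
    have n: "real N \<ge> 1" using N by simp
    obtain X0 where "X0 \<in> (configs N :: (nat \<Rightarrow> 'q) set)" using configs_nonempty by blast
    hence B: "B \<ge> 0" using gB[of X0] by linarith
    let ?S = "\<lambda>X. if 2 / real N \<le> \<delta> then of_bool (\<epsilon> / 2 \<le> norm (V N X) \<and> norm (V N X) \<le> \<epsilon> + \<delta>0) else 1 :: real"
    have step: "\<bar>(\<Sum>i\<in>{1..N}. cond_weight p \<beta> N X i r * (chi N (X(i := r)) * g (X(i := r)) - chi N X * g X))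
        - chi N X * (\<Sum>i\<in>{1..N}. cond_weight p \<beta> N X i r * (g (X(i := r)) - g X))\<bar> \<le> real N * (B * ?S X)"
      if X: "X \<in> configs N" for X
    proof -
      have eq: "(\<Sum>i\<in>{1..N}. cond_weight p \<beta> N X i r * (chi N (X(i := r)) * g (X(i := r)) - chi N X * g X))
        - chi N X * (\<Sum>i\<in>{1..N}. cond_weight p \<beta> N X i r * (g (X(i := r)) - g X))
        = (\<Sum>i\<in>{1..N}. cond_weight p \<beta> N X i r * ((chi N (X(i := r)) - chi N X) * g (X(i := r))))"
        unfolding sum_distrib_left sum_subtractf[symmetric] by (intro sum.cong refl) (simp add: algebra_simps)
      have "\<bar>\<Sum>i\<in>{1..N}. cond_weight p \<beta> N X i r * ((chi N (X(i := r)) - chi N X) * g (X(i := r)))\<bar> \<le> (\<Sum>i\<in>{1..N}. \<bar>cond_weight p \<beta> N X i r * ((chi N (X(i := r)) - chi N X) * g (X(i := r)))\<bar>)"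
        by (rule sum_abs)
      also have "\<dots> \<le> (\<Sum>i\<in>{1..N}. 1 * (?S X * B))"
      proof (intro sum_mono)
        fix i assume i: "i \<in> {1..N}"
        have S0: "?S X \<ge> 0" by simp
        have "\<bar>chi N (X(i := r)) - chi N X\<bar> \<le> ?S X"
        proof (cases "2 / real N \<le> \<delta>")
          case True
          have V: "\<bar>norm (V N (X(i := r))) - norm (V N X)\<bar> \<le> \<delta>"
          proof -
            have "\<bar>norm (V N (X(i := r))) - norm (V N X)\<bar> \<le> norm (V N (X(i := r)) - V N X)"
              by (rule norm_triangle_ineq3)
            also have "\<dots> \<le> 2 / real N"
              using magnetization_update_norm[OF i, of X r] by (simp add: V_def)
            finally show ?thesis using True by linarith
          qed
          have d: "\<delta> \<le> \<delta>0" "\<delta> \<le> \<epsilon> / 2" by (simp_all add: \<delta>_def)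
          \<comment> \<open>The cutoff can change only for a magnetization in the annulus, whose
            probability is \<open>O(1 / N ^ 4)\<close>; the sum over the sites then costs one power
            of \<open>N\<close>.\<close>
          have "chi N (X(i := r)) = chi N X \<or> (\<epsilon> / 2 \<le> norm (V N X) \<and> norm (V N X) \<le> \<epsilon> + \<delta>0)"
          proof (rule ccontr)
            assume n: "\<not> ?thesis"
            hence "norm (V N X) < \<epsilon> / 2 \<or> norm (V N X) > \<epsilon> + \<delta>0" by linarith
            hence "(norm (V N (X(i := r))) < \<epsilon>) = (norm (V N X) < \<epsilon>)" using V d d0(1) eps_pos by linarith
            thus False using n by (simp add: chi_eq)
          qed
          thus ?thesis using True chi_01[of N X] chi_01[of N "X(i := r)"] by auto
        next
          case False
          thus ?thesis using chi_01[of N X] chi_01[of N "X(i := r)"] by auto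
        qed
        moreover have "\<bar>g (X(i := r))\<bar> \<le> B" by (rule gB[OF configs_update[OF X i]])
        ultimately have "\<bar>(chi N (X(i := r)) - chi N X) * g (X(i := r))\<bar> \<le> ?S X * B"
          unfolding abs_mult using S0 by (intro mult_mono) auto
        moreover have "\<bar>cond_weight p \<beta> N X i r\<bar> \<le> 1"
          using cond_weight_nonneg[OF i, of p \<beta> X r] cond_weight_le_1[OF i, of p \<beta> X r] by simp
        ultimately show "\<bar>cond_weight p \<beta> N X i r * ((chi N (X(i := r)) - chi N X) * g (X(i := r)))\<bar> \<le> 1 * (?S X * B)"
          unfolding abs_mult[of "cond_weight p \<beta> N X i r"] by (intro mult_mono) auto
      qed
      also have "\<dots> = real N * (B * ?S X)" by simp
      finally show ?thesis unfolding eq .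
    qed
    have "gm N (\<lambda>X. chi N X * (g X * (site_count N X r - W N X r)))
        = gm N (\<lambda>X. (chi N X * g X) * (site_count N X r - (\<Sum>i\<in>{1..N}. cond_weight p \<beta> N X i r)))"
      by (simp add: W_def mult.assoc)
    also have "\<dots> = gm N (\<lambda>X. \<Sum>i\<in>{1..N}. cond_weight p \<beta> N X i r * (chi N (X(i := r)) * g (X(i := r)) - chi N X * g X))"
      by (rule gibbs_mean_exchange)
    finally have "\<bar>gm N (\<lambda>X. chi N X * (g X * (site_count N X r - W N X r)))
       - gm N (\<lambda>X. chi N X * (\<Sum>i\<in>{1..N}. cond_weight p \<beta> N X i r * (g (X(i := r)) - g X)))\<bar> \<le> gm N (\<lambda>X. real N * (B * ?S X))"
      using gibbs_mean_diff_le[OF step, where p = p and b = \<beta>] by simp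
    also have "\<dots> = real N * (B * gm N ?S)" by (simp only: gibbs_mean_cmult)
    also have "\<dots> \<le> real N * (B * (C / real N ^ 4))"
    proof (intro mult_left_mono)
      show "gm N ?S \<le> C / real N ^ 4"
      proof (cases "2 / real N \<le> \<delta>")
        case True
        have "gm N ?S \<le> C0 / real N ^ 4" using d0(3)[OF N] True by simp
        also have "\<dots> \<le> C / real N ^ 4" using \<delta> by (intro divide_right_mono) (auto simp: C_def)
        finally show ?thesis .
      next
        case False
        hence "real N < 2 / \<delta>" using \<delta> n by (simp add: field_simps)
        hence "real N ^ 4 \<le> (2 / \<delta>) ^ 4" by (intro power_mono) auto
        hence "real N ^ 4 \<le> C" using d0 by (simp add: C_def)
        hence "1 \<le> C / real N ^ 4" using n by (simp add: pos_le_divide_eq)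
        thus ?thesis using False by (simp add: gibbs_mean_const)
      qed
    qed (use B in auto)
    also have "\<dots> = C * B / real N ^ 3" using n by (simp add: power4_eq_xxxx power3_eq_cube)
    finally show "\<bar>gm N (\<lambda>X. chi N X * (g X * (site_count N X r - W N X r)))
       - gm N (\<lambda>X. chi N X * (\<Sum>i\<in>{1..N}. cond_weight p \<beta> N X i r * (g (X(i := r)) - g X)))\<bar> \<le> C * B / real N ^ 3" .
  qed
qed

lemma W_approx:
  assumes N: "N \<ge> 1"
  shows "\<bar>W N X r - real N * mean_field p \<beta> (magnetization N X) r\<bar> \<le> 4 * \<beta> * (real p)\<^sup>2"
proof -
  have eq: "W N X r - real N * mean_field p \<beta> (magnetization N X) r
      = (\<Sum>i\<in>{1..N}. cond_weight p \<beta> N X i r - mean_field p \<beta> (magnetization N X) r)"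
    by (simp add: W_def sum_subtractf)
  have "\<bar>\<Sum>i\<in>{1..N}. cond_weight p \<beta> N X i r - mean_field p \<beta> (magnetization N X) r\<bar> \<le> (\<Sum>i\<in>{1..N}. 4 * (\<bar>\<beta>\<bar> * (real p)\<^sup>2 / real N))"
    by (rule order_trans[OF sum_abs sum_mono[OF cond_weight_approx]])
  also have "\<dots> = 4 * \<beta> * (real p)\<^sup>2" using N beta_pos by simp
  finally show ?thesis unfolding eq .
qed

text \<open>Each of the \<open>N\<close> conditional weights differs from the mean-field weight by
  \<open>O(1 / N)\<close>, in total \<open>O(1)\<close>. The quadratic remainder of the mean-field
  map contributes the multiple of \<open>N (norm V)\<^sup>2\<close>.\<close>

lemma drift_count_approx:
  obtains C where "C \<ge> 0" "\<And>N X r. N \<ge> 1 \<Longrightarrow>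
    \<bar>(site_count N X r - W N X r) - real N * drift r (V N X)\<bar> \<le> C * (real N * (norm (V N X))\<^sup>2 + 1)"
proof -
  obtain D where D: "D \<ge> 0" "\<And>x r. x \<in> prob_simplex \<Longrightarrow>
    \<bar>(x $ r - mean_field p \<beta> x r) - drift r (x - m)\<bar> \<le> D * (norm (x - m))\<^sup>2"
    using drift_approx by blast
  define A where "A = 4 * \<beta> * (real p)\<^sup>2"
  have A: "A \<ge> 0" using beta_pos by (simp add: A_def)
  show ?thesis
  proof (rule that[of "D + A"])
    show "D + A \<ge> 0" using D A by simp
    fix N :: nat and X :: "nat \<Rightarrow> 'q" and r assume N: "N \<ge> 1"
    let ?x = "magnetization N X" and ?v = "V N X"
    have "\<bar>real N * ((?x $ r - mean_field p \<beta> ?x r) - drift r ?v)\<bar> \<le> real N * (D * (norm ?v)\<^sup>2)"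
      unfolding abs_mult V_def using D(2)[OF magnetization_simplex[OF N], of X r] by (simp add: mult_left_mono)
    moreover have "site_count N X r = real N * ?x $ r" using N by (simp add: magnetization_nth)
    hence "(site_count N X r - W N X r) - real N * drift r ?v
       = real N * ((?x $ r - mean_field p \<beta> ?x r) - drift r ?v) - (W N X r - real N * mean_field p \<beta> ?x r)"
      by (simp add: algebra_simps)
    ultimately have "\<bar>(site_count N X r - W N X r) - real N * drift r ?v\<bar> \<le> real N * (D * (norm ?v)\<^sup>2) + A"
      using W_approx[OF N, of X r] unfolding A_def[symmetric] by linarith
    moreover have "A * 1 \<le> A * (real N * (norm ?v)\<^sup>2 + 1)" using A by (intro mult_left_mono) auto
    ultimately show "\<bar>(site_count N X r - W N X r) - real N * drift r ?v\<bar> \<le> (D + A) * (real N * (norm ?v)\<^sup>2 + 1)"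
      using D(1) by (simp add: algebra_simps)
  qed
qed

lemma V_update:
  assumes i: "i \<in> {1..N}"
  shows "V N (X(i := r)) $ r - V N X $ r = of_bool (X i \<noteq> r) / real N"
proof -
  have "V N (X(i := r)) $ r - V N X $ r = (site_count N (X(i := r)) r - site_count N X r) / real N"
    by (simp add: V_def magnetization_nth diff_divide_distrib)
  also have "site_count N (X(i := r)) r - site_count N X r = of_bool (X i \<noteq> r)"
    unfolding site_count_update[OF i] by simp
  finally show ?thesis .
qed

text \<open>The test functions \<open>V $ r\<close> with weights \<open>1 / m $ r\<close> turn the
  drift into a coercive form, while an update changes \<open>V $ r\<close> by at most
  \<open>1 / N\<close>, so that the other side of the exchange identity is bounded. The cubic
  remainder is absorbed: where \<open>norm V < t\<close> it is a small multiple of the moment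
  itself, and elsewhere the probability is \<open>O(1 / N ^ 4)\<close>.\<close>

lemma second_moment_bound:
  obtains C where "C \<ge> 0" "\<And>N. N \<ge> 1 \<Longrightarrow> gm N (\<lambda>X. chi N X * (real N * (norm (V N X))\<^sup>2)) \<le> C"
proof -
  obtain C1 where C1: "C1 \<ge> 0" "\<And>N g B r. N \<ge> 1 \<Longrightarrow> \<forall>X\<in>configs N. \<bar>g X\<bar> \<le> B \<Longrightarrow>
      \<bar>gm N (\<lambda>X. chi N X * (g X * (site_count N X r - W N X r)))
       - gm N (\<lambda>X. chi N X * (\<Sum>i\<in>{1..N}. cond_weight p \<beta> N X i r * (g (X(i := r)) - g X)))\<bar> \<le> C1 * B / real N ^ 3"
    by (rule local_exchange) (rule that)
  obtain C2 where C2: "C2 \<ge> 0" "\<And>N X r. N \<ge> 1 \<Longrightarrow>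
    \<bar>(site_count N X r - W N X r) - real N * drift r (V N X)\<bar> \<le> C2 * (real N * (norm (V N X))\<^sup>2 + 1)"
    by (rule drift_count_approx) (rule that)
  obtain \<kappa> where k: "\<kappa> > 0" "\<And>v. (\<Sum>r\<in>UNIV. v $ r) = 0 \<Longrightarrow> \<kappa> * (norm v)\<^sup>2 \<le> (\<Sum>r\<in>UNIV. curv r * (v $ r)\<^sup>2)"
    by (rule curv_form_lower) (rule that)
  define M where "M = (\<Sum>r\<in>UNIV. 1 / m $ r)"
  have M: "M \<ge> 0" unfolding M_def using m_pos by (intro sum_nonneg) (simp add: less_imp_le)
  \<comment> \<open>Small enough for \<open>M * C2 * t \<le> \<kappa> / 2\<close>, which leaves half
    of the coercivity.\<close>
  define t where "t = \<kappa> / (2 * (M * C2 + 1))"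
  have MC: "M * C2 \<ge> 0" using M C2 by simp
  have t: "t > 0" "M * C2 * t \<le> \<kappa> / 2"
    using k MC by (auto simp: t_def field_simps)
  obtain C3 where C3: "C3 \<ge> 0" "\<And>N. N \<ge> 1 \<Longrightarrow> gm N (\<lambda>X. chi N X * of_bool (t \<le> norm (V N X))) \<le> C3 / real N ^ 4"
    by (rule inner_tail[OF t(1)]) (rule that)
  define C where "C = (2 / \<kappa>) * (M * (1 + 2 * C1) + M * C2 * (8 * C3 + 2))"
  show ?thesis
  proof (rule that[of C])
    show "C \<ge> 0" using k M MC C1 C3 by (simp add: C_def)
    fix N :: nat assume N: "N \<ge> 1"
    have n: "real N \<ge> 1" using N by simp
    let ?U = "gm N (\<lambda>X. chi N X * (real N * (norm (V N X))\<^sup>2))"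
    let ?R = "gm N (\<lambda>X. chi N X * (norm (V N X) * (C2 * (real N * (norm (V N X))\<^sup>2 + 1))))"
    have each: "gm N (\<lambda>X. chi N X * (V N X $ r * (real N * drift r (V N X)))) \<le> 1 + 2 * C1 + ?R" for r
    proof -
      have "\<bar>V N X $ r\<bar> \<le> 2" for X using abs_V_nth_le norm_V_le[OF N] by (rule order_trans)
      hence "\<forall>X\<in>configs N. \<bar>V N X $ r\<bar> \<le> 2" by blast
      note ex = C1(2)[OF N this, of r]
      have "gm N (\<lambda>X. chi N X * (\<Sum>i\<in>{1..N}. cond_weight p \<beta> N X i r * (V N (X(i := r)) $ r - V N X $ r))) \<le> gm N (\<lambda>X. 1)"
      proof (rule gibbs_mean_mono)
        fix X :: "nat \<Rightarrow> 'q"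
        have "(\<Sum>i\<in>{1..N}. cond_weight p \<beta> N X i r * (V N (X(i := r)) $ r - V N X $ r)) \<le> (\<Sum>i\<in>{1..N}. 1 * (1 / real N))"
        proof (intro sum_mono mult_mono)
          fix i assume i: "i \<in> {1..N}"
          show "V N (X(i := r)) $ r - V N X $ r \<le> 1 / real N" "0 \<le> V N (X(i := r)) $ r - V N X $ r"
            unfolding V_update[OF i] by simp_all
        qed (auto intro: cond_weight_le_1)
        hence "(\<Sum>i\<in>{1..N}. cond_weight p \<beta> N X i r * (V N (X(i := r)) $ r - V N X $ r)) \<le> 1" using n by simp
        thus "chi N X * (\<Sum>i\<in>{1..N}. cond_weight p \<beta> N X i r * (V N (X(i := r)) $ r - V N X $ r)) \<le> 1"
          using chi_01[of N X] by auto
      qed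
      hence 1: "gm N (\<lambda>X. chi N X * (V N X $ r * (site_count N X r - W N X r))) \<le> 1 + C1 * 2 / real N ^ 3"
        using ex by (simp add: gibbs_mean_const)
      have 2: "\<bar>gm N (\<lambda>X. chi N X * (V N X $ r * (site_count N X r - W N X r)))
          - gm N (\<lambda>X. chi N X * (V N X $ r * (real N * drift r (V N X))))\<bar> \<le> ?R"
      proof (rule gibbs_mean_diff_le)
        fix X :: "nat \<Rightarrow> 'q"
        have "\<bar>V N X $ r * ((site_count N X r - W N X r) - real N * drift r (V N X))\<bar>
            \<le> norm (V N X) * (C2 * (real N * (norm (V N X))\<^sup>2 + 1))"
          unfolding abs_mult[of "V N X $ r"] using abs_V_nth_le C2(2)[OF N] by (intro mult_mono) auto
        thus "\<bar>chi N X * (V N X $ r * (site_count N X r - W N X r)) - chi N X * (V N X $ r * (real N * drift r (V N X)))\<bar>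
            \<le> chi N X * (norm (V N X) * (C2 * (real N * (norm (V N X))\<^sup>2 + 1)))"
          using chi_01[of N X] by (auto simp: right_diff_distrib)
      qed
      have "C1 * 2 / real N ^ 3 \<le> C1 * 2" using C1 n by (simp add: divide_le_eq_1 mult_left_le one_le_power divide_le_eq mult_le_cancel_left1)
      thus ?thesis using 1 2 by linarith
    qed
    have "\<kappa> * ?U \<le> gm N (\<lambda>X. chi N X * (real N * (\<Sum>r\<in>UNIV. curv r * (V N X $ r)\<^sup>2)))"
      unfolding gibbs_mean_cmult[symmetric]
    proof (rule gibbs_mean_mono)
      fix X :: "nat \<Rightarrow> 'q"
      have "chi N X * real N * (\<kappa> * (norm (V N X))\<^sup>2) \<le> chi N X * real N * (\<Sum>r\<in>UNIV. curv r * (V N X $ r)\<^sup>2)"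
        using chi_nonneg[of N X] k(2)[OF sum_V[OF N]] by (intro mult_left_mono) auto
      thus "\<kappa> * (chi N X * (real N * (norm (V N X))\<^sup>2)) \<le> chi N X * (real N * (\<Sum>r\<in>UNIV. curv r * (V N X $ r)\<^sup>2))"
        by (simp add: mult_ac)
    qed
    also have "\<dots> = gm N (\<lambda>X. \<Sum>r\<in>UNIV. (1 / m $ r) * (chi N X * (V N X $ r * (real N * drift r (V N X)))))"
    proof (rule gibbs_mean_cong)
      fix X :: "nat \<Rightarrow> 'q"
      show "chi N X * (real N * (\<Sum>r\<in>UNIV. curv r * (V N X $ r)\<^sup>2)) = (\<Sum>r\<in>UNIV. (1 / m $ r) * (chi N X * (V N X $ r * (real N * drift r (V N X)))))"
        unfolding drift_curv[OF sum_V[OF N], symmetric] sum_distrib_left by (intro sum.cong refl) (simp add: mult_ac)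
    qed
    also have "\<dots> = (\<Sum>r\<in>UNIV. (1 / m $ r) * gm N (\<lambda>X. chi N X * (V N X $ r * (real N * drift r (V N X)))))"
      by (simp only: gibbs_mean_sum gibbs_mean_cmult)
    also have "\<dots> \<le> (\<Sum>r\<in>UNIV. (1 / m $ r) * (1 + 2 * C1 + ?R))"
      using m_pos by (intro sum_mono mult_left_mono each) (simp add: less_imp_le)
    also have "\<dots> = M * (1 + 2 * C1 + ?R)" by (simp only: M_def sum_distrib_right)
    finally have main: "\<kappa> * ?U \<le> M * (1 + 2 * C1 + ?R)" .
    have "?R \<le> gm N (\<lambda>X. C2 * (t * (chi N X * (real N * (norm (V N X))\<^sup>2)) + (8 * real N * (chi N X * of_bool (t \<le> norm (V N X))) + 2)))"
    proof (rule gibbs_mean_mono)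
      fix X :: "nat \<Rightarrow> 'q"
      let ?v = "norm (V N X)"
      have v2: "?v \<le> 2" by (rule norm_V_le[OF N])
      have "?v * (real N * ?v\<^sup>2) \<le> t * (real N * ?v\<^sup>2) + 8 * real N * of_bool (t \<le> ?v)"
      proof (cases "t \<le> ?v")
        case True
        have "?v ^ 3 \<le> 2 ^ 3" using v2 by (intro power_mono) auto
        hence "real N * ?v ^ 3 \<le> real N * 8" using n by (intro mult_left_mono) auto
        moreover have "0 \<le> t * (real N * ?v\<^sup>2)" using t by simp
        moreover have "?v * (real N * ?v\<^sup>2) = real N * ?v ^ 3" by (simp add: power2_eq_square power3_eq_cube)
        moreover have "8 * real N * of_bool (t \<le> ?v) = 8 * real N" using True by simp
        ultimately show ?thesis by linarith
      next
        case False
        hence "?v * (real N * ?v\<^sup>2) \<le> t * (real N * ?v\<^sup>2)" by (intro mult_right_mono) auto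
        thus ?thesis using False by simp
      qed
      hence "?v * (real N * ?v\<^sup>2 + 1) \<le> t * (real N * ?v\<^sup>2) + (8 * real N * of_bool (t \<le> ?v) + 2)"
        using v2 by (simp add: algebra_simps)
      hence "chi N X * (?v * (real N * ?v\<^sup>2 + 1)) \<le> t * (chi N X * (real N * ?v\<^sup>2)) + (8 * real N * (chi N X * of_bool (t \<le> ?v)) + 2)"
        using chi_01[of N X] by auto
      hence "C2 * (chi N X * (?v * (real N * ?v\<^sup>2 + 1))) \<le> C2 * (t * (chi N X * (real N * ?v\<^sup>2)) + (8 * real N * (chi N X * of_bool (t \<le> ?v)) + 2))"
        using C2(1) by (rule mult_left_mono)
      thus "chi N X * (?v * (C2 * (real N * ?v\<^sup>2 + 1))) \<le> C2 * (t * (chi N X * (real N * ?v\<^sup>2)) + (8 * real N * (chi N X * of_bool (t \<le> ?v)) + 2))"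
        by (simp only: mult_ac)
    qed
    also have "\<dots> = C2 * (t * ?U + (8 * real N * gm N (\<lambda>X. chi N X * of_bool (t \<le> norm (V N X))) + 2))"
      by (simp only: gibbs_mean_cmult gibbs_mean_add gibbs_mean_const)
    also have "\<dots> \<le> C2 * (t * ?U + (8 * C3 + 2))"
    proof -
      have "real N * gm N (\<lambda>X. chi N X * of_bool (t \<le> norm (V N X))) \<le> real N * (C3 / real N ^ 4)"
        using C3(2)[OF N] by (intro mult_left_mono) auto
      also have "\<dots> = C3 / real N ^ 3" using n by (simp add: power4_eq_xxxx power3_eq_cube)
      also have "\<dots> \<le> C3" using C3(1) n by (simp add: divide_le_eq mult_le_cancel_left1 one_le_power)
      finally show ?thesis using C2(1) by (intro mult_left_mono) auto
    qed
    finally have "M * ?R \<le> M * (C2 * (t * ?U + (8 * C3 + 2)))" using M by (intro mult_left_mono)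
    hence "\<kappa> * ?U \<le> M * (1 + 2 * C1) + M * C2 * t * ?U + M * C2 * (8 * C3 + 2)"
      using main by (simp add: algebra_simps)
    moreover have "M * C2 * t * ?U \<le> \<kappa> / 2 * ?U"
      using t(2) by (intro mult_right_mono gibbs_mean_nonneg) (simp_all add: chi_nonneg)
    ultimately have "\<kappa> / 2 * ?U \<le> M * (1 + 2 * C1) + M * C2 * (8 * C3 + 2)" by simp
    thus "?U \<le> C" using k(1) by (simp add: C_def field_simps)
  qed
qed

end

lemma ln_ge_1: "N \<ge> 3 \<Longrightarrow> ln (real N) \<ge> 1"
proof -
  assume "N \<ge> 3"
  have "exp 1 \<le> (3 :: real)" by (rule exp_le)
  also have "\<dots> \<le> real N" using \<open>N \<ge> 3\<close> by simp
  finally show ?thesis using \<open>N \<ge> 3\<close> by (subst ln_ge_iff) auto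
qed

lemma sqrt_sq_real: "sqrt (real N) * sqrt (real N) = real N" by simp

lemma sqrt_mult_le: "sqrt (real N) * y \<le> 1 + real N * y\<^sup>2"
proof -
  have "u \<le> 1 + u\<^sup>2" for u :: real
  proof -
    have "(u - 1/2)\<^sup>2 = u\<^sup>2 - u + 1/4" by (simp add: power2_eq_square algebra_simps)
    thus ?thesis using zero_le_power2[of "u - 1/2"] by linarith
  qed
  hence "sqrt (real N) * y \<le> 1 + (sqrt (real N) * y)\<^sup>2" .
  thus ?thesis by (simp add: power_mult_distrib)
qed

section \<open>Moments, variance and normal approximation of the distinguished coordinate\<close>

context potts_ball
begin

lemma norm_le_moment:
  assumes "N \<ge> 1"
  shows "norm (V N X) \<le> (1 + real N * (norm (V N X))\<^sup>2) / sqrt (real N)"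
proof -
  have "0 < sqrt (real N)" using assms by simp
  thus ?thesis using sqrt_mult_le[of N "norm (V N X)"] by (simp only: pos_le_divide_eq mult.commute)
qed

lemma gm_chi_le_1: "gm N (chi N) \<le> 1"
  using gibbs_mean_mono[of N "chi N" "\<lambda>_. 1" p \<beta>] by (simp add: chi_le_1 gibbs_mean_const)

lemma gm_chi_nonneg: "0 \<le> gm N (chi N)"
  by (rule gibbs_mean_nonneg) (rule chi_nonneg)

lemma moment_plus_one_bound:
  obtains C where "C \<ge> 0" "\<And>N. N \<ge> 1 \<Longrightarrow> gm N (\<lambda>X. chi N X * (real N * (norm (V N X))\<^sup>2 + 1)) \<le> C"
proof -
  obtain C where C: "C \<ge> 0" "\<And>N. N \<ge> 1 \<Longrightarrow> gm N (\<lambda>X. chi N X * (real N * (norm (V N X))\<^sup>2)) \<le> C"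
    by (rule second_moment_bound) (rule that)
  show ?thesis
  proof (rule that[of "C + 1"])
    fix N :: nat assume N: "N \<ge> 1"
    have "gm N (\<lambda>X. chi N X * (real N * (norm (V N X))\<^sup>2 + 1)) = gm N (\<lambda>X. chi N X * (real N * (norm (V N X))\<^sup>2) + chi N X)"
      by (simp only: distrib_left mult_1_right)
    also have "\<dots> = gm N (\<lambda>X. chi N X * (real N * (norm (V N X))\<^sup>2)) + gm N (chi N)"
      by (rule gibbs_mean_add)
    finally show "gm N (\<lambda>X. chi N X * (real N * (norm (V N X))\<^sup>2 + 1)) \<le> C + 1"
      using C(2)[OF N] gm_chi_le_1[of N] by linarith
  qed (use C in auto)
qed

lemma first_moment_bound:
  obtains C where "C \<ge> 0" "\<And>N. N \<ge> 1 \<Longrightarrow> gm N (\<lambda>X. chi N X * norm (V N X)) \<le> C / sqrt (real N)"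
proof -
  obtain C where C: "C \<ge> 0" "\<And>N. N \<ge> 1 \<Longrightarrow> gm N (\<lambda>X. chi N X * (real N * (norm (V N X))\<^sup>2 + 1)) \<le> C"
    by (rule moment_plus_one_bound) (rule that)
  show ?thesis
  proof (rule that[OF C(1)])
    fix N :: nat assume N: "N \<ge> 1"
    have "gm N (\<lambda>X. chi N X * norm (V N X)) \<le> gm N (\<lambda>X. (1 / sqrt (real N)) * (chi N X * (real N * (norm (V N X))\<^sup>2 + 1)))"
    proof (rule gibbs_mean_mono)
      fix X :: "nat \<Rightarrow> 'q"
      have "chi N X * norm (V N X) \<le> chi N X * ((1 + real N * (norm (V N X))\<^sup>2) / sqrt (real N))"
        by (rule mult_left_mono[OF norm_le_moment[OF N] chi_nonneg])
      thus "chi N X * norm (V N X) \<le> (1 / sqrt (real N)) * (chi N X * (real N * (norm (V N X))\<^sup>2 + 1))"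
        by (simp add: mult_ac add.commute)
    qed
    also have "\<dots> = (1 / sqrt (real N)) * gm N (\<lambda>X. chi N X * (real N * (norm (V N X))\<^sup>2 + 1))"
      by (rule gibbs_mean_cmult)
    also have "\<dots> \<le> (1 / sqrt (real N)) * C" using C(2)[OF N] by (intro mult_left_mono) auto
    finally show "gm N (\<lambda>X. chi N X * norm (V N X)) \<le> C / sqrt (real N)" by simp
  qed
qed

text \<open>Where \<open>norm V\<close> is at most of order \<open>sqrt (ln N / N)\<close>, one
  factor comes out of the second moment; \<open>sqrt (ln N)\<close> is enlarged to
  \<open>ln N\<close>, as the final rate allows. Elsewhere the probability
  \<open>O(1 / N\<^sup>2)\<close> outweighs the factor \<open>8 N\<close>.\<close>

lemma third_moment_bound:
  obtains C where "C \<ge> 0" "\<And>N. N \<ge> 3 \<Longrightarrow> gm N (\<lambda>X. chi N X * (norm (V N X) * (real N * (norm (V N X))\<^sup>2))) \<le> C * (ln (real N) / sqrt (real N))"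
proof -
  obtain C0 where C0: "C0 \<ge> 0" "\<And>N. N \<ge> 1 \<Longrightarrow> gm N (\<lambda>X. chi N X * (real N * (norm (V N X))\<^sup>2)) \<le> C0"
    by (rule second_moment_bound) (rule that)
  obtain K C1 where K: "K > 0" "C1 \<ge> 0"
    "\<And>N. N \<ge> 1 \<Longrightarrow> gm N (\<lambda>X. chi N X * of_bool (K * ln (real N) / real N \<le> (norm (V N X))\<^sup>2)) \<le> C1 / (real N)\<^sup>2"
    by (rule log_scale_tail) (rule that)
  show ?thesis
  proof (rule that[of "sqrt K * C0 + 8 * C1"])
    show "sqrt K * C0 + 8 * C1 \<ge> 0" using C0 K by simp
    fix N :: nat assume N3: "N \<ge> 3"
    hence N: "N \<ge> 1" by simp
    have n: "real N \<ge> 1" using N by simp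
    note L = ln_ge_1[OF N3]
    let ?L = "ln (real N) / sqrt (real N)"
    have "gm N (\<lambda>X. chi N X * (norm (V N X) * (real N * (norm (V N X))\<^sup>2)))
        \<le> gm N (\<lambda>X. (sqrt K * ?L) * (chi N X * (real N * (norm (V N X))\<^sup>2))
            + (8 * real N) * (chi N X * of_bool (K * ln (real N) / real N \<le> (norm (V N X))\<^sup>2)))"
    proof (rule gibbs_mean_mono)
      fix X :: "nat \<Rightarrow> 'q"
      let ?v = "norm (V N X)"
      let ?t = "of_bool (K * ln (real N) / real N \<le> ?v\<^sup>2) :: real"
      have v2: "?v \<le> 2" by (rule norm_V_le[OF N])
      have "?v * (real N * ?v\<^sup>2) \<le> (sqrt K * ?L) * (real N * ?v\<^sup>2) + 8 * real N * ?t"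
      proof (cases "K * ln (real N) / real N \<le> ?v\<^sup>2")
        case True
        have "?v ^ 3 \<le> 2 ^ 3" using v2 by (intro power_mono) auto
        hence "real N * ?v ^ 3 \<le> real N * 8" using n by (intro mult_left_mono) auto
        moreover have "0 \<le> (sqrt K * ?L) * (real N * ?v\<^sup>2)" using K L by (intro mult_nonneg_nonneg divide_nonneg_nonneg) auto
        moreover have "?v * (real N * ?v\<^sup>2) = real N * ?v ^ 3" by (simp add: power2_eq_square power3_eq_cube)
        moreover have "8 * real N * ?t = 8 * real N" using True by simp
        ultimately show ?thesis by linarith
      next
        case False
        hence "?v \<le> sqrt (K * ln (real N) / real N)" by (intro real_le_rsqrt) simp
        also have "\<dots> = sqrt K * (sqrt (ln (real N)) / sqrt (real N))"
          using K L n by (simp add: real_sqrt_mult real_sqrt_divide)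
        also have "\<dots> \<le> sqrt K * ?L"
        proof -
          have "sqrt (ln (real N)) \<le> ln (real N)" using L by (intro real_le_lsqrt) (auto simp: power2_eq_square)
          thus ?thesis using K by (intro mult_left_mono divide_right_mono) auto
        qed
        finally have "?v * (real N * ?v\<^sup>2) \<le> (sqrt K * ?L) * (real N * ?v\<^sup>2)" by (intro mult_right_mono) auto
        moreover have "0 \<le> 8 * real N * ?t" by simp
        ultimately show ?thesis by linarith
      qed
      hence "chi N X * (?v * (real N * ?v\<^sup>2)) \<le> chi N X * ((sqrt K * ?L) * (real N * ?v\<^sup>2) + 8 * real N * ?t)"
        by (rule mult_left_mono[OF _ chi_nonneg])
      thus "chi N X * (?v * (real N * ?v\<^sup>2)) \<le> (sqrt K * ?L) * (chi N X * (real N * ?v\<^sup>2)) + (8 * real N) * (chi N X * ?t)"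
        by (simp only: distrib_left mult_ac)
    qed
    also have "\<dots> = (sqrt K * ?L) * gm N (\<lambda>X. chi N X * (real N * (norm (V N X))\<^sup>2))
        + (8 * real N) * gm N (\<lambda>X. chi N X * of_bool (K * ln (real N) / real N \<le> (norm (V N X))\<^sup>2))"
      by (simp only: gibbs_mean_add gibbs_mean_cmult)
    also have "\<dots> \<le> (sqrt K * ?L) * C0 + (8 * real N) * (C1 / (real N)\<^sup>2)"
      using C0(2)[OF N] K(3)[OF N] K(1) L
      by (intro add_mono mult_left_mono) (auto intro!: mult_nonneg_nonneg divide_nonneg_nonneg)
    also have "(8 * real N) * (C1 / (real N)\<^sup>2) \<le> 8 * C1 * ?L"
    proof -
      have "1 / real N \<le> ?L"
      proof -
        have "1 / real N \<le> 1 / sqrt (real N)" using n by (intro divide_left_mono) (auto intro!: real_le_lsqrt simp: power2_eq_square)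
        also have "\<dots> \<le> ?L" using L by (intro divide_right_mono) auto
        finally show ?thesis .
      qed
      hence "8 * C1 * (1 / real N) \<le> 8 * C1 * ?L" using K(2) by (intro mult_left_mono) auto
      thus ?thesis using n by (simp add: power2_eq_square)
    qed
    finally show "gm N (\<lambda>X. chi N X * (norm (V N X) * (real N * (norm (V N X))\<^sup>2))) \<le> (sqrt K * C0 + 8 * C1) * ?L"
      by (simp add: algebra_simps)
  qed
qed

lemma drift_c: "N \<ge> 1 \<Longrightarrow> drift c (V N X) = lam * V N X $ c"
  by (rule drift_peak[OF sum_V])

text \<open>For a constant test function the jump side of the exchange identity vanishes, so only
  the quadratic remainder balances the linear drift. The order \<open>1 / N\<close>, better than
  that of \<open>norm V\<close>, makes the squared mean negligible in the conditional
  variance.\<close>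

lemma mean_bound:
  obtains C where "C \<ge> 0" "\<And>N. N \<ge> 1 \<Longrightarrow> \<bar>gm N (\<lambda>X. chi N X * V N X $ c)\<bar> \<le> C / real N"
proof -
  obtain C1 where C1: "C1 \<ge> 0" "\<And>N g B r. N \<ge> 1 \<Longrightarrow> \<forall>X\<in>configs N. \<bar>g X\<bar> \<le> B \<Longrightarrow>
      \<bar>gm N (\<lambda>X. chi N X * (g X * (site_count N X r - W N X r)))
       - gm N (\<lambda>X. chi N X * (\<Sum>i\<in>{1..N}. cond_weight p \<beta> N X i r * (g (X(i := r)) - g X)))\<bar> \<le> C1 * B / real N ^ 3"
    by (rule local_exchange) (rule that)
  obtain C2 where C2: "C2 \<ge> 0" "\<And>N X r. N \<ge> 1 \<Longrightarrow>
    \<bar>(site_count N X r - W N X r) - real N * drift r (V N X)\<bar> \<le> C2 * (real N * (norm (V N X))\<^sup>2 + 1)"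
    by (rule drift_count_approx) (rule that)
  obtain C3 where C3: "C3 \<ge> 0" "\<And>N. N \<ge> 1 \<Longrightarrow> gm N (\<lambda>X. chi N X * (real N * (norm (V N X))\<^sup>2 + 1)) \<le> C3"
    by (rule moment_plus_one_bound) (rule that)
  show ?thesis
  proof (rule that[of "(C1 + C2 * C3) / lam"])
    show "(C1 + C2 * C3) / lam \<ge> 0" using C1 C2 C3 lam_pos by simp
    fix N :: nat assume N: "N \<ge> 1"
    have n: "real N \<ge> 1" using N by simp
    have "\<bar>gm N (\<lambda>X. chi N X * (1 * (site_count N X c - W N X c)))
       - gm N (\<lambda>X. chi N X * (\<Sum>i\<in>{1..N}. cond_weight p \<beta> N X i c * (1 - 1)))\<bar> \<le> C1 * 1 / real N ^ 3"
      by (rule C1(2)[OF N, where g = "\<lambda>_. 1"]) simp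
    hence "\<bar>gm N (\<lambda>X. chi N X * (site_count N X c - W N X c))\<bar> \<le> C1 / real N ^ 3"
      by (simp add: gibbs_mean_const)
    moreover have "C1 / real N ^ 3 \<le> C1" using C1(1) n by (simp add: divide_le_eq mult_le_cancel_left1 one_le_power)
    moreover have "\<bar>gm N (\<lambda>X. chi N X * (site_count N X c - W N X c)) - gm N (\<lambda>X. (real N * lam) * (chi N X * V N X $ c))\<bar>
        \<le> gm N (\<lambda>X. C2 * (chi N X * (real N * (norm (V N X))\<^sup>2 + 1)))"
    proof (rule gibbs_mean_diff_le)
      fix X :: "nat \<Rightarrow> 'q"
      have "\<bar>chi N X * ((site_count N X c - W N X c) - real N * drift c (V N X))\<bar> \<le> chi N X * (C2 * (real N * (norm (V N X))\<^sup>2 + 1))"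
        unfolding abs_mult using C2(2)[OF N, of X c] chi_nonneg[of N X] by (simp add: mult_left_mono)
      thus "\<bar>chi N X * (site_count N X c - W N X c) - (real N * lam) * (chi N X * V N X $ c)\<bar>
          \<le> C2 * (chi N X * (real N * (norm (V N X))\<^sup>2 + 1))"
        unfolding drift_c[OF N] right_diff_distrib by (simp only: mult_ac)
    qed
    moreover have "gm N (\<lambda>X. C2 * (chi N X * (real N * (norm (V N X))\<^sup>2 + 1))) \<le> C2 * C3"
      unfolding gibbs_mean_cmult using C2(1) C3(2)[OF N] by (intro mult_left_mono)
    ultimately have "\<bar>(real N * lam) * gm N (\<lambda>X. chi N X * V N X $ c)\<bar> \<le> C1 + C2 * C3"
      unfolding gibbs_mean_cmult by linarith
    thus "\<bar>gm N (\<lambda>X. chi N X * V N X $ c)\<bar> \<le> (C1 + C2 * C3) / lam / real N"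
      using n lam_pos by (simp add: abs_mult field_simps)
  qed
qed

text \<open>Every such recolouring raises \<open>V $ c\<close> by exactly \<open>1 / N\<close>, so
  this is the total rate of upward jumps of the \<open>c\<close>-th coordinate.\<close>

definition up_rate :: "nat \<Rightarrow> (nat \<Rightarrow> 'q) \<Rightarrow> real" where
  "up_rate N X = (\<Sum>i\<in>{1..N}. cond_weight p \<beta> N X i c * of_bool (X i \<noteq> c))"

lemma a_one_minus_a_pos: "a * (1 - a) > 0" using a_pos a_less_1 by simp

lemma a_one_minus_a_le: "a * (1 - a) \<le> 1"
  using a_pos a_less_1 by (intro mult_le_one) auto

text \<open>A fraction close to \<open>1 - a\<close> of the sites has a colour other than
  \<open>c\<close>, and each of them takes colour \<open>c\<close> with weight close to
  \<open>a\<close>.\<close>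

lemma up_rate_approx:
  obtains C where "C \<ge> 0" "\<And>N X. N \<ge> 1 \<Longrightarrow> \<bar>up_rate N X - real N * (a * (1 - a))\<bar> \<le> C * (real N * norm (V N X) + 1)"
proof -
  obtain D where D: "D \<ge> 0" "\<And>x r. x \<in> prob_simplex \<Longrightarrow>
    \<bar>(x $ r - mean_field p \<beta> x r) - drift r (x - m)\<bar> \<le> D * (norm (x - m))\<^sup>2"
    by (rule drift_approx) (rule that)
  define A where "A = 4 * (\<bar>\<beta>\<bar> * (real p)\<^sup>2)"
  have A: "A \<ge> 0" by (simp add: A_def)
  define B where "B = \<bar>1 - lam\<bar> + 2 * D + 1"
  have B: "B \<ge> 0" using D by (simp add: B_def)
  show ?thesis
  proof (rule that[of "A + B"])
    show "A + B \<ge> 0" using A B by simp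
    fix N :: nat and X :: "nat \<Rightarrow> 'q" assume N: "N \<ge> 1"
    have n: "real N \<ge> 1" using N by simp
    define x where "x = magnetization N X $ c"
    define f where "f = mean_field p \<beta> (magnetization N X) c"
    define v where "v = norm (V N X)"
    have v: "0 \<le> v" "v \<le> 2" using norm_V_le[OF N] by (auto simp: v_def)
    have x: "0 \<le> x" "x \<le> 1" using magnetization_nonneg magnetization_le_1[OF N] by (auto simp: x_def)
    have xV: "x - a = V N X $ c" by (simp add: x_def V_def peak_nth)
    have sum1: "(\<Sum>i\<in>{1..N}. of_bool (X i \<noteq> c)) = real N * (1 - x)"
    proof -
      have "(\<Sum>i\<in>{1..N}. of_bool (X i \<noteq> c)) = (\<Sum>i\<in>{1..N}. 1 - of_bool (X i = c) :: real)"
        by (intro sum.cong) auto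
      also have "\<dots> = real N - site_count N X c" unfolding sum_subtractf site_count_def by simp
      also have "\<dots> = real N * (1 - x)" using n by (simp add: x_def magnetization_nth algebra_simps)
      finally show ?thesis .
    qed
    have "\<bar>up_rate N X - real N * (1 - x) * f\<bar> \<le> A"
    proof -
      have eq: "up_rate N X - real N * (1 - x) * f = (\<Sum>i\<in>{1..N}. (cond_weight p \<beta> N X i c - f) * of_bool (X i \<noteq> c))"
        unfolding sum1[symmetric] up_rate_def sum_distrib_right sum_subtractf[symmetric]
        by (intro sum.cong refl) (simp add: algebra_simps)
      have "\<bar>\<Sum>i\<in>{1..N}. (cond_weight p \<beta> N X i c - f) * of_bool (X i \<noteq> c)\<bar> \<le> (\<Sum>i\<in>{1..N}. A / real N)"
      proof (rule order_trans[OF sum_abs sum_mono])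
        fix i assume i: "i \<in> {1..N}"
        have "\<bar>cond_weight p \<beta> N X i c - f\<bar> \<le> A / real N"
          using cond_weight_approx[OF i, of p \<beta> X c] by (simp add: f_def A_def)
        moreover have "A / real N \<ge> 0" using A by simp
        ultimately show "\<bar>(cond_weight p \<beta> N X i c - f) * of_bool (X i \<noteq> c)\<bar> \<le> A / real N" by auto
      qed
      also have "\<dots> = A" using n by simp
      finally show ?thesis unfolding eq .
    qed
    moreover have "\<bar>real N * (1 - x) * f - real N * (a * (1 - a))\<bar> \<le> real N * (B * v)"
    proof -
      have fa: "\<bar>f - a\<bar> \<le> (\<bar>1 - lam\<bar> + 2 * D) * v"
      proof -
        have "\<bar>(x - f) - lam * V N X $ c\<bar> \<le> D * v\<^sup>2"
          using D(2)[OF magnetization_simplex[OF N], of X c] drift_c[OF N, of X] by (simp add: x_def f_def v_def V_def)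
        moreover have "D * v\<^sup>2 \<le> D * (2 * v)" using D v by (intro mult_left_mono) (auto simp: power2_eq_square mult_right_mono)
        moreover have "f - a = (1 - lam) * V N X $ c - ((x - f) - lam * V N X $ c)" using xV by (simp add: algebra_simps)
        moreover have "\<bar>(1 - lam) * V N X $ c\<bar> \<le> \<bar>1 - lam\<bar> * v"
          unfolding abs_mult v_def by (intro mult_left_mono abs_V_nth_le) auto
        ultimately show ?thesis by (simp add: algebra_simps abs_le_iff)
      qed
      have "(1 - x) * f - a * (1 - a) = (1 - x) * (f - a) - a * (x - a)" by (simp add: algebra_simps)
      hence "\<bar>(1 - x) * f - a * (1 - a)\<bar> \<le> \<bar>(1 - x) * (f - a)\<bar> + \<bar>a * (x - a)\<bar>" by linarith
      also have "\<dots> \<le> 1 * \<bar>f - a\<bar> + 1 * v"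
        unfolding abs_mult xV v_def using x a_pos a_less_1 by (intro add_mono mult_mono abs_V_nth_le) auto
      also have "\<dots> \<le> B * v" using fa by (simp add: B_def algebra_simps)
      finally have "\<bar>(1 - x) * f - a * (1 - a)\<bar> \<le> B * v" .
      hence "real N * \<bar>(1 - x) * f - a * (1 - a)\<bar> \<le> real N * (B * v)" using n by (intro mult_left_mono) auto
      moreover have "real N * \<bar>(1 - x) * f - a * (1 - a)\<bar> = \<bar>real N * ((1 - x) * f - a * (1 - a))\<bar>"
        by (simp only: abs_mult abs_of_nat)
      moreover have "real N * ((1 - x) * f - a * (1 - a)) = real N * (1 - x) * f - real N * (a * (1 - a))"
        by (simp add: algebra_simps)
      ultimately show ?thesis by simp
    qed
    ultimately have "\<bar>up_rate N X - real N * (a * (1 - a))\<bar> \<le> A + real N * (B * v)" by linarith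
    also have "\<dots> \<le> (A + B) * (real N * v + 1)"
    proof -
      have "0 \<le> A * (real N * v)" "0 \<le> B" using A B v by auto
      thus ?thesis by (simp add: algebra_simps)
    qed
    finally show "\<bar>up_rate N X - real N * (a * (1 - a))\<bar> \<le> (A + B) * (real N * norm (V N X) + 1)" by (simp add: v_def)
  qed
qed

text \<open>The stationary variance: jump intensity \<open>a * (1 - a)\<close> divided by the
  restoring rate \<open>lam\<close>.\<close>

definition var :: real where "var = a * (1 - a) / lam"

lemma var_pos: "var > 0" using a_one_minus_a_pos lam_pos by (simp add: var_def)

text \<open>With the test function \<open>V $ c\<close> the exchange identity balances
  \<open>lam * N * (V $ c)\<^sup>2\<close> against \<open>a * (1 - a)\<close> in the mean over the
  ball. The errors are first and third moments; the third moment brings in the logarithm.\<close>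

lemma variance_approx:
  obtains C where "C \<ge> 0" "\<And>N. N \<ge> 3 \<Longrightarrow>
    \<bar>gm N (\<lambda>X. chi N X * (real N * (V N X $ c)\<^sup>2)) - var * gm N (chi N)\<bar> \<le> C * (ln (real N) / sqrt (real N))"
proof -
  obtain C1 where C1: "C1 \<ge> 0" "\<And>N g B r. N \<ge> 1 \<Longrightarrow> \<forall>X\<in>configs N. \<bar>g X\<bar> \<le> B \<Longrightarrow>
      \<bar>gm N (\<lambda>X. chi N X * (g X * (site_count N X r - W N X r)))
       - gm N (\<lambda>X. chi N X * (\<Sum>i\<in>{1..N}. cond_weight p \<beta> N X i r * (g (X(i := r)) - g X)))\<bar> \<le> C1 * B / real N ^ 3"
    by (rule local_exchange) (rule that)
  obtain C2 where C2: "C2 \<ge> 0" "\<And>N X r. N \<ge> 1 \<Longrightarrow>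
    \<bar>(site_count N X r - W N X r) - real N * drift r (V N X)\<bar> \<le> C2 * (real N * (norm (V N X))\<^sup>2 + 1)"
    by (rule drift_count_approx) (rule that)
  obtain C3 where C3: "C3 \<ge> 0" "\<And>N. N \<ge> 3 \<Longrightarrow> gm N (\<lambda>X. chi N X * (norm (V N X) * (real N * (norm (V N X))\<^sup>2))) \<le> C3 * (ln (real N) / sqrt (real N))"
    by (rule third_moment_bound) (rule that)
  obtain C4 where C4: "C4 \<ge> 0" "\<And>N. N \<ge> 1 \<Longrightarrow> gm N (\<lambda>X. chi N X * norm (V N X)) \<le> C4 / sqrt (real N)"
    by (rule first_moment_bound) (rule that)
  obtain C5 where C5: "C5 \<ge> 0" "\<And>N X. N \<ge> 1 \<Longrightarrow> \<bar>up_rate N X - real N * (a * (1 - a))\<bar> \<le> C5 * (real N * norm (V N X) + 1)"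
    by (rule up_rate_approx) (rule that)
  define C where "C = (C1 * 2 + C2 * (C3 + C4) + C5 * (C4 + 1)) / lam"
  show ?thesis
  proof (rule that[of C])
    show "C \<ge> 0" using C1 C2 C3 C4 C5 lam_pos by (simp add: C_def)
    fix N :: nat assume N3: "N \<ge> 3"
    hence N: "N \<ge> 1" by simp
    have n: "real N \<ge> 1" using N by simp
    let ?L = "ln (real N) / sqrt (real N)"
    have L1: "1 / sqrt (real N) \<le> ?L" using ln_ge_1[OF N3] by (intro divide_right_mono) auto
    have L2: "1 / real N \<le> 1 / sqrt (real N)" using n by (intro divide_left_mono) (auto intro!: real_le_lsqrt simp: power2_eq_square)
    have L3: "1 / real N ^ 3 \<le> 1 / real N"
      using n by (intro divide_left_mono) (auto simp: power3_eq_cube mult_le_cancel_left1 one_le_mult_iff intro: order_trans[of _ "real N * 1"] mult_left_mono mult_ge1_I)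
    have g4: "gm N (\<lambda>X. chi N X * norm (V N X)) \<le> C4 * ?L"
    proof -
      have "C4 * (1 / sqrt (real N)) \<le> C4 * ?L" by (rule mult_left_mono[OF L1 C4(1)])
      thus ?thesis using C4(2)[OF N] by simp
    qed
    have "\<forall>X\<in>configs N. \<bar>V N X $ c\<bar> \<le> 2" using abs_V_nth_le norm_V_le[OF N] order_trans by metis
    from C1(2)[OF N this, of c]
    have "\<bar>gm N (\<lambda>X. chi N X * (V N X $ c * (site_count N X c - W N X c)))
       - gm N (\<lambda>X. chi N X * (\<Sum>i\<in>{1..N}. cond_weight p \<beta> N X i c * (V N (X(i := c)) $ c - V N X $ c)))\<bar> \<le> C1 * 2 / real N ^ 3" .
    moreover have "C1 * 2 / real N ^ 3 \<le> C1 * 2 * ?L"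
    proof -
      have "C1 * 2 * (1 / real N ^ 3) \<le> C1 * 2 * ?L" using L1 L2 L3 C1(1) by (intro mult_left_mono) linarith+
      thus ?thesis by simp
    qed
    moreover have "gm N (\<lambda>X. chi N X * (\<Sum>i\<in>{1..N}. cond_weight p \<beta> N X i c * (V N (X(i := c)) $ c - V N X $ c)))
        = gm N (\<lambda>X. chi N X * (up_rate N X / real N))"
    proof (rule gibbs_mean_cong)
      fix X :: "nat \<Rightarrow> 'q"
      have "(\<Sum>i\<in>{1..N}. cond_weight p \<beta> N X i c * (V N (X(i := c)) $ c - V N X $ c)) = up_rate N X / real N"
        unfolding up_rate_def sum_divide_distrib by (intro sum.cong refl) (simp add: V_update)
      thus "chi N X * (\<Sum>i\<in>{1..N}. cond_weight p \<beta> N X i c * (V N (X(i := c)) $ c - V N X $ c)) = chi N X * (up_rate N X / real N)"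
        by simp
    qed
    moreover have "\<bar>gm N (\<lambda>X. chi N X * (V N X $ c * (site_count N X c - W N X c))) - gm N (\<lambda>X. lam * (chi N X * (real N * (V N X $ c)\<^sup>2)))\<bar>
        \<le> gm N (\<lambda>X. C2 * (chi N X * (norm (V N X) * (real N * (norm (V N X))\<^sup>2)) + chi N X * norm (V N X)))"
    proof (rule gibbs_mean_diff_le)
      fix X :: "nat \<Rightarrow> 'q"
      have "\<bar>chi N X * (V N X $ c * ((site_count N X c - W N X c) - real N * drift c (V N X)))\<bar>
          \<le> chi N X * (norm (V N X) * (C2 * (real N * (norm (V N X))\<^sup>2 + 1)))"
        unfolding abs_mult using C2(2)[OF N, of X c] chi_nonneg[of N X] abs_V_nth_le[of N X c]
        by (intro mult_mono) auto
      moreover have "chi N X * (V N X $ c * ((site_count N X c - W N X c) - real N * drift c (V N X)))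
          = chi N X * (V N X $ c * (site_count N X c - W N X c)) - lam * (chi N X * (real N * (V N X $ c)\<^sup>2))"
        unfolding drift_c[OF N] by (simp add: algebra_simps power2_eq_square)
      moreover have "chi N X * (norm (V N X) * (C2 * (real N * (norm (V N X))\<^sup>2 + 1)))
          = C2 * (chi N X * (norm (V N X) * (real N * (norm (V N X))\<^sup>2)) + chi N X * norm (V N X))"
        by (simp add: algebra_simps)
      ultimately show "\<bar>chi N X * (V N X $ c * (site_count N X c - W N X c)) - lam * (chi N X * (real N * (V N X $ c)\<^sup>2))\<bar>
          \<le> C2 * (chi N X * (norm (V N X) * (real N * (norm (V N X))\<^sup>2)) + chi N X * norm (V N X))" by (simp only:)
    qed
    moreover have "gm N (\<lambda>X. C2 * (chi N X * (norm (V N X) * (real N * (norm (V N X))\<^sup>2)) + chi N X * norm (V N X))) \<le> C2 * (C3 * ?L + C4 * ?L)"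
      unfolding gibbs_mean_cmult gibbs_mean_add using C2(1) C3(2)[OF N3] g4 by (intro mult_left_mono add_mono)
    moreover have "\<bar>gm N (\<lambda>X. chi N X * (up_rate N X / real N)) - gm N (\<lambda>X. (a * (1 - a)) * chi N X)\<bar>
        \<le> gm N (\<lambda>X. C5 * (chi N X * norm (V N X) + 1 / real N))"
    proof (rule gibbs_mean_diff_le)
      fix X :: "nat \<Rightarrow> 'q"
      have "\<bar>up_rate N X / real N - a * (1 - a)\<bar> = \<bar>up_rate N X - real N * (a * (1 - a))\<bar> / real N"
      proof -
        have "up_rate N X / real N - a * (1 - a) = (up_rate N X - real N * (a * (1 - a))) / real N"
          using n by (simp add: diff_divide_distrib)
        thus ?thesis by (simp only: abs_divide abs_of_nat)
      qed
      also have "\<dots> \<le> (C5 * (real N * norm (V N X) + 1)) / real N"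
        using C5(2)[OF N, of X] by (intro divide_right_mono) auto
      also have "\<dots> = C5 * (norm (V N X) + 1 / real N)" using n by (simp add: field_simps)
      finally have "chi N X * \<bar>up_rate N X / real N - a * (1 - a)\<bar> \<le> chi N X * (C5 * (norm (V N X) + 1 / real N))"
        by (rule mult_left_mono[OF _ chi_nonneg])
      also have "\<dots> \<le> C5 * (chi N X * norm (V N X) + 1 / real N)"
        using chi_01[of N X] C5(1) by auto
      also have "chi N X * \<bar>up_rate N X / real N - a * (1 - a)\<bar> = \<bar>chi N X * (up_rate N X / real N - a * (1 - a))\<bar>"
        using chi_nonneg[of N X] by (simp only: abs_mult abs_of_nonneg)
      also have "chi N X * (up_rate N X / real N - a * (1 - a)) = chi N X * (up_rate N X / real N) - (a * (1 - a)) * chi N X"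
        by (simp only: right_diff_distrib mult.commute)
      finally show "\<bar>chi N X * (up_rate N X / real N) - (a * (1 - a)) * chi N X\<bar> \<le> C5 * (chi N X * norm (V N X) + 1 / real N)" .
    qed
    moreover have "gm N (\<lambda>X. C5 * (chi N X * norm (V N X) + 1 / real N)) \<le> C5 * (C4 * ?L + 1 * ?L)"
      unfolding gibbs_mean_cmult gibbs_mean_add gibbs_mean_const using C5(1) g4 L1 L2 by (intro mult_left_mono add_mono) auto
    ultimately have "\<bar>lam * gm N (\<lambda>X. chi N X * (real N * (V N X $ c)\<^sup>2)) - (a * (1 - a)) * gm N (\<lambda>X. chi N X)\<bar>
        \<le> C1 * 2 * ?L + C2 * (C3 * ?L + C4 * ?L) + C5 * (C4 * ?L + 1 * ?L)"
      unfolding gibbs_mean_cmult by linarith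
    also have "\<dots> = lam * (C * ?L)"
    proof -
      have "lam * C = C1 * 2 + C2 * (C3 + C4) + C5 * (C4 + 1)" using lam_pos by (simp add: C_def)
      moreover have "lam * (C * ?L) = (lam * C) * ?L" by simp
      ultimately show ?thesis by (simp only:) (simp only: algebra_simps)
    qed
    also have "(a * (1 - a)) * gm N (\<lambda>X. chi N X) = lam * (var * gm N (chi N))"
      using lam_pos by (simp add: var_def)
    finally have "\<bar>lam * (gm N (\<lambda>X. chi N X * (real N * (V N X $ c)\<^sup>2)) - var * gm N (chi N))\<bar> \<le> lam * (C * ?L)"
      by (simp only: right_diff_distrib)
    thus "\<bar>gm N (\<lambda>X. chi N X * (real N * (V N X $ c)\<^sup>2)) - var * gm N (chi N)\<bar> \<le> C * ?L"
      unfolding abs_mult[of lam] abs_of_pos[OF lam_pos] mult_le_cancel_left_pos[OF lam_pos] .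
  qed
qed

definition sd :: real where "sd = sqrt var"

definition Y :: "nat \<Rightarrow> (nat \<Rightarrow> 'q) \<Rightarrow> real" where
  "Y N X = sqrt (real N) * V N X $ c / sd"

text \<open>The spacing of the lattice of values of \<open>Y\<close>: recolouring one site to
  \<open>c\<close> raises \<open>Y\<close> by \<open>mesh N\<close> or leaves it unchanged.\<close>

definition mesh :: "nat \<Rightarrow> real" where "mesh N = 1 / (sd * sqrt (real N))"

lemma sd_pos: "sd > 0" using var_pos by (simp add: sd_def)

lemma sd_sq: "sd * sd = var" using var_pos by (simp add: sd_def)

lemma mesh_pos: "N \<ge> 1 \<Longrightarrow> mesh N > 0" using sd_pos by (simp add: mesh_def)

lemma Y_eq_count:
  assumes N: "N \<ge> 1"
  shows "Y N X = (site_count N X c - real N * a) * mesh N"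
proof -
  define s where "s = sqrt (real N)"
  have s: "s > 0" "s * s = real N" using N by (auto simp: s_def)
  have "V N X $ c = (site_count N X c - real N * a) / real N"
    using N by (simp add: V_def magnetization_nth peak_nth diff_divide_distrib)
  hence "Y N X = s * ((site_count N X c - real N * a) / (s * s)) / sd"
    unfolding Y_def s_def[symmetric] s(2) by simp
  also have "\<dots> = (site_count N X c - real N * a) * (1 / (sd * s))"
    using s(1) sd_pos by (simp add: field_simps)
  finally show ?thesis by (simp add: mesh_def s_def)
qed

lemma Y_update:
  assumes i: "i \<in> {1..N}"
  shows "Y N (X(i := c)) = Y N X + mesh N * of_bool (X i \<noteq> c)"
proof -
  have N: "N \<ge> 1" using i by simp
  show ?thesis unfolding Y_eq_count[OF N] site_count_update[OF i] by (simp add: algebra_simps)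
qed

lemma site_count_int: "\<exists>j::int. site_count N X r = of_int j"
proof -
  have "site_count N X r = of_int (\<Sum>i\<in>{1..N}. of_bool (X i = r))" by (simp add: site_count_def)
  thus ?thesis by blast
qed

lemma abs_Y_le: "N \<ge> 1 \<Longrightarrow> \<bar>Y N X\<bar> \<le> (1 / sd) * (real N * (norm (V N X))\<^sup>2 + 1)"
proof -
  have "sqrt (real N) * \<bar>V N X $ c\<bar> \<le> sqrt (real N) * norm (V N X)"
    by (intro mult_left_mono abs_V_nth_le) auto
  also have "\<dots> \<le> 1 + real N * (norm (V N X))\<^sup>2" by (rule sqrt_mult_le)
  finally have "sqrt (real N) * \<bar>V N X $ c\<bar> / sd \<le> (1 + real N * (norm (V N X))\<^sup>2) / sd"
    using sd_pos by (intro divide_right_mono) auto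
  thus ?thesis using sd_pos by (simp add: Y_def abs_mult add.commute)
qed

text \<open>On the lattice of values of \<open>Y\<close> the exchange identity is a discretisation of Stein's equation.\<close>

lemma stein_pointwise:
  obtains C where "C \<ge> 0" "\<And>N X (k::int) z. N \<ge> 1 \<Longrightarrow> z = (of_int k - real N * a) * mesh N \<Longrightarrow>
    \<bar>stein_sol z (Y N X) * (site_count N X c - W N X c) - up_rate N X * (stein_sol z (Y N X + mesh N) - stein_sol z (Y N X))
     + lam * sd * sqrt (real N) * (of_bool (Y N X < z) - Phi z)\<bar> \<le> C * (real N * (norm (V N X))\<^sup>2 + 1)"
proof -
  obtain C2 where C2: "C2 \<ge> 0" "\<And>N X r. N \<ge> 1 \<Longrightarrow>
    \<bar>(site_count N X r - W N X r) - real N * drift r (V N X)\<bar> \<le> C2 * (real N * (norm (V N X))\<^sup>2 + 1)"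
    by (rule drift_count_approx) (rule that)
  obtain C5 where C5: "C5 \<ge> 0" "\<And>N X. N \<ge> 1 \<Longrightarrow> \<bar>up_rate N X - real N * (a * (1 - a))\<bar> \<le> C5 * (real N * norm (V N X) + 1)"
    by (rule up_rate_approx) (rule that)
  define C where "C = stein_C * C2 + 4 * C5 / sd + (stein_C + 2 / sd + 2 / sd) / var"
  show ?thesis
  proof (rule that[of C])
    show "C \<ge> 0" using C2 C5 stein_C_ge_1 sd_pos var_pos by (simp add: C_def)
    fix N :: nat and X :: "nat \<Rightarrow> 'q" and k :: int and z :: real
    assume N: "N \<ge> 1" and z: "z = (of_int k - real N * a) * mesh N"
    define y where "y = Y N X"
    define h where "h = mesh N"
    define f where "f = stein_sol z"
    define s where "s = sqrt (real N)"
    define P where "P = real N * (norm (V N X))\<^sup>2 + 1"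
    define I where "I = of_bool (y < z) - Phi z"
    have s: "s \<ge> 1" "s * s = real N" using N by (auto simp: s_def)
    have h: "h > 0" "h = 1 / (sd * s)" using mesh_pos[OF N] by (auto simp: h_def mesh_def s_def)
    have P: "P \<ge> 1" by (simp add: P_def)
    have hsd: "h \<le> 1 / sd" unfolding h(2) using s sd_pos by (intro divide_left_mono) auto
    \<comment> \<open>Both \<open>y\<close> and \<open>z\<close> are lattice points, so
      \<open>y < z\<close> leaves room for a whole step below the corner of
      \<open>stein_sol\<close>.\<close>
    have step: "y + h \<le> z" if "y < z"
    proof -
      obtain j :: int where j: "site_count N X c = of_int j" using site_count_int by blast
      have "(of_int j - real N * a) * h < (of_int k - real N * a) * h"
        using that unfolding y_def Y_eq_count[OF N] z j h_def .
      hence "j < k" using h(1) by (simp add: mult_less_cancel_right_pos)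
      hence "of_int j + 1 \<le> (of_int k :: real)" by linarith
      hence "(of_int j + 1 - real N * a) * h \<le> (of_int k - real N * a) * h" using h(1) by (intro mult_right_mono) auto
      thus ?thesis unfolding y_def Y_eq_count[OF N] z j h_def by (simp add: algebra_simps)
    qed
    have d1: "\<bar>f (y + h) - f y\<bar> \<le> 2 * h"
      and d2: "\<bar>f (y + h) - f y - h * (y * f y + of_bool (y < z) - Phi z)\<bar> \<le> h\<^sup>2 * (stein_C + 2 * \<bar>y\<bar> + 2 * h)"
      unfolding f_def using h(1) step by (intro stein_sol_step; linarith)+
    have e1: "\<bar>f y * (site_count N X c - W N X c) - lam * sd * s * (y * f y)\<bar> \<le> stein_C * C2 * P"
    proof -
      have "lam * sd * s * y = lam * (s * s) * V N X $ c"
        unfolding y_def Y_def s_def[symmetric] using sd_pos by simp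
      moreover have "real N * drift c (V N X) = lam * (s * s) * V N X $ c"
        unfolding drift_c[OF N] s(2) by simp
      ultimately have "real N * drift c (V N X) = lam * sd * s * y" by (simp only:)
      hence "f y * (site_count N X c - W N X c) - lam * sd * s * (y * f y)
          = f y * ((site_count N X c - W N X c) - real N * drift c (V N X))"
        by (simp add: algebra_simps)
      moreover have "\<bar>f y * ((site_count N X c - W N X c) - real N * drift c (V N X))\<bar> \<le> stein_C * (C2 * P)"
        unfolding abs_mult f_def P_def using stein_sol_bounds(1)[of z y] C2(2)[OF N, of X c] stein_C_ge_1
        by (intro mult_mono) auto
      ultimately show ?thesis by simp
    qed
    have e2: "\<bar>up_rate N X * (f (y + h) - f y) - real N * (a * (1 - a)) * (f (y + h) - f y)\<bar> \<le> 4 * C5 / sd * P"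
    proof -
      have "\<bar>(up_rate N X - real N * (a * (1 - a))) * (f (y + h) - f y)\<bar> \<le> (C5 * (real N * norm (V N X) + 1)) * (2 * h)"
        unfolding abs_mult using C5(2)[OF N, of X] d1 C5(1) by (intro mult_mono) auto
      also have "\<dots> = 2 * C5 * (h * (real N * norm (V N X)) + h)" by (simp add: algebra_simps)
      also have "\<dots> \<le> 2 * C5 * (P / sd + P / sd)"
      proof (intro mult_left_mono add_mono)
        have "h * (real N * norm (V N X)) = (s * norm (V N X)) / sd"
          unfolding h(2) s(2)[symmetric] using s(1) sd_pos by (simp add: field_simps)
        also have "\<dots> \<le> P / sd" using sqrt_mult_le[of N "norm (V N X)"] sd_pos
          by (intro divide_right_mono) (auto simp: P_def s_def)
        finally show "h * (real N * norm (V N X)) \<le> P / sd" .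
        have "1 / sd \<le> P / sd" using P sd_pos by (intro divide_right_mono) auto
        thus "h \<le> P / sd" using hsd by linarith
      qed (use C5 in auto)
      finally show ?thesis by (simp add: algebra_simps)
    qed
    have Nh: "real N * h\<^sup>2 = 1 / var"
      unfolding h(2) s(2)[symmetric] sd_sq[symmetric] using s(1) sd_pos by (simp add: field_simps power2_eq_square)
    \<comment> \<open>The difference of \<open>f\<close> is replaced by \<open>h\<close> times its
      derivative; \<open>N\<close> such steps, each with an error of order \<open>h\<^sup>2\<close>,
      cost a multiple of \<open>P\<close>.\<close>
    have e3: "\<bar>real N * (a * (1 - a)) * (f (y + h) - f y) - lam * sd * s * (y * f y + I)\<bar> \<le> (stein_C + 2 / sd + 2 / sd) / var * P"
    proof -
      \<comment> \<open>The choice \<open>sd * sd = a * (1 - a) / lam\<close> gives the jump part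
        and the drift part the same coefficient, as Stein's equation requires.\<close>
      have "real N * (a * (1 - a)) * h = lam * sd * s"
      proof -
        have q: "a * (1 - a) = lam * (sd * sd)" using lam_pos by (simp add: sd_sq var_def)
        show ?thesis unfolding q h(2) s(2)[symmetric] using s(1) sd_pos by (simp add: field_simps)
      qed
      moreover have "M * q * D - T * J = q * (M * (D - h * J))" if "M * q * h = T" for M q D T J :: real
        using that[symmetric] by (simp add: algebra_simps)
      moreover have "y * f y + I = y * f y + of_bool (y < z) - Phi z" by (simp add: I_def)
      ultimately have eq: "real N * (a * (1 - a)) * (f (y + h) - f y) - lam * sd * s * (y * f y + I)
          = (a * (1 - a)) * (real N * (f (y + h) - f y - h * (y * f y + of_bool (y < z) - Phi z)))"
        by (simp only:)
      have "\<bar>(a * (1 - a)) * (real N * (f (y + h) - f y - h * (y * f y + of_bool (y < z) - Phi z)))\<bar>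
          \<le> 1 * (real N * (h\<^sup>2 * (stein_C + 2 * \<bar>y\<bar> + 2 * h)))"
        unfolding abs_mult[of "a * (1 - a)"] abs_mult[of "real N"]
        using a_one_minus_a_pos a_one_minus_a_le d2 by (intro mult_mono) auto
      also have "\<dots> = (stein_C + 2 * \<bar>y\<bar> + 2 * h) / var" using Nh by (simp add: mult.assoc[symmetric])
      also have "\<dots> \<le> (stein_C * P + 2 * ((1 / sd) * P) + 2 * ((1 / sd) * P)) / var"
      proof (intro divide_right_mono add_mono mult_left_mono)
        show "stein_C \<le> stein_C * P" using stein_C_ge_1 P by (simp add: mult_le_cancel_left1)
        show "\<bar>y\<bar> \<le> (1 / sd) * P" unfolding y_def P_def by (rule abs_Y_le[OF N])
        have "1 / sd * 1 \<le> 1 / sd * P" using P sd_pos by (intro mult_left_mono) auto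
        thus "h \<le> 1 / sd * P" using hsd by linarith
      qed (use var_pos in auto)
      also have "\<dots> = (stein_C + 2 / sd + 2 / sd) / var * P" by (simp add: algebra_simps)
      finally show ?thesis unfolding eq .
    qed
    \<comment> \<open>The errors come from linearising the drift, freezing the jump rate and passing
      to the derivative. The terms with \<open>y * f y\<close> cancel, and the centred indicator is
      left.\<close>
    have split: "f y * (site_count N X c - W N X c) - up_rate N X * (f (y + h) - f y) + lam * sd * s * I
        = (f y * (site_count N X c - W N X c) - lam * sd * s * (y * f y))
         - (up_rate N X * (f (y + h) - f y) - real N * (a * (1 - a)) * (f (y + h) - f y))
         - (real N * (a * (1 - a)) * (f (y + h) - f y) - lam * sd * s * (y * f y + I))"
      by (simp add: algebra_simps)
    have "\<bar>f y * (site_count N X c - W N X c) - up_rate N X * (f (y + h) - f y) + lam * sd * s * I\<bar>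
        \<le> stein_C * C2 * P + 4 * C5 / sd * P + (stein_C + 2 / sd + 2 / sd) / var * P"
      unfolding split using e1 e2 e3 by linarith
    also have "\<dots> = C * P" unfolding C_def distrib_right ..
    finally show "\<bar>stein_sol z (Y N X) * (site_count N X c - W N X c) - up_rate N X * (stein_sol z (Y N X + mesh N) - stein_sol z (Y N X))
       + lam * sd * sqrt (real N) * (of_bool (Y N X < z) - Phi z)\<bar> \<le> C * (real N * (norm (V N X))\<^sup>2 + 1)"
      unfolding f_def y_def h_def s_def I_def P_def .
  qed
qed

text \<open>For lattice thresholds the error of \<open>stein_pointwise\<close> has bounded mean, and
  division by \<open>lam * sd * sqrt N\<close> gives the rate without a logarithm. Moving a general
  \<open>z\<close> up to the next lattice point does not change the event and changes
  \<open>Phi\<close> by at most the mesh.\<close>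

lemma berry_esseen:
  obtains C where "C \<ge> 0" "\<And>N z. N \<ge> 1 \<Longrightarrow>
    \<bar>gm N (\<lambda>X. chi N X * of_bool (Y N X \<le> z)) - Phi z * gm N (chi N)\<bar> \<le> C / sqrt (real N)"
proof -
  obtain C1 where C1: "C1 \<ge> 0" "\<And>N g B r. N \<ge> 1 \<Longrightarrow> \<forall>X\<in>configs N. \<bar>g X\<bar> \<le> B \<Longrightarrow>
      \<bar>gm N (\<lambda>X. chi N X * (g X * (site_count N X r - W N X r)))
       - gm N (\<lambda>X. chi N X * (\<Sum>i\<in>{1..N}. cond_weight p \<beta> N X i r * (g (X(i := r)) - g X)))\<bar> \<le> C1 * B / real N ^ 3"
    by (rule local_exchange) (rule that)
  obtain C2 where C2: "C2 \<ge> 0" "\<And>N X (k::int) z. N \<ge> 1 \<Longrightarrow> z = (of_int k - real N * a) * mesh N \<Longrightarrow>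
    \<bar>stein_sol z (Y N X) * (site_count N X c - W N X c) - up_rate N X * (stein_sol z (Y N X + mesh N) - stein_sol z (Y N X))
     + lam * sd * sqrt (real N) * (of_bool (Y N X < z) - Phi z)\<bar> \<le> C2 * (real N * (norm (V N X))\<^sup>2 + 1)"
    by (rule stein_pointwise) (rule that)
  obtain C3 where C3: "C3 \<ge> 0" "\<And>N. N \<ge> 1 \<Longrightarrow> gm N (\<lambda>X. chi N X * (real N * (norm (V N X))\<^sup>2 + 1)) \<le> C3"
    by (rule moment_plus_one_bound) (rule that)
  define C where "C = (C1 * stein_C + C2 * C3) / (lam * sd)"
  have ls: "lam * sd > 0" using lam_pos sd_pos by simp
  have C0: "C \<ge> 0" using C1 C2 C3 stein_C_ge_1 ls by (simp add: C_def)
  have lattice: "\<bar>gm N (\<lambda>X. chi N X * of_bool (Y N X < z)) - Phi z * gm N (chi N)\<bar> \<le> C / sqrt (real N)"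
    if N: "N \<ge> 1" and z: "z = (of_int k - real N * a) * mesh N" for N z and k :: int
  proof -
    have n: "real N \<ge> 1" using N by simp
    let ?f = "\<lambda>X. stein_sol z (Y N X)"
    let ?D = "\<lambda>X. up_rate N X * (stein_sol z (Y N X + mesh N) - stein_sol z (Y N X))"
    let ?I = "\<lambda>X. of_bool (Y N X < z) - Phi z"
    let ?s = "lam * sd * sqrt (real N)"
    have "\<forall>X\<in>configs N. \<bar>?f X\<bar> \<le> stein_C" using stein_sol_bounds(1) by blast
    from C1(2)[OF N this, of c]
    have 1: "\<bar>gm N (\<lambda>X. chi N X * (?f X * (site_count N X c - W N X c)))
       - gm N (\<lambda>X. chi N X * (\<Sum>i\<in>{1..N}. cond_weight p \<beta> N X i c * (?f (X(i := c)) - ?f X)))\<bar> \<le> C1 * stein_C / real N ^ 3" .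
    have "C1 * stein_C \<ge> 0" using C1 stein_C_ge_1 by simp
    hence 2: "C1 * stein_C / real N ^ 3 \<le> C1 * stein_C" using n by (simp add: divide_le_eq mult_le_cancel_left1 one_le_power)
    have 3: "gm N (\<lambda>X. chi N X * (\<Sum>i\<in>{1..N}. cond_weight p \<beta> N X i c * (?f (X(i := c)) - ?f X))) = gm N (\<lambda>X. chi N X * ?D X)"
    proof (rule gibbs_mean_cong)
      fix X :: "nat \<Rightarrow> 'q"
      have "(\<Sum>i\<in>{1..N}. cond_weight p \<beta> N X i c * (?f (X(i := c)) - ?f X)) = ?D X"
        unfolding up_rate_def sum_distrib_right
      proof (intro sum.cong refl)
        fix i assume i: "i \<in> {1..N}"
        show "cond_weight p \<beta> N X i c * (?f (X(i := c)) - ?f X)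
            = cond_weight p \<beta> N X i c * of_bool (X i \<noteq> c) * (stein_sol z (Y N X + mesh N) - stein_sol z (Y N X))"
          unfolding Y_update[OF i] by simp
      qed
      thus "chi N X * (\<Sum>i\<in>{1..N}. cond_weight p \<beta> N X i c * (?f (X(i := c)) - ?f X)) = chi N X * ?D X" by simp
    qed
    have 4: "\<bar>gm N (\<lambda>X. ?s * (chi N X * ?I X)) - (gm N (\<lambda>X. chi N X * ?D X) - gm N (\<lambda>X. chi N X * (?f X * (site_count N X c - W N X c))))\<bar>
        \<le> gm N (\<lambda>X. C2 * (chi N X * (real N * (norm (V N X))\<^sup>2 + 1)))"
      unfolding gibbs_mean_diff[symmetric]
    proof (rule gibbs_mean_abs_le)
      fix X :: "nat \<Rightarrow> 'q"
      let ?Q = "?f X * (site_count N X c - W N X c) - ?D X + ?s * ?I X"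
      have "\<bar>chi N X * ?Q\<bar> \<le> chi N X * (C2 * (real N * (norm (V N X))\<^sup>2 + 1))"
        unfolding abs_mult using C2(2)[OF N z, of X] chi_nonneg[of N X] by (intro mult_mono) auto
      moreover have "chi N X * ?Q = ?s * (chi N X * ?I X) - (chi N X * ?D X - chi N X * (?f X * (site_count N X c - W N X c)))"
        by (simp only: ring_distribs mult_ac)
      ultimately show "\<bar>?s * (chi N X * ?I X) - (chi N X * ?D X - chi N X * (?f X * (site_count N X c - W N X c)))\<bar>
          \<le> C2 * (chi N X * (real N * (norm (V N X))\<^sup>2 + 1))" by (simp only: mult_ac)
    qed
    have "gm N (\<lambda>X. C2 * (chi N X * (real N * (norm (V N X))\<^sup>2 + 1))) \<le> C2 * C3"
      unfolding gibbs_mean_cmult using C2(1) C3(2)[OF N] by (intro mult_left_mono)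
    hence "\<bar>gm N (\<lambda>X. ?s * (chi N X * ?I X))\<bar> \<le> C1 * stein_C + C2 * C3"
      using 1 2 4 unfolding 3 by linarith
    also have "gm N (\<lambda>X. ?s * (chi N X * ?I X)) = ?s * (gm N (\<lambda>X. chi N X * of_bool (Y N X < z)) - Phi z * gm N (chi N))"
    proof -
      have "gm N (\<lambda>X. chi N X * ?I X) = gm N (\<lambda>X. chi N X * of_bool (Y N X < z) - Phi z * chi N X)"
        by (simp only: right_diff_distrib mult.commute)
      thus ?thesis by (simp only: gibbs_mean_cmult gibbs_mean_diff)
    qed
    finally have *: "\<bar>?s * (gm N (\<lambda>X. chi N X * of_bool (Y N X < z)) - Phi z * gm N (chi N))\<bar> \<le> C1 * stein_C + C2 * C3" .
    have sp: "?s > 0" using ls n by simp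
    have "?s * \<bar>gm N (\<lambda>X. chi N X * of_bool (Y N X < z)) - Phi z * gm N (chi N)\<bar> \<le> C1 * stein_C + C2 * C3"
      using * unfolding abs_mult[of ?s] abs_of_pos[OF sp] .
    hence "\<bar>gm N (\<lambda>X. chi N X * of_bool (Y N X < z)) - Phi z * gm N (chi N)\<bar> \<le> (C1 * stein_C + C2 * C3) / ?s"
      using ls n by (subst pos_le_divide_eq) (auto simp: mult_ac)
    thus ?thesis by (simp add: C_def)
  qed
  show ?thesis
  proof (rule that[of "C + 1 / sd"])
    show "C + 1 / sd \<ge> 0" using C0 sd_pos by simp
    fix N :: nat and z :: real assume N: "N \<ge> 1"
    \<comment> \<open>The first lattice index strictly above \<open>z\<close>, so that
      \<open>Y \<le> z\<close> and \<open>Y < z'\<close> are the same event.\<close>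
    define k where "k = \<lfloor>z / mesh N + real N * a\<rfloor> + 1"
    define z' where "z' = (of_int k - real N * a) * mesh N"
    note h = mesh_pos[OF N]
    have k: "of_int k > z / mesh N + real N * a" "of_int k \<le> z / mesh N + real N * a + 1"
      unfolding k_def by linarith+
    have zz: "z \<le> z'" "z' \<le> z + mesh N"
    proof -
      have "z / mesh N * mesh N \<le> (of_int k - real N * a) * mesh N" using k h by (intro mult_right_mono) auto
      thus "z \<le> z'" using h by (simp add: z'_def)
      have "(of_int k - real N * a) * mesh N \<le> (z / mesh N + 1) * mesh N" using k h by (intro mult_right_mono) auto
      thus "z' \<le> z + mesh N" using h by (simp add: z'_def distrib_right)
    qed
    have ev: "(Y N X \<le> z) = (Y N X < z')" for X
    proof -
      obtain j :: int where j: "site_count N X c = of_int j" using site_count_int by blast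
      have "(Y N X \<le> z) = (of_int j - real N * a \<le> z / mesh N)"
        unfolding Y_eq_count[OF N] j using h by (simp add: pos_le_divide_eq)
      also have "\<dots> = (j < k)" unfolding k_def by linarith
      also have "\<dots> = (Y N X < z')"
        unfolding Y_eq_count[OF N] j z'_def using h by (simp add: mult_less_cancel_right_pos)
      finally show ?thesis .
    qed
    have "\<bar>Phi z' * gm N (chi N) - Phi z * gm N (chi N)\<bar> \<le> \<bar>Phi z' - Phi z\<bar> * 1"
      unfolding left_diff_distrib[symmetric] abs_mult using gm_chi_nonneg gm_chi_le_1 by (intro mult_left_mono) auto
    also have "\<dots> \<le> mesh N"
    proof -
      have "\<bar>z' - z\<bar> \<le> mesh N" using zz by linarith
      thus ?thesis unfolding mult_1_right by (rule order_trans[OF Phi_lipschitz])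
    qed
    also have "mesh N = 1 / sd / sqrt (real N)" by (simp add: mesh_def)
    finally have "\<bar>Phi z' * gm N (chi N) - Phi z * gm N (chi N)\<bar> \<le> 1 / sd / sqrt (real N)" .
    thus "\<bar>gm N (\<lambda>X. chi N X * of_bool (Y N X \<le> z)) - Phi z * gm N (chi N)\<bar> \<le> (C + 1 / sd) / sqrt (real N)"
      using lattice[OF N z'_def] unfolding ev add_divide_distrib by linarith
  qed
qed

end

section \<open>Square roots of matrices and the normal vector\<close>

text \<open>Serves for first variations: at \<open>t = s / (\<bar>K\<bar> + 1)\<close> the linear
  term \<open>2 * t * s\<close> outgrows the quadratic one unless \<open>s = 0\<close>.\<close>

lemma quadratic_nonneg_imp_zero:
  fixes s K :: real
  assumes "s \<ge> 0" "\<And>t. 2 * t * s \<le> t\<^sup>2 * K"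
  shows "s = 0"
proof (rule ccontr)
  assume "s \<noteq> 0"
  hence s: "s > 0" using assms(1) by simp
  define t where "t = s / (\<bar>K\<bar> + 1)"
  have t: "t > 0" using s by (simp add: t_def add_nonneg_pos)
  have "t * (2 * s) \<le> t * (t * K)" using assms(2)[of t] by (simp add: power2_eq_square mult_ac)
  hence "2 * s \<le> t * K" using t by simp
  also have "\<dots> \<le> t * (\<bar>K\<bar> + 1)" using t by (intro mult_left_mono) auto
  also have "\<dots> = s" by (simp add: t_def add_nonneg_pos less_imp_neq[symmetric])
  finally show False using s by simp
qed

lemma symmetric_inner_swap:
  fixes A :: "real^'n^'n"
  assumes "transpose A = A"
  shows "x \<bullet> (A *v y) = (A *v x) \<bullet> y"
  using dot_lmul_matrix[of x A y] assms by (metis transpose_matrix_vector)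

text \<open>A maximizer \<open>e\<close> of the quadratic form on the unit sphere of
  \<open>U\<close> is an eigenvector: along \<open>w = A e - l e\<close> the first variation is
  \<open>2 t (w \<bullet> w)\<close> and has to vanish. The orthogonal complement of
  \<open>e\<close> in \<open>U\<close> is again invariant and has smaller dimension.\<close>

lemma symmetric_eigenbasis_subspace:
  fixes A :: "real^'n::finite^'n"
  assumes sym: "transpose A = A"
  shows "subspace U \<Longrightarrow> (\<forall>x\<in>U. A *v x \<in> U) \<Longrightarrow>
    \<exists>B. finite B \<and> pairwise orthogonal B \<and> (\<forall>e\<in>B. norm e = 1 \<and> A *v e = (e \<bullet> (A *v e)) *\<^sub>R e) \<and> span B = U"
proof (induction "dim U" arbitrary: U rule: less_induct)
  case (less U)
  note U = less.prems(1) and inv = less.prems(2)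
  show ?case
  proof (cases "U = {0}")
    case True
    thus ?thesis by (intro exI[of _ "{}"]) auto
  next
    case False
    then obtain u where u: "u \<in> U" "u \<noteq> 0" using subspace_0[OF U] by blast
    let ?S = "sphere 0 1 \<inter> U"
    have "u /\<^sub>R norm u \<in> ?S" using u U by (auto simp: subspace_scale)
    hence "?S \<noteq> {}" by blast
    moreover have "compact ?S" by (intro compact_Int_closed compact_sphere closed_subspace U)
    moreover have "continuous_on ?S (\<lambda>x. x \<bullet> (A *v x))"
      by (intro continuous_intros linear_continuous_on_compose[OF continuous_on_id matrix_vector_mul_linear])
    ultimately obtain e where e: "e \<in> ?S" "\<And>x. x \<in> ?S \<Longrightarrow> x \<bullet> (A *v x) \<le> e \<bullet> (A *v e)"
      using continuous_attains_sup[of ?S "\<lambda>x. x \<bullet> (A *v x)"] by blast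
    define l where "l = e \<bullet> (A *v e)"
    have e1: "norm e = 1" "e \<in> U" "e \<bullet> e = 1" using e(1) by (auto simp: norm_eq_1)
    have max: "x \<bullet> (A *v x) \<le> l * (x \<bullet> x)" if "x \<in> U" for x
    proof (cases "x = 0")
      case False
      have "(x /\<^sub>R norm x) \<bullet> (A *v (x /\<^sub>R norm x)) \<le> l"
        unfolding l_def by (rule e(2)) (use False that U in \<open>auto simp: subspace_scale\<close>)
      hence "(x \<bullet> (A *v x)) / (norm x)\<^sup>2 \<le> l"
        by (simp add: matrix_vector_mult_scaleR power2_eq_square divide_inverse mult_ac)
      thus ?thesis using False by (simp add: pos_divide_le_eq dot_square_norm)
    qed simp
    define w where "w = A *v e - l *\<^sub>R e"
    have wU: "w \<in> U" unfolding w_def using inv e1 U by (intro subspace_diff subspace_scale) auto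
    have "e \<bullet> w = 0" using e1 by (simp add: w_def inner_diff_right l_def)
    hence we: "w \<bullet> e = 0" by (simp add: inner_commute)
    have wA: "w \<bullet> (A *v e) = w \<bullet> w"
    proof -
      have "A *v e = w + l *\<^sub>R e" by (simp add: w_def)
      thus ?thesis using we by (simp add: inner_add_right)
    qed
    have "w \<bullet> w = 0"
    proof (rule quadratic_nonneg_imp_zero)
      fix t :: real
      let ?x = "e + t *\<^sub>R w"
      have "?x \<in> U" using e1 wU U by (intro subspace_add subspace_scale)
      from max[OF this] have "l + t * (e \<bullet> (A *v w)) + t * (w \<bullet> (A *v e)) + t * t * (w \<bullet> (A *v w)) \<le> l * (1 + t * t * (w \<bullet> w))"
        using e1 we by (simp add: matrix_vector_right_distrib matrix_vector_mult_scaleR inner_add_left inner_add_right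
            l_def[symmetric] inner_commute[of e w] algebra_simps)
      moreover have "e \<bullet> (A *v w) = w \<bullet> w"
        using symmetric_inner_swap[OF sym, of e w] wA by (simp add: inner_commute)
      ultimately show "2 * t * (w \<bullet> w) \<le> t\<^sup>2 * (l * (w \<bullet> w) - w \<bullet> (A *v w))"
        unfolding wA by (simp add: power2_eq_square algebra_simps)
    qed simp
    hence Ae: "A *v e = l *\<^sub>R e" by (simp add: w_def)
    let ?U = "{x \<in> U. x \<bullet> e = 0}"
    have sU: "subspace ?U" using U by (auto simp: subspace_def inner_add_left)
    have iU: "\<forall>x\<in>?U. A *v x \<in> ?U"
    proof
      fix x assume x: "x \<in> ?U"
      have "(A *v x) \<bullet> e = x \<bullet> (A *v e)" using symmetric_inner_swap[OF sym, of x e] by simp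
      thus "A *v x \<in> ?U" using x inv Ae by auto
    qed
    have "e \<notin> ?U" using e1 by simp
    hence "?U \<subset> U" using e1 by blast
    hence "span ?U \<subset> span U" using U sU by (simp only: span_eq_iff[THEN iffD2, OF U] span_eq_iff[THEN iffD2, OF sU])
    hence "dim ?U < dim U" by (rule dim_psubset)
    from less.hyps[OF this sU iU] obtain B where B: "finite B" "pairwise orthogonal B"
      "\<forall>e\<in>B. norm e = 1 \<and> A *v e = (e \<bullet> (A *v e)) *\<^sub>R e" "span B = ?U" by blast
    have BU: "b \<in> U" "b \<bullet> e = 0" if "b \<in> B" for b using B(4) span_base[OF that] by auto
    have "pairwise orthogonal (insert e B)"
      unfolding pairwise_insert using B(2) BU by (auto simp: orthogonal_def inner_commute)
    moreover have "span (insert e B) = U"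
    proof
      show "span (insert e B) \<subseteq> U" using BU e1 by (intro span_minimal U) auto
      show "U \<subseteq> span (insert e B)"
      proof
        fix x assume x: "x \<in> U"
        have "x - (x \<bullet> e) *\<^sub>R e \<in> ?U" using x e1 U by (auto simp: inner_diff_left intro!: subspace_diff subspace_scale)
        hence "x - (x \<bullet> e) *\<^sub>R e \<in> span B" using B(4) by simp
        thus "x \<in> span (insert e B)" unfolding span_insert by blast
      qed
    qed
    ultimately show ?thesis using B(1,3) e1 Ae by (intro exI[of _ "insert e B"]) (auto simp: l_def)
  qed
qed

lemma symmetric_eigenbasis:
  fixes A :: "real^'n::finite^'n"
  assumes sym: "transpose A = A"
  obtains B where "finite B" "\<And>e. e \<in> B \<Longrightarrow> norm e = 1" "\<And>e. e \<in> B \<Longrightarrow> A *v e = (e \<bullet> (A *v e)) *\<^sub>R e"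
    "\<And>x. (\<Sum>e\<in>B. (x \<bullet> e) *\<^sub>R e) = x" "\<And>d e. d \<in> B \<Longrightarrow> e \<in> B \<Longrightarrow> d \<noteq> e \<Longrightarrow> d \<bullet> e = 0"
proof -
  obtain B where B: "finite B" "pairwise orthogonal B"
      "\<forall>e\<in>B. norm e = 1 \<and> A *v e = (e \<bullet> (A *v e)) *\<^sub>R e" "span B = UNIV"
    using symmetric_eigenbasis_subspace[OF sym, of UNIV] by auto
  show ?thesis
  proof (rule that[OF B(1)])
    show "(\<Sum>e\<in>B. (x \<bullet> e) *\<^sub>R e) = x" for x
      by (rule orthonormal_basis_expand[OF B(2)]) (use B in auto)
    show "d \<bullet> e = 0" if "d \<in> B" "e \<in> B" "d \<noteq> e" for d e
      using B(2) that by (auto simp: pairwise_def orthogonal_def)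
  qed (use B(3) in auto)
qed

text \<open>A zero of a nonnegative form is a minimum, so the first variation along
  \<open>B *v x\<close> vanishes.\<close>

lemma psd_kernel:
  fixes B :: "real^'n::finite^'n"
  assumes sym: "transpose B = B" and psd: "\<And>x. 0 \<le> x \<bullet> (B *v x)" and zero: "x \<bullet> (B *v x) = 0"
  shows "B *v x = 0"
proof -
  define w where "w = B *v x"
  have "w \<bullet> w = 0"
  proof (rule quadratic_nonneg_imp_zero)
    fix t :: real
    have "0 \<le> (x - t *\<^sub>R w) \<bullet> (B *v (x - t *\<^sub>R w))" by (rule psd)
    also have "\<dots> = - t * (x \<bullet> (B *v w)) - t * (w \<bullet> w) + t * t * (w \<bullet> (B *v w))"
      using zero by (simp add: matrix_vector_mult_diff_distrib matrix_vector_mult_scaleR inner_diff_left inner_diff_right w_def[symmetric] algebra_simps)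
    also have "x \<bullet> (B *v w) = w \<bullet> w" using symmetric_inner_swap[OF sym, of x w] by (simp add: w_def)
    finally show "2 * t * (w \<bullet> w) \<le> t\<^sup>2 * (w \<bullet> (B *v w))" by (simp add: power2_eq_square algebra_simps)
  qed simp
  thus ?thesis by (simp add: w_def)
qed

text \<open>Equal squares give \<open>B D + D C = 0\<close> for the difference \<open>D\<close>. On
  an eigenvector \<open>e\<close> of \<open>D\<close> with eigenvalue \<open>l\<close> this reads
  \<open>l (e \<bullet> B e + e \<bullet> C e) = 0\<close>. So either \<open>l = 0\<close>, or both
  forms vanish at \<open>e\<close> and then \<open>B e = C e = 0\<close> by
  \<open>psd_kernel\<close>; in both cases \<open>D e = 0\<close>.\<close>

lemma psd_sqrt_unique:
  fixes B C :: "real^'n::finite^'n"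
  assumes B: "transpose B = B" "\<And>x. 0 \<le> x \<bullet> (B *v x)" and C: "transpose C = C" "\<And>x. 0 \<le> x \<bullet> (C *v x)"
    and eq: "B ** B = C ** C"
  shows "B = C"
proof -
  let ?D = "B - C"
  have mv: "?D *v x = B *v x - C *v x" for x by (simp add: matrix_vector_mult_diff_rdistrib)
  have symD: "transpose ?D = ?D" using B(1) C(1) by (simp add: transpose_def vec_eq_iff)
  obtain E where E: "finite E" "\<And>e. e \<in> E \<Longrightarrow> norm e = 1" "\<And>e. e \<in> E \<Longrightarrow> ?D *v e = (e \<bullet> (?D *v e)) *\<^sub>R e"
    "\<And>x. (\<Sum>e\<in>E. (x \<bullet> e) *\<^sub>R e) = x" "\<And>d e. d \<in> E \<Longrightarrow> e \<in> E \<Longrightarrow> d \<noteq> e \<Longrightarrow> d \<bullet> e = 0"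
    by (rule symmetric_eigenbasis[OF symD]) (rule that)
  have De: "?D *v e = 0" if e: "e \<in> E" for e
  proof -
    define l where "l = e \<bullet> (?D *v e)"
    have le: "B *v e - C *v e = l *\<^sub>R e" using E(3)[OF e] unfolding l_def mv .
    have "B *v (B *v e) = C *v (C *v e)" using eq by (metis matrix_vector_mul_assoc)
    hence "B *v (B *v e - C *v e) + (B *v (C *v e) - C *v (C *v e)) = 0"
      by (simp add: matrix_vector_mult_diff_distrib)
    hence "B *v (l *\<^sub>R e) + ?D *v (C *v e) = 0" unfolding le mv .
    hence "e \<bullet> (B *v (l *\<^sub>R e)) + e \<bullet> (?D *v (C *v e)) = 0"
      unfolding inner_add_right[symmetric] by simp
    moreover have "e \<bullet> (?D *v (C *v e)) = l * (e \<bullet> (C *v e))"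
      using symmetric_inner_swap[OF symD, of e "C *v e"] le unfolding mv by simp
    ultimately have "l * (e \<bullet> (B *v e) + e \<bullet> (C *v e)) = 0"
      by (simp add: matrix_vector_mult_scaleR algebra_simps)
    hence "l = 0 \<or> (e \<bullet> (B *v e) = 0 \<and> e \<bullet> (C *v e) = 0)"
      using B(2)[of e] C(2)[of e] by (auto simp: add_nonneg_eq_0_iff)
    thus ?thesis using psd_kernel[OF B, of e] psd_kernel[OF C, of e] le mv by auto
  qed
  have "?D *v x = 0" for x
  proof -
    have "?D *v (\<Sum>e\<in>E. (x \<bullet> e) *\<^sub>R e) = (\<Sum>e\<in>E. ?D *v ((x \<bullet> e) *\<^sub>R e))"
      by (rule linear_sum[OF matrix_vector_mul_linear])
    also have "\<dots> = 0" using De by (intro sum.neutral) (simp add: matrix_vector_mult_scaleR)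
    finally show ?thesis unfolding E(4) .
  qed
  hence "?D = 0" by (metis matrix_eq matrix_vector_mult_0)
  thus ?thesis by simp
qed

lemma psd_sqrt_exists:
  fixes A :: "real^'n::finite^'n"
  assumes sym: "transpose A = A" and psd: "\<And>x. 0 \<le> x \<bullet> (A *v x)"
  obtains B where "transpose B = B" "\<And>x. 0 \<le> x \<bullet> (B *v x)" "B ** B = A"
proof -
  obtain E where E: "finite E" "\<And>e. e \<in> E \<Longrightarrow> norm e = 1" "\<And>e. e \<in> E \<Longrightarrow> A *v e = (e \<bullet> (A *v e)) *\<^sub>R e"
    "\<And>x. (\<Sum>e\<in>E. (x \<bullet> e) *\<^sub>R e) = x" "\<And>d e. d \<in> E \<Longrightarrow> e \<in> E \<Longrightarrow> d \<noteq> e \<Longrightarrow> d \<bullet> e = 0"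
    by (rule symmetric_eigenbasis[OF sym]) (rule that)
  define s where "s e = sqrt (e \<bullet> (A *v e))" for e
  define f where "f x = (\<Sum>e\<in>E. (s e * (x \<bullet> e)) *\<^sub>R e)" for x
  have lin: "linear f"
    unfolding f_def by (intro linearI) (simp_all add: inner_add_left algebra_simps sum.distrib scaleR_sum_right scaleR_add_left)
  define B where "B = matrix f"
  have Bf: "B *v x = f x" for x unfolding B_def by (rule fun_cong[OF matrix_vector_mul(2)[OF lin]])
  have fe: "f x \<bullet> e = s e * (x \<bullet> e)" if e: "e \<in> E" for x e
  proof -
    have "f x \<bullet> e = (\<Sum>d\<in>E. (s d * (x \<bullet> d)) * (d \<bullet> e))" by (simp add: f_def inner_sum_left)
    also have "\<dots> = (\<Sum>d\<in>E. if d = e then s e * (x \<bullet> e) else 0)"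
      using E(2)[OF e] E(5) e by (intro sum.cong refl) (auto simp: norm_eq_1)
    also have "\<dots> = s e * (x \<bullet> e)" using E(1) e by simp
    finally show ?thesis .
  qed
  have xf: "x \<bullet> f y = (\<Sum>e\<in>E. s e * (y \<bullet> e) * (x \<bullet> e))" for x y
    by (simp add: f_def inner_sum_right)
  have symB: "transpose B = B"
  proof -
    have entry: "B $ i $ j = axis i 1 \<bullet> (B *v axis j 1)" for i j
      by (simp add: inner_axis' matrix_vector_mult_basis column_def)
    have "x \<bullet> (B *v y) = y \<bullet> (B *v x)" for x y
      unfolding Bf xf by (simp add: mult_ac)
    hence "B $ i $ j = B $ j $ i" for i j unfolding entry .
    thus ?thesis by (simp add: transpose_def vec_eq_iff)
  qed
  moreover have "0 \<le> x \<bullet> (B *v x)" for x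
    unfolding Bf xf using psd by (intro sum_nonneg) (simp add: s_def mult.assoc)
  moreover have "B ** B = A"
  proof -
    have "(B ** B) *v x = A *v x" for x
    proof -
      have "(B ** B) *v x = f (f x)" by (simp add: matrix_vector_mul_assoc[symmetric] Bf)
      also have "\<dots> = (\<Sum>e\<in>E. (x \<bullet> e) *\<^sub>R (A *v e))"
        unfolding f_def[of "f x"]
      proof (intro sum.cong refl)
        fix e assume e: "e \<in> E"
        have "s e * s e = e \<bullet> (A *v e)" using psd[of e] by (simp add: s_def)
        thus "(s e * (f x \<bullet> e)) *\<^sub>R e = (x \<bullet> e) *\<^sub>R (A *v e)"
          unfolding fe[OF e] by (subst E(3)[OF e]) (simp add: mult_ac)
      qed
      also have "\<dots> = (\<Sum>e\<in>E. A *v ((x \<bullet> e) *\<^sub>R e))" by (simp add: matrix_vector_mult_scaleR)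
      also have "\<dots> = A *v (\<Sum>e\<in>E. (x \<bullet> e) *\<^sub>R e)"
        by (rule linear_sum[OF matrix_vector_mul_linear, symmetric])
      finally show ?thesis unfolding E(4) .
    qed
    thus ?thesis by (simp add: matrix_eq)
  qed
  ultimately show ?thesis by (rule that)
qed

text \<open>Existence and uniqueness together make the definite description in
  \<open>psd_sqrt\<close> denote the intended matrix.\<close>

lemma psd_sqrt_properties:
  fixes A :: "real^'n::finite^'n"
  assumes sym: "transpose A = A" and psd: "\<And>x. 0 \<le> x \<bullet> (A *v x)"
  shows "transpose (psd_sqrt A) = psd_sqrt A" "psd_sqrt A ** psd_sqrt A = A"
proof -
  let ?P = "\<lambda>B. transpose B = B \<and> (\<forall>x. 0 \<le> x \<bullet> (B *v x)) \<and> B ** B = A"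
  obtain B where "transpose B = B" "\<And>x. 0 \<le> x \<bullet> (B *v x)" "B ** B = A"
    by (rule psd_sqrt_exists[OF assms]) (rule that)
  hence B: "?P B" by auto
  have "?P (psd_sqrt A)" unfolding psd_sqrt_def
  proof (rule theI[of ?P, OF B])
    fix C assume "?P C"
    thus "C = B" using B by - (rule psd_sqrt_unique, auto)
  qed
  thus "transpose (psd_sqrt A) = psd_sqrt A" "psd_sqrt A ** psd_sqrt A = A" by auto
qed

section \<open>The standard normal vector\<close>

lemma prod_Basis_cart:
  fixes f :: "real^'n::finite \<Rightarrow> 'a::comm_monoid_mult"
  shows "(\<Prod>b\<in>Basis. f b) = (\<Prod>r\<in>UNIV. f (axis r 1))"
proof -
  have "(Basis :: (real^'n) set) = range (\<lambda>r. axis r 1)" by (auto simp: Basis_vec_def)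
  moreover have inj: "inj (\<lambda>r::'n. axis r (1::real))" by (auto simp: inj_def axis_eq_axis)
  ultimately have "(\<Prod>b\<in>Basis. f b) = prod f (range (\<lambda>r. axis r 1))" by (simp only:)
  also have "\<dots> = prod (f \<circ> (\<lambda>r. axis r 1)) UNIV" by (rule prod.reindex[OF inj])
  finally show ?thesis by (simp add: comp_def)
qed

text \<open>Coordinates are identified with basis vectors through \<open>axis\<close>, so that the
  product formula for \<open>lborel\<close>, stated over \<open>Basis\<close>, applies.\<close>

lemma emeasure_std_normal_vector_box:
  fixes A :: "'n::finite \<Rightarrow> real set"
  assumes A: "\<And>r. A r \<in> sets borel"
  shows "emeasure std_normal_vector {z. \<forall>r. z $ r \<in> A r} = (\<Prod>r\<in>UNIV. emeasure std_normal_distribution (A r))"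
proof -
  let ?i = "inv (\<lambda>r::'n. axis r (1::real))"
  have inj: "inj (\<lambda>r::'n. axis r (1::real))" by (auto simp: inj_def axis_eq_axis)
  have i: "?i (axis r 1) = r" for r using inv_f_f[OF inj] by simp
  define f where "f b t = ennreal (phi t) * indicator (A (?i b)) t" for b t
  have fm: "f b \<in> borel_measurable borel" for b unfolding f_def using A by measurable
  have m: "{z :: real^'n. \<forall>r. z $ r \<in> A r} \<in> sets borel"
  proof -
    have "{z :: real^'n. \<forall>r. z $ r \<in> A r} = (\<Inter>r. (\<lambda>z. z $ r) -` A r \<inter> space borel)" by auto
    also have "\<dots> \<in> sets borel" using A by (intro sets.finite_INT measurable_sets[OF _ A]) auto
    finally show ?thesis .
  qed
  have "emeasure std_normal_vector {z. \<forall>r. z $ r \<in> A r}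
      = (\<integral>\<^sup>+z. ennreal (\<Prod>r\<in>UNIV. phi (z $ r)) * indicator {z. \<forall>r. z $ r \<in> A r} z \<partial>(lborel :: (real^'n) measure))"
    unfolding std_normal_vector_def by (rule emeasure_density) (use m in auto)
  also have "\<dots> = (\<integral>\<^sup>+z. (\<Prod>b\<in>Basis. f b (z \<bullet> b)) \<partial>(lborel :: (real^'n) measure))"
  proof (rule nn_integral_cong)
    fix z :: "real^'n"
    have "indicator {z. \<forall>r. z $ r \<in> A r} z = (\<Prod>r\<in>UNIV. indicator (A r) (z $ r) :: ennreal)"
    proof (cases "\<forall>r. z $ r \<in> A r")
      case False
      then obtain r where "z $ r \<notin> A r" by auto
      hence "(\<Prod>r\<in>UNIV. indicator (A r) (z $ r) :: ennreal) = 0" by (intro prod_zero bexI[of _ r]) simp_all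
      thus ?thesis using False by simp
    qed simp
    moreover have "ennreal (\<Prod>r\<in>UNIV. phi (z $ r)) = (\<Prod>r\<in>UNIV. ennreal (phi (z $ r)))"
      by (rule prod_ennreal[symmetric]) (simp add: phi_pos less_imp_le)
    ultimately show "ennreal (\<Prod>r\<in>UNIV. phi (z $ r)) * indicator {z. \<forall>r. z $ r \<in> A r} z = (\<Prod>b\<in>Basis. f b (z \<bullet> b))"
      unfolding prod_Basis_cart f_def i by (simp add: prod.distrib cart_eq_inner_axis[symmetric])
  qed
  also have "\<dots> = (\<Prod>b\<in>Basis. \<integral>\<^sup>+t. f b t \<partial>lborel)"
    by (rule nn_integral_lborel_prod) (use fm in auto)
  also have "\<dots> = (\<Prod>r\<in>UNIV. emeasure std_normal_distribution (A r))"
    unfolding prod_Basis_cart f_def i using A by (intro prod.cong refl emeasure_density[symmetric]) auto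
  finally show ?thesis .
qed

lemma prob_space_std_normal_vector: "prob_space (std_normal_vector :: (real^'n::finite) measure)"
proof
  have "emeasure (std_normal_vector :: (real^'n) measure) {z. \<forall>r. z $ r \<in> (UNIV :: real set)}
      = (\<Prod>r\<in>(UNIV :: 'n set). emeasure std_normal_distribution UNIV)"
    by (rule emeasure_std_normal_vector_box) simp
  also have "emeasure std_normal_distribution UNIV = 1"
    using std_normal.emeasure_space_1 by simp
  finally show "emeasure (std_normal_vector :: (real^'n) measure) (space std_normal_vector) = 1"
    by (simp add: std_normal_vector_def)
qed

lemma sets_std_normal_vector [simp, measurable_cong]: "sets std_normal_vector = sets borel"
  by (simp add: std_normal_vector_def)

lemma space_std_normal_vector [simp]: "space std_normal_vector = UNIV"
  by (simp add: std_normal_vector_def)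

lemma measure_std_normal_vector_halfspace:
  fixes u :: "real^'n::finite"
  assumes u: "u \<noteq> 0"
  shows "measure std_normal_vector {z. u \<bullet> z \<le> x} = Phi (x / norm u)"
proof -
  interpret N: prob_space "std_normal_vector :: (real^'n) measure" by (rule prob_space_std_normal_vector)
  have coord: "(\<lambda>z :: real^'n. z $ r) \<in> borel_measurable borel" for r by simp
  have single: "emeasure std_normal_vector {z. z $ r \<in> A} = emeasure std_normal_distribution A"
    if A: "A \<in> sets borel" for A and r :: 'n
  proof -
    have "{z :: real^'n. z $ r \<in> A} = {z. \<forall>s. z $ s \<in> (if s = r then A else UNIV)}" by auto
    hence "emeasure std_normal_vector {z :: real^'n. z $ r \<in> A}
        = (\<Prod>s\<in>UNIV. emeasure std_normal_distribution (if s = r then A else UNIV))"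
      using A emeasure_std_normal_vector_box[of "\<lambda>s. if s = r then A else UNIV"] by simp
    also have "\<dots> = (\<Prod>s\<in>UNIV. if s = r then emeasure std_normal_distribution A else 1)"
      using std_normal.emeasure_space_1 by (intro prod.cong) auto
    finally show ?thesis by simp
  qed
  have dist1: "distributed std_normal_vector lborel (\<lambda>z :: real^'n. z $ r) phi" for r
    unfolding distributed_def
  proof (intro conjI)
    show "distr std_normal_vector lborel (\<lambda>z :: real^'n. z $ r) = std_normal_distribution"
    proof (rule measure_eqI)
      fix A assume "A \<in> sets (distr std_normal_vector lborel (\<lambda>z :: real^'n. z $ r))"
      hence A: "A \<in> sets borel" by simp
      have "emeasure (distr std_normal_vector lborel (\<lambda>z :: real^'n. z $ r)) A = emeasure std_normal_vector {z :: real^'n. z $ r \<in> A}"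
        using A by (subst emeasure_distr) (auto simp: vimage_def)
      thus "emeasure (distr std_normal_vector lborel (\<lambda>z :: real^'n. z $ r)) A = emeasure std_normal_distribution A"
        using single[OF A] by simp
    qed simp
  qed auto
  have indep: "N.indep_vars (\<lambda>_. borel) (\<lambda>r z. z $ r) UNIV"
  proof (subst N.indep_vars_finite[where E = "\<lambda>_. sets borel"])
    show "\<forall>A\<in>UNIV \<rightarrow> sets borel. N.prob (\<Inter>j\<in>UNIV. (\<lambda>z. z $ j) -` A j \<inter> space std_normal_vector)
        = (\<Prod>j\<in>UNIV. N.prob ((\<lambda>z. z $ j) -` A j \<inter> space std_normal_vector))"
    proof
      fix A :: "'n \<Rightarrow> real set" assume "A \<in> UNIV \<rightarrow> sets borel"
      hence A: "A r \<in> sets borel" for r by auto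
      have "(\<Inter>j\<in>UNIV. (\<lambda>z :: real^'n. z $ j) -` A j \<inter> space std_normal_vector) = {z. \<forall>r. z $ r \<in> A r}" by auto
      hence "emeasure std_normal_vector (\<Inter>j\<in>UNIV. (\<lambda>z :: real^'n. z $ j) -` A j \<inter> space std_normal_vector)
          = (\<Prod>r\<in>UNIV. emeasure std_normal_distribution (A r))"
        using emeasure_std_normal_vector_box[OF A] by simp
      also have "\<dots> = (\<Prod>r\<in>UNIV. emeasure std_normal_vector ((\<lambda>z :: real^'n. z $ r) -` A r \<inter> space std_normal_vector))"
        using single[OF A] by (intro prod.cong refl) (simp add: vimage_def)
      finally have "ennreal (N.prob (\<Inter>j\<in>UNIV. (\<lambda>z. z $ j) -` A j \<inter> space std_normal_vector))
        = (\<Prod>j\<in>UNIV. ennreal (N.prob ((\<lambda>z. z $ j) -` A j \<inter> space std_normal_vector)))"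
        by (simp only: N.emeasure_eq_measure)
      thus "N.prob (\<Inter>j\<in>UNIV. (\<lambda>z. z $ j) -` A j \<inter> space std_normal_vector)
        = (\<Prod>j\<in>UNIV. N.prob ((\<lambda>z. z $ j) -` A j \<inter> space std_normal_vector))"
        by (subst (asm) prod_ennreal) (auto simp: prod_nonneg)
    qed
  qed (auto simp: Int_stable_def sets.sigma_sets_eq[of borel, simplified])
  \<comment> \<open>The theorem on sums of independent normal variables requires positive standard
    deviations, so zero coefficients are dropped.\<close>
  let ?I = "{r. u $ r \<noteq> 0}"
  have I: "finite ?I" "?I \<noteq> {}" using u by (auto simp: vec_eq_iff)
  have "distributed std_normal_vector lborel (\<lambda>z. \<Sum>r\<in>?I. u $ r * z $ r)
      (normal_density (\<Sum>r\<in>?I. 0) (sqrt (\<Sum>r\<in>?I. \<bar>u $ r\<bar>\<^sup>2)))"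
  proof (rule N.sum_indep_normal[OF I])
    have "N.indep_vars (\<lambda>_. borel) (\<lambda>r. (\<lambda>t. u $ r * t) \<circ> (\<lambda>z. z $ r)) ?I"
      by (rule N.indep_vars_compose[OF N.indep_vars_subset[OF indep]]) auto
    thus "N.indep_vars (\<lambda>_. borel) (\<lambda>r z. u $ r * z $ r) ?I" by (simp add: comp_def)
    fix r assume r: "r \<in> ?I"
    thus "0 < \<bar>u $ r\<bar>" by simp
    have "distributed std_normal_vector lborel (\<lambda>z. 0 + u $ r * z $ r) (normal_density (0 + u $ r * 0) (\<bar>u $ r\<bar> * 1))"
      by (rule N.normal_density_affine[OF dist1]) (use r in auto)
    thus "distributed std_normal_vector lborel (\<lambda>z. u $ r * z $ r) (normal_density 0 \<bar>u $ r\<bar>)" by simp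
  qed
  moreover have "(\<Sum>r\<in>?I. u $ r * z $ r) = u \<bullet> z" for z
    unfolding inner_vec_def by (rule sum.mono_neutral_cong_left) auto
  moreover have "sqrt (\<Sum>r\<in>?I. \<bar>u $ r\<bar>\<^sup>2) = norm u"
  proof -
    have "(\<Sum>r\<in>?I. \<bar>u $ r\<bar>\<^sup>2) = u \<bullet> u"
      unfolding inner_vec_def by (rule sum.mono_neutral_cong_left) (auto simp: power2_eq_square)
    thus ?thesis by (simp add: norm_eq_sqrt_inner)
  qed
  ultimately have "distributed std_normal_vector lborel (\<lambda>z. u \<bullet> z) (normal_density 0 (norm u))" by simp
  hence "distributed std_normal_vector lborel (\<lambda>z. (u \<bullet> z - 0) / norm u) phi"
    using N.normal_standard_normal_convert[of "norm u" "\<lambda>z. u \<bullet> z" 0] u by simp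
  hence d: "distr std_normal_vector lborel (\<lambda>z. (u \<bullet> z) / norm u) = std_normal_distribution"
    by (simp add: distributed_def)
  have "Phi (x / norm u) = measure (distr std_normal_vector lborel (\<lambda>z. (u \<bullet> z) / norm u)) {..x / norm u}"
    unfolding d cdf_def ..
  also have "\<dots> = measure std_normal_vector ((\<lambda>z. (u \<bullet> z) / norm u) -` {..x / norm u} \<inter> space std_normal_vector)"
    by (rule measure_distr) auto
  also have "(\<lambda>z. (u \<bullet> z) / norm u) -` {..x / norm u} \<inter> space std_normal_vector = {z. u \<bullet> z \<le> x}"
    using u by (auto simp: divide_le_cancel)
  finally show ?thesis by simp
qed

section \<open>The conditional covariance and the weights of the peaks\<close>

lemma measurable_potts:
  fixes f :: "(nat \<Rightarrow> 'q::finite) \<Rightarrow> real"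
  shows "f \<in> borel_measurable (potts p b N)"
  by (auto simp: measurable_def sets_potts space_potts)

lemma integral_uniform_potts:
  fixes f :: "(nat \<Rightarrow> 'q::finite) \<Rightarrow> real"
  assumes A: "A \<subseteq> configs N" and pos: "gibbs_mean p b N (indicator A) > 0"
  shows "(LINT X|uniform_measure (potts p b N) A. f X)
    = gibbs_mean p b N (\<lambda>X. indicator A X * f X) / gibbs_mean p b N (indicator A)"
proof -
  let ?P = "gibbs_mean p b N (indicator A)"
  have d: "(\<lambda>x. indicator A x / emeasure (potts p b N) A :: ennreal) = (\<lambda>x. ennreal (indicator A x / ?P))"
  proof
    fix x
    show "indicator A x / emeasure (potts p b N) A = ennreal (indicator A x / ?P)"
      unfolding emeasure_potts[OF A] using pos divide_ennreal[of 1 ?P] by (cases "x \<in> A") auto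
  qed
  have "(LINT X|uniform_measure (potts p b N) A. f X) = (LINT X|potts p b N. (indicator A X / ?P) *\<^sub>R f X)"
    unfolding uniform_measure_def d
    by (rule integral_density) (use pos in \<open>auto intro!: measurable_potts\<close>)
  also have "\<dots> = gibbs_mean p b N (\<lambda>X. (1 / ?P) * (indicator A X * f X))"
    unfolding integral_potts by simp
  also have "\<dots> = (1 / ?P) * gibbs_mean p b N (\<lambda>X. indicator A X * f X)" by (rule gibbs_mean_cmult)
  finally show ?thesis by simp
qed

context potts_ball
begin

definition cond_mean :: "nat \<Rightarrow> ((nat \<Rightarrow> 'q) \<Rightarrow> real) \<Rightarrow> real" where
  "cond_mean N f = gm N (\<lambda>X. chi N X * f X) / gm N (chi N)"

lemma cond_mean_cmult: "cond_mean N (\<lambda>X. k * f X) = k * cond_mean N f"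
proof -
  have "gm N (\<lambda>X. chi N X * (k * f X)) = k * gm N (\<lambda>X. chi N X * f X)"
    unfolding gibbs_mean_cmult[symmetric] by (simp only: mult.left_commute)
  thus ?thesis by (simp add: cond_mean_def)
qed

lemma cond_mean_sum: "cond_mean N (\<lambda>X. \<Sum>i\<in>I. f i X) = (\<Sum>i\<in>I. cond_mean N (f i))"
  by (simp add: cond_mean_def sum_distrib_left gibbs_mean_sum sum_divide_distrib)

lemma cond_mean_add: "cond_mean N (\<lambda>X. f X + g X) = cond_mean N f + cond_mean N g"
  by (simp add: cond_mean_def distrib_left gibbs_mean_add add_divide_distrib)

lemma cond_mean_const: "gm N (chi N) > 0 \<Longrightarrow> cond_mean N (\<lambda>X. k) = k"
proof -
  assume "gm N (chi N) > 0"
  moreover have "gm N (\<lambda>X. chi N X * k) = k * gm N (chi N)"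
    unfolding gibbs_mean_cmult[symmetric] by (simp only: mult.commute)
  ultimately show ?thesis by (simp add: cond_mean_def)
qed

lemma cond_mean_nonneg: "(\<And>X. 0 \<le> f X) \<Longrightarrow> 0 \<le> cond_mean N f"
  unfolding cond_mean_def by (intro divide_nonneg_nonneg gibbs_mean_nonneg mult_nonneg_nonneg chi_nonneg)

lemma cond_mean_integral:
  assumes "gm N (chi N) > 0"
  shows "(LINT X|uniform_measure (potts p \<beta> N) {X \<in> configs N. magnetization N X \<in> ball m \<epsilon>}. f X) = cond_mean N f"
proof -
  let ?A = "{X \<in> configs N. magnetization N X \<in> ball m \<epsilon>}"
  have 1: "gm N (indicator ?A) = gm N (chi N)"
    by (rule gibbs_mean_cong) (simp add: chi_def indicator_def)
  have 2: "gm N (\<lambda>X. indicator ?A X * f X) = gm N (\<lambda>X. chi N X * f X)"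
    by (rule gibbs_mean_cong) (simp add: chi_def indicator_def)
  show ?thesis unfolding cond_mean_def 1[symmetric] 2[symmetric]
  proof (rule integral_uniform_potts)
    show "0 < gm N (indicator ?A)" unfolding 1 by (rule assms)
  qed auto
qed

definition dev :: "nat \<Rightarrow> (nat \<Rightarrow> 'q) \<Rightarrow> real^'q" where
  "dev N X = (\<chi> r. sqrt (real N) * (V N X $ r - cond_mean N (\<lambda>X. V N X $ r)))"

abbreviation Sig :: "nat \<Rightarrow> real^'q^'q" where "Sig N \<equiv> cond_covariance p \<beta> \<epsilon> N m"

lemma Sig_nth:
  assumes "gm N (chi N) > 0"
  shows "Sig N $ r $ s = cond_mean N (\<lambda>X. dev N X $ r * dev N X $ s)"
proof -
  have "Sig N $ r $ s = cond_mean N (\<lambda>X. (sqrt (real N) * V N X $ r - cond_mean N (\<lambda>X. sqrt (real N) * V N X $ r))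
      * (sqrt (real N) * V N X $ s - cond_mean N (\<lambda>X. sqrt (real N) * V N X $ s)))"
    unfolding cond_covariance_def covariance_matrix_def cond_mean_integral[OF assms] V_def by simp
  thus ?thesis by (simp add: dev_def cond_mean_cmult right_diff_distrib)
qed

lemma Sig_inner:
  assumes "gm N (chi N) > 0"
  shows "x \<bullet> (Sig N *v y) = cond_mean N (\<lambda>X. (x \<bullet> dev N X) * (y \<bullet> dev N X))"
proof -
  have "x \<bullet> (Sig N *v y) = (\<Sum>r\<in>UNIV. \<Sum>s\<in>UNIV. (x $ r * y $ s) * Sig N $ r $ s)"
    unfolding inner_vec_def matrix_vector_mult_def by (simp add: sum_distrib_left mult_ac)
  also have "\<dots> = (\<Sum>r\<in>UNIV. \<Sum>s\<in>UNIV. cond_mean N (\<lambda>X. (x $ r * y $ s) * (dev N X $ r * dev N X $ s)))"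
    by (simp only: Sig_nth[OF assms] cond_mean_cmult)
  also have "\<dots> = cond_mean N (\<lambda>X. \<Sum>r\<in>UNIV. \<Sum>s\<in>UNIV. (x $ r * y $ s) * (dev N X $ r * dev N X $ s))"
    by (simp only: cond_mean_sum)
  also have "(\<lambda>X. \<Sum>r\<in>UNIV. \<Sum>s\<in>UNIV. (x $ r * y $ s) * (dev N X $ r * dev N X $ s)) = (\<lambda>X. (x \<bullet> dev N X) * (y \<bullet> dev N X))"
    by (simp add: inner_vec_def sum_product mult_ac)
  finally show ?thesis .
qed

lemma Sig_symmetric: "gm N (chi N) > 0 \<Longrightarrow> transpose (Sig N) = Sig N"
  by (simp add: vec_eq_iff transpose_def Sig_nth mult.commute)

lemma Sig_psd: "gm N (chi N) > 0 \<Longrightarrow> 0 \<le> x \<bullet> (Sig N *v x)"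
  unfolding Sig_inner by (rule cond_mean_nonneg) simp

text \<open>The variance of \<open>sqrt N * V $ c\<close> conditioned on the ball, in expanded form.
  By \<open>rho_Sig_rho\<close> it is all that the limit law needs of the covariance matrix.\<close>

definition varN :: "nat \<Rightarrow> real" where
  "varN N = cond_mean N (\<lambda>X. real N * (V N X $ c)\<^sup>2) - real N * (cond_mean N (\<lambda>X. V N X $ c))\<^sup>2"

text \<open>The centred deviation has coordinate sum zero as well, so \<open>rho\<close> sees only
  its \<open>c\<close>-th coordinate.\<close>

lemma rho_Sig_rho:
  assumes N: "N \<ge> 1" and pos: "gm N (chi N) > 0"
  shows "rho p \<beta> m \<bullet> (Sig N *v rho p \<beta> m) = gam\<^sup>2 * varN N"
proof -
  define \<mu> where "\<mu> = cond_mean N (\<lambda>X. V N X $ c)"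
  have "(\<Sum>r\<in>UNIV. cond_mean N (\<lambda>X. V N X $ r)) = 0"
    unfolding cond_mean_sum[symmetric] sum_V[OF N] by (rule cond_mean_const[OF pos])
  hence "(\<Sum>r\<in>UNIV. dev N X $ r) = 0" for X
    using sum_V[OF N, of X] by (simp add: dev_def sum_distrib_left[symmetric] sum_subtractf)
  hence "rho p \<beta> m \<bullet> dev N X = gam * (sqrt (real N) * (V N X $ c - \<mu>))" for X
    using rho_inner[of "dev N X"] by (simp add: dev_def \<mu>_def)
  hence "rho p \<beta> m \<bullet> (Sig N *v rho p \<beta> m)
      = cond_mean N (\<lambda>X. (gam * (sqrt (real N) * (V N X $ c - \<mu>))) * (gam * (sqrt (real N) * (V N X $ c - \<mu>))))"
    unfolding Sig_inner[OF pos] by (simp only:)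
  also have "(\<lambda>X. (gam * (sqrt (real N) * (V N X $ c - \<mu>))) * (gam * (sqrt (real N) * (V N X $ c - \<mu>))))
      = (\<lambda>X. gam\<^sup>2 * (real N * (V N X $ c)\<^sup>2 + ((- 2 * real N * \<mu>) * V N X $ c + real N * \<mu>\<^sup>2)))"
  proof
    fix X :: "nat \<Rightarrow> 'q"
    have "(g * (s * d)) * (g * (s * d)) = g\<^sup>2 * ((s * s) * d\<^sup>2)" for g s d :: real
      by (simp add: power2_eq_square mult_ac)
    hence "(gam * (sqrt (real N) * (V N X $ c - \<mu>))) * (gam * (sqrt (real N) * (V N X $ c - \<mu>)))
        = gam\<^sup>2 * (real N * (V N X $ c - \<mu>)\<^sup>2)" by (simp only: sqrt_sq_real)
    also have "real N * (V N X $ c - \<mu>)\<^sup>2 = real N * (V N X $ c)\<^sup>2 + ((- 2 * real N * \<mu>) * V N X $ c + real N * \<mu>\<^sup>2)"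
      by (simp add: power2_eq_square algebra_simps)
    finally show "(gam * (sqrt (real N) * (V N X $ c - \<mu>))) * (gam * (sqrt (real N) * (V N X $ c - \<mu>)))
        = gam\<^sup>2 * (real N * (V N X $ c)\<^sup>2 + ((- 2 * real N * \<mu>) * V N X $ c + real N * \<mu>\<^sup>2))" .
  qed
  also have "cond_mean N (\<lambda>X. gam\<^sup>2 * (real N * (V N X $ c)\<^sup>2 + ((- 2 * real N * \<mu>) * V N X $ c + real N * \<mu>\<^sup>2)))
      = gam\<^sup>2 * (cond_mean N (\<lambda>X. real N * (V N X $ c)\<^sup>2) + ((- 2 * real N * \<mu>) * \<mu> + real N * \<mu>\<^sup>2))"
    unfolding cond_mean_cmult[of N "gam\<^sup>2"] cond_mean_add cond_mean_cmult[of N "- 2 * real N * \<mu>"] cond_mean_const[OF pos]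
    unfolding \<mu>_def ..
  also have "\<dots> = gam\<^sup>2 * varN N"
    by (simp add: varN_def \<mu>_def[symmetric] power2_eq_square)
  finally show ?thesis .
qed

text \<open>Moving the symmetric square root \<open>B\<close> to the other side gives a linear form
  in a standard normal vector. Its variance is \<open>rho \<bullet> (B (B rho))\<close>, and
  \<open>B ** B\<close> is the covariance matrix; the root itself is never computed.\<close>

lemma cond_normal_halfspace:
  assumes N: "N \<ge> 1" and pos: "gm N (chi N) > 0" and v: "varN N > 0"
  shows "measure std_normal_vector {z. rho p \<beta> m \<bullet> (psd_sqrt (Sig N) *v z) \<le> x} = Phi (x / (gam * sqrt (varN N)))"
proof -
  let ?B = "psd_sqrt (Sig N)" and ?r = "rho p \<beta> m"
  note B = psd_sqrt_properties[OF Sig_symmetric[OF pos] Sig_psd[OF pos]]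
  have swap: "?r \<bullet> (?B *v z) = (?B *v ?r) \<bullet> z" for z by (rule symmetric_inner_swap[OF B(1)])
  have "(?B *v ?r) \<bullet> (?B *v ?r) = ?r \<bullet> (?B *v (?B *v ?r))" by (simp add: swap)
  also have "\<dots> = gam\<^sup>2 * varN N"
    unfolding matrix_vector_mul_assoc B(2) by (rule rho_Sig_rho[OF N pos])
  finally have nsq: "(?B *v ?r) \<bullet> (?B *v ?r) = gam\<^sup>2 * varN N" .
  hence n: "norm (?B *v ?r) = gam * sqrt (varN N)"
    using gam_pos by (simp add: norm_eq_sqrt_inner real_sqrt_mult)
  have "?B *v ?r \<noteq> 0" using n gam_pos v by auto
  thus ?thesis unfolding swap by (simp add: measure_std_normal_vector_halfspace n)
qed

text \<open>Conditional means divide by the probability of the ball, hence the lower bound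
  \<open>d\<close> for it. The squared mean contributes only \<open>O(1 / N)\<close>.\<close>

lemma varN_approx:
  assumes d: "d > 0"
  obtains C where "C \<ge> 0" "\<And>N. N \<ge> 3 \<Longrightarrow> gm N (chi N) \<ge> d \<Longrightarrow> \<bar>varN N - var\<bar> \<le> C * (ln (real N) / sqrt (real N))"
proof -
  obtain C1 where C1: "C1 \<ge> 0" "\<And>N. N \<ge> 3 \<Longrightarrow>
    \<bar>gm N (\<lambda>X. chi N X * (real N * (V N X $ c)\<^sup>2)) - var * gm N (chi N)\<bar> \<le> C1 * (ln (real N) / sqrt (real N))"
    by (rule variance_approx) (rule that)
  obtain C2 where C2: "C2 \<ge> 0" "\<And>N. N \<ge> 1 \<Longrightarrow> \<bar>gm N (\<lambda>X. chi N X * V N X $ c)\<bar> \<le> C2 / real N"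
    by (rule mean_bound) (rule that)
  show ?thesis
  proof (rule that[of "C1 / d + (C2 / d)\<^sup>2"])
    show "C1 / d + (C2 / d)\<^sup>2 \<ge> 0" using C1 d by simp
    fix N :: nat assume N3: "N \<ge> 3" and pd: "gm N (chi N) \<ge> d"
    hence N: "N \<ge> 1" by simp
    have n: "real N \<ge> 1" using N by simp
    let ?L = "ln (real N) / sqrt (real N)"
    define P where "P = gm N (chi N)"
    have P: "P \<ge> d" "P > 0" using pd d by (auto simp: P_def)
    have L: "1 / real N \<le> ?L"
    proof -
      have "1 / real N \<le> 1 / sqrt (real N)" using n by (intro divide_left_mono) (auto intro!: real_le_lsqrt simp: power2_eq_square)
      also have "\<dots> \<le> ?L" using ln_ge_1[OF N3] by (intro divide_right_mono) auto
      finally show ?thesis .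
    qed
    have L0: "?L \<ge> 0" using L n by (smt (verit) divide_nonneg_nonneg of_nat_0_le_iff)
    have "\<bar>cond_mean N (\<lambda>X. real N * (V N X $ c)\<^sup>2) - var\<bar> = \<bar>gm N (\<lambda>X. chi N X * (real N * (V N X $ c)\<^sup>2)) - var * P\<bar> / P"
    proof -
      have "cond_mean N (\<lambda>X. real N * (V N X $ c)\<^sup>2) - var = (gm N (\<lambda>X. chi N X * (real N * (V N X $ c)\<^sup>2)) - var * P) / P"
        using P by (simp add: cond_mean_def P_def[symmetric] diff_divide_distrib)
      thus ?thesis using P by (simp only: abs_divide abs_of_pos)
    qed
    also have "\<dots> \<le> (C1 * ?L) / d"
      using C1(2)[OF N3] P d L0 C1(1) unfolding P_def[symmetric] by (intro frac_le) auto
    finally have 1: "\<bar>cond_mean N (\<lambda>X. real N * (V N X $ c)\<^sup>2) - var\<bar> \<le> (C1 * ?L) / d" .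
    have "\<bar>cond_mean N (\<lambda>X. V N X $ c)\<bar> \<le> (C2 / real N) / d"
      unfolding cond_mean_def abs_divide P_def[symmetric] abs_of_pos[OF P(2)]
      using C2(2)[OF N] C2(1) P d by (intro frac_le) auto
    hence "(cond_mean N (\<lambda>X. V N X $ c))\<^sup>2 \<le> ((C2 / real N) / d)\<^sup>2"
      using C2(1) d by (subst abs_le_square_iff[symmetric]) (simp add: abs_of_nonneg)
    hence "real N * (cond_mean N (\<lambda>X. V N X $ c))\<^sup>2 \<le> real N * ((C2 / real N) / d)\<^sup>2"
      by (intro mult_left_mono) auto
    also have "\<dots> = (C2 / d)\<^sup>2 * (1 / real N)" using n by (simp add: power2_eq_square)
    also have "\<dots> \<le> (C2 / d)\<^sup>2 * ?L" using L by (intro mult_left_mono) auto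
    finally have 2: "real N * (cond_mean N (\<lambda>X. V N X $ c))\<^sup>2 \<le> (C2 / d)\<^sup>2 * ?L" .
    have "0 \<le> real N * (cond_mean N (\<lambda>X. V N X $ c))\<^sup>2" by simp
    hence "\<bar>varN N - var\<bar> \<le> (C1 * ?L) / d + (C2 / d)\<^sup>2 * ?L" using 1 2 unfolding varN_def by linarith
    thus "\<bar>varN N - var\<bar> \<le> (C1 / d + (C2 / d)\<^sup>2) * ?L" by (simp only: distrib_right times_divide_eq_left)
  qed
qed

end

section \<open>Colour permutations and the equal weight of the peaks\<close>

definition permute_config :: "('q \<Rightarrow> 'q) \<Rightarrow> nat \<Rightarrow> (nat \<Rightarrow> 'q::finite) \<Rightarrow> nat \<Rightarrow> 'q" where
  "permute_config \<pi> N X = restrict (\<pi> \<circ> X) {1..N}"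

lemma permute_config_mem: "X \<in> configs N \<Longrightarrow> permute_config \<pi> N X \<in> configs N"
  by (simp add: permute_config_def configs_def)

lemma permute_config_involution:
  assumes "\<And>r. \<pi> (\<pi> r) = r" "X \<in> configs N"
  shows "permute_config \<pi> N (permute_config \<pi> N X) = X"
  using assms(2) by (auto simp: permute_config_def configs_def assms(1) restrict_def PiE_def extensional_def fun_eq_iff)

lemma magnetization_permute_config:
  assumes "\<And>r. \<pi> (\<pi> r) = r"
  shows "magnetization N (permute_config \<pi> N X) = (\<chi> r. magnetization N X $ \<pi> r)"
proof -
  have "(\<pi> (X i) = r) = (X i = \<pi> r)" for i r using assms by metis
  hence "site_count N (permute_config \<pi> N X) r = site_count N X (\<pi> r)" for r
    unfolding site_count_def permute_config_def by (intro sum.cong refl) simp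
  thus ?thesis by (simp add: vec_eq_iff magnetization_nth)
qed

lemma gibbs_mean_permute:
  fixes f :: "(nat \<Rightarrow> 'q::finite) \<Rightarrow> real"
  assumes inv: "\<And>r. \<pi> (\<pi> r) = r"
  shows "gibbs_mean p b N (\<lambda>X. f (permute_config \<pi> N X)) = gibbs_mean p b N f"
proof -
  have bij: "bij \<pi>" using inv by (metis bijI' )
  have w: "boltzmann_weight p b N (permute_config \<pi> N X) = boltzmann_weight p b N X" for X :: "nat \<Rightarrow> 'q"
    unfolding boltzmann_weight_def magnetization_permute_config[OF inv]
    using sum.reindex_bij_betw[OF bij, of "\<lambda>r. (magnetization N X $ r) ^ p"] by simp
  have "(\<Sum>X\<in>configs N. boltzmann_weight p b N X * f X)
      = (\<Sum>X\<in>configs N. boltzmann_weight p b N (permute_config \<pi> N X) * f (permute_config \<pi> N X))"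
    by (rule sum.reindex_bij_witness[where i = "permute_config \<pi> N" and j = "permute_config \<pi> N"])
       (simp_all add: permute_config_mem permute_config_involution[OF inv])
  thus ?thesis unfolding w by (simp add: gibbs_mean_def)
qed

lemma norm_permute:
  fixes x :: "real^'q::finite"
  assumes "bij \<pi>"
  shows "norm (\<chi> r. x $ \<pi> r) = norm x"
proof -
  have "(\<chi> r. x $ \<pi> r) \<bullet> (\<chi> r. x $ \<pi> r) = x \<bullet> x"
    unfolding inner_vec_def using sum.reindex_bij_betw[OF assms, of "\<lambda>r. x $ r * x $ r"] by simp
  thus ?thesis by (simp add: norm_eq_sqrt_inner)
qed

text \<open>The transposition of \<open>c\<close> and \<open>d\<close> preserves the Gibbs measure
  and exchanges the two peaks.\<close>

lemma gibbs_mean_ball_symmetric: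
  fixes c d :: "'q::finite"
  shows "gibbs_mean p \<beta> N (\<lambda>X. of_bool (norm (magnetization N X - peak a b c) < t))
       = gibbs_mean p \<beta> N (\<lambda>X. of_bool (norm (magnetization N X - peak a b d) < t))"
proof -
  define \<pi> where "\<pi> = (\<lambda>r. if r = c then d else if r = d then c else r)"
  have inv: "\<pi> (\<pi> r) = r" for r by (auto simp: \<pi>_def)
  have bij: "bij \<pi>" using inv by (metis bijI')
  have "norm (magnetization N (permute_config \<pi> N X) - peak a b c) = norm (magnetization N X - peak a b d)" for X
  proof -
    have "magnetization N (permute_config \<pi> N X) - peak a b c = (\<chi> r. (magnetization N X - peak a b d) $ \<pi> r)"
      unfolding magnetization_permute_config[OF inv] by (auto simp: vec_eq_iff peak_nth \<pi>_def)
    thus ?thesis by (simp only: norm_permute[OF bij])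
  qed
  thus ?thesis
    using gibbs_mean_permute[OF inv, of p \<beta> N "\<lambda>X. of_bool (norm (magnetization N X - peak a b c) < t)"] by simp
qed

locale potts_full = potts_ball p \<beta> a b c \<epsilon>
  for p :: nat and \<beta> a b :: real and c :: "'q::finite" and \<epsilon> :: real +
  assumes maximizers_range: "maximizers p \<beta> = range (peak a b :: 'q \<Rightarrow> real^'q)"
    and separated: "\<And>i j :: 'q. i \<noteq> j \<Longrightarrow> \<epsilon> < dist (peak a b i) (peak a b j)"
begin

text \<open>Balls of radius \<open>\<epsilon>\<close> about different peaks may overlap, as
  \<open>\<epsilon>\<close> is only smaller than the distances between peaks. With radius
  \<open>\<epsilon> / 3\<close> they are disjoint.\<close>

definition near :: "nat \<Rightarrow> 'q \<Rightarrow> (nat \<Rightarrow> 'q) \<Rightarrow> real" where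
  "near N j X = of_bool (norm (magnetization N X - peak a b j) < \<epsilon> / 3)"

definition far :: "nat \<Rightarrow> (nat \<Rightarrow> 'q) \<Rightarrow> real" where
  "far N X = of_bool (\<forall>j. norm (magnetization N X - peak a b j) \<ge> \<epsilon> / 3)"

lemma near_far_partition: "(\<Sum>j\<in>UNIV. near N j X) + far N X = 1"
proof (cases "\<exists>j. norm (magnetization N X - peak a b j) < \<epsilon> / 3")
  case True
  then obtain j where j: "norm (magnetization N X - peak a b j) < \<epsilon> / 3" by auto
  have "near N i X = (if i = j then 1 else 0)" for i
  proof (cases "i = j")
    case False
    have "dist (peak a b i) (peak a b j) \<le> dist (peak a b i) (magnetization N X) + dist (magnetization N X) (peak a b j)"
      by (rule dist_triangle)
    hence "\<epsilon> < norm (magnetization N X - peak a b i) + norm (magnetization N X - peak a b j)"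
      using separated[OF False] by (simp add: dist_norm norm_minus_commute)
    hence "\<not> norm (magnetization N X - peak a b i) < \<epsilon> / 3" using j eps_pos by linarith
    thus ?thesis using False by (simp add: near_def)
  qed (use j in \<open>simp add: near_def\<close>)
  moreover have "far N X = 0" using j by (auto simp: far_def not_le)
  ultimately show ?thesis by simp
next
  case False
  thus ?thesis by (simp add: near_def far_def not_less)
qed

text \<open>On the compact part of the simplex away from all peaks, \<open>H\<close> stays below its
  maximum by a fixed gap.\<close>

lemma far_tail:
  obtains C where "C \<ge> 0" "\<And>N. N \<ge> 1 \<Longrightarrow> gm N (far N) \<le> C / real N ^ 4"
proof -
  let ?B = "{x :: real^'q. \<forall>j. norm (x - peak a b j) \<ge> \<epsilon> / 3}"
  let ?T = "prob_simplex \<inter> ?B"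
  have "closed ?B" by (intro closed_Collect_all closed_Collect_le continuous_intros)
  hence cT: "compact ?T" by (rule compact_Int_closed[OF compact_prob_simplex])
  obtain e where e: "e > 0" "\<And>x. x \<in> ?T \<Longrightarrow> e \<le> H p \<beta> m - H p \<beta> x"
  proof (cases "?T = {}")
    case True
    show ?thesis by (rule that[of 1]) (use True in auto)
  next
    case False
    have "continuous_on ?T (\<lambda>x. H p \<beta> m - H p \<beta> x)"
      by (intro continuous_intros continuous_on_subset[OF continuous_on_H]) auto
    from continuous_attains_inf[OF cT False this]
    obtain z where z: "z \<in> ?T" "\<And>x. x \<in> ?T \<Longrightarrow> H p \<beta> m - H p \<beta> z \<le> H p \<beta> m - H p \<beta> x" by auto
    have "z \<noteq> peak a b j" for j
    proof
      assume zj: "z = peak a b j"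
      have "\<epsilon> / 3 \<le> norm (z - peak a b j)" using z(1) by simp
      thus False using eps_pos by (simp add: zj)
    qed
    hence "z \<notin> maximizers p \<beta>" unfolding maximizers_range by auto
    then obtain y where y: "y \<in> (prob_simplex :: (real^'q) set)" "H p \<beta> z < H p \<beta> y"
      using z by (auto simp: maximizers_iff not_le)
    have "H p \<beta> y \<le> H p \<beta> m" using y peak_max by (simp add: maximizers_iff)
    hence "H p \<beta> m - H p \<beta> z > 0" using y by simp
    thus ?thesis using that z by blast
  qed
  obtain C where C: "C \<ge> 0" "\<And>N. N \<ge> 1 \<Longrightarrow> (real N + 1) ^ CARD('q) * exp (- real N * e) \<le> C / real N ^ 4"
    by (rule exp_decay_poly[OF e(1)]) (rule that)
  show ?thesis
  proof (rule that[OF C(1)])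
    fix N :: nat assume N: "N \<ge> 1"
    have "gm N (\<lambda>X. of_bool (magnetization N X \<in> ?B)) \<le> (real N + 1) ^ CARD('q) * exp (- real N * e)"
      by (rule gibbs_concentration[OF N]) (use e in auto)
    thus "gm N (far N) \<le> C / real N ^ 4" using C(2)[OF N] by (simp add: far_def[abs_def])
  qed
qed

text \<open>The covariance is conditioned on the ball of radius \<open>\<epsilon>\<close>, but the
  partition uses the smaller one; the shell between the two contains no maximizer.\<close>

lemma chi_minus_near_tail:
  obtains C where "C \<ge> 0" "\<And>N. N \<ge> 1 \<Longrightarrow> gm N (\<lambda>X. chi N X - near N c X) \<le> C / real N ^ 4"
    "\<And>N X. near N c X \<le> chi N X"
proof -
  have "\<epsilon> / 3 > 0" using eps_pos by simp
  then obtain C where C: "C \<ge> 0" "\<And>N. N \<ge> 1 \<Longrightarrow> gm N (\<lambda>X. chi N X * of_bool (\<epsilon> / 3 \<le> norm (V N X))) \<le> C / real N ^ 4"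
    by (rule inner_tail) (rule that)
  show ?thesis
  proof (rule that[OF C(1)])
    show "near N c X \<le> chi N X" for N X using eps_pos by (simp add: near_def chi_eq V_def)
    fix N :: nat assume N: "N \<ge> 1"
    have "gm N (\<lambda>X. chi N X - near N c X) \<le> gm N (\<lambda>X. chi N X * of_bool (\<epsilon> / 3 \<le> norm (V N X)))"
      by (rule gibbs_mean_mono) (auto simp: chi_eq near_def V_def)
    thus "gm N (\<lambda>X. chi N X - near N c X) \<le> C / real N ^ 4" using C(2)[OF N] by linarith
  qed
qed

text \<open>The disjoint small balls have equal probabilities by symmetry and exhaust everything
  except the far event.\<close>

lemma gm_chi_approx:
  obtains C where "C \<ge> 0" "\<And>N. N \<ge> 1 \<Longrightarrow> \<bar>gm N (chi N) - 1 / real CARD('q)\<bar> \<le> C / real N ^ 4"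
proof -
  obtain C1 where C1: "C1 \<ge> 0" "\<And>N. N \<ge> 1 \<Longrightarrow> gm N (far N) \<le> C1 / real N ^ 4"
    by (rule far_tail) (rule that)
  obtain C2 where C2: "C2 \<ge> 0" "\<And>N. N \<ge> 1 \<Longrightarrow> gm N (\<lambda>X. chi N X - near N c X) \<le> C2 / real N ^ 4" "\<And>N X. near N c X \<le> chi N X"
    by (rule chi_minus_near_tail) (rule that)
  show ?thesis
  proof (rule that[of "C1 + C2"])
    fix N :: nat assume N: "N \<ge> 1"
    have "gm N (near N j) = gm N (near N c)" for j
      unfolding near_def[abs_def] by (rule gibbs_mean_ball_symmetric)
    hence "(\<Sum>j\<in>UNIV. gm N (near N j)) = (\<Sum>j\<in>(UNIV :: 'q set). gm N (near N c))" by (rule sum.cong[OF refl])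
    hence near_sum: "(\<Sum>j\<in>UNIV. gm N (near N j)) = real CARD('q) * gm N (near N c)" by simp
    have "gm N (\<lambda>X. (\<Sum>j\<in>UNIV. near N j X) + far N X) = 1"
      unfolding near_far_partition by (rule gibbs_mean_const)
    hence tot: "real CARD('q) * gm N (near N c) + gm N (far N) = 1"
      unfolding gibbs_mean_add gibbs_mean_sum near_sum .
    have q: "real CARD('q) \<ge> 1" using q2 by simp
    have f0: "0 \<le> gm N (far N)" by (rule gibbs_mean_nonneg) (simp add: far_def)
    have "gm N (near N c) = (1 - gm N (far N)) / real CARD('q)" using tot q by (simp add: field_simps)
    hence "1 / real CARD('q) - gm N (near N c) = gm N (far N) / real CARD('q)" by (simp add: diff_divide_distrib)
    moreover have "gm N (far N) / real CARD('q) \<le> gm N (far N)" using q f0 by (simp add: divide_le_eq mult_le_cancel_left1)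
    moreover have "0 \<le> gm N (far N) / real CARD('q)" using f0 by simp
    moreover have "0 \<le> gm N (\<lambda>X. chi N X - near N c X)" by (rule gibbs_mean_nonneg) (simp add: C2(3))
    ultimately have "\<bar>gm N (chi N) - 1 / real CARD('q)\<bar> \<le> C1 / real N ^ 4 + C2 / real N ^ 4"
      using C1(2)[OF N] C2(2)[OF N] unfolding gibbs_mean_diff by linarith
    thus "\<bar>gm N (chi N) - 1 / real CARD('q)\<bar> \<le> (C1 + C2) / real N ^ 4" by (simp add: add_divide_distrib)
  qed (use C1 C2 in auto)
qed

end

section \<open>The maximum pseudolikelihood estimate\<close>

lemma has_derivative_softmax_scaled:
  fixes \<theta> :: "'q::finite \<Rightarrow> real"
  shows "((\<lambda>b. softmax (\<lambda>t. b * \<theta> t) r) has_real_derivative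
     softmax (\<lambda>t. b * \<theta> t) r * (\<theta> r - (\<Sum>s\<in>UNIV. softmax (\<lambda>t. b * \<theta> t) s * \<theta> s))) (at b)"
proof -
  have lin: "quad_approx (\<lambda>y. y * \<theta> s) b (\<lambda>v. v * \<theta> s)" for s
    by (rule quad_approx_linear) (rule bounded_linear_mult_left)
  have "((\<lambda>y. softmax (\<lambda>s. y * \<theta> s) r) has_derivative
     (\<lambda>v. softmax (\<lambda>s. b * \<theta> s) r * (v * \<theta> r - (\<Sum>s\<in>UNIV. softmax (\<lambda>s. b * \<theta> s) s * (v * \<theta> s))))) (at b)"
    by (rule quad_approx_has_derivative) (rule quad_approx_softmax[where \<theta> = "\<lambda>y s. y * \<theta> s" and L = "\<lambda>s v. v * \<theta> s", OF lin])
  moreover have "softmax (\<lambda>s. b * \<theta> s) r * (v * \<theta> r - (\<Sum>s\<in>UNIV. softmax (\<lambda>s. b * \<theta> s) s * (v * \<theta> s)))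
    = (softmax (\<lambda>t. b * \<theta> t) r * (\<theta> r - (\<Sum>s\<in>UNIV. softmax (\<lambda>t. b * \<theta> t) s * \<theta> s))) * v" for v
  proof -
    have "(\<Sum>s\<in>UNIV. softmax (\<lambda>s. b * \<theta> s) s * (v * \<theta> s)) = v * (\<Sum>s\<in>UNIV. softmax (\<lambda>t. b * \<theta> t) s * \<theta> s)"
      unfolding sum_distrib_left by (simp only: mult.left_commute)
    thus ?thesis by (simp add: right_diff_distrib mult_ac)
  qed
  ultimately show ?thesis unfolding has_field_derivative_def by simp
qed

text \<open>The mean of the statistic \<open>\<theta>\<close> in the exponential family with
  parameter \<open>b\<close>. Its derivative is the variance of \<open>\<theta>\<close>, which makes
  the log pseudolikelihood concave.\<close>

definition softmax_mean :: "('q::finite \<Rightarrow> real) \<Rightarrow> real \<Rightarrow> real" where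
  "softmax_mean \<theta> b = (\<Sum>s\<in>UNIV. softmax (\<lambda>t. b * \<theta> t) s * \<theta> s)"

definition softmax_variance :: "('q::finite \<Rightarrow> real) \<Rightarrow> real \<Rightarrow> real" where
  "softmax_variance \<theta> b = (\<Sum>s\<in>UNIV. softmax (\<lambda>t. b * \<theta> t) s * (\<theta> s - softmax_mean \<theta> b)\<^sup>2)"

lemma has_derivative_ln_softmax:
  "((\<lambda>b. ln (softmax (\<lambda>t. b * \<theta> t) r)) has_real_derivative (\<theta> r - softmax_mean \<theta> b)) (at b)"
  for \<theta> :: "'q::finite \<Rightarrow> real"
proof -
  have "((\<lambda>b. ln (softmax (\<lambda>t. b * \<theta> t) r)) has_real_derivative
      1 / softmax (\<lambda>t. b * \<theta> t) r * (softmax (\<lambda>t. b * \<theta> t) r * (\<theta> r - softmax_mean \<theta> b))) (at b)"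
    unfolding softmax_mean_def
    by (rule DERIV_chain2[OF DERIV_ln_divide has_derivative_softmax_scaled]) (rule softmax_pos)
  thus ?thesis using softmax_pos[of "\<lambda>t. b * \<theta> t" r] by simp
qed

lemma has_derivative_softmax_mean: "(softmax_mean \<theta> has_real_derivative softmax_variance \<theta> b) (at b)"
  for \<theta> :: "'q::finite \<Rightarrow> real"
proof -
  let ?w = "softmax (\<lambda>t. b * \<theta> t)" and ?\<mu> = "softmax_mean \<theta> b"
  have "((\<lambda>b. \<Sum>s\<in>UNIV. softmax (\<lambda>t. b * \<theta> t) s * \<theta> s) has_real_derivative
      (\<Sum>s\<in>UNIV. ?w s * (\<theta> s - ?\<mu>) * \<theta> s)) (at b)"
    unfolding softmax_mean_def by (intro DERIV_sum DERIV_cmult_right has_derivative_softmax_scaled)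
  moreover have "(\<Sum>s\<in>UNIV. ?w s * (\<theta> s - ?\<mu>) * \<theta> s) = softmax_variance \<theta> b"
  proof -
    have "(\<Sum>s\<in>UNIV. ?w s * (\<theta> s - ?\<mu>)) = ?\<mu> - (\<Sum>s\<in>UNIV. ?w s) * ?\<mu>"
      by (simp add: right_diff_distrib sum_subtractf softmax_mean_def[of \<theta> b, symmetric] sum_distrib_right)
    hence z: "(\<Sum>s\<in>UNIV. ?w s * (\<theta> s - ?\<mu>)) = 0" by (simp add: sum_softmax)
    have "(\<Sum>s\<in>UNIV. ?w s * (\<theta> s - ?\<mu>) * \<theta> s) = softmax_variance \<theta> b + (\<Sum>s\<in>UNIV. ?w s * (\<theta> s - ?\<mu>)) * ?\<mu>"
      unfolding softmax_variance_def sum_distrib_right sum.distrib[symmetric]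
      by (intro sum.cong refl) (simp add: power2_eq_square algebra_simps)
    thus ?thesis unfolding z by simp
  qed
  ultimately show ?thesis by (simp add: softmax_mean_def[abs_def])
qed

lemma softmax_variance_nonneg: "0 \<le> softmax_variance \<theta> b"
  unfolding softmax_variance_def by (intro sum_nonneg mult_nonneg_nonneg softmax_nonneg) auto

lemma softmax_variance_pos:
  fixes \<theta> :: "'q::finite \<Rightarrow> real"
  assumes "\<theta> r \<noteq> \<theta> s"
  shows "0 < softmax_variance \<theta> b"
proof -
  obtain u where u: "\<theta> u \<noteq> softmax_mean \<theta> b" using assms by metis
  show ?thesis unfolding softmax_variance_def
  proof (rule sum_pos2[where i = u])
    show "0 < softmax (\<lambda>t. b * \<theta> t) u * (\<theta> u - softmax_mean \<theta> b)\<^sup>2"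
      using u by (intro mult_pos_pos softmax_pos) auto
  qed (auto intro!: mult_nonneg_nonneg softmax_nonneg)
qed

lemma unique_max_of_decreasing_derivative:
  fixes f g g' :: "real \<Rightarrow> real"
  assumes f: "\<And>b. (f has_real_derivative g b) (at b)"
    and g: "\<And>b. (g has_real_derivative g' b) (at b)" and neg: "\<And>b. g' b < 0"
    and lu: "l < u" and gl: "g l > 0" and gu: "g u < 0"
  obtains z where "l < z" "z < u" "\<And>b. b \<noteq> z \<Longrightarrow> f b < f z"
proof -
  have dec: "g y < g x" if "x < y" for x y
    by (rule DERIV_neg_imp_decreasing[OF that]) (use g neg in blast)
  have "isCont g x" for x using g by (rule DERIV_isCont)
  then obtain z where z: "l \<le> z" "z \<le> u" "g z = 0"
    using IVT2[of g u 0 l] lu gl gu by force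
  have "l < z" "z < u" using z gl gu by (metis less_eq_real_def less_irrefl)+
  moreover have "f b < f z" if "b \<noteq> z" for b
  proof (cases "b < z")
    case True
    show ?thesis
    proof (rule DERIV_pos_imp_increasing_open[OF True])
      fix x assume "b < x" "x < z"
      thus "\<exists>y. (f has_real_derivative y) (at x) \<and> 0 < y" using f[of x] dec[of x z] z by auto
    qed (use f in \<open>auto intro!: DERIV_isCont continuous_at_imp_continuous_on\<close>)
  next
    case False
    hence zb: "z < b" using that by simp
    show ?thesis
    proof (rule DERIV_neg_imp_decreasing_open[OF zb])
      fix x assume "z < x" "x < b"
      thus "\<exists>y. (f has_real_derivative y) (at x) \<and> y < 0" using f[of x] dec[of z x] z by auto
    qed (use f in \<open>auto intro!: DERIV_isCont continuous_at_imp_continuous_on\<close>)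
  qed
  ultimately show ?thesis by (rule that)
qed

lemma gibbs_mean_indicator:
  assumes "A \<subseteq> (configs N :: (nat \<Rightarrow> 'q::finite) set)"
  shows "gibbs_mean p b N (indicator A) = (\<Sum>X\<in>A. boltzmann_weight p b N X) / gibbs_total TYPE('q) p b N"
  using sum.inter_restrict[OF finite_configs, of "boltzmann_weight p b N" N A] assms
  by (simp add: gibbs_mean_def indicator_def Int_absorb1 if_distrib cong: if_cong)

lemma cond_prob_site:
  fixes X :: "nat \<Rightarrow> 'q::finite"
  assumes X: "X \<in> configs N" and i: "i \<in> {1..N}"
  shows "\<P>(Y in potts p b N. Y i = X i \<bar> \<forall>j\<in>{1..N} - {i}. Y j = X j) = cond_weight p b N X i (X i)"
proof -
  let ?Q = "\<lambda>Y. \<forall>j\<in>{1..N} - {i}. Y j = X j"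
  have eqI: "Y = X(i := Y i)" if "Y \<in> configs N" "?Q Y" for Y
  proof
    fix j show "Y j = (X(i := Y i)) j"
      using that X i by (cases "j \<in> {1..N}") (auto simp: configs_def PiE_iff extensional_def)
  qed
  \<comment> \<open>The conditioning event consists of the \<open>q\<close> recolourings of site
    \<open>i\<close>; extensionality fixes the values outside \<open>{1..N}\<close>.\<close>
  have Q: "{Y \<in> configs N. ?Q Y} = range (\<lambda>s. X(i := s))"
  proof
    show "{Y \<in> configs N. ?Q Y} \<subseteq> range (\<lambda>s. X(i := s))" using eqI by blast
    show "range (\<lambda>s. X(i := s)) \<subseteq> {Y \<in> configs N. ?Q Y}"
    proof (rule image_subsetI)
      fix s
      have "?Q (X(i := s))" by simp
      thus "X(i := s) \<in> {Y \<in> configs N. ?Q Y}" by (simp only: mem_Collect_eq configs_update[OF X i] simp_thms)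
    qed
  qed
  have PQ: "{Y \<in> configs N. Y i = X i \<and> ?Q Y} = {X}"
  proof
    show "{Y \<in> configs N. Y i = X i \<and> ?Q Y} \<subseteq> {X}"
    proof
      fix Y assume "Y \<in> {Y \<in> configs N. Y i = X i \<and> ?Q Y}"
      hence Y: "Y \<in> configs N" "Y i = X i" "?Q Y" by simp_all
      show "Y \<in> {X}" using eqI[OF Y(1,3)] unfolding Y(2) by simp
    qed
    show "{X} \<subseteq> {Y \<in> configs N. Y i = X i \<and> ?Q Y}" using X by simp
  qed
  have inj: "inj (\<lambda>s. X(i := s))" by (rule injI) (metis fun_upd_same)
  have 1: "measure (potts p b N) {Y \<in> configs N. ?Q Y}
      = (\<Sum>s\<in>UNIV. boltzmann_weight p b N (X(i := s))) / gibbs_total TYPE('q) p b N"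
    by (simp add: measure_potts gibbs_mean_indicator) (simp add: Q sum.reindex[OF inj])
  have 2: "measure (potts p b N) {Y \<in> configs N. Y i = X i \<and> ?Q Y}
      = boltzmann_weight p b N X / gibbs_total TYPE('q) p b N"
    unfolding PQ using X by (simp add: measure_potts gibbs_mean_indicator)
  show ?thesis
    unfolding cond_prob_def space_potts 1 2 cond_weight_def
    using gibbs_total_pos[where 'q = 'q, of p b N] by simp
qed

definition local_field :: "nat \<Rightarrow> nat \<Rightarrow> (nat \<Rightarrow> 'q::finite) \<Rightarrow> nat \<Rightarrow> 'q \<Rightarrow> real" where
  "local_field p N X i t = increment p N (rest_count N X i t)"

definition log_pl :: "nat \<Rightarrow> nat \<Rightarrow> (nat \<Rightarrow> 'q::finite) \<Rightarrow> real \<Rightarrow> real" where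
  "log_pl p N X b = (\<Sum>i\<in>{1..N}. ln (softmax (\<lambda>t. b * local_field p N X i t) (X i)))"

definition score :: "nat \<Rightarrow> nat \<Rightarrow> (nat \<Rightarrow> 'q::finite) \<Rightarrow> real \<Rightarrow> real" where
  "score p N X b = (\<Sum>i\<in>{1..N}. local_field p N X i (X i) - softmax_mean (local_field p N X i) b)"

lemma cond_weight_local_field:
  "i \<in> {1..N} \<Longrightarrow> cond_weight p b N X i s = softmax (\<lambda>t. b * local_field p N X i t) s"
  by (simp add: cond_weight_softmax local_field_def)

lemma pseudolikelihood_eq_exp:
  assumes "X \<in> configs N"
  shows "pseudolikelihood p N X b = exp (log_pl p N X b)"
  unfolding pseudolikelihood_def log_pl_def exp_sum[OF finite_atLeastAtMost]
  by (intro prod.cong refl) (simp add: cond_prob_site[OF assms] cond_weight_local_field softmax_pos)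

lemma log_pl_has_derivative: "(log_pl p N X has_real_derivative score p N X b) (at b)"
  unfolding log_pl_def[abs_def] score_def by (intro DERIV_sum has_derivative_ln_softmax)

lemma score_has_derivative:
  "(score p N X has_real_derivative (\<Sum>i\<in>{1..N}. 0 - softmax_variance (local_field p N X i) b)) (at b)"
  unfolding score_def[abs_def] by (intro DERIV_sum DERIV_diff DERIV_const has_derivative_softmax_mean)

text \<open>One nonconstant local field makes the score strictly decreasing, so the sign change
  brackets its only zero, which is the unique maximizer over all real parameters. Uniqueness has to
  be shown first, because only then does \<open>is_mple\<close> say anything about
  \<open>est X\<close>.\<close>

lemma mple_between:
  fixes X :: "nat \<Rightarrow> 'q::finite"
  assumes mple: "is_mple p N est" and X: "X \<in> configs N"
    and i: "i \<in> {1..N}" "local_field p N X i r \<noteq> local_field p N X i s"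
    and lu: "l < u" "score p N X l > 0" "score p N X u < 0"
  shows "l < est X" "est X < u"
proof -
  have neg: "(\<Sum>j\<in>{1..N}. 0 - softmax_variance (local_field p N X j) b) < 0" for b
  proof -
    have "0 < (\<Sum>j\<in>{1..N}. softmax_variance (local_field p N X j) b)"
      by (rule sum_pos2[OF _ i(1)]) (use i(2) in \<open>auto intro: softmax_variance_pos softmax_variance_nonneg\<close>)
    thus ?thesis by (simp add: sum_negf)
  qed
  obtain z where z: "l < z" "z < u" "\<And>b. b \<noteq> z \<Longrightarrow> log_pl p N X b < log_pl p N X z"
    by (rule unique_max_of_decreasing_derivative[OF log_pl_has_derivative score_has_derivative neg lu]) (rule that)
  have arg: "is_arg_max (pseudolikelihood p N X) (\<lambda>_. True) b \<longleftrightarrow> b = z" for b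
  proof
    assume "is_arg_max (pseudolikelihood p N X) (\<lambda>_. True) b"
    hence "\<not> log_pl p N X b < log_pl p N X z" by (simp add: is_arg_max_def pseudolikelihood_eq_exp[OF X])
    thus "b = z" using z(3) by blast
  next
    assume "b = z"
    thus "is_arg_max (pseudolikelihood p N X) (\<lambda>_. True) b"
      using z(3) by (auto simp: is_arg_max_def pseudolikelihood_eq_exp[OF X]) (metis less_irrefl less_trans)
  qed
  have "\<exists>!b. is_arg_max (pseudolikelihood p N X) (\<lambda>_. True) b" unfolding arg by simp
  hence "is_arg_max (pseudolikelihood p N X) (\<lambda>_. True) (est X)" using mple X by (simp add: is_mple_def)
  hence "est X = z" unfolding arg .
  thus "l < est X" "est X < u" using z by auto
qed

text \<open>At each site the local fields and the conditional weights are within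
  \<open>O(1 / N)\<close> of their mean-field values, so the sum over the sites is off by
  \<open>O(1)\<close>. The mean-field form of the sum is \<open>N p S\<close>, because a sum over
  sites is a sum over colours weighted by the magnetization.\<close>

lemma score_approx:
  fixes X :: "nat \<Rightarrow> 'q::finite"
  assumes N: "N \<ge> 1" and b: "\<bar>b\<bar> \<le> B"
  shows "\<bar>score p N X b - real N * (real p * S p (magnetization N X) b)\<bar>
    \<le> (real p)\<^sup>2 + real CARD('q) * ((real p)\<^sup>2 + real p * (4 * (B * (real p)\<^sup>2)))"
proof -
  define x where "x = magnetization N X"
  let ?k = "p - 1"
  let ?F = "\<lambda>t. real p * (x $ t) ^ ?k"
  let ?M = "mean_field p b x"
  have n: "real N > 0" using N by simp
  have x01: "0 \<le> x $ t" "x $ t \<le> 1" for t using magnetization_nonneg magnetization_le_1[OF N] by (auto simp: x_def)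
  have F: "0 \<le> ?F t" "?F t \<le> real p" for t
    using x01 by (auto intro!: mult_left_le power_le_one)
  have "(\<Sum>i\<in>{1..N}. ?F (X i)) = (\<Sum>r\<in>UNIV. site_count N X r * ?F r)" by (rule sum_site_count[symmetric])
  also have "\<dots> = real N * (\<Sum>r\<in>UNIV. x $ r * ?F r)"
    using n by (simp add: sum_distrib_left x_def magnetization_nth)
  finally have s1: "(\<Sum>i\<in>{1..N}. ?F (X i)) = real N * (\<Sum>r\<in>UNIV. x $ r * ?F r)" .
  have xp: "x $ r * ?F r = real p * (x $ r) ^ p" for r by (cases p) simp_all
  have SS: "real N * (real p * S p x b) = (\<Sum>i\<in>{1..N}. ?F (X i) - (\<Sum>t\<in>UNIV. ?M t * ?F t))"
    unfolding sum_subtractf s1 xp S_eq_mean_field by (simp add: right_diff_distrib sum_distrib_left mult_ac)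
  have ti: "\<bar>(local_field p N X i (X i) - softmax_mean (local_field p N X i) b) - (?F (X i) - (\<Sum>t\<in>UNIV. ?M t * ?F t))\<bar>
      \<le> ((real p)\<^sup>2 + real CARD('q) * ((real p)\<^sup>2 + real p * (4 * (B * (real p)\<^sup>2)))) / real N"
    if i: "i \<in> {1..N}" for i
  proof -
    let ?w = "softmax (\<lambda>t. b * local_field p N X i t)"
    have L: "\<bar>local_field p N X i t - ?F t\<bar> \<le> (real p)\<^sup>2 / real N" for t
      unfolding local_field_def x_def by (rule increment_magnetization[OF i])
    have W: "\<bar>?w t - ?M t\<bar> \<le> 4 * (B * (real p)\<^sup>2 / real N)" for t
    proof -
      have "\<bar>?w t - ?M t\<bar> \<le> 4 * (\<bar>b\<bar> * (real p)\<^sup>2 / real N)"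
        unfolding cond_weight_local_field[OF i, symmetric] x_def by (rule cond_weight_approx[OF i])
      also have "\<dots> \<le> 4 * (B * (real p)\<^sup>2 / real N)" using b by (intro mult_left_mono divide_right_mono mult_right_mono) auto
      finally show ?thesis .
    qed
    have t: "\<bar>?w t * local_field p N X i t - ?M t * ?F t\<bar> \<le> (real p)\<^sup>2 / real N + real p * (4 * (B * (real p)\<^sup>2 / real N))" for t
    proof -
      have e: "?w t * local_field p N X i t - ?M t * ?F t = ?w t * (local_field p N X i t - ?F t) + ?F t * (?w t - ?M t)"
        by (simp add: algebra_simps)
      have "\<bar>?w t\<bar> \<le> 1" unfolding abs_of_nonneg[OF softmax_nonneg] by (rule softmax_le_1)
      hence "\<bar>?w t * (local_field p N X i t - ?F t)\<bar> \<le> 1 * ((real p)\<^sup>2 / real N)"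
        unfolding abs_mult using L by (intro mult_mono) auto
      moreover have "\<bar>?F t * (?w t - ?M t)\<bar> \<le> real p * (4 * (B * (real p)\<^sup>2 / real N))"
        unfolding abs_mult[of "?F t"] abs_of_nonneg[OF F(1)] using F W by (intro mult_mono) auto
      ultimately show ?thesis unfolding e by linarith
    qed
    have "\<bar>softmax_mean (local_field p N X i) b - (\<Sum>t\<in>UNIV. ?M t * ?F t)\<bar>
        \<le> (\<Sum>t\<in>(UNIV :: 'q set). \<bar>?w t * local_field p N X i t - ?M t * ?F t\<bar>)"
      unfolding softmax_mean_def sum_subtractf[symmetric] by (rule sum_abs)
    also have "\<dots> \<le> real CARD('q) * ((real p)\<^sup>2 / real N + real p * (4 * (B * (real p)\<^sup>2 / real N)))"
      by (rule sum_bounded_above) (rule t)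
    finally have "\<bar>(local_field p N X i (X i) - softmax_mean (local_field p N X i) b) - (?F (X i) - (\<Sum>t\<in>UNIV. ?M t * ?F t))\<bar>
      \<le> (real p)\<^sup>2 / real N + real CARD('q) * ((real p)\<^sup>2 / real N + real p * (4 * (B * (real p)\<^sup>2 / real N)))"
      using L[of "X i"] by linarith
    also have "\<dots> = ((real p)\<^sup>2 + real CARD('q) * ((real p)\<^sup>2 + real p * (4 * (B * (real p)\<^sup>2)))) / real N"
      by (simp add: add_divide_distrib distrib_left)
    finally show ?thesis .
  qed
  have "\<bar>score p N X b - real N * (real p * S p x b)\<bar>
    \<le> (\<Sum>i\<in>{1..N}. \<bar>(local_field p N X i (X i) - softmax_mean (local_field p N X i) b) - (?F (X i) - (\<Sum>t\<in>UNIV. ?M t * ?F t))\<bar>)"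
    unfolding score_def SS sum_subtractf[symmetric] by (rule sum_abs)
  also have "\<dots> \<le> real (card {1..N}) * (((real p)\<^sup>2 + real CARD('q) * ((real p)\<^sup>2 + real p * (4 * (B * (real p)\<^sup>2)))) / real N)"
    by (rule sum_bounded_above) (rule ti)
  finally show ?thesis using n by (simp add: x_def)
qed


context potts_ball
begin

text \<open>For \<open>x\<close> of coordinate sum zero the joint differential of \<open>S\<close>
  at the peak depends only on \<open>x $ c\<close> and \<open>y\<close>, and it vanishes along
  \<open>y = gam * x $ c\<close>; this is where the linearised estimator lies.\<close>

lemma S_local:
  obtains C d where "C \<ge> 0" "d > 0"
    "\<And>x y. (\<Sum>r\<in>UNIV. x $ r) = 0 \<Longrightarrow> (norm x)\<^sup>2 + y\<^sup>2 < d \<Longrightarrow>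
      \<bar>S p (m + x) (\<beta> + y) - VS * (gam * x $ c - y)\<bar> \<le> C * ((norm x)\<^sup>2 + y\<^sup>2)"
proof -
  obtain C K where C: "bounded_linear (\<lambda>v :: (real^'q) \<times> real. gradS \<bullet> fst v - VS * snd v)" "C \<ge> 0" "K \<ge> 0"
    "\<And>v :: (real^'q) \<times> real. \<bar>gradS \<bullet> fst v - VS * snd v\<bar> \<le> K * norm v"
    "\<forall>\<^sub>F z in nhds (m, \<beta>). \<bar>S p (fst z) (snd z) - S p (fst (m, \<beta>)) (snd (m, \<beta>))
        - (gradS \<bullet> fst (z - (m, \<beta>)) - VS * snd (z - (m, \<beta>)))\<bar> \<le> C * (norm (z - (m, \<beta>)))\<^sup>2"
    by (rule quad_approxE[OF quad_approx_S_peak]) (rule that)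
  obtain d where d: "d > 0" "\<And>z. dist z (m, \<beta>) < d \<Longrightarrow> \<bar>S p (fst z) (snd z) - S p (fst (m, \<beta>)) (snd (m, \<beta>))
        - (gradS \<bullet> fst (z - (m, \<beta>)) - VS * snd (z - (m, \<beta>)))\<bar> \<le> C * (norm (z - (m, \<beta>)))\<^sup>2"
    using C(5) unfolding eventually_nhds_metric by metis
  show ?thesis
  proof (rule that[of C "d\<^sup>2"])
    fix x :: "real^'q" and y :: real
    assume x: "(\<Sum>r\<in>UNIV. x $ r) = 0" and n: "(norm x)\<^sup>2 + y\<^sup>2 < d\<^sup>2"
    let ?z = "(m + x, \<beta> + y)"
    have diff: "?z - (m, \<beta>) = (x, y)" by simp
    have nz: "(norm (?z - (m, \<beta>)))\<^sup>2 = (norm x)\<^sup>2 + y\<^sup>2" unfolding diff by (simp add: norm_Pair)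
    hence "(norm (?z - (m, \<beta>)))\<^sup>2 < d\<^sup>2" using n by linarith
    hence "dist ?z (m, \<beta>) < d" using d(1) unfolding dist_norm by (rule power_less_imp_less_base[OF _ less_imp_le])
    from d(2)[OF this] have "\<bar>S p (m + x) (\<beta> + y) - (gradS \<bullet> x - VS * y)\<bar> \<le> C * ((norm x)\<^sup>2 + y\<^sup>2)"
      unfolding nz by (simp add: S_peak)
    moreover have "gradS \<bullet> x - VS * y = VS * (gam * x $ c - y)"
      unfolding gradS_inner[OF x] gam_def using VS_pos by (simp add: right_diff_distrib)
    ultimately show "\<bar>S p (m + x) (\<beta> + y) - VS * (gam * x $ c - y)\<bar> \<le> C * ((norm x)\<^sup>2 + y\<^sup>2)" by simp
  qed (use C d in auto)
qed

text \<open>At the peak the mean-field values for \<open>c\<close> and \<open>d\<close> differ by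
  \<open>p * \<Delta>\<close>. Four errors, two from passing to the actual magnetization and two
  from discretisation, are each below \<open>p * \<Delta> / 8\<close>.\<close>

lemma local_field_nonconstant:
  assumes N: "N \<ge> 1" and i: "i \<in> {1..N}" and d: "d \<noteq> c"
    and v: "norm (V N X) < \<Delta> / (8 * real p)" and L: "1 / real N < \<Delta> / (8 * real p)"
  shows "local_field p N X i c \<noteq> local_field p N X i d"
proof -
  define x where "x = magnetization N X"
  have p0: "real p > 0" using p2 by simp
  have pw: "\<bar>real p * (x $ t) ^ (p - 1) - real p * (m $ t) ^ (p - 1)\<bar> \<le> real p * (real p * norm (V N X))" for t
  proof -
    have "norm ((x $ t) ^ (p - 1) - (m $ t) ^ (p - 1)) \<le> real (p - 1) * norm (x $ t - m $ t)"
    proof (rule norm_power_diff)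
      show "norm (x $ t) \<le> 1" using magnetization_nonneg[of N X t] magnetization_le_1[OF N, of X t] by (simp add: x_def)
      show "norm (m $ t) \<le> 1" using m_pos[of t] a_less_1 b_less_1 by (simp add: peak_nth)
    qed
    also have "\<dots> \<le> real p * norm (V N X)"
      using abs_V_nth_le[of N X t] by (intro mult_mono) (auto simp: V_def x_def)
    finally have "\<bar>(x $ t) ^ (p - 1) - (m $ t) ^ (p - 1)\<bar> \<le> real p * norm (V N X)" by simp
    hence "real p * \<bar>(x $ t) ^ (p - 1) - (m $ t) ^ (p - 1)\<bar> \<le> real p * (real p * norm (V N X))"
      by (rule mult_left_mono) simp
    thus ?thesis using p0 by (simp only: right_diff_distrib[symmetric] abs_mult abs_of_pos)
  qed
  have inc: "\<bar>local_field p N X i t - real p * (x $ t) ^ (p - 1)\<bar> \<le> (real p)\<^sup>2 / real N" for t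
    unfolding local_field_def x_def by (rule increment_magnetization[OF i])
  have "real p * (real p * norm (V N X)) < real p * (real p * (\<Delta> / (8 * real p)))"
    using v p0 by (intro mult_strict_left_mono) auto
  hence 1: "real p * (real p * norm (V N X)) < real p * \<Delta> / 8" using p0 by simp
  have "(real p)\<^sup>2 * (1 / real N) < (real p)\<^sup>2 * (\<Delta> / (8 * real p))"
    using L p0 by (intro mult_strict_left_mono) auto
  hence 2: "(real p)\<^sup>2 / real N < real p * \<Delta> / 8" using p0 by (simp add: power2_eq_square)
  have 3: "real p * (m $ c) ^ (p - 1) - real p * (m $ d) ^ (p - 1) = real p * \<Delta>"
    using d by (simp add: peak_nth \<Delta>_def right_diff_distrib)
  have 4: "real p * \<Delta> > 0" using p0 Delta_pos by simp
  show ?thesis using 1 2 3 4 pw[of c] pw[of d] inc[of c] inc[of d] by linarith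
qed

text \<open>The score is evaluated at \<open>\<beta> + gam * V $ c\<close> shifted by
  \<open>M * ln N / N\<close> to either side. There the linear part of \<open>N p S\<close> is a
  multiple of \<open>M * ln N\<close> of known sign, while all remainders are of order
  \<open>ln N\<close> in the given window for \<open>V\<close>. A large \<open>M\<close> therefore
  decides the sign.\<close>

lemma mple_expansion:
  fixes \<kappa> :: real
  assumes \<kappa>: "\<kappa> > 0"
  obtains M N0 where "M \<ge> 0" "N0 \<ge> 3"
    "\<And>N est X. N \<ge> N0 \<Longrightarrow> is_mple p N est \<Longrightarrow> X \<in> configs N \<Longrightarrow> (norm (V N X))\<^sup>2 < \<kappa> * ln (real N) / real N \<Longrightarrow>
      \<bar>est X - \<beta> - gam * V N X $ c\<bar> \<le> M * (ln (real N) / real N)"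
proof -
  obtain C d where C: "C \<ge> 0" "d > 0"
    "\<And>x y. (\<Sum>r\<in>UNIV. x $ r) = 0 \<Longrightarrow> (norm x)\<^sup>2 + y\<^sup>2 < d \<Longrightarrow>
      \<bar>S p (m + x) (\<beta> + y) - VS * (gam * x $ c - y)\<bar> \<le> C * ((norm x)\<^sup>2 + y\<^sup>2)"
    by (rule S_local) (rule that)
  have p0: "real p > 0" using p2 by simp
  \<comment> \<open>A bound for \<open>(norm V)\<^sup>2 + y\<^sup>2\<close> in units of
    \<open>ln N / N\<close>, where \<open>y\<close> is the displacement of the parameter.\<close>
  define Q where "Q = \<kappa> + (2 * gam\<^sup>2 * \<kappa> + 2)"
  define B where "B = (real p)\<^sup>2 + real CARD('q) * ((real p)\<^sup>2 + real p * (4 * ((\<beta> + 1) * (real p)\<^sup>2)))"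
  \<comment> \<open>\<open>p * VS * M\<close> exceeds the constants of all remainders by
    \<open>1\<close>, so the sign is decided with the margin \<open>ln N \<ge> 1\<close>.\<close>
  define M where "M = (B + real p * (C * Q) + 1) / (real p * VS)"
  define \<delta> where "\<delta> = \<Delta> / (8 * real p)"
  have Q: "Q > 0" using \<kappa> by (simp add: Q_def add_pos_nonneg)
  have B: "B \<ge> 0" unfolding B_def using beta_pos by (intro add_nonneg_nonneg mult_nonneg_nonneg) auto
  have pV: "real p * VS > 0" using p0 VS_pos by simp
  have M: "M > 0" unfolding M_def using B C(1) Q p0 pV by (intro divide_pos_pos add_nonneg_pos add_nonneg_nonneg mult_nonneg_nonneg) auto
  have dl: "\<delta> > 0" using Delta_pos p0 by (simp add: \<delta>_def)
  \<comment> \<open>Thresholds for \<open>L = ln N / N\<close>: \<open>1 / M\<^sup>2\<close> gives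
    \<open>(M * L)\<^sup>2 \<le> L\<close>, \<open>d / Q\<close> keeps the point where
    \<open>S_local\<close> holds, \<open>1 / Q\<close> gives \<open>\<bar>y\<bar> \<le> 1\<close>,
    and the last two make a local field nonconstant.\<close>
  define e where "e = Min {1 / M\<^sup>2, d / Q, 1 / Q, \<delta>\<^sup>2 / \<kappa>, \<delta>}"
  have e: "e > 0" unfolding e_def using M C(2) Q dl \<kappa> by simp
  have eb: "e \<le> 1 / M\<^sup>2" "e \<le> d / Q" "e \<le> 1 / Q" "e \<le> \<delta>\<^sup>2 / \<kappa>" "e \<le> \<delta>" unfolding e_def by simp_all
  have "\<forall>\<^sub>F N in sequentially. ln (real N) / real N < e"
    using order_tendstoD(2)[OF lim_ln_over_n e] by simp
  then obtain N1 where N1: "\<And>N. N \<ge> N1 \<Longrightarrow> ln (real N) / real N < e"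
    unfolding eventually_sequentially by blast
  obtain d' :: 'q where d': "d' \<noteq> c"
  proof -
    have "\<exists>r :: 'q. r \<noteq> c"
    proof (rule ccontr)
      assume "\<not> (\<exists>r :: 'q. r \<noteq> c)"
      hence "(UNIV :: 'q set) = {c}" by auto
      hence "CARD('q) = 1" by (metis card_1_singleton_iff One_nat_def)
      thus False using q2 by simp
    qed
    thus ?thesis using that by blast
  qed
  show ?thesis
  proof (rule that[of M "max 3 N1"])
    fix N :: nat and est :: "(nat \<Rightarrow> 'q) \<Rightarrow> real" and X :: "nat \<Rightarrow> 'q"
    assume NN: "N \<ge> max 3 N1" and mple: "is_mple p N est" and X: "X \<in> configs N"
      and v: "(norm (V N X))\<^sup>2 < \<kappa> * ln (real N) / real N"
    have N3: "N \<ge> 3" and N: "N \<ge> 1" using NN by auto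
    have n: "real N > 0" using N by simp
    define L where "L = ln (real N) / real N"
    have Le: "L < e" using N1[of N] NN by (simp add: L_def)
    have ln1: "ln (real N) \<ge> 1" by (rule ln_ge_1[OF N3])
    have L0: "L > 0" unfolding L_def using ln1 n by (intro divide_pos_pos) linarith+
    have NL: "real N * L = ln (real N)" using n by (simp add: L_def)
    have vL: "(norm (V N X))\<^sup>2 < \<kappa> * L" using v by (simp add: L_def)
    have invN: "1 / real N < \<delta>"
    proof -
      have "1 / real N \<le> L" unfolding L_def using ln1 by (intro divide_right_mono) auto
      thus ?thesis using Le eb(5) by linarith
    qed
    have nv: "norm (V N X) < \<delta>"
    proof -
      have "\<kappa> * L \<le> \<kappa> * (\<delta>\<^sup>2 / \<kappa>)" using Le eb(4) \<kappa> by (intro mult_left_mono) auto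
      hence "(norm (V N X))\<^sup>2 < \<delta>\<^sup>2" using vL \<kappa> by simp
      thus ?thesis using dl by (rule power_less_imp_less_base[OF _ less_imp_le])
    qed
    have sign: "g * s < 0" if "s = 1 \<or> s = -1" and h: "\<bar>g + s * W\<bar> \<le> U" "W = U + l" "1 \<le> l" for g s W U l :: real
      using that(1)
    proof
      assume a: "s = 1"
      show ?thesis using h[unfolded a] unfolding a by linarith
    next
      assume a: "s = -1"
      show ?thesis using h[unfolded a] unfolding a by linarith
    qed
    \<comment> \<open>The factor \<open>s\<close> treats the two ends of the bracket at
      once.\<close>
    have core: "score p N X (\<beta> + (gam * V N X $ c + s * (M * L))) * s < 0" if s: "s = 1 \<or> s = -1" for s
    proof -
      define y where "y = gam * V N X $ c + s * (M * L)"
      have "y\<^sup>2 \<le> 2 * (gam * V N X $ c)\<^sup>2 + 2 * (s * (M * L))\<^sup>2"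
        unfolding y_def by (smt (verit) power2_sum power2_diff zero_le_power2)
      moreover have "(gam * V N X $ c)\<^sup>2 \<le> gam\<^sup>2 * (\<kappa> * L)"
      proof -
        have "(V N X $ c)\<^sup>2 \<le> (norm (V N X))\<^sup>2"
          using abs_V_nth_le[of N X c] by (simp add: abs_le_square_iff[symmetric])
        hence "(V N X $ c)\<^sup>2 \<le> \<kappa> * L" using vL by linarith
        thus ?thesis unfolding power_mult_distrib by (rule mult_left_mono) simp
      qed
      moreover have "(s * (M * L))\<^sup>2 \<le> L"
      proof -
        have "M\<^sup>2 * L \<le> M\<^sup>2 * (1 / M\<^sup>2)" using Le eb(1) by (intro mult_left_mono) auto
        hence "M\<^sup>2 * L \<le> 1" using M by simp
        hence "(M\<^sup>2 * L) * L \<le> 1 * L" using L0 by (intro mult_right_mono) auto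
        moreover have "s\<^sup>2 = 1" using s by auto
        ultimately show ?thesis by (simp add: power_mult_distrib power2_eq_square mult_ac)
      qed
      ultimately have y2: "y\<^sup>2 \<le> (2 * gam\<^sup>2 * \<kappa> + 2) * L" by (simp add: distrib_right)
      have tot: "(norm (V N X))\<^sup>2 + y\<^sup>2 < Q * L" using y2 vL unfolding Q_def by (simp add: distrib_right)
      have "Q * L < Q * (d / Q)" using Le eb(2) Q by (intro mult_strict_left_mono) auto
      hence small: "(norm (V N X))\<^sup>2 + y\<^sup>2 < d" using tot Q by simp
      have "Q * L < Q * (1 / Q)" using Le eb(3) Q by (intro mult_strict_left_mono) auto
      hence "(norm (V N X))\<^sup>2 + y\<^sup>2 < 1" using tot Q by simp
      hence "y\<^sup>2 \<le> 1\<^sup>2" by (smt (verit) one_power2 zero_le_power2)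
      hence "\<bar>y\<bar> \<le> \<bar>1\<bar>" unfolding abs_le_square_iff .
      hence yb: "\<bar>\<beta> + y\<bar> \<le> \<beta> + 1" using beta_pos by linarith
      have mx: "magnetization N X = m + V N X" by (simp add: V_def)
      have sc: "\<bar>score p N X (\<beta> + y) - real N * (real p * S p (m + V N X) (\<beta> + y))\<bar> \<le> B"
        using score_approx[OF N yb, of p X] unfolding B_def mx .
      have "\<bar>S p (m + V N X) (\<beta> + y) - VS * (gam * V N X $ c - y)\<bar> \<le> C * ((norm (V N X))\<^sup>2 + y\<^sup>2)"
        by (rule C(3)[OF sum_V[OF N] small])
      also have "\<dots> \<le> C * (Q * L)" using tot C(1) by (intro mult_left_mono) auto
      also have "VS * (gam * V N X $ c - y) = - (s * (VS * (M * L)))" by (simp add: y_def)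
      finally have Sb: "\<bar>S p (m + V N X) (\<beta> + y) - - (s * (VS * (M * L)))\<bar> \<le> C * (Q * L)" .
      have "real N * (real p * \<bar>S p (m + V N X) (\<beta> + y) - - (s * (VS * (M * L)))\<bar>) \<le> real N * (real p * (C * (Q * L)))"
        using Sb by (intro mult_left_mono) auto
      also have "\<dots> = real p * (C * Q) * ln (real N)" unfolding NL[symmetric] by simp
      finally have "\<bar>real N * (real p * (S p (m + V N X) (\<beta> + y) - - (s * (VS * (M * L)))))\<bar> \<le> real p * (C * Q) * ln (real N)"
        by (simp add: abs_mult)
      hence Sc: "\<bar>real N * (real p * S p (m + V N X) (\<beta> + y)) + s * (real p * VS * M * (real N * L))\<bar> \<le> real p * (C * Q) * ln (real N)"
        by (simp add: algebra_simps)
      have pVM: "real p * VS * M = B + real p * (C * Q) + 1" unfolding M_def using p0 VS_pos by simp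
      have Bl: "B \<le> B * ln (real N)" using B ln1 mult_left_mono[of 1 "ln (real N)" B] by simp
      have "\<bar>score p N X (\<beta> + y) + s * ((B + real p * (C * Q) + 1) * ln (real N))\<bar>
          \<le> (B + real p * (C * Q)) * ln (real N)"
        using sc Sc Bl unfolding NL pVM by (simp add: distrib_right)
      moreover have "(B + real p * (C * Q) + 1) * ln (real N) = (B + real p * (C * Q)) * ln (real N) + ln (real N)"
        by (simp add: distrib_right)
      ultimately show "score p N X (\<beta> + (gam * V N X $ c + s * (M * L))) * s < 0"
        unfolding y_def[symmetric] by (rule sign[OF s _ _ ln1])
    qed
    have i: "1 \<in> {1..N}" using N by simp
    have nc: "local_field p N X 1 c \<noteq> local_field p N X 1 d'"
      by (rule local_field_nonconstant[OF N i d']) (use nv invN in \<open>simp_all add: \<delta>_def\<close>)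
    have lu: "\<beta> + (gam * V N X $ c + (-1) * (M * L)) < \<beta> + (gam * V N X $ c + 1 * (M * L))"
      using M L0 by simp
    have up: "score p N X (\<beta> + (gam * V N X $ c + 1 * (M * L))) < 0" using core[of 1] by simp
    have lo: "score p N X (\<beta> + (gam * V N X $ c + (-1) * (M * L))) > 0" using core[of "-1"] by simp
    show "\<bar>est X - \<beta> - gam * V N X $ c\<bar> \<le> M * (ln (real N) / real N)"
      using mple_between[OF mple X i nc lu lo up] unfolding L_def[symmetric] by linarith
  qed (use M in auto)
qed

end

section \<open>The limit law\<close>

text \<open>\<open>Phi_scale\<close> reduces the claim to the two scale factors, and
  \<open>(sqrt w - sqrt v) / sqrt v \<le> (w - v) / v\<close> for \<open>v \<le> w\<close>. The
  bound does not depend on \<open>x\<close>.\<close>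

lemma Phi_variance_ratio:
  assumes g: "g > 0" and v: "v > 0" and w: "w > 0"
  shows "\<bar>Phi (x / (g * sqrt v)) - Phi (x / (g * sqrt w))\<bar> \<le> \<bar>v - w\<bar> / min v w"
proof -
  let ?s = "1 / (g * sqrt v)" and ?t = "1 / (g * sqrt w)"
  have pos: "?s > 0" "?t > 0" using g v w by auto
  have main: "\<bar>1 / (g * sqrt v) - 1 / (g * sqrt w)\<bar> / min (1 / (g * sqrt v)) (1 / (g * sqrt w)) \<le> \<bar>v - w\<bar> / min v w"
    if le: "v \<le> w" and v: "v > 0" for v w :: real
  proof -
    have w: "w > 0" using le v by simp
    have sle: "sqrt v \<le> sqrt w" using le by simp
    have sv: "sqrt v > 0" "sqrt w > 0" using v w by auto
    have "1 / (g * sqrt w) \<le> 1 / (g * sqrt v)" using g sv sle by (intro divide_left_mono mult_left_mono mult_pos_pos) auto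
    hence "\<bar>1 / (g * sqrt v) - 1 / (g * sqrt w)\<bar> / min (1 / (g * sqrt v)) (1 / (g * sqrt w))
        = (1 / (g * sqrt v) - 1 / (g * sqrt w)) / (1 / (g * sqrt w))" by (simp add: min_def)
    also have "\<dots> = (sqrt w - sqrt v) / sqrt v" using g sv by (simp add: field_simps)
    also have "\<dots> = (sqrt w - sqrt v) * sqrt v / v"
    proof -
      have "v = sqrt v * sqrt v" using v by simp
      thus ?thesis using sv by (metis mult_divide_mult_cancel_right less_irrefl)
    qed
    also have "\<dots> \<le> (sqrt w - sqrt v) * (sqrt w + sqrt v) / v"
      using sle sv v by (intro divide_right_mono mult_left_mono) auto
    also have "(sqrt w - sqrt v) * (sqrt w + sqrt v) = w - v"
      using v w by (simp add: algebra_simps)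
    finally show ?thesis using le by (simp add: min_def)
  qed
  have "\<bar>?s - ?t\<bar> / min ?s ?t \<le> \<bar>v - w\<bar> / min v w"
  proof (cases "v \<le> w")
    case True
    thus ?thesis by (rule main) (rule v)
  next
    case False
    hence "w \<le> v" by simp
    from main[OF this w] show ?thesis by (simp only: abs_minus_commute[of "1 / (g * sqrt w)"] abs_minus_commute[of w] min.commute)
  qed
  thus ?thesis using Phi_scale[OF pos, of x] by simp
qed

lemma ln_over_sqrt_tendsto: "(\<lambda>N. ln (real N) / sqrt (real N)) \<longlonglongrightarrow> 0"
  using lim_ln_over_power[of "1/2"] by (simp add: powr_half_sqrt)

lemma rates_le_ln_over_sqrt:
  assumes "N \<ge> 3"
  shows "1 / sqrt (real N) \<le> ln (real N) / sqrt (real N)"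
    "1 / (real N)\<^sup>2 \<le> ln (real N) / sqrt (real N)" "1 / real N ^ 4 \<le> ln (real N) / sqrt (real N)"
proof -
  have n: "real N \<ge> 1" using assms by simp
  show 1: "1 / sqrt (real N) \<le> ln (real N) / sqrt (real N)"
    using ln_ge_1[OF assms] by (intro divide_right_mono) auto
  have "sqrt (real N) \<le> real N" using n by (intro real_le_lsqrt) (auto simp: power2_eq_square)
  moreover have "real N \<le> (real N)\<^sup>2" "real N \<le> real N ^ 4" using n by (intro self_le_power; simp)+
  ultimately have "sqrt (real N) \<le> (real N)\<^sup>2" "sqrt (real N) \<le> real N ^ 4" by linarith+
  hence "1 / (real N)\<^sup>2 \<le> 1 / sqrt (real N)" "1 / real N ^ 4 \<le> 1 / sqrt (real N)"
    using n by (intro divide_left_mono; simp)+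
  thus "1 / (real N)\<^sup>2 \<le> ln (real N) / sqrt (real N)" "1 / real N ^ 4 \<le> ln (real N) / sqrt (real N)"
    using 1 by linarith+
qed

context potts_full
begin

text \<open>Off the logarithmic tail, the events for the estimator and for \<open>Y\<close> differ
  by a shift of the threshold of order \<open>ln N / sqrt N\<close>. As \<open>Phi\<close> is
  Lipschitz, this costs the final rate, and the other errors are not larger in order.\<close>

lemma near_distribution:
  obtains C N0 where "C \<ge> 0" "N0 \<ge> 3" "\<And>N est x. N \<ge> N0 \<Longrightarrow> is_mple p N est \<Longrightarrow>
    \<bar>gm N (\<lambda>X. of_bool (sqrt (real N) * (est X - \<beta>) \<le> x) * near N c X)
      - Phi (x / (gam * sd)) / real CARD('q)\<bar> \<le> C * (ln (real N) / sqrt (real N))"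
proof -
  obtain K CT where K: "K > 0" "CT \<ge> 0"
    "\<And>N. N \<ge> 1 \<Longrightarrow> gm N (\<lambda>X. chi N X * of_bool (K * ln (real N) / real N \<le> (norm (V N X))\<^sup>2)) \<le> CT / (real N)\<^sup>2"
    by (rule log_scale_tail) (rule that)
  obtain M N0 where M: "M \<ge> 0" "N0 \<ge> 3"
    "\<And>N est X. N \<ge> N0 \<Longrightarrow> is_mple p N est \<Longrightarrow> X \<in> configs N \<Longrightarrow> (norm (V N X))\<^sup>2 < K * ln (real N) / real N \<Longrightarrow>
      \<bar>est X - \<beta> - gam * V N X $ c\<bar> \<le> M * (ln (real N) / real N)"
    by (rule mple_expansion[OF K(1)]) (rule that)
  obtain CB where CB: "CB \<ge> 0" "\<And>N z. N \<ge> 1 \<Longrightarrow>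
    \<bar>gm N (\<lambda>X. chi N X * of_bool (Y N X \<le> z)) - Phi z * gm N (chi N)\<bar> \<le> CB / sqrt (real N)"
    by (rule berry_esseen) (rule that)
  obtain CQ where CQ: "CQ \<ge> 0" "\<And>N. N \<ge> 1 \<Longrightarrow> \<bar>gm N (chi N) - 1 / real CARD('q)\<bar> \<le> CQ / real N ^ 4"
    by (rule gm_chi_approx) (rule that)
  obtain CN where CN: "CN \<ge> 0" "\<And>N. N \<ge> 1 \<Longrightarrow> gm N (\<lambda>X. chi N X - near N c X) \<le> CN / real N ^ 4"
    "\<And>N X. near N c X \<le> chi N X"
    by (rule chi_minus_near_tail) (rule that)
  define w where "w = 1 / (gam * sd)"
  have gs: "gam * sd > 0" using gam_pos sd_pos by simp
  hence w: "w > 0" by (simp add: w_def)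
  define C where "C = CB + CQ + M * w + CT + CN"
  have q: "real CARD('q) \<ge> 1" using q2 by simp
  show ?thesis
  proof (rule that[of C N0])
    show "C \<ge> 0" unfolding C_def using CB CQ M(1) w K(2) CN by (intro add_nonneg_nonneg mult_nonneg_nonneg) auto
    fix N :: nat and est :: "(nat \<Rightarrow> 'q) \<Rightarrow> real" and x :: real
    assume N0: "N \<ge> N0" and mple: "is_mple p N est"
    have N3: "N \<ge> 3" and N: "N \<ge> 1" using N0 M(2) by auto
    have n: "real N > 0" using N by simp
    define u where "u = ln (real N) / sqrt (real N)"
    have su: "sqrt (real N) * (ln (real N) / real N) = u"
      unfolding u_def using n by (simp add: field_simps real_sqrt_mult_self)
    define E where "E X = (of_bool (sqrt (real N) * (est X - \<beta>) \<le> x) :: real)" for X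
    define T where "T X = chi N X * of_bool (K * ln (real N) / real N \<le> (norm (V N X))\<^sup>2)" for X
    \<comment> \<open>The thresholds for \<open>Y\<close>, moved up and down by the error of the
      expansion of the estimator; \<open>w\<close> rescales them.\<close>
    define zp where "zp = (x + M * u) * w"
    define zm where "zm = (x - M * u) * w"
    have near01: "near N c X = 0 \<or> near N c X = 1" for X by (simp add: near_def)
    have E01: "E X = 0 \<or> E X = 1" for X by (simp add: E_def)
    have Yz: "(Y N X \<le> (x + t) * w) = (gam * (sqrt (real N) * V N X $ c) \<le> x + t)" for X t
    proof -
      have "gam * (sqrt (real N) * V N X $ c) = gam * sd * Y N X" using sd_pos by (simp add: Y_def)
      moreover have "(Y N X \<le> (x + t) * w) = (gam * sd * Y N X \<le> x + t)"
        unfolding w_def using gs by (simp add: pos_le_divide_eq mult.commute)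
      ultimately show ?thesis by (simp only:)
    qed
    have exp: "\<bar>sqrt (real N) * (est X - \<beta>) - gam * (sqrt (real N) * V N X $ c)\<bar> \<le> M * u"
      if X: "X \<in> configs N" and small: "\<not> K * ln (real N) / real N \<le> (norm (V N X))\<^sup>2" for X
    proof -
      have "\<bar>est X - \<beta> - gam * V N X $ c\<bar> \<le> M * (ln (real N) / real N)"
        by (rule M(3)[OF N0 mple X]) (use small in simp)
      hence "sqrt (real N) * \<bar>est X - \<beta> - gam * V N X $ c\<bar> \<le> sqrt (real N) * (M * (ln (real N) / real N))"
        by (rule mult_left_mono) simp
      also have "\<dots> = M * u" unfolding su[symmetric] by simp
      also have "sqrt (real N) * \<bar>est X - \<beta> - gam * V N X $ c\<bar> = \<bar>sqrt (real N) * (est X - \<beta> - gam * V N X $ c)\<bar>"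
        by (simp add: abs_mult)
      also have "sqrt (real N) * (est X - \<beta> - gam * V N X $ c) = sqrt (real N) * (est X - \<beta>) - gam * (sqrt (real N) * V N X $ c)"
        by (simp add: algebra_simps)
      finally show ?thesis .
    qed
    have up: "E X * near N c X \<le> chi N X * of_bool (Y N X \<le> zp) + T X" if X: "X \<in> configs N" for X
    proof (cases "K * ln (real N) / real N \<le> (norm (V N X))\<^sup>2")
      case True
      hence "T X = chi N X" by (simp add: T_def)
      thus ?thesis using CN(3)[of N X] E01[of X] near01[of X] chi_01[of N X] by auto
    next
      case False
      have T: "T X = 0" using False by (simp add: T_def)
      show ?thesis
      proof (cases "sqrt (real N) * (est X - \<beta>) \<le> x")
        case True
        hence "Y N X \<le> zp" unfolding zp_def Yz using exp[OF X False] by linarith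
        thus ?thesis using CN(3)[of N X] True by (simp add: T E_def)
      next
        case False
        thus ?thesis using chi_nonneg[of N X] by (simp add: T E_def)
      qed
    qed
    \<comment> \<open>The lower bound also pays for the shell \<open>chi - near\<close>, because the
      normal approximation is known on the larger ball.\<close>
    have lo: "chi N X * of_bool (Y N X \<le> zm) \<le> E X * near N c X + (T X + (chi N X - near N c X))" if X: "X \<in> configs N" for X
    proof (cases "K * ln (real N) / real N \<le> (norm (V N X))\<^sup>2")
      case True
      hence "T X = chi N X" by (simp add: T_def)
      thus ?thesis using CN(3)[of N X] E01[of X] near01[of X] chi_01[of N X] by auto
    next
      case False
      have T: "T X = 0" using False by (simp add: T_def)
      show ?thesis
      proof (cases "Y N X \<le> zm")
        case True
        have zm': "zm = (x + (- (M * u))) * w" by (simp add: zm_def)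
        have "sqrt (real N) * (est X - \<beta>) \<le> x" using True exp[OF X False] unfolding zm' Yz by linarith
        thus ?thesis using True by (simp add: T E_def)
      next
        case False
        thus ?thesis using CN(3)[of N X] E01[of X] near01[of X] by (auto simp: T)
      qed
    qed
    have gup: "gm N (\<lambda>X. E X * near N c X) \<le> gm N (\<lambda>X. chi N X * of_bool (Y N X \<le> zp)) + gm N T"
      unfolding gibbs_mean_add[symmetric] by (rule gibbs_mean_mono) (rule up)
    have glo: "gm N (\<lambda>X. chi N X * of_bool (Y N X \<le> zm)) \<le> gm N (\<lambda>X. E X * near N c X) + (gm N T + gm N (\<lambda>X. chi N X - near N c X))"
      unfolding gibbs_mean_add[symmetric] by (rule gibbs_mean_mono) (rule lo)
    note rate = rates_le_ln_over_sqrt[OF N3, folded u_def]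
    have B1: "CB / sqrt (real N) \<le> CB * u" using mult_left_mono[OF rate(1) CB(1)] by simp
    have T1: "gm N T \<le> CT * u" using K(3)[OF N] mult_left_mono[OF rate(2) K(2)] by (simp add: T_def[abs_def])
    have Q1: "CQ / real N ^ 4 \<le> CQ * u" using mult_left_mono[OF rate(3) CQ(1)] by simp
    have D1: "gm N (\<lambda>X. chi N X - near N c X) \<le> CN * u" using CN(2)[OF N] mult_left_mono[OF rate(3) CN(1)] by simp
    have D0: "gm N T \<ge> 0" by (rule gibbs_mean_nonneg) (simp add: T_def chi_nonneg)
    have P1: "\<bar>Phi z * gm N (chi N) - Phi z / real CARD('q)\<bar> \<le> CQ * u" for z
    proof -
      have eq: "Phi z * gm N (chi N) - Phi z / real CARD('q) = Phi z * (gm N (chi N) - 1 / real CARD('q))"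
        by (simp add: right_diff_distrib)
      have "Phi z * \<bar>gm N (chi N) - 1 / real CARD('q)\<bar> \<le> 1 * (CQ / real N ^ 4)"
        by (rule mult_mono[OF Phi_bounds(2) CQ(2)[OF N]]) auto
      thus ?thesis unfolding eq abs_mult abs_of_nonneg[OF Phi_bounds(1)] using Q1 by linarith
    qed
    have L: "\<bar>Phi z / real CARD('q) - Phi (x / (gam * sd)) / real CARD('q)\<bar> \<le> M * w * u"
      if "\<bar>z - x * w\<bar> \<le> M * w * u" for z
    proof -
      have "\<bar>Phi z - Phi (x * w)\<bar> \<le> M * w * u" using Phi_lipschitz[of z "x * w"] that by linarith
      hence "\<bar>Phi z - Phi (x * w)\<bar> / real CARD('q) \<le> M * w * u" using q
        by (smt (verit) divide_le_eq_1 frac_le abs_ge_zero div_by_1 zero_less_one)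
      moreover have "x / (gam * sd) = x * w" by (simp add: w_def)
      moreover have "Phi z / real CARD('q) - Phi (x * w) / real CARD('q) = (Phi z - Phi (x * w)) / real CARD('q)"
        by (simp add: diff_divide_distrib)
      ultimately show ?thesis by simp
    qed
    have u0: "u \<ge> 0" unfolding u_def using ln_ge_1[OF N3] by simp
    have Muw: "M * w * u \<ge> 0" using M(1) w u0 by simp
    have zp: "\<bar>zp - x * w\<bar> \<le> M * w * u"
    proof -
      have "zp - x * w = M * w * u" by (simp add: zp_def algebra_simps)
      thus ?thesis using Muw by simp
    qed
    have zm: "\<bar>zm - x * w\<bar> \<le> M * w * u"
    proof -
      have "zm - x * w = - (M * w * u)" by (simp add: zm_def algebra_simps)
      thus ?thesis using Muw by simp
    qed
    have Cu: "C * u = CB * u + CQ * u + M * w * u + CT * u + CN * u" by (simp add: C_def distrib_right)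
    have CNu: "CN * u \<ge> 0" using CN(1) u0 by simp
    have "\<bar>gm N (\<lambda>X. E X * near N c X) - Phi (x / (gam * sd)) / real CARD('q)\<bar> \<le> C * u"
      unfolding abs_le_iff
    proof
      show "gm N (\<lambda>X. E X * near N c X) - Phi (x / (gam * sd)) / real CARD('q) \<le> C * u"
        using gup CB(2)[OF N, of zp] B1 T1 P1[of zp] L[OF zp] CNu unfolding Cu by linarith
      show "- (gm N (\<lambda>X. E X * near N c X) - Phi (x / (gam * sd)) / real CARD('q)) \<le> C * u"
        using glo CB(2)[OF N, of zm] B1 T1 D1 P1[of zm] L[OF zm] unfolding Cu by linarith
    qed
    thus "\<bar>gm N (\<lambda>X. of_bool (sqrt (real N) * (est X - \<beta>) \<le> x) * near N c X)
      - Phi (x / (gam * sd)) / real CARD('q)\<bar> \<le> C * (ln (real N) / sqrt (real N))"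
      unfolding E_def u_def .
  qed (rule M)
qed

text \<open>For large \<open>N\<close> the ball has probability at least \<open>1 / (2 q)\<close>
  and \<open>varN N \<ge> var / 2\<close>. Then \<open>varN_approx\<close> applies, and the
  variances are compared through \<open>Phi_variance_ratio\<close>.\<close>

lemma normal_limit:
  obtains C N0 where "C \<ge> 0" "N0 \<ge> 3" "\<And>N x. N \<ge> N0 \<Longrightarrow>
    \<bar>measure std_normal_vector {z. rho p \<beta> m \<bullet> (psd_sqrt (Sig N) *v z) \<le> x} - Phi (x / (gam * sd))\<bar>
      \<le> C * (ln (real N) / sqrt (real N))"
proof -
  define d where "d = 1 / (2 * real CARD('q))"
  have q: "real CARD('q) > 0" using q2 by simp
  have d: "d > 0" using q by (simp add: d_def)
  obtain CQ where CQ: "CQ \<ge> 0" "\<And>N. N \<ge> 1 \<Longrightarrow> \<bar>gm N (chi N) - 1 / real CARD('q)\<bar> \<le> CQ / real N ^ 4"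
    by (rule gm_chi_approx) (rule that)
  obtain CV where CV: "CV \<ge> 0" "\<And>N. N \<ge> 3 \<Longrightarrow> gm N (chi N) \<ge> d \<Longrightarrow> \<bar>varN N - var\<bar> \<le> CV * (ln (real N) / sqrt (real N))"
    by (rule varN_approx[OF d]) (rule that)
  \<comment> \<open>This gives \<open>CQ * u \<le> d\<close>, so that the ball has probability at
    least \<open>2 * d - d\<close>, and \<open>CV * u \<le> var / 2\<close>.\<close>
  define e where "e = min (d / (CQ + 1)) (var / 2 / (CV + 1))"
  have e: "e > 0" unfolding e_def using d CQ(1) CV(1) var_pos by simp
  have "\<forall>\<^sub>F N in sequentially. ln (real N) / sqrt (real N) < e"
    by (rule order_tendstoD(2)[OF ln_over_sqrt_tendsto e])
  then obtain N1 where N1: "\<And>N. N \<ge> N1 \<Longrightarrow> ln (real N) / sqrt (real N) < e"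
    unfolding eventually_sequentially by blast
  show ?thesis
  proof (rule that[of "CV * (2 / var)" "max 3 N1"])
    show "CV * (2 / var) \<ge> 0" using CV(1) var_pos by simp
    fix N :: nat and x :: real
    assume NN: "N \<ge> max 3 N1"
    hence N3: "N \<ge> 3" and N: "N \<ge> 1" by auto
    define u where "u = ln (real N) / sqrt (real N)"
    have ue: "u < e" using N1[of N] NN by (simp add: u_def)
    have u0: "u \<ge> 0" unfolding u_def using ln_ge_1[OF N3] by simp
    have small: "k * u \<le> t" if "k \<ge> 0" "e \<le> t / (k + 1)" "t > 0" for k t
    proof -
      have "(k + 1) * u \<le> (k + 1) * (t / (k + 1))" using that ue by (intro mult_left_mono) auto
      hence "(k + 1) * u \<le> t" using that(1) by simp
      thus ?thesis using u0 by (simp add: distrib_right)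
    qed
    have "CQ / real N ^ 4 \<le> CQ * u"
      using mult_left_mono[OF rates_le_ln_over_sqrt(3)[OF N3] CQ(1)] by (simp add: u_def)
    also have "\<dots> \<le> d" by (rule small) (use CQ(1) d in \<open>auto simp: e_def\<close>)
    finally have "\<bar>gm N (chi N) - 1 / real CARD('q)\<bar> \<le> d" using CQ(2)[OF N] by linarith
    moreover have "1 / real CARD('q) = 2 * d" using q by (simp add: d_def)
    ultimately have gd: "gm N (chi N) \<ge> d" by linarith
    have vv: "\<bar>varN N - var\<bar> \<le> CV * u" unfolding u_def by (rule CV(2)[OF N3 gd])
    also have "\<dots> \<le> var / 2" by (rule small) (use CV(1) var_pos in \<open>auto simp: e_def\<close>)
    finally have vh: "varN N \<ge> var / 2" by linarith
    hence vpos: "varN N > 0" using var_pos by linarith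
    have "\<bar>Phi (x / (gam * sqrt (varN N))) - Phi (x / (gam * sqrt var))\<bar> \<le> \<bar>varN N - var\<bar> / min (varN N) var"
      by (rule Phi_variance_ratio[OF gam_pos vpos var_pos])
    also have "\<dots> \<le> (CV * u) / (var / 2)"
      using vv vh var_pos CV(1) u0 by (intro frac_le) auto
    also have "\<dots> = CV * (2 / var) * u" by simp
    finally show "\<bar>measure std_normal_vector {z. rho p \<beta> m \<bullet> (psd_sqrt (Sig N) *v z) \<le> x} - Phi (x / (gam * sd))\<bar>
      \<le> CV * (2 / var) * (ln (real N) / sqrt (real N))"
      using cond_normal_halfspace[OF N less_le_trans[OF d gd] vpos, of x] by (simp add: sd_def u_def)
  qed simp
qed

text \<open>The existential form, uniform in \<open>est\<close> and \<open>x\<close>, allows a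
  choice of constants for every peak outside the locale.\<close>

lemma peak_contribution:
  "\<exists>C N0. 0 \<le> C \<and> 3 \<le> N0 \<and> (\<forall>N est x. N \<ge> N0 \<longrightarrow> is_mple p N est \<longrightarrow>
    \<bar>gm N (\<lambda>X. of_bool (sqrt (real N) * (est X - \<beta>) \<le> x) * near N c X)
      - (1 / real CARD('q)) * measure std_normal_vector {z. rho p \<beta> m \<bullet> (psd_sqrt (Sig N) *v z) \<le> x}\<bar>
      \<le> C * (ln (real N) / sqrt (real N)))"
proof -
  obtain C1 N1 where 1: "C1 \<ge> 0" "N1 \<ge> 3" "\<And>N est x. N \<ge> N1 \<Longrightarrow> is_mple p N est \<Longrightarrow>
    \<bar>gm N (\<lambda>X. of_bool (sqrt (real N) * (est X - \<beta>) \<le> x) * near N c X)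
      - Phi (x / (gam * sd)) / real CARD('q)\<bar> \<le> C1 * (ln (real N) / sqrt (real N))"
    by (rule near_distribution) (rule that)
  obtain C2 N2 where 2: "C2 \<ge> 0" "N2 \<ge> 3" "\<And>N x. N \<ge> N2 \<Longrightarrow>
    \<bar>measure std_normal_vector {z. rho p \<beta> m \<bullet> (psd_sqrt (Sig N) *v z) \<le> x} - Phi (x / (gam * sd))\<bar>
      \<le> C2 * (ln (real N) / sqrt (real N))"
    by (rule normal_limit) (rule that)
  have q: "real CARD('q) \<ge> 1" using q2 by simp
  show ?thesis
  proof (intro exI conjI allI impI)
    show "0 \<le> C1 + C2" using 1 2 by simp
    show "3 \<le> max N1 N2" using 1 by simp
    fix N :: nat and est :: "(nat \<Rightarrow> 'q) \<Rightarrow> real" and x :: real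
    assume N: "max N1 N2 \<le> N" and mple: "is_mple p N est"
    define G where "G = measure std_normal_vector {z. rho p \<beta> m \<bullet> (psd_sqrt (Sig N) *v z) \<le> x}"
    have "\<bar>Phi (x / (gam * sd)) - G\<bar> \<le> C2 * (ln (real N) / sqrt (real N))"
      using 2(3)[of N x] N unfolding G_def by (simp add: abs_minus_commute)
    moreover have "\<bar>Phi (x / (gam * sd)) - G\<bar> / real CARD('q) \<le> \<bar>Phi (x / (gam * sd)) - G\<bar>"
      using q by (simp add: divide_le_eq mult_le_cancel_left1)
    ultimately have "\<bar>Phi (x / (gam * sd)) / real CARD('q) - (1 / real CARD('q)) * G\<bar> \<le> C2 * (ln (real N) / sqrt (real N))"
      by (simp add: diff_divide_distrib[symmetric] abs_divide)
    moreover have "\<bar>gm N (\<lambda>X. of_bool (sqrt (real N) * (est X - \<beta>) \<le> x) * near N c X)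
      - Phi (x / (gam * sd)) / real CARD('q)\<bar> \<le> C1 * (ln (real N) / sqrt (real N))"
      by (rule 1(3)) (use N mple in auto)
    ultimately show "\<bar>gm N (\<lambda>X. of_bool (sqrt (real N) * (est X - \<beta>) \<le> x) * near N c X)
      - (1 / real CARD('q)) * measure std_normal_vector {z. rho p \<beta> m \<bullet> (psd_sqrt (Sig N) *v z) \<le> x}\<bar>
      \<le> (C1 + C2) * (ln (real N) / sqrt (real N))"
      unfolding G_def[symmetric] distrib_right by linarith
  qed
qed

end

theorem theorem3p8:
  fixes p :: nat and \<beta> \<epsilon> :: real
    and m :: "'q::finite \<Rightarrow> real^'q"
    and beta_hat :: "nat \<Rightarrow> (nat \<Rightarrow> 'q) \<Rightarrow> real"
  assumes "p \<ge> 2" and "CARD('q) \<ge> 2"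
    and "\<beta> > beta_c TYPE('q) p"
    and "bij_betw m UNIV (maximizers p \<beta>)"
    and "\<epsilon> > 0" and "\<And>i j. i \<noteq> j \<Longrightarrow> \<epsilon> < dist (m i) (m j)"
    and "\<And>N. is_mple p N (beta_hat N)"
  shows "(\<lambda>N. SUP x::real.
            \<bar>measure (potts p \<beta> N) {X \<in> configs N. sqrt (real N) * (beta_hat N X - \<beta>) \<le> x}
             - (1 / real CARD('q)) * (\<Sum>i\<in>UNIV. measure std_normal_vector
                 {z. rho p \<beta> (m i) \<bullet> (psd_sqrt (cond_covariance p \<beta> \<epsilon> N (m i)) *v z) \<le> x})\<bar>)
         \<in> O(\<lambda>N. ln (real N) / sqrt (real N))"
proof -
  have card: "card (maximizers p \<beta> :: (real^'q) set) = CARD('q)"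
    using bij_betw_same_card[OF assms(4)] by simp
  obtain a b where ab: "0 < b" "b < a" "maximizers p \<beta> = range (peak a b :: 'q \<Rightarrow> real^'q)"
    "a + (real CARD('q) - 1) * b = 1" "crit_fun p \<beta> a = crit_fun p \<beta> b" "\<beta> > 0"
    "\<beta> * real p * (real p - 1) * b ^ (p - 1) < 1"
    "\<beta> * real p * (real p - 1) * ((real CARD('q) - 1) * a ^ (p - 1) * b + a * b ^ (p - 1)) < 1"
    by (rule maximizers_peak_structure[OF card assms(2,1)]) (rule that)
  have inj_peak: "inj (peak a b :: 'q \<Rightarrow> real^'q)"
  proof (rule injI)
    fix i j :: 'q assume "peak a b i = peak a b j"
    hence "peak a b i $ i = peak a b j $ i" by simp
    thus "i = j" using ab(2) by (simp add: peak_nth split: if_splits)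
  qed
  \<comment> \<open>\<open>m\<close> is an arbitrary enumeration of the maximizers; its separation
    is carried over to the enumeration by colours.\<close>
  have sep: "\<epsilon> < dist (peak a b i) (peak a b j)" if "i \<noteq> j" for i j :: 'q
  proof -
    have "peak a b i \<in> range m" "peak a b j \<in> range m" using assms(4) ab(3) by (auto simp: bij_betw_def)
    then obtain i' j' where ij: "peak a b i = m i'" "peak a b j = m j'" by auto
    have "i' \<noteq> j'" using ij that inj_peak by (metis injD)
    thus ?thesis using assms(6) ij by simp
  qed
  have full: "potts_full p \<beta> a b j \<epsilon>" for j :: 'q
  proof unfold_locales
    show "finite (maximizers p \<beta> :: (real^'q) set)" unfolding ab(3) by simp
    fix t :: "real^'q" assume "t \<in> maximizers p \<beta>" "t \<noteq> peak a b j"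
    then obtain i where "t = peak a b i" "i \<noteq> j" unfolding ab(3) by auto
    thus "\<epsilon> < dist (peak a b j) t" using sep[of j i] by simp
  qed (use assms(1,2,5) ab sep in auto)
  define G where "G N x t = measure std_normal_vector
     {z. rho p \<beta> t \<bullet> (psd_sqrt (cond_covariance p \<beta> \<epsilon> N t) *v z) \<le> x}" for N x and t :: "real^'q"
  \<comment> \<open>These constants depend only on \<open>a\<close>, \<open>b\<close> and
    \<open>\<epsilon>\<close>, so the instances of the locale at the various peaks share one
    partition.\<close>
  define near where "near = (potts_full.near a b \<epsilon> :: nat \<Rightarrow> 'q \<Rightarrow> (nat \<Rightarrow> 'q) \<Rightarrow> real)"
  define far where "far = (potts_full.far a b \<epsilon> :: nat \<Rightarrow> (nat \<Rightarrow> 'q) \<Rightarrow> real)"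
  have "\<forall>j. \<exists>C N0. 0 \<le> C \<and> 3 \<le> N0 \<and> (\<forall>N est x. N \<ge> N0 \<longrightarrow> is_mple p N est \<longrightarrow>
    \<bar>gibbs_mean p \<beta> N (\<lambda>X. of_bool (sqrt (real N) * (est X - \<beta>) \<le> x) * near N j X)
      - (1 / real CARD('q)) * G N x (peak a b j)\<bar> \<le> C * (ln (real N) / sqrt (real N)))"
    unfolding G_def near_def by (rule allI) (rule potts_full.peak_contribution[OF full])
  from choice[OF this] obtain C where "\<forall>j. \<exists>N0. 0 \<le> C j \<and> 3 \<le> N0 \<and> (\<forall>N est x. N \<ge> N0 \<longrightarrow> is_mple p N est \<longrightarrow>
    \<bar>gibbs_mean p \<beta> N (\<lambda>X. of_bool (sqrt (real N) * (est X - \<beta>) \<le> x) * near N j X)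
      - (1 / real CARD('q)) * G N x (peak a b j)\<bar> \<le> C j * (ln (real N) / sqrt (real N)))" ..
  from choice[OF this] obtain N0 where CN0: "\<forall>j. 0 \<le> C j \<and> 3 \<le> N0 j \<and> (\<forall>N est x. N \<ge> N0 j \<longrightarrow> is_mple p N est \<longrightarrow>
    \<bar>gibbs_mean p \<beta> N (\<lambda>X. of_bool (sqrt (real N) * (est X - \<beta>) \<le> x) * near N j X)
      - (1 / real CARD('q)) * G N x (peak a b j)\<bar> \<le> C j * (ln (real N) / sqrt (real N)))" ..
  have C: "0 \<le> C j" "3 \<le> N0 j"
    "N \<ge> N0 j \<Longrightarrow> is_mple p N est \<Longrightarrow>
    \<bar>gibbs_mean p \<beta> N (\<lambda>X. of_bool (sqrt (real N) * (est X - \<beta>) \<le> x) * near N j X)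
      - (1 / real CARD('q)) * G N x (peak a b j)\<bar> \<le> C j * (ln (real N) / sqrt (real N))"
    for j N est x
    using CN0[THEN spec, of j] by simp_all
  obtain CF where CF: "CF \<ge> 0" "\<And>N. N \<ge> 1 \<Longrightarrow> gibbs_mean p \<beta> N (far N) \<le> CF / real N ^ 4"
    by (rule potts_full.far_tail[OF full, folded far_def]) (rule that)
  have part: "(\<Sum>j\<in>UNIV. near N j X) + far N X = 1" for N X
    unfolding near_def far_def by (rule potts_full.near_far_partition[OF full])
  have far0: "0 \<le> far N X" for N X
    unfolding far_def potts_full.far_def[OF full] by simp
  define A where "A = (\<Sum>j\<in>UNIV. C j) + CF"
  define n0 where "n0 = Max (range N0)"
  have n0: "N0 j \<le> n0" for j unfolding n0_def by (intro Max_ge) auto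
  have bound: "\<bar>measure (potts p \<beta> N) {X \<in> configs N. sqrt (real N) * (beta_hat N X - \<beta>) \<le> x}
      - (1 / real CARD('q)) * (\<Sum>i\<in>UNIV. G N x (m i))\<bar> \<le> A * (ln (real N) / sqrt (real N))"
    if N: "N \<ge> n0" for N x
  proof -
    define u where "u = ln (real N) / sqrt (real N)"
    define E where "E X = (of_bool (sqrt (real N) * (beta_hat N X - \<beta>) \<le> x) :: real)" for X
    have N3: "N \<ge> 3" using C(2) n0 N by (meson order_trans)
    hence N1: "N \<ge> 1" by simp
    have "measure (potts p \<beta> N) {X \<in> configs N. sqrt (real N) * (beta_hat N X - \<beta>) \<le> x}
        = gibbs_mean p \<beta> N (indicator {X \<in> configs N. sqrt (real N) * (beta_hat N X - \<beta>) \<le> x})"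
      by (rule measure_potts) auto
    also have "\<dots> = gibbs_mean p \<beta> N (\<lambda>X. (\<Sum>j\<in>UNIV. E X * near N j X) + E X * far N X)"
    proof (rule gibbs_mean_cong)
      fix X :: "nat \<Rightarrow> 'q" assume X: "X \<in> configs N"
      have "(\<Sum>j\<in>UNIV. E X * near N j X) + E X * far N X = E X * ((\<Sum>j\<in>UNIV. near N j X) + far N X)"
        by (simp add: distrib_left sum_distrib_left)
      thus "indicator {X \<in> configs N. sqrt (real N) * (beta_hat N X - \<beta>) \<le> x} X
          = (\<Sum>j\<in>UNIV. E X * near N j X) + E X * far N X"
        unfolding part using X by (simp add: E_def indicator_def)
    qed
    also have "\<dots> = (\<Sum>j\<in>UNIV. gibbs_mean p \<beta> N (\<lambda>X. E X * near N j X)) + gibbs_mean p \<beta> N (\<lambda>X. E X * far N X)"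
      by (simp only: gibbs_mean_add gibbs_mean_sum)
    finally have meas: "measure (potts p \<beta> N) {X \<in> configs N. sqrt (real N) * (beta_hat N X - \<beta>) \<le> x} = \<dots>" .
    have "(\<Sum>i\<in>UNIV. G N x (m i)) = (\<Sum>t\<in>maximizers p \<beta>. G N x t)"
      by (rule sum.reindex_bij_betw[OF assms(4)])
    also have "\<dots> = (\<Sum>j\<in>UNIV. G N x (peak a b j))"
      unfolding ab(3) by (simp add: sum.reindex[OF inj_peak])
    finally have GS: "(1 / real CARD('q)) * (\<Sum>i\<in>UNIV. G N x (m i)) = (\<Sum>j\<in>UNIV. (1 / real CARD('q)) * G N x (peak a b j))"
      by (simp only: sum_distrib_left)
    have near_sum: "\<bar>(\<Sum>j\<in>UNIV. gibbs_mean p \<beta> N (\<lambda>X. E X * near N j X)) - (\<Sum>j\<in>UNIV. (1 / real CARD('q)) * G N x (peak a b j))\<bar>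
        \<le> (\<Sum>j\<in>UNIV. C j * u)"
      unfolding sum_subtractf[symmetric]
    proof (rule order_trans[OF sum_abs], rule sum_mono)
      fix j :: 'q
      show "\<bar>gibbs_mean p \<beta> N (\<lambda>X. E X * near N j X) - (1 / real CARD('q)) * G N x (peak a b j)\<bar> \<le> C j * u"
        unfolding E_def u_def by (rule C(3)[OF order_trans[OF n0 N] assms(7)])
    qed
    have "gibbs_mean p \<beta> N (\<lambda>X. E X * far N X) \<le> gibbs_mean p \<beta> N (far N)"
      by (rule gibbs_mean_mono) (use far0 in \<open>auto simp: E_def\<close>)
    also have "\<dots> \<le> CF * u"
      using CF(2)[OF N1] mult_left_mono[OF rates_le_ln_over_sqrt(3)[OF N3] CF(1)] by (simp add: u_def)
    finally have fu: "gibbs_mean p \<beta> N (\<lambda>X. E X * far N X) \<le> CF * u" .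
    have f0: "0 \<le> gibbs_mean p \<beta> N (\<lambda>X. E X * far N X)"
    proof (rule gibbs_mean_nonneg)
      fix X show "0 \<le> E X * far N X" using far0[of N X] by (auto simp: E_def)
    qed
    have Au: "A * u = (\<Sum>j\<in>UNIV. C j * u) + CF * u" by (simp add: A_def distrib_right sum_distrib_right)
    show ?thesis using near_sum fu f0 unfolding meas GS u_def[symmetric] Au by linarith
  qed
  show ?thesis
  proof (rule bigoI[where c = A])
    show "\<forall>\<^sub>F N in sequentially. norm (SUP x::real.
            \<bar>measure (potts p \<beta> N) {X \<in> configs N. sqrt (real N) * (beta_hat N X - \<beta>) \<le> x}
             - (1 / real CARD('q)) * (\<Sum>i\<in>UNIV. measure std_normal_vector
                 {z. rho p \<beta> (m i) \<bullet> (psd_sqrt (cond_covariance p \<beta> \<epsilon> N (m i)) *v z) \<le> x})\<bar>)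
        \<le> A * norm (ln (real N) / sqrt (real N))"
      unfolding eventually_sequentially G_def[symmetric]
    proof (intro exI allI impI)
      fix N assume N: "n0 \<le> N"
      let ?f = "\<lambda>x. \<bar>measure (potts p \<beta> N) {X \<in> configs N. sqrt (real N) * (beta_hat N X - \<beta>) \<le> x}
             - (1 / real CARD('q)) * (\<Sum>i\<in>UNIV. G N x (m i))\<bar>"
      let ?u = "ln (real N) / sqrt (real N)"
      have le: "Sup (range ?f) \<le> A * ?u"
        by (rule cSUP_least) (simp, rule bound[OF N])
      \<comment> \<open>A real supremum bounds its members only if the range is bounded above. With
        that, the nonnegative value at \<open>0\<close> shows that the supremum is nonnegative, and
        its norm is the supremum itself.\<close>
      have bdd: "bdd_above (range ?f)" using bound[OF N] by (rule bdd_aboveI2)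
      have "?f 0 \<le> Sup (range ?f)" by (rule cSUP_upper[OF UNIV_I bdd])
      hence ge: "0 \<le> Sup (range ?f)" by (rule order_trans[OF abs_ge_zero])
      have A: "A \<ge> 0" unfolding A_def using C(1) CF(1) by (intro add_nonneg_nonneg sum_nonneg) auto
      have "norm (Sup (range ?f)) \<le> A * ?u" using le ge by simp
      also have "\<dots> \<le> A * norm ?u" unfolding real_norm_def by (rule mult_left_mono[OF abs_ge_self A])
      finally show "norm (Sup (range ?f)) \<le> A * norm ?u" .
    qed
  qed
qed

end
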